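(* Let $\alpha>0$ and $h\in\mathbb R$ be constants and let $\boldsymbol j\in L^\infty((0,\infty);L^{6/5}(\mathbb R^3;\mathbb R^3))$ be fixed. Then, for a given initial value $\boldsymbol m|_{t=0}$, the distributional solution on $(0,\infty)\times\mathbb R^3$ of $$\partial_t\boldsymbol m=\boldsymbol m\times(\alpha\,\partial_t\boldsymbol m+\Delta\boldsymbol m+\Delta^2\boldsymbol m-h\,\hat{\boldsymbol e}_3)-(\boldsymbol j\cdot\nabla)\boldsymbol m$$ with regularity $$\boldsymbol m\in L^\infty((0,\infty);H^2(\mathbb R^3;\mathbb S^2))\cap\dot H^1((0,\infty);L^2(\mathbb R^3;\mathbb R^3))$$ is unique; that is, any two such solutions with the same initial value coincide.
   Context: $\hat{\boldsymbol e}_3=(0,0,1)$ and $H^2(\mathbb R^3;\mathbb S^2)=\{\boldsymbol m:\mathbb R^3\to\mathbb S^2:\ \boldsymbol m-\hat{\boldsymbol e}_3\in H^2(\mathbb R^3;\mathbb R^3)\}$; $L^\infty$ in time refers to $\boldsymbol m-\hat{\boldsymbol e}_3$ in $H^2$. $\boldsymbol m\in\dot H^1((0,\infty);L^2)$ means $\partial_t\boldsymbol m\in L^2((0,\infty)\times\mathbb R^3)$; in particular $\boldsymbol m-\hat{\boldsymbol e}_3$ is continuous in time with values in $L^2$, so initial values make sense. In the distributional formulation, $\boldsymbol m\times\Delta^2\boldsymbol m=\Delta(\boldsymbol m\times\Delta\boldsymbol m)-2\sum_{k=1}^3\partial_k(\partial_k\boldsymbol m\times\Delta\boldsymbol m)$.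 *)

theory Defs
  imports "HOL-Analysis.Analysis"
begin

text \<open>
  Functions are considered up to equality almost everywhere with respect to Lebesgue measure;
  a class is represented by any of its measurable members.
\<close>

subsection \<open>Test functions, distributions and weak derivatives\<close>

primrec Ck :: "nat \<Rightarrow> ('a::euclidean_space \<Rightarrow> 'b::real_normed_vector) \<Rightarrow> bool" where
  "Ck 0 f \<longleftrightarrow> continuous_on UNIV f"
| "Ck (Suc k) f \<longleftrightarrow>
     (\<forall>x. f differentiable (at x)) \<and> (\<forall>v. Ck k (\<lambda>x. frechet_derivative f (at x) v))"

text \<open>The space \<open>C\<^sub>c\<^sup>\<infinity>(\<Omega>)\<close> for open \<open>\<Omega>\<close>, each function being extended by zero.\<close>

definition test_functions :: "'a::euclidean_space set \<Rightarrow> ('a \<Rightarrow> real) set" where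
  "test_functions \<Omega> =
     {\<phi>. (\<forall>k. Ck k \<phi>) \<and> compact (closure {x. \<phi> x \<noteq> 0}) \<and> closure {x. \<phi> x \<noteq> 0} \<subseteq> \<Omega>}"

text \<open>
  A \<open>'b\<close>-valued distribution is represented by its action on real test functions; two
  distributions on \<open>\<Omega>\<close> are equal iff they agree on \<open>test_functions \<Omega>\<close>.
\<close>

type_synonym ('a, 'b) distribution = "('a \<Rightarrow> real) \<Rightarrow> 'b"

definition dist_of ::
  "'a::euclidean_space set \<Rightarrow> ('a \<Rightarrow> 'b::euclidean_space) \<Rightarrow> ('a, 'b) distribution" where
  "dist_of \<Omega> f \<phi> = (LINT x|lebesgue_on \<Omega>. \<phi> x *\<^sub>R f x)"

definition dist_deriv ::
  "'a::euclidean_space \<Rightarrow> ('a, 'b::euclidean_space) distribution \<Rightarrow> ('a, 'b) distribution" where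
  "dist_deriv v T \<phi> = - T (\<lambda>x. frechet_derivative \<phi> (at x) v)"

definition locally_integrable_on ::
  "'a::euclidean_space set \<Rightarrow> ('a \<Rightarrow> 'b::euclidean_space) \<Rightarrow> bool" where
  "locally_integrable_on \<Omega> f \<longleftrightarrow> (\<forall>K. compact K \<and> K \<subseteq> \<Omega> \<longrightarrow> integrable (lebesgue_on K) f)"

definition has_weak_deriv ::
  "'a::euclidean_space set \<Rightarrow> 'a \<Rightarrow> ('a \<Rightarrow> 'b::euclidean_space) \<Rightarrow> ('a \<Rightarrow> 'b) \<Rightarrow> bool" where
  "has_weak_deriv \<Omega> v u w \<longleftrightarrow>
     locally_integrable_on \<Omega> u \<and> locally_integrable_on \<Omega> w \<and>
     (\<forall>\<phi>\<in>test_functions \<Omega>. dist_deriv v (dist_of \<Omega> u) \<phi> = dist_of \<Omega> w \<phi>)"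

definition weakly_differentiable ::
  "'a::euclidean_space set \<Rightarrow> 'a \<Rightarrow> ('a \<Rightarrow> 'b::euclidean_space) \<Rightarrow> bool" where
  "weakly_differentiable \<Omega> v u \<longleftrightarrow> (\<exists>w. has_weak_deriv \<Omega> v u w)"

text \<open>
  A weak derivative is determined only almost everywhere, so this picks a representative.
\<close>

definition weak_deriv ::
  "'a::euclidean_space set \<Rightarrow> 'a \<Rightarrow> ('a \<Rightarrow> 'b::euclidean_space) \<Rightarrow> 'a \<Rightarrow> 'b" where
  "weak_deriv \<Omega> v u = (SOME w. has_weak_deriv \<Omega> v u w)"


subsection \<open>Lebesgue and Sobolev spaces\<close>

definition Lp :: "real \<Rightarrow> 'a measure \<Rightarrow> ('a \<Rightarrow> 'b::euclidean_space) set" where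
  "Lp p M = {f \<in> borel_measurable M. integrable M (\<lambda>x. norm (f x) powr p)}"

definition Lp_norm :: "real \<Rightarrow> 'a measure \<Rightarrow> ('a \<Rightarrow> 'b::euclidean_space) \<Rightarrow> real" where
  "Lp_norm p M f = (LINT x|M. norm (f x) powr p) powr (1 / p)"

definition H2 :: "('a::euclidean_space \<Rightarrow> 'b::euclidean_space) set" where
  "H2 = {u \<in> Lp 2 lebesgue.
     \<forall>i\<in>Basis. weakly_differentiable UNIV i u \<and> weak_deriv UNIV i u \<in> Lp 2 lebesgue \<and>
       (\<forall>j\<in>Basis. weakly_differentiable UNIV j (weak_deriv UNIV i u) \<and>
          weak_deriv UNIV j (weak_deriv UNIV i u) \<in> Lp 2 lebesgue)}"

definition H2_norm :: "('a::euclidean_space \<Rightarrow> 'b::euclidean_space) \<Rightarrow> real" where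
  "H2_norm u = sqrt ((Lp_norm 2 lebesgue u)\<^sup>2
     + (\<Sum>i\<in>Basis. (Lp_norm 2 lebesgue (weak_deriv UNIV i u))\<^sup>2)
     + (\<Sum>i\<in>Basis. \<Sum>j\<in>Basis. (Lp_norm 2 lebesgue (weak_deriv UNIV j (weak_deriv UNIV i u)))\<^sup>2))"

definition e3 :: "real^3" where
  "e3 = vector [0, 0, 1]"

definition H2_sphere :: "(real^3 \<Rightarrow> real^3) set" where
  "H2_sphere = {u. (AE x in lebesgue. u x \<in> sphere 0 1) \<and> (\<lambda>x. u x - e3) \<in> H2}"


subsection \<open>Function spaces on space-time\<close>

definition spacetime :: "(real \<times> (real^3)) set" where
  "spacetime = {0<..} \<times> UNIV"

abbreviation time_dir :: "real \<times> (real^3)" where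
  "time_dir \<equiv> (1, 0)"

abbreviation space_dir :: "3 \<Rightarrow> real \<times> (real^3)" where
  "space_dir k \<equiv> (0, axis k 1)"

text \<open>
  Elements of the Bochner spaces over \<open>(0,\<infinity>)\<close> are represented by jointly measurable functions
  on space-time.  Since the spaces of values are separable, this amounts to strong measurability
  of \<open>t \<mapsto> f(t,\<cdot>)\<close>.
\<close>

definition Linf_Lp :: "real \<Rightarrow> (real \<times> (real^3) \<Rightarrow> real^3) set" where
  "Linf_Lp p = {f \<in> borel_measurable (lebesgue_on spacetime).
     \<exists>C. AE t in lebesgue_on {0<..}.
       (\<lambda>x. f (t, x)) \<in> Lp p lebesgue \<and> Lp_norm p lebesgue (\<lambda>x. f (t, x)) \<le> C}"

definition Linf_H2_sphere :: "(real \<times> (real^3) \<Rightarrow> real^3) set" where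
  "Linf_H2_sphere = {m \<in> borel_measurable (lebesgue_on spacetime).
     \<exists>C. AE t in lebesgue_on {0<..}.
       (\<lambda>x. m (t, x)) \<in> H2_sphere \<and> H2_norm (\<lambda>x. m (t, x) - e3) \<le> C}"

definition Hdot1_L2 :: "(real \<times> (real^3) \<Rightarrow> real^3) set" where
  "Hdot1_L2 = {m. \<exists>w \<in> Lp 2 (lebesgue_on spacetime). has_weak_deriv spacetime time_dir m w}"

text \<open>
  The value at \<open>t = 0\<close> is that of the representative \<open>M\<close> of \<open>m\<close> for which \<open>M - e3\<close> is
  continuous from \<open>[0,\<infinity>)\<close> to \<open>L\<^sup>2\<close>.
\<close>

definition has_initial_value :: "(real \<times> (real^3) \<Rightarrow> real^3) \<Rightarrow> (real^3 \<Rightarrow> real^3) \<Rightarrow> bool" where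
  "has_initial_value m m0 \<longleftrightarrow>
     (\<exists>M :: real \<Rightarrow> real^3 \<Rightarrow> real^3.
        (\<forall>t\<ge>0. (\<lambda>x. M t x - e3) \<in> Lp 2 lebesgue) \<and>
        (\<forall>s\<ge>0. ((\<lambda>t. Lp_norm 2 lebesgue (\<lambda>x. M t x - M s x)) \<longlongrightarrow> 0) (at s within {0..})) \<and>
        (AE t in lebesgue_on {0<..}. AE x in lebesgue. M t x = m (t, x)) \<and>
        (AE x in lebesgue. M 0 x = m0 x))"


subsection \<open>The equation\<close>

unbundle cross3_syntax

text \<open>
  The distribution \<open>m \<times> \<Delta>\<^sup>2 m\<close>, read as
  \<open>\<Delta>(m \<times> \<Delta>m) - 2 \<Sum>\<^sub>k \<partial>\<^sub>k(\<partial>\<^sub>k m \<times> \<Delta>m)\<close>, where \<open>Dm k\<close> is \<open>\<partial>\<^sub>k m\<close> and \<open>Lm\<close> is \<open>\<Delta>m\<close>.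
\<close>

definition cross_bilaplacian ::
  "(real \<times> (real^3) \<Rightarrow> real^3) \<Rightarrow> (3 \<Rightarrow> real \<times> (real^3) \<Rightarrow> real^3) \<Rightarrow> (real \<times> (real^3) \<Rightarrow> real^3)
     \<Rightarrow> (real \<times> (real^3), real^3) distribution" where
  "cross_bilaplacian m Dm Lm \<phi> =
     (\<Sum>k\<in>UNIV. dist_deriv (space_dir k) (dist_deriv (space_dir k)
        (dist_of spacetime (\<lambda>z. m z \<times> Lm z))) \<phi>)
     - 2 *\<^sub>R (\<Sum>k\<in>UNIV. dist_deriv (space_dir k) (dist_of spacetime (\<lambda>z. Dm k z \<times> Lm z)) \<phi>)"

text \<open>
  The functions \<open>Dt\<close>, \<open>D k\<close> and \<open>DD k\<close> are the distributional derivatives \<open>\<partial>\<^sub>t m\<close>, \<open>\<partial>\<^sub>k m\<close> and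
  \<open>\<partial>\<^sub>k\<partial>\<^sub>k m\<close> on space-time; they are unique almost everywhere, and exist for every
  \<open>m \<in> Linf_H2_sphere \<inter> Hdot1_L2\<close>.  For such \<open>m\<close>, and \<open>j\<close> in \<open>L\<^sup>\<infinity>(L\<^bsup>6/5\<^esup>)\<close>, all functions to
  which \<open>dist_of\<close> is applied are locally integrable.
\<close>

definition distributional_solution ::
  "real \<Rightarrow> real \<Rightarrow> (real \<times> (real^3) \<Rightarrow> real^3) \<Rightarrow> (real \<times> (real^3) \<Rightarrow> real^3) \<Rightarrow> bool" where
  "distributional_solution \<alpha> h j m \<longleftrightarrow>
     (\<exists>Dt D DD.
        has_weak_deriv spacetime time_dir m Dt \<and>
        (\<forall>k. has_weak_deriv spacetime (space_dir k) m (D k)) \<and>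
        (\<forall>k. has_weak_deriv spacetime (space_dir k) (D k) (DD k)) \<and>
        (let Lm = (\<lambda>z. \<Sum>k\<in>UNIV. DD k z) in
         \<forall>\<phi>\<in>test_functions spacetime.
           dist_deriv time_dir (dist_of spacetime m) \<phi> =
             dist_of spacetime (\<lambda>z. m z \<times> (\<alpha> *\<^sub>R Dt z + Lm z - h *\<^sub>R e3)) \<phi>
             + cross_bilaplacian m D Lm \<phi>
             - dist_of spacetime (\<lambda>z. \<Sum>k\<in>UNIV. (j z $ k) *\<^sub>R D k z) \<phi>))"

unbundle no cross3_syntax

end

theory Submission
  imports Defs
begin

text \<open>
  The difference \<open>u = m1 - m2\<close> of two solutions satisfies, at almost every time, the estimate
  \<open>\<integral> \<partial>\<^sub>t u \<bullet> u \<le> C \<integral> |u|\<^sup>2\<close> with a constant that depends only on the bounds of the two solutions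
  (\<open>slice_energy_estimate\<close>). Since both solutions start from the same value, Gronwall's lemma
  (\<open>gronwall_AE\<close>) gives \<open>u = 0\<close>.

  For the estimate the two equations are subtracted and tested with \<open>u + \<alpha> m1 \<times> m2\<close>. This multiplier
  turns the damping terms into a multiple of \<open>\<partial>\<^sub>t u \<bullet> u\<close> (\<open>multiplier_identity\<close>), and the fourth order
  term yields the dissipation \<open>- \<alpha> \<integral> |\<Delta>u|\<^sup>2\<close>, because \<open>|m| = 1\<close> makes the component of \<open>\<Delta>u\<close> along \<open>m\<close> a
  term of lower order (\<open>difference_energy_pointwise\<close>). The remaining terms are controlled by
  interpolation: \<open>\<parallel>\<nabla>u\<parallel>\<^sup>2\<close> in \<open>L\<^sup>4\<close> and \<open>|u|\<^sup>2\<close> in the supremum norm are at most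
  \<open>\<delta> \<integral> |\<Delta>u|\<^sup>2 + C \<integral> |u|\<^sup>2\<close> with \<open>\<delta>\<close> arbitrarily small (\<open>H2f_interpolation\<close>), which rests on the
  Gagliardo--Nirenberg--Sobolev and Morrey inequalities. The current in \<open>L\<^bsup>6/5\<^esup>\<close> is paired with the
  gradient in \<open>L\<^sup>6\<close>, which \<open>\<Delta>u\<close> bounds, and with \<open>u\<close> in the supremum norm.

  The multiplier is not a test function. Weak derivatives are therefore treated as absolute
  continuity along almost every line (\<open>line_ac\<close>), which has a product rule. At almost every time a
  solution satisfies the equation against all translates of smooth kernels (\<open>solution_slices\<close>), and
  such a mollified equation can be tested with functions of low regularity
  (\<open>test_mollified_equation\<close>).
\<close>

section \<open>Notation\<close>

text \<open>Short forms for Borel measurability, Lebesgue integrals and sums over the three coordinates.\<close>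

abbreviation "Bm \<equiv> borel_measurable borel"
abbreviation "integ \<equiv> integrable lborel"
abbreviation "FD \<equiv> frechet_derivative"
abbreviation "tests \<equiv> test_functions"
abbreviation AE_lborel (binder "AEl " 10) where "AE_lborel P \<equiv> AE x in lborel. P x"
abbreviation nn_lborel (binder "NN " 60) where "nn_lborel f \<equiv> \<integral>\<^sup>+x. f x \<partial>lborel"
abbreviation sum_all (binder "SUM3 " 10) where "sum_all f \<equiv> \<Sum>k\<in>UNIV. f k"
abbreviation limit_of (infix "--->" 60) where "X ---> L \<equiv> X \<longlonglongrightarrow> L"
notation scaleR (infixr "*R" 75)

lemmas Bi_integrable_add = Bochner_Integration.integrable_add
lemmas Bi_integrable_bound = Bochner_Integration.integrable_bound
lemmas Bi_integrable_diff = Bochner_Integration.integrable_diff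
lemmas Bi_integrable_sum = Bochner_Integration.integrable_sum
lemmas Bi_integral_add = Bochner_Integration.integral_add
lemmas Bi_integral_cong = Bochner_Integration.integral_cong
lemmas Bi_integral_diff = Bochner_Integration.integral_diff
lemmas Bi_integral_sum = Bochner_Integration.integral_sum

section \<open>Smooth compactly supported functions\<close>

lemma Ck_SucD: "Ck (Suc k) f ==> Ck k f"
proof (induction k arbitrary: f)
 case 0
 then show ?case
  by (auto intro!: continuous_at_imp_continuous_on differentiable_imp_continuous_within)
next
 case (Suc k)
 then show ?case by (metis Ck.simps(2))
qed

lemma Ck_const: "Ck k (%x. c)"
 by (induction k arbitrary: c) (auto)

lemma Ck_add: "Ck k f ==> Ck k g ==> Ck k (%x. f x + g x)"
proof (induction k arbitrary: f g)
 case 0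
 then show ?case by (auto intro: continuous_on_add)
next
 case (Suc k)
 have "FD (%x. f x + g x) (at x) v =
   FD f (at x) v + FD g (at x) v" for x v
 proof -
  have "((%x. f x + g x) has_derivative
    (%v. FD f (at x) v + FD g (at x) v)) (at x)"
   using Suc.prems by (intro has_derivative_add) (auto simp: frechet_derivative_works[symmetric])
  from frechet_derivative_at[OF this] show ?thesis by metis
 qed
 then show ?case using Suc by auto
qed

lemma Ck_mult:
 fixes f g :: "'a::euclidean_space => real"
 shows "Ck k f ==> Ck k g ==> Ck k (%x. f x * g x)"
proof (induction k arbitrary: f g)
 case 0
 then show ?case by (auto intro: continuous_on_mult)
next
 case (Suc k)
 have d: "((%x. f x * g x) has_derivative
   (%v. f x * FD g (at x) v + FD f (at x) v * g x)) (at x)" for x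
  using Suc.prems by (intro has_derivative_mult) (auto simp: frechet_derivative_works[symmetric])
 have "FD (%x. f x * g x) (at x) v =
   f x * FD g (at x) v + FD f (at x) v * g x" for x v
  using frechet_derivative_at[OF d[of x]] by metis
 moreover have "(%x. f x * g x) differentiable (at x)" for x
  using d differentiable_def by blast
 moreover have "Ck k f" "Ck k g" using Suc.prems Ck_SucD by blast+
 ultimately show ?case using Suc by (auto intro!: Ck_add)
qed

lemma Ck_prod:
 fixes f :: "'i => 'a::euclidean_space => real"
 assumes "finite I" "!!i. i \<in> I ==> Ck k (f i)"
 shows "Ck k (%x. \<Prod>i\<in>I. f i x)"
 using assms by (induction I rule: finite_induct) (auto intro!: Ck_mult Ck_const)

lemma Ck_affine:
 fixes A :: "'a::euclidean_space => 'c::euclidean_space"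
 assumes "bounded_linear A"
 shows "Ck k g ==> Ck k (%x. g (A x + d))"
proof (induction k arbitrary: g)
 case 0
 then show ?case
  using continuous_on_compose2[of UNIV g UNIV "%x. A x + d"]
  by (simp add: continuous_on_add linear_continuous_on assms)
next
 case (Suc k)
 have A: "((%x. A x + d) has_derivative A) (at x)" for x
  using has_derivative_add_const[OF bounded_linear_imp_has_derivative[OF assms]] by blast
 have d: "((%x. g (A x + d)) has_derivative (%v. FD g (at (A x + d)) (A v))) (at x)" for x
  using Suc.prems
  by (intro has_derivative_compose[OF A]) (auto simp: frechet_derivative_works[symmetric])
 have "FD (%x. g (A x + d)) (at x) v = FD g (at (A x + d)) (A v)" for x v
  using frechet_derivative_at[OF d[of x]] by metis
 moreover have "(%x. g (A x + d)) differentiable (at x)" for x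
  using d differentiable_def by blast
 moreover have "Ck k (%x. FD g (at (A x + d)) (A v))" for v
  using Suc.IH[of "%y. FD g (at y) (A v)"] Suc.prems by auto
 ultimately show ?case by auto
qed

text \<open>
 The functions \<open>p(1/s) exp(-1/s)\<close> on the positive half-line, extended by zero, are stable under
 differentiation; carrying the polynomial \<open>p\<close> along is what makes the induction over the order
 of smoothness work.
\<close>

definition flat_exp :: "real poly => real => real" where
 "flat_exp p s = (if s > 0 then poly p (1/s) * exp (- (1/s)) else 0)"

lemma poly_times_exp_minus_tendsto_0:
 fixes p :: "real poly"
 shows "((%x. poly p x * exp (- x)) \<longlongrightarrow> 0) at_top"
proof -
 have "((%x. \<Sum>i\<le>degree p. coeff p i * (x ^ i / exp x)) \<longlongrightarrow> (\<Sum>i\<le>degree p. coeff p i * 0)) at_top"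
  by (intro tendsto_sum tendsto_mult tendsto_const tendsto_power_div_exp_0)
 moreover have "(\<Sum>i\<le>degree p. coeff p i * (x ^ i / exp x)) = poly p x * exp (- x)" for x
  by (simp add: poly_altdef sum_distrib_right exp_minus divide_inverse mult.assoc)
 ultimately show ?thesis by simp
qed

lemma flat_exp_deriv:
 "(flat_exp p has_real_derivative flat_exp ([:0, 0, 1:] * (p - pderiv p)) s) (at s)"
proof -
 consider "s > 0" | "s < 0" | "s = 0" by linarith
 then show ?thesis
 proof cases
  case 1
  have "((%s. poly p (1/s) * exp (- (1/s))) has_real_derivative
    flat_exp ([:0, 0, 1:] * (p - pderiv p)) s) (at s)"
   using 1 by (auto intro!: derivative_eq_intros DERIV_chain'[where g="poly p"] poly_DERIV
     simp: flat_exp_def field_simps power2_eq_square)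
  moreover have "eventually (%s. poly p (1/s) * exp (- (1/s)) = flat_exp p s) (nhds s)"
   using 1 eventually_nhds_in_open[of "{0<..}" s] by (auto simp: flat_exp_def elim: eventually_mono)
  ultimately show ?thesis by (subst (asm) DERIV_cong_ev[OF refl _ refl])
 next
  case 2
  have "eventually (%s. 0 = flat_exp p s) (nhds s)"
   using 2 eventually_nhds_in_open[of "{..<0}" s] by (auto simp: flat_exp_def elim: eventually_mono)
  moreover have "((%s. 0) has_real_derivative flat_exp ([:0, 0, 1:] * (p - pderiv p)) s) (at s)"
   using 2 by (auto simp: flat_exp_def)
  ultimately show ?thesis by (subst (asm) DERIV_cong_ev[OF refl _ refl])
 next
  case 3
  have "((%h. flat_exp p h / h) \<longlongrightarrow> 0) (at 0)"
  proof (rule filterlim_split_at)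
   show "((%h. flat_exp p h / h) \<longlongrightarrow> 0) (at_left 0)"
    by (rule tendsto_eventually) (auto simp: eventually_at_filter flat_exp_def)
   have "((%h. poly ([:0,1:] * p) (inverse h) * exp (- (inverse h))) \<longlongrightarrow> 0) (at_right 0)"
    by (rule filterlim_compose[OF poly_times_exp_minus_tendsto_0 filterlim_inverse_at_top_right])
   then show "((%h. flat_exp p h / h) \<longlongrightarrow> 0) (at_right 0)"
    by (rule Lim_transform_eventually)
     (auto simp: eventually_at_filter flat_exp_def inverse_eq_divide)
  qed
  then show ?thesis using 3 by (simp add: DERIV_def) (simp add: flat_exp_def)
 qed
qed

lemma Ck_flat_exp: "Ck k (flat_exp p)"
proof (induction k arbitrary: p)
 case 0
 then show ?case
  by (auto intro!: continuous_at_imp_continuous_on DERIV_isCont flat_exp_deriv)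
next
 case (Suc k)
 let ?q = "[:0, 0, 1:] * (p - pderiv p)"
 have d: "(flat_exp p has_derivative (*) (flat_exp ?q s)) (at s)" for s
  using flat_exp_deriv[of p s] unfolding has_field_derivative_def .
 have e: "FD (flat_exp p) (at s) v = flat_exp ?q s * v" for s v
  using frechet_derivative_at[OF d[of s]] by metis
 have dd: "flat_exp p differentiable (at x)" for x using d differentiable_def by blast
 show ?case unfolding Ck.simps e using dd by (auto intro!: Ck_mult Ck_const Suc)
qed

abbreviation fexp :: "real => real" where "fexp \<equiv> flat_exp 1"

lemma fexp_pos: "s > 0 ==> fexp s > 0" and fexp_nonneg: "0 <= fexp s" and fexp_le1: "fexp s <= 1"
 and fexp_0: "s <= 0 ==> fexp s = 0"
 by (auto simp: flat_exp_def)

lemma fexp_scaled_tendsto: "(%k. fexp (real k * s)) ---> (if s > 0 then 1 else 0)"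
proof (cases "s > 0")
 case True
 have "(%k. exp (- ((1/s) * inverse (real k)))) ---> exp (- ((1/s) * 0))"
  by (intro tendsto_intros lim_inverse_n)
 then have "(%k. fexp (real k * s)) ---> 1"
  by (rule_tac Lim_transform_eventually[where f="%k. exp (- ((1/s) * inverse (real k)))"])
   (use True in \<open>auto simp: flat_exp_def field_simps intro!: eventually_sequentiallyI[of 1]\<close>)
 then show ?thesis using True by simp
next
 case False
 then show ?thesis by (auto simp: fexp_0 mult_nonneg_nonpos)
qed

definition box_bump :: "nat => 'a::euclidean_space => 'a => 'a => real" where
 "box_bump k a b x = (\<Prod>i\<in>Basis. fexp (real k * (x \<bullet> i - a \<bullet> i)) * fexp (real k * (b \<bullet> i - x \<bullet> i)))"

lemma Ck_box_bump: "Ck n (box_bump k a b)"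
proof -
 have 1: "Ck n (%x. fexp (real k * (x \<bullet> i - a \<bullet> i)))" for i
 proof -
  have "bounded_linear (%x. real k * (x \<bullet> i))"
   by (intro bounded_linear_const_mult bounded_linear_inner_left)
  from Ck_affine[OF this Ck_flat_exp, of n 1 "- real k * (a \<bullet> i)"] show ?thesis
   by (simp add: algebra_simps)
 qed
 have 2: "Ck n (%x. fexp (real k * (b \<bullet> i - x \<bullet> i)))" for i
 proof -
  have "bounded_linear (%x. - real k * (x \<bullet> i))"
   by (intro bounded_linear_const_mult bounded_linear_inner_left)
  from Ck_affine[OF this Ck_flat_exp, of n 1 "real k * (b \<bullet> i)"] show ?thesis
   by (simp add: algebra_simps)
 qed
 show ?thesis unfolding box_bump_def[abs_def] by (intro Ck_prod Ck_mult 1 2) auto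
qed

lemma box_bump_nonneg: "0 <= box_bump k a b x"
 unfolding box_bump_def by (intro prod_nonneg mult_nonneg_nonneg) (auto intro: fexp_nonneg)

lemma box_bump_le1: "box_bump k a b x <= 1"
 unfolding box_bump_def
 by (intro prod_le_1 conjI mult_nonneg_nonneg mult_le_one fexp_nonneg fexp_le1)

lemma box_bump_outside: "x \<notin> box a b ==> box_bump k a b x = 0"
 unfolding box_bump_def box_def by (fastforce simp: not_less mult_nonneg_nonpos intro: fexp_0)

lemma box_bump_pos: "k > 0 ==> x \<in> box a b ==> 0 < box_bump k a b x"
 unfolding box_bump_def box_def by (intro prod_pos mult_pos_pos fexp_pos) auto

lemma box_bump_tendsto: "(%k. box_bump k a b x) ---> indicator (box a b) x"
proof -
 have "(%k. box_bump k a b x) --->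
  (\<Prod>i\<in>Basis. (if x \<bullet> i - a \<bullet> i > 0 then 1 else 0) * (if b \<bullet> i - x \<bullet> i > 0 then 1 else 0))"
  unfolding box_bump_def by (intro tendsto_prod tendsto_mult fexp_scaled_tendsto)
 also have "(\<Prod>i\<in>Basis. (if x \<bullet> i - a \<bullet> i > 0 then 1 else 0) * (if b \<bullet> i - x \<bullet> i > 0 then 1 else 0))
   = (indicator (box a b) x :: real)"
  by (auto simp: indicator_def box_def prod_zero_iff intro!: prod.neutral)
 finally show ?thesis .
qed

lemma test_functionsI:
 assumes "!!k. Ck k phi" "compact K" "K \<subseteq> Om" "!!x. x \<notin> K ==> phi x = 0"
 shows "phi : tests Om"
proof -
 have "{x. phi x ~= 0} \<subseteq> K" using assms(4) by auto
 then have "closure {x. phi x ~= 0} \<subseteq> K" using assms(2) by (simp add: closure_minimal compact_imp_closed)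
 moreover from this have "compact (closure {x. phi x ~= 0})"
  using assms(2) by (metis closed_closure compact_Int_closed inf.absorb_iff2)
 ultimately show ?thesis unfolding test_functions_def using assms by auto
qed

lemma test_functionsD:
 assumes "phi : tests Om"
 obtains K where "compact K" "K \<subseteq> Om" "!!x. x \<notin> K ==> phi x = 0"
  "!!x v. x \<notin> K ==> FD phi (at x) v = 0"
proof
 define K where "K = closure {x. phi x ~= 0}"
 show "compact K" "K \<subseteq> Om" using assms by (auto simp: test_functions_def K_def)
 show 0: "phi x = 0" if "x \<notin> K" for x
  using that closure_subset[of "{x. phi x ~= 0}"] unfolding K_def[symmetric] by auto
 have "open (- K)" by (simp add: K_def open_Compl)
 then have "(phi has_derivative (%v. 0)) (at x)" if "x \<notin> K" for x
  by (rule has_derivative_transform_within_open[where f="%y. 0", OF has_derivative_const]) (use that 0 in auto)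
 from frechet_derivative_at[OF this, symmetric]
 show "FD phi (at x) v = 0" if "x \<notin> K" for x v using that by simp
qed

lemma test_functions_Ck: "phi : tests Om ==> Ck k phi"
 by (simp add: test_functions_def)

lemma test_functions_differentiable: "phi : tests Om ==> phi differentiable (at x)"
 using test_functions_Ck[of phi Om "Suc 0"] by simp

lemma test_functions_has_derivative:
 "phi : tests Om ==> (phi has_derivative FD phi (at x)) (at x)"
 by (simp add: test_functions_differentiable frechet_derivative_works[symmetric])

lemma test_functions_continuous: "phi : tests Om ==> continuous_on UNIV phi"
 using test_functions_Ck[of phi Om 0] by simp

lemma test_functions_frechet:
 assumes "phi : tests Om"
 shows "(%x. FD phi (at x) v) : tests Om"
proof -
 obtain K where "compact K" "K \<subseteq> Om" "!!x v. x \<notin> K ==> FD phi (at x) v = 0"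
  using test_functionsD[OF assms] by metis
 then show ?thesis
  using test_functions_Ck[OF assms, of "Suc k" for k] by (intro test_functionsI[of _ K]) auto
qed

lemma box_bump_test: "cbox a b \<subseteq> Om ==> box_bump k a b : tests Om"
 by (rule test_functionsI[of _ "cbox a b"])
  (use box_subset_cbox[of a b] in \<open>auto intro: Ck_box_bump box_bump_outside\<close>)

lemma frechet_affine:
 fixes A :: "'a::euclidean_space => 'c::euclidean_space"
 assumes "bounded_linear A" "phi differentiable (at (A x + d))"
 shows "FD (%x. phi (A x + d)) (at x) v = FD phi (at (A x + d)) (A v)"
proof -
 have A: "((%x. A x + d) has_derivative A) (at x)" for x
  using has_derivative_add_const[OF bounded_linear_imp_has_derivative[OF assms(1)]] by blast
 have d: "((%x. phi (A x + d)) has_derivative (%v. FD phi (at (A x + d)) (A v))) (at x)"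
  using assms(2) by (intro has_derivative_compose[OF A]) (auto simp: frechet_derivative_works[symmetric])
 from frechet_derivative_at[OF this] show ?thesis by metis
qed

lemma test_functions_affine:
 fixes phi :: "'a::euclidean_space => real"
 assumes "phi : tests Om" "c ~= 0" "!!x. x \<in> Om ==> (x - d) /\<^sub>R c \<in> Om'"
 shows "(%x. phi (c *R x + d)) : tests Om'"
proof -
 obtain K where K: "compact K" "K \<subseteq> Om" "!!x. x \<notin> K ==> phi x = 0"
  using test_functionsD[OF assms(1)] by metis
 show ?thesis
 proof (rule test_functionsI[of _ "(%x. (x - d) /\<^sub>R c) ` K"])
  show "Ck k (%x. phi (c *R x + d))" for k
   by (intro Ck_affine test_functions_Ck[OF assms(1)] bounded_linear_scaleR_right)
  show "compact ((%x. (x - d) /\<^sub>R c) ` K)"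
   by (intro compact_continuous_image K continuous_intros)
  show "(%x. (x - d) /\<^sub>R c) ` K \<subseteq> Om'" using K assms by auto
  fix x assume *: "x \<notin> (%x. (x - d) /\<^sub>R c) ` K"
  have "((c *R x + d) - d) /\<^sub>R c = x" using assms(2) by simp
  then have "c *R x + d \<notin> K" using * by (metis imageI)
  then show "phi (c *R x + d) = 0" by (rule K)
 qed
qed

lemma test_functions_tensor:
 fixes psi :: "'a::euclidean_space => real" and eta :: "'b::euclidean_space => real"
 assumes "psi : tests A" "eta : tests B"
 shows "(%z. psi (fst z) * eta (snd z)) : tests (A \<times> B)"
proof -
 obtain K where K: "compact K" "K \<subseteq> A" "!!x. x \<notin> K ==> psi x = 0"
  using test_functionsD[OF assms(1)] by metis
 obtain L where L: "compact L" "L \<subseteq> B" "!!x. x \<notin> L ==> eta x = 0"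
  using test_functionsD[OF assms(2)] by metis
 show ?thesis
 proof (rule test_functionsI[of _ "K \<times> L"])
  show "Ck k (%z. psi (fst z) * eta (snd z))" for k
   using Ck_affine[OF bounded_linear_fst test_functions_Ck[OF assms(1)], of k 0]
    Ck_affine[OF bounded_linear_snd test_functions_Ck[OF assms(2)], of k 0]
   by (intro Ck_mult) auto
  show "psi (fst z) * eta (snd z) = 0" if "z \<notin> K \<times> L" for z
   using that K(3) L(3) by (cases z) auto
 qed (use K L in \<open>auto intro: compact_Times\<close>)
qed

lemma frechet_tensor:
 fixes psi :: "'a::euclidean_space => real" and eta :: "'b::euclidean_space => real"
 assumes "psi differentiable (at (fst z))" "eta differentiable (at (snd z))"
 shows "FD (%z. psi (fst z) * eta (snd z)) (at z) v =
  psi (fst z) * FD eta (at (snd z)) (snd v) +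
  FD psi (at (fst z)) (fst v) * eta (snd z)"
proof -
 have "((%z. psi (fst z)) has_derivative (%v. FD psi (at (fst z)) (fst v))) (at z)"
  using assms by (intro has_derivative_compose[OF has_derivative_fst[OF has_derivative_ident]])
   (simp add: frechet_derivative_works[symmetric])
 moreover have "((%z. eta (snd z)) has_derivative (%v. FD eta (at (snd z)) (snd v))) (at z)"
  using assms by (intro has_derivative_compose[OF has_derivative_snd[OF has_derivative_ident]])
   (simp add: frechet_derivative_works[symmetric])
 ultimately have "((%z. psi (fst z) * eta (snd z)) has_derivative (%v. psi (fst z) * FD eta (at (snd z)) (snd v) +
  FD psi (at (fst z)) (fst v) * eta (snd z))) (at z)"
  by (rule has_derivative_mult)
 from frechet_derivative_at[OF this, symmetric] show ?thesis by simp
qed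

lemma frechet_scaled_dir:
 "phi : tests Om ==> FD phi (at x) (c *R v) = c * FD phi (at x) v"
 using linear_scale[OF linear_frechet_derivative[OF test_functions_differentiable]] by fastforce

section \<open>Functions with vanishing integrals\<close>

text \<open>Local integrability on \<open>Om\<close>, for Borel representatives.\<close>

definition loc_int :: "'a::euclidean_space set => ('a => real) => bool" where
 "loc_int Om f \<longleftrightarrow> f : Bm \<and>
  (\<forall>K. compact K \<and> K \<subseteq> Om --> integ (%x. indicator K x * f x))"

lemma loc_int_measurable: "loc_int Om f ==> f : Bm"
 by (simp add: loc_int_def)

lemma loc_int_mult_bounded:
 assumes "loc_int Om f" and g[measurable]: "g : Bm"
  and "compact K" "K \<subseteq> Om" "!!x. x \<notin> K ==> g x = 0" "!!x. \<bar>g x\<bar> <= B"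
 shows "integ (%x. g x * f x)"
proof (rule Bi_integrable_bound)
 have [measurable]: "f : Bm" using assms(1) by (rule loc_int_measurable)
 show "integ (%x. B * (indicator K x * f x))"
  using assms unfolding loc_int_def by (intro integrable_mult_right) auto
 show "(%x. g x * f x) : borel_measurable lborel" by measurable
 show "AEl x. norm (g x * f x) <= norm (B * (indicator K x * f x))"
 proof (rule AE_I2)
  fix x
  show "norm (g x * f x) <= norm (B * (indicator K x * f x))"
   using assms(5)[of x] assms(6)[of x] by (cases "x \<in> K") (auto simp: abs_mult intro!: mult_right_mono)
 qed
qed

lemma test_functions_measurable [measurable_dest]:
 "phi : tests Om ==> phi : Bm"
 by (intro borel_measurable_continuous_onI test_functions_continuous)

lemma test_functions_bounded:
 fixes phi :: "'a::euclidean_space => real"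
 assumes "phi : tests Om"
 obtains K B where "compact K" "K \<subseteq> Om" "!!x. x \<notin> K ==> phi x = 0" "!!x. \<bar>phi x\<bar> <= B" "0 <= B"
proof -
 obtain K where K: "compact K" "K \<subseteq> Om" "!!x. x \<notin> K ==> phi x = 0"
  using test_functionsD[OF assms] by metis
 have "compact (phi ` K)"
  using K(1) test_functions_continuous[OF assms] by (intro compact_continuous_image) (auto intro: continuous_on_subset)
 then have "bounded (phi ` K)" by (rule compact_imp_bounded)
 then obtain B where B: "!!y. y \<in> phi ` K ==> norm y <= B"
  unfolding bounded_iff by blast
 have "\<bar>phi x\<bar> <= \<bar>B\<bar>" for x
 proof (cases "x \<in> K")
  case True
  then show ?thesis using B[of "phi x"] by simp
 next
  case False
  then show ?thesis using K(3)[of x] by simp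
 qed
 then show ?thesis using that[OF K(1,2), of "\<bar>B\<bar>"] K(3) by (metis abs_ge_zero)
qed

lemma loc_int_mult_test:
 assumes "loc_int Om f" "phi : tests Om"
 shows "integ (%x. phi x * f x)"
proof -
 obtain K B where "compact K" "K \<subseteq> Om" "!!x. x \<notin> K ==> phi x = 0" "!!x. \<bar>phi x\<bar> <= B"
  using test_functions_bounded[OF assms(2)] by metis
 then show ?thesis by (rule loc_int_mult_bounded[OF assms(1) test_functions_measurable[OF assms(2)]])
qed

text \<open>
 The boxes generate the Borel sets, so the densities of the positive and of the negative part of the function agree.
\<close>

lemma zero_if_box_integrals_zero:
 fixes g :: "'a::euclidean_space => real"
 assumes g: "integ g" and z: "!!c d. (LBINT x. indicator (box c d) x * g x) = 0"
 shows "AEl x. g x = 0"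
proof (rule density_unique_real[OF g])
 have [measurable]: "g : Bm" using g by auto
 let ?G = "range (%(a, b). box a b) :: 'a set set"
 have gi: "integ (%x. indicator A x * g x)" if "A \<in> sets borel" for A
  using integrable_real_mult_indicator[OF _ g, of A] that by (simp add: mult.commute)
 have "(LBINT x. g x) = 0"
 proof -
  let ?B = "%n::nat. box (- (real n *R One)) (real n *R One) :: 'a set"
  have "(%n. LBINT x. indicator (?B n) x * g x) ---> (LBINT x. g x)"
  proof (rule integral_dominated_convergence[where w="%x. \<bar>g x\<bar>"])
   show "AEl x. (%n. indicator (?B n) x * g x) ---> g x"
   proof (rule AE_I2)
    fix x :: 'a
    have "x \<in> (\<Union>i. ?B i)" unfolding UN_box_eq_UNIV by auto
    then obtain n where n: "x \<in> ?B n" by auto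
    have "x \<in> ?B m" if "m >= n" for m
    proof -
     have "?B n \<subseteq> ?B m" using that by (intro subset_box_imp) auto
     then show ?thesis using n by blast
    qed
    then show "(%n. indicator (?B n) x * g x) ---> g x"
     by (intro tendsto_eventually eventually_sequentiallyI[of n]) auto
   qed
  qed (use g in \<open>auto simp: indicator_def\<close>)
  moreover have "(%n. LBINT x. indicator (?B n) x * g x) = (%n. 0)" using z by auto
  ultimately show ?thesis using LIMSEQ_unique tendsto_const by metis
 qed
 note all = this
 have *: "(LBINT x. indicator A x * g x) = 0" if A: "A \<in> sigma_sets UNIV ?G" for A
 proof (rule sigma_sets_induct_disjoint[OF _ _ A])
  show "Int_stable ?G" by (auto simp: Int_stable_def box_Int_box)
  show "?G \<subseteq> Pow UNIV" by auto
  show "!!A. A \<in> ?G ==> (LBINT x. indicator A x * g x) = 0" using z by auto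
  show "(LBINT x. indicator {} x * g x) = 0" by simp
  show "(LBINT x. indicator (UNIV - A) x * g x) = 0"
   if "A \<in> sigma_sets UNIV ?G" "(LBINT x. indicator A x * g x) = 0" for A
  proof -
   have "A \<in> sets borel" using that(1) by (simp add: borel_eq_box)
   have "(LBINT x. indicator (UNIV - A) x * g x) = (LBINT x. g x - indicator A x * g x)"
    by (intro Bi_integral_cong) (auto simp: indicator_def)
   also have "... = 0" using g gi[OF \<open>A \<in> sets borel\<close>] all that by simp
   finally show ?thesis .
  qed
  fix A :: "nat => 'a set"
  assume d: "disjoint_family A" and A: "range A \<subseteq> sigma_sets UNIV ?G"
   and 0: "!!i. (LBINT x. indicator (A i) x * g x) = 0"
  have "A i \<in> sets lborel" for i using A by (auto simp: borel_eq_box)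
  then have "(\<integral>x\<in>(\<Union>i. A i). g x \<partial>lborel) = (\<Sum>i. \<integral>x\<in>A i. g x \<partial>lborel)"
   using d g by (intro lebesgue_integral_countable_add)
    (auto simp: disjoint_family_on_def set_integrable_def intro!: gi)
  then show "(LBINT x. indicator (\<Union> (range A)) x * g x) = 0"
   using 0 by (simp add: set_lebesgue_integral_def)
 qed
 show "(\<integral>x\<in>A. g x \<partial>lborel) = (\<integral>x\<in>A. 0 \<partial>lborel)" if "A \<in> sets lborel" for A
  using *[of A] that by (simp add: set_lebesgue_integral_def borel_eq_box)
qed simp

lemma AE_on_open_if_AE_on_cbox:
 fixes Om :: "'a::euclidean_space set"
 assumes "open Om" "!!a b. cbox a b \<subseteq> Om ==> AEl x. x \<in> cbox a b --> P x"
 shows "AEl x. x \<in> Om --> P x"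
proof -
 obtain \<D> where D: "countable \<D>" "\<D> \<subseteq> Pow Om" "!!X. X \<in> \<D> ==> \<exists>a b. X = cbox a b" "\<Union>\<D> = Om"
  using open_countable_Union_open_cbox[OF assms(1)] by metis
 have "AEl x. x \<in> X --> P x" if "X \<in> \<D>" for X
  using D(2) D(3)[OF that] that assms(2) by blast
 then have "AEl x. \<forall>X\<in>\<D>. x \<in> X --> P x"
  by (subst AE_ball_countable[OF D(1)]) blast
 then show ?thesis by eventually_elim (use D(4) in blast)
qed

text \<open>
 Smooth bumps converge boundedly to the indicator of a box.
\<close>

lemma zero_if_test_integrals_zero:
 fixes f :: "'a::euclidean_space => real"
 assumes "open Om" and f: "loc_int Om f" and z: "!!phi. phi : tests Om ==> (LBINT x. phi x * f x) = 0"
 shows "AEl x. x \<in> Om --> f x = 0"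
proof (rule AE_on_open_if_AE_on_cbox[OF assms(1)])
 fix a b :: 'a assume ab: "cbox a b \<subseteq> Om"
 have [measurable]: "f : Bm" using f by (rule loc_int_measurable)
 have int: "integ (%x. indicator (cbox a b) x * f x)"
  using f ab by (simp add: loc_int_def)
 have zb: "(LBINT x. indicator (box c d) x * f x) = 0" if "box c d \<subseteq> box a b" for c d
 proof (cases "box c d = {}")
  case False
  then have cd: "cbox c d \<subseteq> cbox a b" using that by (metis closure_box closure_mono closure_closed closed_cbox box_subset_cbox subset_trans closure_minimal)
  have "(%k. LBINT x. box_bump k c d x * f x) ---> (LBINT x. indicator (box c d) x * f x)"
  proof (rule integral_dominated_convergence[where w="%x. norm (indicator (cbox a b) x * f x)"])
   show "AEl x. (%k. box_bump k c d x * f x) ---> indicator (box c d) x * f x"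
    by (intro AE_I2 tendsto_mult box_bump_tendsto tendsto_const)
   show "AEl x. norm (box_bump k c d x * f x) <= norm (indicator (cbox a b) x * f x)" for k
   proof (intro AE_I2)
    fix x
    show "norm (box_bump k c d x * f x) <= norm (indicator (cbox a b) x * f x)"
     using box_bump_nonneg[of k c d x] box_bump_le1[of k c d x] box_bump_outside[of x c d k] cd box_subset_cbox[of c d]
     by (cases "x \<in> box c d") (auto simp: abs_mult indicator_def intro!: mult_left_le_one_le)
   qed
   show "(%x. box_bump k c d x * f x) : borel_measurable lborel" for k
    using test_functions_measurable[OF box_bump_test[of c d UNIV k]] by simp
  qed (use int in auto)
  moreover have "(LBINT x. box_bump k c d x * f x) = 0" for k
   using cd ab by (intro z box_bump_test) auto
  ultimately have "(%k::nat. 0) ---> (LBINT x. indicator (box c d) x * f x)" by simp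
  from LIMSEQ_unique[OF this tendsto_const] show ?thesis .
 qed simp
 have "AEl x. indicator (box a b) x * f x = 0"
 proof (rule zero_if_box_integrals_zero)
  show "integ (%x. indicator (box a b) x * f x)"
   by (rule Bi_integrable_bound[OF int]) (use box_subset_cbox[of a b] in \<open>auto simp: indicator_def\<close>)
  fix c d :: 'a
  obtain c' d' where cd: "box c d \<inter> box a b = box c' d'" by (rule that[OF box_Int_box])
  have "(LBINT x. indicator (box c d) x * (indicator (box a b) x * f x))
    = (LBINT x. indicator (box c' d') x * f x)"
   unfolding cd[symmetric] indicator_inter_arith by (simp only: mult.assoc)
  also have "... = 0" by (rule zb) (metis cd inf.cobounded2)
  finally show "(LBINT x. indicator (box c d) x * (indicator (box a b) x * f x)) = 0" .
 qed
 moreover have "AEl x. x \<notin> cbox a b - box a b"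
  using null_sets_cbox_Diff_box AE_not_in by blast
 ultimately show "AEl x. x \<in> cbox a b --> f x = 0"
 proof eventually_elim
  case (elim x)
  then show ?case by (cases "x \<in> box a b") auto
 qed
qed

subsection \<open>Translations and Tonelli\<close>

lemma nn_integral_shift:
 fixes c :: "'a::euclidean_space"
 assumes [measurable]: "f : Bm"
 shows "(NN x. f (x + c)) = (NN x. f x)"
 using nn_integral_distr[of "(+) c" lborel borel f] by (simp add: lborel_distr_plus add.commute)

lemma integral_shift:
 fixes c :: "'a::euclidean_space" and f :: "'a => real"
 assumes [measurable]: "f : Bm"
 shows "(LBINT x. f (x + c)) = (LBINT x. f x)"
 using integral_distr[of "(+) c" lborel borel f] by (simp add: lborel_distr_plus add.commute)

lemma integrable_shift:
 fixes c :: "'a::euclidean_space" and f :: "'a => real"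
 assumes "integ f"
 shows "integ (%x. f (x + c))"
proof -
 have [measurable]: "f : Bm" using assms by auto
 show ?thesis
  using integrable_distr_eq[of "(+) c" lborel borel f] assms by (simp add: lborel_distr_plus add.commute)
qed

lemma AE_shift:
 fixes c :: "'a::euclidean_space"
 assumes "AEl x. P x"
 shows "AEl x. P (x + c)"
proof -
 have "AE x in distr lborel borel ((+) c). P x" by (subst lborel_distr_plus) (rule assms)
 then have "AEl x. P (c + x)" by (rule AE_distrD[rotated]) simp
 then show ?thesis by (simp add: add.commute)
qed

lemma lborel_distr_minus: "distr lborel borel (%x. c - x) = (lborel :: 'a::euclidean_space measure)"
 using lborel_affine[of "-1" c] by (simp add: density_1)

lemma nn_integral_reflect:
 fixes c :: "'a::euclidean_space"
 assumes [measurable]: "f : Bm"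
 shows "(NN x. f (c - x)) = (NN x. f x)"
 using nn_integral_distr[of "%x. c - x" lborel borel f] by (simp add: lborel_distr_minus)

lemma (in pair_sigma_finite) integrable_prodI:
 fixes f :: "'a => 'b => real"
 assumes [measurable]: "case_prod f : borel_measurable (M1 \<Otimes>\<^sub>M M2)"
  and "(\<integral>\<^sup>+x. \<integral>\<^sup>+y. ennreal \<bar>f x y\<bar> \<partial>M2 \<partial>M1) < \<infinity>"
 shows "integrable (M1 \<Otimes>\<^sub>M M2) (case_prod f)"
proof (rule integrableI_bounded)
 have "(\<integral>\<^sup>+z. ennreal (norm (case_prod f z)) \<partial>(M1 \<Otimes>\<^sub>M M2)) = (\<integral>\<^sup>+x. \<integral>\<^sup>+y. ennreal \<bar>f x y\<bar> \<partial>M2 \<partial>M1)"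
  by (subst M2.nn_integral_fst[symmetric]) auto
 then show "(\<integral>\<^sup>+z. ennreal (norm (case_prod f z)) \<partial>(M1 \<Otimes>\<^sub>M M2)) < \<infinity>" using assms by simp
qed fact

lemma (in pair_sigma_finite) integrable_prodI':
 fixes f :: "'a => 'b => real"
 assumes [measurable]: "case_prod f : borel_measurable (M1 \<Otimes>\<^sub>M M2)"
  and "(\<integral>\<^sup>+y. \<integral>\<^sup>+x. ennreal \<bar>f x y\<bar> \<partial>M1 \<partial>M2) < \<infinity>"
 shows "integrable (M1 \<Otimes>\<^sub>M M2) (case_prod f)"
proof (rule integrableI_bounded)
 have "(\<integral>\<^sup>+z. ennreal (norm (case_prod f z)) \<partial>(M1 \<Otimes>\<^sub>M M2)) = (\<integral>\<^sup>+y. \<integral>\<^sup>+x. ennreal \<bar>f x y\<bar> \<partial>M1 \<partial>M2)"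
  by (subst nn_integral_snd[symmetric]) auto
 then show "(\<integral>\<^sup>+z. ennreal (norm (case_prod f z)) \<partial>(M1 \<Otimes>\<^sub>M M2)) < \<infinity>" using assms by simp
qed fact

section \<open>Absolute continuity along lines\<close>

definition wder ::
 "'a::euclidean_space set => 'a => ('a => real) => ('a => real) => bool" where
 "wder Om v f g \<longleftrightarrow> loc_int Om f \<and> loc_int Om g \<and>
  (\<forall>phi\<in>tests Om. (LBINT x. FD phi (at x) v * f x) = - (LBINT x. phi x * g x))"

definition line_ac :: "(real => real) => (real => real) => bool" where
 "line_ac F f \<longleftrightarrow> (\<forall>r>0. integ (%s. indicator {0..r} s * f s)) \<and>
  (AEl r. 0 < r --> F r = F 0 + (LBINT s. indicator {0..r} s * f s))"

lemma measurable_segment_integral [measurable]: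
 fixes h :: "'a => real => real"
 assumes [measurable]: "R : borel_measurable M" "case_prod h : borel_measurable (M \<Otimes>\<^sub>M borel)"
 shows "(%p. LBINT s. indicator {0..R p} s * h p s) : borel_measurable M"
proof -
 have "(%(p, s). (if 0 <= s \<and> s <= R p then h p s else 0)) : borel_measurable (M \<Otimes>\<^sub>M lborel)"
  by measurable
 then have "(%p. LBINT s. (if 0 <= s \<and> s <= R p then h p s else 0)) : borel_measurable M"
  by (rule lborel.borel_measurable_lebesgue_integral)
 moreover have "(%p. LBINT s. (if 0 <= s \<and> s <= R p then h p s else 0)) = (%p. LBINT s. indicator {0..R p} s * h p s)"
  by (intro ext Bi_integral_cong) (auto simp: indicator_def)
 ultimately show ?thesis by simp
qed

subsection \<open>Weak derivatives as increments along lines\<close>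

lemma segment_integrable_prod:
 fixes v :: "'a::euclidean_space"
 assumes fwd: "!!x s. x \<in> Om ==> 0 <= s ==> x + s *R v \<in> Om" and g: "loc_int Om g"
  and K: "compact K" "K \<subseteq> Om"
 shows "integrable (lborel \<Otimes>\<^sub>M lborel) (%(x, s). indicator K x * (indicator {0..r} s * g (x + s *R v)))"
proof (rule lborel_pair.integrable_prodI')
 have [measurable]: "g : Bm" using g by (rule loc_int_measurable)
 have [measurable]: "K \<in> sets borel" using K by (simp add: borel_compact)
 show "(%(x, s). indicator K x * (indicator {0..r} s * g (x + s *R v))) : borel_measurable (lborel \<Otimes>\<^sub>M lborel)"
  by measurable
 define K' where "K' = (%(x, s). x + s *R v) ` (K \<times> {0..r})"
 have K': "compact K'" unfolding K'_def case_prod_unfold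
  by (intro compact_continuous_image compact_Times K compact_Icc continuous_intros)
 have K'Om: "K' \<subseteq> Om" using fwd K(2) by (auto simp: K'_def)
 have [measurable]: "K' \<in> sets borel" using K' by (simp add: borel_compact)
 define N where "N = (NN x. ennreal \<bar>indicator K' x * g x\<bar>)"
 have "integ (%x. indicator K' x * g x)" using g K' K'Om by (simp add: loc_int_def)
 then have N: "N < \<infinity>" by (simp add: N_def integrable_iff_bounded)
 have inner: "(NN x. ennreal \<bar>indicator K x * (indicator {0..r} s * g (x + s *R v))\<bar>) <= N * indicator {0..r} s" for s
 proof (cases "s \<in> {0..r}")
  case True
  have "(NN x. ennreal \<bar>indicator K x * (indicator {0..r} s * g (x + s *R v))\<bar>)
   <= (NN x. ennreal \<bar>indicator K' (x + s *R v) * g (x + s *R v)\<bar>)"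
  proof (intro nn_integral_mono ennreal_leI)
   fix x
   show "\<bar>indicator K x * (indicator {0..r} s * g (x + s *R v))\<bar> <= \<bar>indicator K' (x + s *R v) * g (x + s *R v)\<bar>"
   proof (cases "x \<in> K")
     case x: True
     have "x + s *R v \<in> K'" unfolding K'_def by (rule image_eqI[of _ _ "(x, s)"]) (use x True in auto)
     then show ?thesis using x True by simp
    qed simp
  qed
  also have "... = N" unfolding N_def by (rule nn_integral_shift[where f="%x. ennreal \<bar>indicator K' x * g x\<bar>"]) measurable
  finally show ?thesis using True by simp
 qed simp
 have "(NN s. NN x. ennreal \<bar>indicator K x * (indicator {0..r} s * g (x + s *R v))\<bar>) <= (NN s. N * indicator {0..r} s)"
  by (intro nn_integral_mono inner)
 also have "... = N * emeasure lborel {0..r}" by (simp add: nn_integral_cmult_indicator)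
 also have "... < \<infinity>" using N by (simp add: ennreal_mult_less_top emeasure_lborel_Icc_eq)
 finally show "(NN s. NN x. ennreal \<bar>indicator K x * (indicator {0..r} s * g (x + s *R v))\<bar>) < \<infinity>" .
qed

lemma segment_integrable_AE:
 fixes v :: "'a::euclidean_space"
 assumes "open Om" and fwd: "!!x s. x \<in> Om ==> 0 <= s ==> x + s *R v \<in> Om" and g: "loc_int Om g"
 shows "AEl x. x \<in> Om --> integ (%s. indicator {0..r} s * g (x + s *R v))"
proof (rule AE_on_open_if_AE_on_cbox[OF assms(1)])
 fix a b :: 'a assume ab: "cbox a b \<subseteq> Om"
 have "AEl x. integ (%s. indicator (cbox a b) x * (indicator {0..r} s * g (x + s *R v)))"
  by (rule lborel_pair.AE_integrable_fst[OF segment_integrable_prod[OF fwd g compact_cbox ab]])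
 then show "AEl x. x \<in> cbox a b --> integ (%s. indicator {0..r} s * g (x + s *R v))"
  by eventually_elim auto
qed

lemma loc_int_shift:
 fixes c :: "'a::euclidean_space"
 assumes "loc_int Om f" "!!x. x \<in> Om ==> x + c \<in> Om"
 shows "loc_int Om (%x. f (x + c))"
 unfolding loc_int_def
proof (intro conjI allI impI)
 have [measurable]: "f : Bm" using assms(1) by (rule loc_int_measurable)
 show "(%x. f (x + c)) : Bm" by measurable
 fix K assume K: "compact K \<and> K \<subseteq> Om"
 have "compact ((%x. x + c) ` K)" using K by (intro compact_continuous_image continuous_intros) auto
 moreover have "(%x. x + c) ` K \<subseteq> Om" using K assms by auto
 ultimately have "integ (%x. indicator ((%x. x + c) ` K) x * f x)"
  using assms(1) by (simp add: loc_int_def)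
 from integrable_shift[OF this, of c]
 have "integ (%x. indicator ((%x. x + c) ` K) (x + c) * f (x + c))" .
 moreover have "indicator ((%x. x + c) ` K) (x + c) = (indicator K x :: real)" for x
  by (auto simp: indicator_def)
 ultimately show "integ (%x. indicator K x * f (x + c))" by simp
qed

lemma loc_int_diff: "loc_int Om f ==> loc_int Om g ==> loc_int Om (%x. f x - g x)"
 and loc_int_add: "loc_int Om f ==> loc_int Om g ==> loc_int Om (%x. f x + g x)"
 and loc_int_cmult: "loc_int Om f ==> loc_int Om (%x. c * f x)"
 by (auto simp: loc_int_def right_diff_distrib distrib_left mult.left_commute)

lemma loc_int_segment:
 fixes v :: "'a::euclidean_space"
 assumes fwd: "!!x s. x \<in> Om ==> 0 <= s ==> x + s *R v \<in> Om" and g: "loc_int Om g"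
 shows "loc_int Om (%x. LBINT s. indicator {0..r} s * g (x + s *R v))"
 unfolding loc_int_def
proof (intro conjI allI impI)
 have [measurable]: "g : Bm" using g by (rule loc_int_measurable)
 show "(%x. LBINT s. indicator {0..r} s * g (x + s *R v)) : Bm"
  by measurable
 fix K assume K: "compact K \<and> K \<subseteq> Om"
 have "integ (%x. LBINT s. indicator K x * (indicator {0..r} s * g (x + s *R v)))"
  by (rule lborel_pair.integrable_fst[OF segment_integrable_prod[OF fwd g]]) (use K in auto)
 then show "integ (%x. indicator K x * (LBINT s. indicator {0..r} s * g (x + s *R v)))"
  by simp
qed

lemma test_functions_shift_back:
 assumes "phi : tests Om" "!!x. x \<in> Om ==> x + c \<in> Om"
 shows "(%x. phi (x - c)) : tests Om"
 using test_functions_affine[OF assms(1), of 1 "- c" Om] assms(2) by simp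

lemma test_line_FTC:
 assumes phi: "phi : tests Om" and "0 <= r"
 shows "integ (%s. indicator {0..r} s * FD phi (at (x + s *R v)) v)"
  and "(LBINT s. indicator {0..r} s * FD phi (at (x + s *R v)) v) = phi (x + r *R v) - phi x"
proof -
 have d: "((%s. phi (x + s *R v)) has_real_derivative FD phi (at (x + s *R v)) v) (at s)" for s
 proof -
  have 1: "((%s. x + s *R v) has_derivative (%h. h *R v)) (at s)"
   by (auto intro!: derivative_eq_intros)
  have "((%s. phi (x + s *R v)) has_derivative (%h. FD phi (at (x + s *R v)) (h *R v))) (at s)"
   by (rule has_derivative_compose[OF 1 test_functions_has_derivative[OF phi]])
  then show ?thesis
   by (simp add: has_field_derivative_def frechet_scaled_dir[OF phi] mult.commute[of _ "FD _ _ _"])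
 qed
 have c: "continuous_on UNIV (%s. FD phi (at (x + s *R v)) v)"
  using test_functions_continuous[OF test_functions_frechet[OF phi, of v]]
  by (rule continuous_on_compose2) (auto intro!: continuous_intros)
 have cc: "continuous_on {0..r} (%s. FD phi (at (x + s *R v)) v)"
  using c continuous_on_subset by blast
 have "has_bochner_integral lborel (%s. FD phi (at (x + s *R v)) v * indicator {0..r} s)
  (phi (x + r *R v) - phi (x + 0 *R v))"
  by (rule has_bochner_integral_FTC_Icc_real[OF \<open>0 <= r\<close> d])
   (use c in \<open>auto simp: continuous_on_eq_continuous_at\<close>)
 then show "integ (%s. indicator {0..r} s * FD phi (at (x + s *R v)) v)"
  and "(LBINT s. indicator {0..r} s * FD phi (at (x + s *R v)) v) = phi (x + r *R v) - phi x"
  by (auto simp: has_bochner_integral_iff mult.commute)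
qed

text \<open>
 For a test function the integral of a directional derivative over a segment is an increment; the translation is moved onto \<open>f\<close>. Only forward translations have to preserve the domain, which allows half-spaces such as the positive times.
\<close>

lemma wder_forward_increment:
 fixes v :: "'a::euclidean_space"
 assumes "open Om" and fwd: "!!x s. x \<in> Om ==> 0 <= s ==> x + s *R v \<in> Om"
  and w: "wder Om v f g" and r: "0 <= r"
 shows "AEl x. x \<in> Om -->
  f (x + r *R v) = f x + (LBINT s. indicator {0..r} s * g (x + s *R v))"
proof -
 have f: "loc_int Om f" and g: "loc_int Om g" using w by (auto simp: wder_def)
 have [measurable]: "f : Bm" "g : Bm"
  using f g by (auto intro: loc_int_measurable)
 let ?G = "%x. \<integral>s. indicator {0..r} s * g (x + s *R v) \<partial>lborel"
 have fr: "loc_int Om (%x. f (x + r *R v))" using f fwd r by (intro loc_int_shift) auto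
 have G: "loc_int Om ?G" by (rule loc_int_segment[OF fwd g])
 have "AEl x. x \<in> Om --> f (x + r *R v) - f x - ?G x = 0"
 proof (rule zero_if_test_integrals_zero[OF assms(1)])
  show "loc_int Om (%x. f (x + r *R v) - f x - ?G x)" by (intro loc_int_diff fr f G)
  fix phi assume phi: "phi : tests Om"
  obtain K B where K: "compact K" "K \<subseteq> Om" "!!x. x \<notin> K ==> phi x = 0" "!!x. \<bar>phi x\<bar> <= B" "0 <= B"
   using test_functions_bounded[OF phi] by metis
  let ?d = "%x. FD phi (at x) v"
  have d: "?d : tests Om" by (rule test_functions_frechet[OF phi])
  have [measurable]: "phi : Bm" "?d : Bm"
   using test_functions_measurable phi d by blast+
  have sh: "(%x. phi (x - s *R v)) : tests Om" if "0 <= s" for s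
   using fwd that by (intro test_functions_shift_back[OF phi]) auto
  \<comment> \<open>Both sides are integrals over the segment of the pairings with the translated test function.\<close>
  have i1: "integrable (lborel \<Otimes>\<^sub>M lborel) (%(x, s). phi x * (indicator {0..r} s * g (x + s *R v)))"
  proof (rule Bi_integrable_bound)
   show "integrable (lborel \<Otimes>\<^sub>M lborel) (%z. B * (case z of (x, s) => indicator K x * (indicator {0..r} s * g (x + s *R v))))"
    by (intro integrable_mult_right segment_integrable_prod[OF fwd g K(1,2)])
   show "(%(x, s). phi x * (indicator {0..r} s * g (x + s *R v))) : borel_measurable (lborel \<Otimes>\<^sub>M lborel)"
    by measurable
   have *: "\<bar>phi x * y\<bar> <= \<bar>B * (indicator K x * y)\<bar>" for x y
    using K(3)[of x] K(4)[of x] K(5) by (cases "x \<in> K") (auto simp: abs_mult intro!: mult_right_mono)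
   then show "AE z in lborel \<Otimes>\<^sub>M lborel. norm (case z of (x, s) => phi x * (indicator {0..r} s * g (x + s *R v)))
    <= norm (B * (case z of (x, s) => indicator K x * (indicator {0..r} s * g (x + s *R v))))"
    by (intro AE_I2) (simp only: real_norm_def case_prod_beta *)
  qed
  have i2: "integrable (lborel \<Otimes>\<^sub>M lborel) (%(x, s). f x * (indicator {0..r} s * ?d (x - s *R v)))"
  proof (rule lborel_pair.integrable_prodI')
   show "(%(x, s). f x * (indicator {0..r} s * ?d (x - s *R v))) : borel_measurable (lborel \<Otimes>\<^sub>M lborel)"
    by measurable
   define K' where "K' = (%(x, s). x + s *R v) ` (K \<times> {0..r})"
   obtain L C where L: "compact L" "L \<subseteq> Om" "!!x. x \<notin> L ==> ?d x = 0" "!!x. \<bar>?d x\<bar> <= C" "0 <= C"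
    using test_functions_bounded[OF d] by metis
   define L' where "L' = (%(x, s). x + s *R v) ` (L \<times> {0..r})"
   have L': "compact L'" unfolding L'_def case_prod_unfold
    by (intro compact_continuous_image compact_Times L compact_Icc continuous_intros)
   have L'Om: "L' \<subseteq> Om" using fwd L(2) by (auto simp: L'_def)
   have [measurable]: "L' \<in> sets borel" using L' by (simp add: borel_compact)
   define N where "N = (NN x. ennreal \<bar>C * (indicator L' x * f x)\<bar>)"
   have "integ (%x. C * (indicator L' x * f x))"
    using f L' L'Om by (intro integrable_mult_right) (simp add: loc_int_def)
   then have N: "N < \<infinity>" by (simp only: N_def integrable_iff_bounded real_norm_def)
   have inner: "(NN x. ennreal \<bar>f x * (indicator {0..r} s * ?d (x - s *R v))\<bar>) <= N * indicator {0..r} s" for s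
   proof (cases "s \<in> {0..r}")
    case True
    have "(NN x. ennreal \<bar>f x * (indicator {0..r} s * ?d (x - s *R v))\<bar>) <= N"
     unfolding N_def
    proof (intro nn_integral_mono ennreal_leI)
     fix x
     show "\<bar>f x * (indicator {0..r} s * ?d (x - s *R v))\<bar> <= \<bar>C * (indicator L' x * f x)\<bar>"
     proof (cases "x - s *R v \<in> L")
      case True
      have "x = (x - s *R v) + s *R v" by simp
      then have "x \<in> L'" using True \<open>s \<in> {0..r}\<close> unfolding L'_def by (metis (mono_tags, lifting) SigmaI case_prod_conv image_eqI)
      then show ?thesis using L(4)[of "x - s *R v"] L(5) \<open>s \<in> {0..r}\<close>
       by (auto simp: abs_mult mult.commute[of "\<bar>f x\<bar>"] intro!: mult_right_mono)
     next
      case False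
      then show ?thesis using L(3)[OF False] by simp
     qed
    qed
    then show ?thesis using True by simp
   qed simp
   have "(NN s. NN x. ennreal \<bar>f x * (indicator {0..r} s * ?d (x - s *R v))\<bar>) <= (NN s. N * indicator {0..r} s)"
    by (intro nn_integral_mono inner)
   also have "... = N * emeasure lborel {0..r}" by (simp add: nn_integral_cmult_indicator)
   also have "... < \<infinity>" using N by (simp add: ennreal_mult_less_top emeasure_lborel_Icc_eq)
   finally show "(NN s. NN x. ennreal \<bar>f x * (indicator {0..r} s * ?d (x - s *R v))\<bar>) < \<infinity>" .
  qed
  have "(LBINT x. phi x * ?G x) = (LBINT x. LBINT s. phi x * (indicator {0..r} s * g (x + s *R v)))"
   by simp
  also have "... = (LBINT s. LBINT x. phi x * (indicator {0..r} s * g (x + s *R v)))"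
   by (rule lborel_pair.Fubini_integral[OF i1, symmetric])
  also have "... = (LBINT s. - (LBINT x. f x * (indicator {0..r} s * ?d (x - s *R v))))"
  proof (intro Bi_integral_cong refl)
   fix s :: real
   show "(LBINT x. phi x * (indicator {0..r} s * g (x + s *R v))) = - (LBINT x. f x * (indicator {0..r} s * ?d (x - s *R v)))"
   proof (cases "s \<in> {0..r}")
    case True
    have fdd: "FD (%x. phi (x - s *R v)) (at x) v = ?d (x - s *R v)" for x
     using frechet_affine[of "%x. x" phi x "- s *R v"] test_functions_differentiable[OF phi]
     by (simp add: bounded_linear_ident)
    have "(LBINT x. phi x * g (x + s *R v)) = (LBINT x. phi (x - s *R v) * g x)"
     using integral_shift[of "%x. phi (x - s *R v) * g x" "s *R v"] by simp
    also have "... = - (LBINT x. FD (%x. phi (x - s *R v)) (at x) v * f x)"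
     using w sh[of s] True unfolding wder_def by simp
    finally show ?thesis using True fdd by (simp add: mult.commute)
   qed simp
  qed
  also have "... = - (LBINT s. LBINT x. f x * (indicator {0..r} s * ?d (x - s *R v)))"
   by simp
  also have "(LBINT s. LBINT x. f x * (indicator {0..r} s * ?d (x - s *R v)))
   = (LBINT x. LBINT s. f x * (indicator {0..r} s * ?d (x - s *R v)))"
   by (rule lborel_pair.Fubini_integral[OF i2])
  also have "... = (LBINT x. f x * (phi x - phi (x - r *R v)))"
  proof (intro Bi_integral_cong refl)
   fix x
   have "(LBINT s. indicator {0..r} s * ?d (x - s *R v)) = - (LBINT s. indicator {0..r} s * FD phi (at (x + s *R (- v))) (- v))"
    using frechet_scaled_dir[OF phi, of _ "-1" v] by simp
   also have "... = phi x - phi (x - r *R v)" using test_line_FTC(2)[OF phi r, of x "- v"] by simp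
   finally show "(LBINT s. f x * (indicator {0..r} s * ?d (x - s *R v))) = f x * (phi x - phi (x - r *R v))"
    by simp
  qed
  finally have 1: "(LBINT x. phi x * ?G x) = - (LBINT x. f x * (phi x - phi (x - r *R v)))" .
  have i3: "integ (%x. phi x * f x)" "integ (%x. phi (x - r *R v) * f x)"
   "integ (%x. phi x * f (x + r *R v))" "integ (%x. phi x * ?G x)"
   using loc_int_mult_test f fr G phi sh[OF r] by blast+
  have 2: "(LBINT x. phi x * f (x + r *R v)) = (LBINT x. phi (x - r *R v) * f x)"
   using integral_shift[of "%x. phi (x - r *R v) * f x" "r *R v"] by simp
  have "(LBINT x. f x * (phi x - phi (x - r *R v))) = (LBINT x. phi x * f x - phi (x - r *R v) * f x)"
   by (intro Bi_integral_cong) (auto simp: algebra_simps)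
  also have "... = (LBINT x. phi x * f x) - (LBINT x. phi (x - r *R v) * f x)"
   by (intro Bi_integral_diff i3)
  finally have 3: "(LBINT x. f x * (phi x - phi (x - r *R v))) = (LBINT x. phi x * f x) - (LBINT x. phi (x - r *R v) * f x)" .
  have "(LBINT x. phi x * (f (x + r *R v) - f x - ?G x))
   = (LBINT x. phi x * f (x + r *R v) - phi x * f x - phi x * ?G x)"
   by (simp only: right_diff_distrib)
  also have "... = (LBINT x. phi x * f (x + r *R v)) - (LBINT x. phi x * f x) - (LBINT x. phi x * ?G x)"
   using i3 by (subst Bi_integral_diff; (intro Bi_integrable_diff)?) simp_all
  finally show "(LBINT x. phi x * (f (x + r *R v) - f x - ?G x)) = 0"
   using 1 2 3 by simp
 qed
 then show ?thesis by eventually_elim auto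
qed

text \<open>
 By Fubini, an increment formula that holds almost everywhere for each length holds on almost every line for almost all lengths.
\<close>

lemma wder_line_ac:
 fixes v :: "'a::euclidean_space"
 assumes "open Om" and fwd: "!!x s. x \<in> Om ==> 0 <= s ==> x + s *R v \<in> Om"
  and w: "wder Om v f g"
 shows "AEl x. x \<in> Om --> line_ac (%s. f (x + s *R v)) (%s. g (x + s *R v))"
proof -
 have f: "loc_int Om f" and g: "loc_int Om g" using w by (auto simp: wder_def)
 have [measurable]: "f : Bm" "g : Bm"
  using f g by (auto intro: loc_int_measurable)
 have [measurable]: "Om \<in> sets borel" using assms(1) by simp
 have 1: "AEl x. x \<in> Om --> (\<forall>r>0. integ (%s. indicator {0..r} s * g (x + s *R v)))"
 proof -
  have "AEl x. \<forall>n::nat. x \<in> Om --> integ (%s. indicator {0..real n} s * g (x + s *R v))"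
   by (subst AE_all_countable) (intro allI segment_integrable_AE assms(1) fwd g)
  then show ?thesis
  proof eventually_elim
   case (elim x)
   show ?case
   proof (intro impI allI)
    fix r :: real assume "x \<in> Om" "r > 0"
    obtain n :: nat where n: "r <= real n" using real_arch_simple by blast
    show "integ (%s. indicator {0..r} s * g (x + s *R v))"
     by (rule Bi_integrable_bound[where f="%s. indicator {0..real n} s * g (x + s *R v)"])
      (use elim \<open>x \<in> Om\<close> n in \<open>auto simp: indicator_def intro!: AE_I2\<close>)
   qed
  qed
 qed
 have "AEl r. AEl x. 0 < r --> x \<in> Om -->
  f (x + r *R v) = f x + (LBINT s. indicator {0..r} s * g (x + s *R v))"
 proof (rule AE_I2)
  fix r :: real
  show "AEl x. 0 < r --> x \<in> Om -->
   f (x + r *R v) = f x + (LBINT s. indicator {0..r} s * g (x + s *R v))"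
   using wder_forward_increment[OF assms, of r] by (cases "0 < r") auto
 qed
 then have "AEl x. AEl r. 0 < r --> x \<in> Om -->
  f (x + r *R v) = f x + (LBINT s. indicator {0..r} s * g (x + s *R v))"
 proof (rule lborel_pair.AE_commute[THEN iffD1, rotated])
  have "Measurable.pred (lborel \<Otimes>\<^sub>M lborel) (%z. 0 < fst z --> snd z \<in> Om -->
   f (snd z + fst z *R v) = f (snd z) + (LBINT s. indicator {0..fst z} s * g (snd z + s *R v)))"
   by measurable
  then show "{z \<in> space (lborel \<Otimes>\<^sub>M lborel). 0 < fst z --> snd z \<in> Om -->
   f (snd z + fst z *R v) = f (snd z) + (LBINT s. indicator {0..fst z} s * g (snd z + s *R v))}
   \<in> sets (lborel \<Otimes>\<^sub>M lborel)"
   by (simp only: pred_def)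
 qed
 with 1 show ?thesis
  by eventually_elim (auto simp: line_ac_def)
qed

subsection \<open>Calculus of functions that are absolutely continuous along a line\<close>

lemma line_ac_integrable:
 assumes "line_ac F f"
 shows "integ (%s. indicator {0..r} s * f s)"
proof (cases "0 < r")
 case False
 have "integ (%s. indicator {0..1} s * f s)" using assms by (simp add: line_ac_def)
 then have "integ (%s. indicator {0..1} s * f s * indicator {0..r} s)"
  by (intro integrable_real_mult_indicator) auto
 moreover have "indicator {0..1} s * f s * indicator {0..r} s = indicator {0..r} s * f s" for s
  using False by (auto simp: indicator_def)
 ultimately show ?thesis by simp
qed (use assms in \<open>simp add: line_ac_def\<close>)

lemma line_ac_const: "line_ac (%s. c) (%s. 0)"
 by (simp add: line_ac_def)

lemma line_ac_add:
 assumes "line_ac F f" "line_ac G g"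
 shows "line_ac (%s. F s + G s) (%s. f s + g s)"
 unfolding line_ac_def
proof (intro conjI allI impI)
 note i = line_ac_integrable[OF assms(1)] line_ac_integrable[OF assms(2)]
 show "integ (%s. indicator {0..r} s * (f s + g s))" for r
  using i by (simp add: distrib_left)
 have "AEl r. 0 < r --> F r = F 0 + (LBINT s. indicator {0..r} s * f s)"
  "AEl r. 0 < r --> G r = G 0 + (LBINT s. indicator {0..r} s * g s)"
  using assms by (auto simp: line_ac_def)
 then show "AEl r. 0 < r --> F r + G r = F 0 + G 0 + (LBINT s. indicator {0..r} s * (f s + g s))"
 proof eventually_elim
  case (elim r)
  then show ?case using i[of r] by (auto simp: distrib_left)
 qed
qed

lemma line_ac_cmult:
 assumes "line_ac F f"
 shows "line_ac (%s. c * F s) (%s. c * f s)"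
 unfolding line_ac_def
proof (intro conjI allI impI)
 note i = line_ac_integrable[OF assms(1)]
 show "integ (%s. indicator {0..r} s * (c * f s))" for r
  using integrable_mult_right[OF i[of r], of c] by (simp add: mult.left_commute)
 have "AEl r. 0 < r --> F r = F 0 + (LBINT s. indicator {0..r} s * f s)"
  using assms by (auto simp: line_ac_def)
 then show "AEl r. 0 < r --> c * F r = c * F 0 + (LBINT s. indicator {0..r} s * (c * f s))"
  by eventually_elim (auto simp: distrib_left mult.left_commute[of _ c])
qed

lemma line_ac_diff:
 assumes "line_ac F f" "line_ac G g"
 shows "line_ac (%s. F s - G s) (%s. f s - g s)"
 using line_ac_add[OF assms(1) line_ac_cmult[OF assms(2), of "-1"]] by simp

lemma line_ac_sum:
 assumes "finite I" "!!i. i \<in> I ==> line_ac (F i) (f i)"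
 shows "line_ac (%s. \<Sum>i\<in>I. F i s) (%s. \<Sum>i\<in>I. f i s)"
 using assms by (induction I rule: finite_induct) (auto intro: line_ac_const line_ac_add)

lemma triangle_Fubini:
 fixes f g :: "real => real"
 assumes f: "integ f" and g: "integ g"
 shows "(LBINT s. (LBINT q. (if q <= s then f q else 0)) * g s + f s * (LBINT q. (if q <= s then g q else 0)))
  = (LBINT s. f s) * (LBINT s. g s)"
  and "integ (%s. (LBINT q. (if q <= s then f q else 0)) * g s)"
proof -
 have [measurable]: "f : Bm" "g : Bm" using f g by auto
 have *: "integrable (lborel \<Otimes>\<^sub>M lborel) (%(s, q). h q * k s)" if "integ h" "integ k" for h k :: "real => real"
 proof (rule lborel_pair.integrable_prodI)
  have [measurable]: "h : Bm" "k : Bm" using that by auto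
  show "(%(s, q). h q * k s) : borel_measurable (lborel \<Otimes>\<^sub>M lborel)" by measurable
  have "(NN s. NN q. ennreal \<bar>h q * k s\<bar>) = (NN q. ennreal \<bar>h q\<bar>) * (NN s. ennreal \<bar>k s\<bar>)"
   by (simp add: abs_mult ennreal_mult nn_integral_multc nn_integral_cmult)
  also have "... < \<infinity>" using that by (simp add: integrable_iff_bounded ennreal_mult_less_top)
  finally show "(NN s. NN q. ennreal \<bar>h q * k s\<bar>) < \<infinity>" .
 qed
 have T: "integrable (lborel \<Otimes>\<^sub>M lborel) (%(s, q). (if q <= s then h q else 0) * k s)"
  if "integ h" "integ k" for h k :: "real => real"
 proof (rule Bi_integrable_bound[OF *[OF that]])
  have [measurable]: "h : Bm" "k : Bm" using that by auto
  show "(%(s, q). (if q <= s then h q else 0) * k s) : borel_measurable (lborel \<Otimes>\<^sub>M lborel)" by measurable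
 qed (auto intro!: AE_I2)
 have i1: "integ (%s. (LBINT q. (if q <= s then h q else 0)) * k s)"
  if "integ h" "integ k" for h k :: "real => real"
  using lborel_pair.integrable_fst[OF T[OF that]] by simp
 show "integ (%s. (LBINT q. (if q <= s then f q else 0)) * g s)" by (rule i1[OF f g])
 have 2: "(LBINT s. f s * (LBINT q. (if q <= s then g q else 0)))
  = (LBINT s. (LBINT q. (if s <= q then f q else 0)) * g s)"
 proof -
  have "(LBINT s. f s * (LBINT q. (if q <= s then g q else 0))) = (LBINT s. LBINT q. (if q <= s then g q else 0) * f s)"
   by (simp add: mult.commute)
  also have "... = (LBINT q. LBINT s. (if q <= s then g q else 0) * f s)"
   by (rule lborel_pair.Fubini_integral[OF T[OF g f], symmetric])
  also have "... = (LBINT q. LBINT s. (if q <= s then f s else 0) * g q)"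
   by (intro Bi_integral_cong) auto
  finally show ?thesis by simp
 qed
 have i3: "integ (%s. (LBINT q. (if s <= q then f q else 0)) * g s)"
 proof -
  have "integ (%q. LBINT s. (if q <= s then g q else 0) * f s)"
   by (rule lborel_pair.integrable_snd[OF T[OF g f]])
  moreover have "(%q. LBINT s. (if q <= s then g q else 0) * f s) = (%q. LBINT s. (if q <= s then f s else 0) * g q)"
   by (intro ext Bi_integral_cong) auto
  ultimately show ?thesis by simp
 qed
 have half: "integ (%q. if q <= s then f q else 0)" "integ (%q. if s <= q then f q else 0)" for s
  by (rule Bi_integrable_bound[OF f]; auto)+
 have split: "(LBINT q. (if q <= s then f q else 0)) + (LBINT q. (if s <= q then f q else 0)) = (LBINT q. f q)" for s
 proof -
  have "(LBINT q. (if q <= s then f q else 0)) + (LBINT q. (if s <= q then f q else 0))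
   = (LBINT q. (if q <= s then f q else 0) + (if s <= q then f q else 0))"
   using half by simp
  also have "... = (LBINT q. f q)"
  proof (rule integral_cong_AE)
   show "AEl q. (if q <= s then f q else 0) + (if s <= q then f q else 0) = f q"
    using AE_lborel_singleton[of s] by eventually_elim auto
  qed auto
  finally show ?thesis .
 qed
 have "(LBINT s. (LBINT q. (if q <= s then f q else 0)) * g s + f s * (LBINT q. (if q <= s then g q else 0)))
  = (LBINT s. (LBINT q. (if q <= s then f q else 0)) * g s) + (LBINT s. f s * (LBINT q. (if q <= s then g q else 0)))"
  using i1[OF f g] i1[OF g f] by (intro Bi_integral_add) (auto simp: mult.commute)
 also have "... = (LBINT s. (LBINT q. (if q <= s then f q else 0)) * g s + (LBINT q. (if s <= q then f q else 0)) * g s)"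
  unfolding 2 by (intro Bi_integral_add[symmetric] i1[OF f g] i3)
 also have "... = (LBINT s. (LBINT q. f q) * g s)"
  by (simp only: split distrib_right[symmetric])
 finally show "(LBINT s. (LBINT q. (if q <= s then f q else 0)) * g s + f s * (LBINT q. (if q <= s then g q else 0)))
  = (LBINT s. f s) * (LBINT s. g s)" by simp
qed

text \<open>
 The product rule is Fubini's theorem on a triangle.
\<close>

lemma line_ac_mult:
 assumes F: "line_ac F f" and G: "line_ac G g"
  and [measurable]: "F : Bm" "f : Bm"
   "G : Bm" "g : Bm"
 shows "line_ac (%s. F s * G s) (%s. F s * g s + f s * G s)"
proof -
 note iF = line_ac_integrable[OF F] and iG = line_ac_integrable[OF G]
 define P where "P s = (LBINT q. indicator {0..s} q * f q)" for s
 define Q where "Q s = (LBINT q. indicator {0..s} q * g q)" for s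
 have [measurable]: "P : Bm" "Q : Bm"
  unfolding P_def Q_def by measurable
 have aeF: "AEl r. 0 < r --> F r = F 0 + P r" and aeG: "AEl r. 0 < r --> G r = G 0 + Q r"
  using F G by (auto simp: line_ac_def P_def Q_def)
 have key: "integ (%s. indicator {0..r} s * (F s * g s + f s * G s)) \<and>
  (LBINT s. indicator {0..r} s * (F s * g s + f s * G s)) = F 0 * Q r + P r * G 0 + P r * Q r" if "0 < r" for r
 proof -
  let ?f = "%s. indicator {0..r} s * f s" and ?g = "%s. indicator {0..r} s * g s"
  let ?P = "%s. \<integral>q. (if q <= s then ?f q else 0) \<partial>lborel" and ?Q = "%s. \<integral>q. (if q <= s then ?g q else 0) \<partial>lborel"
  have PQ: "P s = ?P s" "Q s = ?Q s" if "s \<in> {0..r}" for s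
   unfolding P_def Q_def using that by (auto intro!: Bi_integral_cong simp: indicator_def)
  have e: "AEl s. indicator {0..r} s * (F s * g s + f s * G s) = F 0 * ?g s + G 0 * ?f s + (?P s * ?g s + ?f s * ?Q s)"
   using aeF aeG AE_lborel_singleton[of 0]
  proof eventually_elim
   case (elim s)
   show ?case
   proof (cases "s \<in> {0..r}")
    case True
    then show ?thesis using elim PQ[OF True] by (simp add: algebra_simps)
   qed simp
  qed
  have i: "integ (%s. F 0 * ?g s + G 0 * ?f s + (?P s * ?g s + ?f s * ?Q s))"
   using triangle_Fubini(2)[OF iF[of r] iG[of r]] triangle_Fubini(2)[OF iG[of r] iF[of r]] iF[of r] iG[of r]
   by (intro Bi_integrable_add integrable_mult_right) (auto simp: mult.commute)
  have v: "(LBINT s. F 0 * ?g s + G 0 * ?f s + (?P s * ?g s + ?f s * ?Q s)) = F 0 * Q r + G 0 * P r + P r * Q r"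
  proof -
   have j: "integ (%s. ?P s * ?g s + ?f s * ?Q s)"
    using triangle_Fubini(2)[OF iF[of r] iG[of r]] triangle_Fubini(2)[OF iG[of r] iF[of r]]
    by (intro Bi_integrable_add) (auto simp: mult.commute)
   show ?thesis
    using iF[of r] iG[of r] j triangle_Fubini(1)[OF iF[of r] iG[of r]]
    by (simp add: P_def Q_def)
  qed
  have m: "(%s. indicator {0..r} s * (F s * g s + f s * G s)) : borel_measurable lborel"
   by measurable
  have "(LBINT s. indicator {0..r} s * (F s * g s + f s * G s)) = F 0 * Q r + G 0 * P r + P r * Q r"
   unfolding v[symmetric] by (rule integral_cong_AE[OF m borel_measurable_integrable[OF i] e])
  then show ?thesis
   using i integrable_cong_AE[OF m borel_measurable_integrable[OF i] e] by (simp only: mult.commute[of "G 0"] simp_thms)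
 qed
 show ?thesis unfolding line_ac_def
 proof (intro conjI allI impI)
  show "integ (%s. indicator {0..r} s * (F s * g s + f s * G s))" if "0 < r" for r
   using key[OF that] by blast
  show "AEl r. 0 < r --> F r * G r = F 0 * G 0 + (LBINT s. indicator {0..r} s * (F s * g s + f s * G s))"
   using aeF aeG
  proof eventually_elim
   case (elim r)
   show ?case
   proof
    assume r: "0 < r"
    have "F r * G r = (F 0 + P r) * (G 0 + Q r)" using elim r by simp
    then show "F r * G r = F 0 * G 0 + (LBINT s. indicator {0..r} s * (F s * g s + f s * G s))"
     using conjunct2[OF key[OF r]] by (simp add: distrib_left distrib_right)
   qed
  qed
 qed
qed

lemma line_ac_test: "phi : tests Om ==>
  line_ac (%s. phi (x + s *R v)) (%s. FD phi (at (x + s *R v)) v)"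
 unfolding line_ac_def using test_line_FTC[of phi Om _ x v] by auto

lemma segment_integral_continuous:
 fixes f :: "real => real"
 assumes i: "!!r. integ (%s. indicator {0..r} s * f s)"
  and [measurable]: "f : Bm"
 shows "continuous_on UNIV (%r. LBINT s. indicator {0..r} s * f s)"
proof (rule continuous_at_imp_continuous_on, intro ballI)
 fix r :: real
 show "isCont (%r. LBINT s. indicator {0..r} s * f s) r"
  unfolding isCont_def tendsto_at_iff_sequentially comp_def
 proof (intro allI impI)
  fix X :: "nat => real" assume X: "\<forall>i. X i \<in> UNIV - {r}" "X ---> r"
  obtain B where B: "!!n. \<bar>X n\<bar> <= B" using convergent_imp_bounded[OF X(2)] by (auto simp: bounded_iff)
  show "(%n. LBINT s. indicator {0..X n} s * f s) ---> (LBINT s. indicator {0..r} s * f s)"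
  proof (rule integral_dominated_convergence[where w="%s. norm (indicator {0..B} s * f s)"])
   show "AEl s. (%n. indicator {0..X n} s * f s) ---> indicator {0..r} s * f s"
    using AE_lborel_singleton[of r]
   proof eventually_elim
    case (elim s)
    have "eventually (%n. indicator {0..X n} s = (indicator {0..r} s :: real)) sequentially"
    proof (cases "s < r")
     case True
     then have "eventually (%n. s < X n) sequentially" using X(2) order_tendstoD by blast
     then show ?thesis by eventually_elim (use True in \<open>auto simp: indicator_def\<close>)
    next
     case False
     then have "eventually (%n. X n < s) sequentially" using X(2) elim order_tendstoD by fastforce
     then show ?thesis by eventually_elim (use False elim in \<open>auto simp: indicator_def\<close>)
    qed
    then show ?case by (intro tendsto_eventually) (auto elim: eventually_mono)
   qed
   show "AEl s. norm (indicator {0..X n} s * f s) <= norm (indicator {0..B} s * f s)" for n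
    using B[of n] by (intro AE_I2) (auto simp: indicator_def)
  qed (use i in auto)
 qed
qed

lemma AE_pos_continuous_imp_all:
 fixes I :: "real => real"
 assumes "continuous_on UNIV I" "AEl r. 0 < r --> I r = 0" "0 <= r"
 shows "I r = 0"
proof (rule ccontr)
 assume "I r ~= 0"
 have "open (I -` (- {0}))" using assms(1) by (intro open_vimage) auto
 then obtain e where e: "e > 0" "ball r e \<subseteq> I -` (- {0})" using \<open>I r ~= 0\<close>
  by (metis ComplI open_contains_ball singletonD vimageI)
 have "AEl x. x \<notin> {r<..<r+e}"
  using assms(2)
 proof eventually_elim
  case (elim x)
  show ?case
  proof
   assume "x \<in> {r<..<r+e}"
   then have "x \<in> ball r e" "0 < x" using assms(3) by (auto simp: dist_real_def)
   then show False using elim e by auto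
  qed
 qed
 then have "{r<..<r+e} \<in> null_sets lborel" by (subst AE_iff_null_sets) auto
 then show False using e(1) by (auto simp: null_sets_def)
qed

lemma zero_if_segment_integrals_zero:
 fixes d :: "real => real"
 assumes i: "!!r. integ (%s. indicator {0..r} s * d s)"
  and [measurable]: "d : Bm"
  and z: "AEl r. 0 < r --> (LBINT s. indicator {0..r} s * d s) = 0"
 shows "AEl s. 0 < s --> d s = 0"
proof -
 let ?I = "%r. \<integral>s. indicator {0..r} s * d s \<partial>lborel"
 have I: "?I r = 0" for r
 proof (cases "0 <= r")
  case True
  show ?thesis by (rule AE_pos_continuous_imp_all[OF segment_integral_continuous[OF i assms(2)] z True])
 qed simp
 have "AEl s. indicator {0..real n} s * d s = 0" for n
 proof (rule zero_if_box_integrals_zero[OF i])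
  fix c e :: real
  show "(LBINT s. indicator (box c e) s * (indicator {0..real n} s * d s)) = 0"
  proof (cases "c < e")
   case True
   have "(LBINT s. indicator (box c e) s * (indicator {0..real n} s * d s))
    = (LBINT s. indicator {0..min e (real n)} s * d s - indicator {0..min c (real n)} s * d s)"
   proof (rule integral_cong_AE)
    show "AEl s. indicator (box c e) s * (indicator {0..real n} s * d s)
     = indicator {0..min e (real n)} s * d s - indicator {0..min c (real n)} s * d s"
     using AE_lborel_singleton[of c] AE_lborel_singleton[of e]
     by eventually_elim (use True in \<open>auto simp: indicator_def\<close>)
   qed auto
   also have "... = ?I (min e (real n)) - ?I (min c (real n))"
    by (intro Bi_integral_diff i)
   finally show ?thesis unfolding I by simp
  qed simp
 qed
 then have "AEl s. \<forall>n. indicator {0..real n} s * d s = 0" by (subst AE_all_countable) auto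
 then show ?thesis
 proof eventually_elim
  case (elim s)
  obtain n :: nat where "s <= real n" using real_arch_simple by blast
  then show ?case using elim[rule_format, of n] by auto
 qed
qed

lemma AE_pos_real_ex:
 assumes "AEl r. 0 < r --> P r"
 shows "\<exists>r>0::real. P r"
proof (rule ccontr)
 assume *: "\<not> ?thesis"
 have "AEl r. r \<notin> {0<..<1::real}" using assms by eventually_elim (use * in auto)
 then have "{0<..<1::real} \<in> null_sets lborel" by (subst AE_iff_null_sets) auto
 then show False by (auto simp: null_sets_def)
qed

lemma line_ac_AE_commute:
 fixes f g :: "'a::euclidean_space => real"
 assumes l: "AEl x. x \<in> Om --> line_ac (%s. f (x + s *R v)) (%s. g (x + s *R v))"
  and [measurable]: "f : Bm" "g : Bm" "Om \<in> sets borel"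
 shows "AEl r. AEl x. 0 < r --> x \<in> Om -->
  f (x + r *R v) = f x + (LBINT s. indicator {0..r} s * g (x + s *R v))"
proof (rule lborel_pair.AE_commute[THEN iffD1])
 have "Measurable.pred (lborel \<Otimes>\<^sub>M lborel) (%z. 0 < snd z --> fst z \<in> Om -->
  f (fst z + snd z *R v) = f (fst z) + (LBINT s. indicator {0..snd z} s * g (fst z + s *R v)))"
  by measurable
 then show "{z \<in> space (lborel \<Otimes>\<^sub>M lborel). 0 < snd z --> fst z \<in> Om -->
  f (fst z + snd z *R v) = f (fst z) + (LBINT s. indicator {0..snd z} s * g (fst z + s *R v))}
  \<in> sets (lborel \<Otimes>\<^sub>M lborel)"
  by (simp only: pred_def)
 show "AEl x. AEl r. 0 < r --> x \<in> Om -->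
  f (x + r *R v) = f x + (LBINT s. indicator {0..r} s * g (x + s *R v))"
  using l
 proof eventually_elim
  case (elim x)
  show ?case
  proof (cases "x \<in> Om")
   case True
   then have "line_ac (%s. f (x + s *R v)) (%s. g (x + s *R v))" using elim by blast
   then have "AEl r. 0 < r --> f (x + r *R v) = f (x + 0 *R v) + (LBINT s. indicator {0..r} s * g (x + s *R v))"
    unfolding line_ac_def by blast
   then show ?thesis by eventually_elim auto
  qed simp
 qed
qed

text \<open>
 Increments have integral zero because Lebesgue measure is translation invariant.
\<close>

lemma integral_line_derivative_zero:
 fixes f g :: "'a::euclidean_space => real"
 assumes l: "AEl x. line_ac (%s. f (x + s *R v)) (%s. g (x + s *R v))"
  and f: "integ f" and g: "integ g"
 shows "(LBINT x. g x) = 0"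
proof -
 have [measurable]: "f : Bm" "g : Bm" using f g by auto
 have "AEl r. AEl x. 0 < r --> x \<in> UNIV -->
  f (x + r *R v) = f x + (LBINT s. indicator {0..r} s * g (x + s *R v))"
  by (rule line_ac_AE_commute) (use l in auto)
 then have "AEl r. 0 < r --> (AEl x.
  f (x + r *R v) = f x + (LBINT s. indicator {0..r} s * g (x + s *R v)))"
  by eventually_elim auto
 from AE_pos_real_ex[OF this] obtain r where r: "0 < r" and ae: "AEl x.
  f (x + r *R v) = f x + (LBINT s. indicator {0..r} s * g (x + s *R v))"
  by blast
 have ip: "integrable (lborel \<Otimes>\<^sub>M lborel) (%(x, s). indicator {0..r} s * g (x + s *R v))"
 proof (rule lborel_pair.integrable_prodI')
  have "(NN x. ennreal \<bar>indicator {0..r} s * g (x + s *R v)\<bar>) = indicator {0..r} s * (NN x. ennreal \<bar>g x\<bar>)" for s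
   using nn_integral_shift[of "%x. ennreal \<bar>g x\<bar>" "s *R v"] by (simp add: abs_mult ennreal_mult nn_integral_cmult split: split_indicator)
  then have "(NN s. NN x. ennreal \<bar>indicator {0..r} s * g (x + s *R v)\<bar>)
   = emeasure lborel {0..r} * (NN x. ennreal \<bar>g x\<bar>)"
   by (simp add: nn_integral_multc)
  also have "... < \<infinity>" using g by (simp add: integrable_iff_bounded ennreal_mult_less_top emeasure_lborel_Icc_eq)
  finally show "(NN s. NN x. ennreal \<bar>indicator {0..r} s * g (x + s *R v)\<bar>) < \<infinity>" .
 qed measurable
 have "(LBINT x. f x) = (LBINT x. f (x + r *R v))" by (simp add: integral_shift)
 also have "... = (LBINT x. f x + (LBINT s. indicator {0..r} s * g (x + s *R v)))"
  by (rule integral_cong_AE[OF _ _ ae]) measurable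
 also have "... = (LBINT x. f x) + (LBINT x. LBINT s. indicator {0..r} s * g (x + s *R v))"
  using lborel_pair.integrable_fst[OF ip] f by (intro Bi_integral_add) auto
 also have "(LBINT x. LBINT s. indicator {0..r} s * g (x + s *R v)) = (LBINT s. LBINT x. indicator {0..r} s * g (x + s *R v))"
  by (rule lborel_pair.Fubini_integral[OF ip, symmetric])
 also have "... = (LBINT s. indicator {0..r} s * (LBINT x. g x))"
  by (simp add: integral_shift)
 also have "... = r * (LBINT x. g x)" using r by simp
 finally show ?thesis using r by simp
qed

section \<open>Averages over small translations\<close>

text \<open>
 Averages against a probability measure near the origin cover both mollification and averages over short segments, which play the role of difference quotients.
\<close>

definition averaging :: "'a::euclidean_space measure => bool" where
 "averaging mu \<longleftrightarrow> sets mu = sets borel \<and> emeasure mu UNIV = 1"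

definition avg :: "'a::euclidean_space measure => ('a => real) => 'a => real" where
 "avg mu f x = (\<integral>y. f (x + y) \<partial>mu)"

lemma averagingD:
 assumes "averaging mu"
 shows "sets mu = sets borel" "space mu = UNIV" "emeasure mu UNIV = 1" "finite_measure mu" "sigma_finite_measure mu"
  "measure mu UNIV = 1"
proof -
 show s: "sets mu = sets borel" and e: "emeasure mu UNIV = 1" using assms by (auto simp: averaging_def)
 show sp: "space mu = UNIV" using sets_eq_imp_space_eq[OF s] by simp
 show "finite_measure mu" by (rule finite_measureI) (simp add: sp e)
 then show "sigma_finite_measure mu" by (simp add: finite_measure.axioms(1))
 show "measure mu UNIV = 1" by (simp add: measure_def e)
qed

lemma averaging_measurable:
 fixes f :: "'a::euclidean_space => 'b::topological_space"
 assumes "averaging mu" and [measurable]: "f : Bm"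
 shows "(%y. f (x + y)) : borel_measurable mu"
  and "(%(x, y). f (x + y)) : borel_measurable (lborel \<Otimes>\<^sub>M mu)"
proof -
 note [measurable_cong] = averagingD(1)[OF assms(1)]
 show "(%y. f (x + y)) : borel_measurable mu" by measurable
 show "(%(x, y). f (x + y)) : borel_measurable (lborel \<Otimes>\<^sub>M mu)" by measurable
qed

lemma avg_measurable:
 assumes "averaging mu" "f : Bm"
 shows "avg mu f : Bm"
proof -
 have "(%x. \<integral>y. f (x + y) \<partial>mu) : borel_measurable lborel"
  by (rule sigma_finite_measure.borel_measurable_lebesgue_integral[OF averagingD(5)[OF assms(1)] averaging_measurable(2)[OF assms]])
 then show ?thesis by (simp add: avg_def[abs_def])
qed

lemma nn_integral_Jensen_power:
 assumes "averaging mu" and [measurable]: "g : borel_measurable mu" and "p = 1 \<or> p = 2 \<or> p = (4::nat)"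
 shows "(\<integral>\<^sup>+y. g y \<partial>mu) ^ p <= (\<integral>\<^sup>+y. g y ^ p \<partial>mu)"
proof -
 have 2: "(\<integral>\<^sup>+y. h y \<partial>mu)^2 <= (\<integral>\<^sup>+y. (h y)^2 \<partial>mu)" if [measurable]: "h : borel_measurable mu" for h
  using Cauchy_Schwarz_nn_integral[of h mu "%_. 1"] averagingD(2,3)[OF assms(1)] by simp
 have "(\<integral>\<^sup>+y. g y \<partial>mu) ^ 4 = ((\<integral>\<^sup>+y. g y \<partial>mu)^2)^2" by (simp flip: power_mult)
 also have "... <= (\<integral>\<^sup>+y. (g y)^2 \<partial>mu)^2" by (intro power_mono 2) auto
 also have "... <= (\<integral>\<^sup>+y. ((g y)^2)^2 \<partial>mu)" by (intro 2) measurable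
 also have "... = (\<integral>\<^sup>+y. g y ^ 4 \<partial>mu)" by (simp flip: power_mult)
 finally show ?thesis using assms(3) 2[of g] by auto
qed

lemma avg_power_le:
 assumes "averaging mu" and f: "f : Bm" and p: "p = 1 \<or> p = 2 \<or> p = (4::nat)"
 shows "ennreal (\<bar>avg mu f x\<bar> ^ p) <= (\<integral>\<^sup>+y. ennreal (\<bar>f (x + y)\<bar> ^ p) \<partial>mu)"
proof -
 have [measurable]: "(%y. f (x + y)) : borel_measurable mu" by (rule averaging_measurable[OF assms(1) f])
 have "ennreal \<bar>avg mu f x\<bar> <= (\<integral>\<^sup>+y. ennreal \<bar>f (x + y)\<bar> \<partial>mu)"
 proof (cases "integrable mu (%y. f (x + y))")
  case True
  then show ?thesis using integral_norm_bound_ennreal[OF True] by (simp add: avg_def)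
 next
  case False
  then show ?thesis by (simp add: avg_def not_integrable_integral_eq)
 qed
 then have "ennreal \<bar>avg mu f x\<bar> ^ p <= (\<integral>\<^sup>+y. ennreal \<bar>f (x + y)\<bar> \<partial>mu) ^ p" by (intro power_mono) auto
 also have "... <= (\<integral>\<^sup>+y. ennreal \<bar>f (x + y)\<bar> ^ p \<partial>mu)"
  by (rule nn_integral_Jensen_power[OF assms(1) _ p]) measurable
 finally show ?thesis by (simp add: ennreal_power)
qed

lemma avg_contraction:
 assumes "averaging mu" and f[measurable]: "f : Bm" and p: "p = 1 \<or> p = 2 \<or> p = (4::nat)"
 shows "(NN x. \<integral>\<^sup>+y. ennreal (\<bar>f (x + y)\<bar> ^ p) \<partial>mu) = (NN x. ennreal (\<bar>f x\<bar> ^ p))"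
  and "(NN x. ennreal (\<bar>avg mu f x\<bar> ^ p)) <= (NN x. ennreal (\<bar>f x\<bar> ^ p))"
proof -
 interpret pair_sigma_finite lborel mu
  by (intro pair_sigma_finite.intro averagingD(5)[OF assms(1)] sigma_finite_lborel)
 have m: "(%(x, y). ennreal (\<bar>f (x + y)\<bar> ^ p)) : borel_measurable (lborel \<Otimes>\<^sub>M mu)"
  by (rule averaging_measurable(2)[OF assms(1), of "%z. ennreal (\<bar>f z\<bar> ^ p)"]) measurable
 have "(NN x. \<integral>\<^sup>+y. ennreal (\<bar>f (x + y)\<bar> ^ p) \<partial>mu) = (\<integral>\<^sup>+y. \<integral>\<^sup>+x. ennreal (\<bar>f (x + y)\<bar> ^ p) \<partial>lborel \<partial>mu)"
  by (rule Fubini'[symmetric, OF m])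
 also have "... = (\<integral>\<^sup>+y. (NN x. ennreal (\<bar>f x\<bar> ^ p)) \<partial>mu)"
  by (intro nn_integral_cong nn_integral_shift[where f="%z. ennreal (\<bar>f z\<bar> ^ p)"]) measurable
 also have "... = (NN x. ennreal (\<bar>f x\<bar> ^ p))"
  using averagingD(2,3)[OF assms(1)] by simp
 finally show eq: "(NN x. \<integral>\<^sup>+y. ennreal (\<bar>f (x + y)\<bar> ^ p) \<partial>mu) = (NN x. ennreal (\<bar>f x\<bar> ^ p))" .
 show "(NN x. ennreal (\<bar>avg mu f x\<bar> ^ p)) <= (NN x. ennreal (\<bar>f x\<bar> ^ p))"
  unfolding eq[symmetric] by (intro nn_integral_mono avg_power_le assms)
qed

lemma integrable_power_iff:
 assumes "f : borel_measurable M"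
 shows "integrable M (%x. \<bar>f x :: real\<bar> ^ p) \<longleftrightarrow> (\<integral>\<^sup>+x. ennreal (\<bar>f x\<bar> ^ p) \<partial>M) < \<infinity>"
 using assms by (simp add: integrable_iff_bounded)

lemma avg_AE_integrable:
 fixes f :: "'a::euclidean_space => real"
 assumes "averaging mu" and f[measurable]: "f : Bm" and p: "p = 1 \<or> p = 2 \<or> p = (4::nat)"
  and i: "integ (%x. \<bar>f x\<bar> ^ p)"
 shows "AEl x. integrable mu (%y. f (x + y))"
proof -
 have m: "(%(x, y). ennreal (\<bar>f (x + y)\<bar> ^ p)) : borel_measurable (lborel \<Otimes>\<^sub>M mu)"
  by (rule averaging_measurable(2)[OF assms(1), of "%z. ennreal (\<bar>f z\<bar> ^ p)"]) measurable
 have "(NN x. \<integral>\<^sup>+y. ennreal (\<bar>f (x + y)\<bar> ^ p) \<partial>mu) < \<infinity>"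
  using i by (simp add: avg_contraction(1)[OF assms(1) f p] integrable_iff_bounded)
 then have "AEl x. (\<integral>\<^sup>+y. ennreal (\<bar>f (x + y)\<bar> ^ p) \<partial>mu) ~= \<infinity>"
  using sigma_finite_measure.borel_measurable_nn_integral[OF averagingD(5)[OF assms(1)] m]
  by (intro nn_integral_PInf_AE) auto
 then show ?thesis
 proof eventually_elim
  case (elim x)
  have [measurable]: "(%y. f (x + y)) : borel_measurable mu" by (rule averaging_measurable[OF assms(1) f])
  have "(\<integral>\<^sup>+y. ennreal \<bar>f (x + y)\<bar> \<partial>mu) ^ p <= (\<integral>\<^sup>+y. ennreal (\<bar>f (x + y)\<bar> ^ p) \<partial>mu)"
   using nn_integral_Jensen_power[OF assms(1) _ p, of "%y. ennreal \<bar>f (x + y)\<bar>"] by (simp add: ennreal_power)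
  then have "(\<integral>\<^sup>+y. ennreal \<bar>f (x + y)\<bar> \<partial>mu) ^ p < \<infinity>" using elim by (simp add: less_top order_le_less_trans)
  then have "(\<integral>\<^sup>+y. ennreal \<bar>f (x + y)\<bar> \<partial>mu) < \<infinity>" using p by (auto simp: power_less_top_ennreal)
  then show ?case by (simp add: integrable_iff_bounded)
 qed
qed

lemma abs_power_sum3:
 fixes a b c :: real
 shows "\<bar>a + b + c\<bar> ^ p <= 3 ^ p * (\<bar>a\<bar> ^ p + \<bar>b\<bar> ^ p + \<bar>c\<bar> ^ p)"
proof -
 define m where "m = max \<bar>a\<bar> (max \<bar>b\<bar> \<bar>c\<bar>)"
 have "\<bar>a + b + c\<bar> <= 3 * m" by (simp add: m_def)
 then have "\<bar>a + b + c\<bar> ^ p <= (3 * m) ^ p" by (intro power_mono) auto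
 also have "... = 3 ^ p * m ^ p" by (simp add: power_mult_distrib)
 also have "m ^ p <= \<bar>a\<bar> ^ p + \<bar>b\<bar> ^ p + \<bar>c\<bar> ^ p"
  unfolding m_def max_def by auto
 finally show ?thesis by simp
qed

text \<open>
 Truncation reduces to bounded functions with bounded support; those are almost everywhere limits
 of continuous functions, which may be clamped and cut off without losing the limit.
\<close>

lemma continuous_compact_support_dense:
 fixes f :: "'a::euclidean_space => real"
 assumes [measurable]: "f : Bm" and i: "integ (%x. \<bar>f x\<bar> ^ p)"
  and p: "0 < p" and e: "0 < e"
 obtains h R where "continuous_on UNIV h" "!!x. R < norm x ==> h x = 0"
  "(NN x. ennreal (\<bar>f x - h x\<bar> ^ p)) < ennreal e"
proof -
 define e' where "e' = e / (3 ^ p * 2)"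
 have e': "e' > 0" using e by (simp add: e'_def)
 define F where "F k x = (if \<bar>f x\<bar> <= real k \<and> norm x <= real k then f x else 0)" for k :: nat and x
 have [measurable]: "F k : Bm" for k unfolding F_def by measurable
 have "(%k. LBINT x. \<bar>f x - F k x\<bar> ^ p) ---> (\<integral>x. 0 \<partial>(lborel :: 'a measure))"
 proof (rule integral_dominated_convergence[OF _ _ i])
  show "AEl x. (%k. \<bar>f x - F k x\<bar> ^ p) ---> 0"
  proof (rule AE_I2)
   fix x
   obtain n :: nat where n: "max \<bar>f x\<bar> (norm x) <= real n" using real_arch_simple by blast
   show "(%k. \<bar>f x - F k x\<bar> ^ p) ---> 0"
    by (rule tendsto_eventually, rule eventually_sequentiallyI[of n]) (use n p in \<open>auto simp: F_def\<close>)
  qed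
  show "AEl x. norm (\<bar>f x - F k x\<bar> ^ p) <= \<bar>f x\<bar> ^ p" for k
   by (rule AE_I2) (use p in \<open>auto simp: F_def\<close>)
 qed auto
 then have "eventually (%k. (LBINT x. \<bar>f x - F k x\<bar> ^ p) < e') sequentially"
  using order_tendstoD(2)[OF _ e'] by simp
 then obtain k where k: "(LBINT x. \<bar>f x - F k x\<bar> ^ p) < e'"
  by (auto simp: eventually_sequentially)
 have ik: "integ (%x. \<bar>f x - F k x\<bar> ^ p)"
  by (rule Bi_integrable_bound[OF i]) (use p in \<open>auto simp: F_def\<close>)
 have "F k measurable_on UNIV" by (rule lebesgue_measurable_imp_measurable_on_real) (auto intro: measurable_completion)
 then obtain N g where N: "negligible N" and g: "!!n. continuous_on UNIV (g n)"
  and lim: "!!x. x \<notin> N ==> (%n. g n x) ---> F k x"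
  unfolding measurable_on_def by auto
 define c where "c x = max 0 (min 1 (real k + 1 - norm x))" for x :: 'a
 define h where "h n x = max (- real k) (min (real k) (g n x)) * c x" for n and x :: 'a
 have hc: "continuous_on UNIV (h n)" for n
  unfolding h_def c_def by (intro continuous_intros g)
 have [measurable]: "h n : Bm" for n using hc by (rule borel_measurable_continuous_onI)
 have hb: "\<bar>h n x\<bar> <= real k" for n x
 proof -
  have "\<bar>h n x\<bar> <= real k * 1" unfolding h_def abs_mult by (intro mult_mono) (auto simp: c_def)
  then show ?thesis by simp
 qed
 have h0: "h n x = 0" if "real k + 1 < norm x" for n x using that by (simp add: h_def c_def)
 have "(%n. LBINT x. \<bar>F k x - h n x\<bar> ^ p) ---> (\<integral>x. 0 \<partial>(lborel :: 'a measure))"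
 proof (rule integral_dominated_convergence[where w="%x. (2 * real k) ^ p * indicator (cball 0 (real k + 1)) x"])
  have "AEl x. x \<notin> N" using N negligible_iff_null_sets AE_not_in
   by (metis AE_completion_iff null_sets_completion_iff2 completion.complete lebesgue_on_UNIV_eq)
  then show "AEl x. (%n. \<bar>F k x - h n x\<bar> ^ p) ---> 0"
  proof eventually_elim
   case (elim x)
   have "(%n. h n x) ---> max (- real k) (min (real k) (F k x)) * c x"
    unfolding h_def by (intro tendsto_intros lim elim)
   moreover have "max (- real k) (min (real k) (F k x)) * c x = F k x"
    by (auto simp: F_def c_def)
   ultimately have "(%n. \<bar>F k x - h n x\<bar> ^ p) ---> \<bar>F k x - F k x\<bar> ^ p"
    by (intro tendsto_intros) auto
   then show ?case using p by (simp only: diff_self abs_zero power_0_left) simp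
  qed
  show "AEl x. norm (\<bar>F k x - h n x\<bar> ^ p) <= (2 * real k) ^ p * indicator (cball 0 (real k + 1)) x" for n
  proof (rule AE_I2)
   fix x
   have "\<bar>F k x\<bar> <= real k" by (simp add: F_def)
   then have "\<bar>F k x - h n x\<bar> ^ p <= (2 * real k) ^ p" using hb[of n x] by (intro power_mono) auto
   moreover have "F k x - h n x = 0" if "x \<notin> cball 0 (real k + 1)" using that h0[of x n] by (auto simp: F_def)
   ultimately show "norm (\<bar>F k x - h n x\<bar> ^ p) <= (2 * real k) ^ p * indicator (cball 0 (real k + 1)) x"
    by (cases "x \<in> cball 0 (real k + 1)") (auto simp: zero_power[OF p])
  qed
  show "integ (%x. (2 * real k) ^ p * indicator (cball (0::'a) (real k + 1)) x)"
   using emeasure_lborel_cball_finite[of 0 "real k + 1"]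
   by (intro integrable_mult_right integrable_real_indicator) auto
 qed auto
 then have "eventually (%n. (LBINT x. \<bar>F k x - h n x\<bar> ^ p) < e') sequentially"
  using order_tendstoD(2)[OF _ e'] by simp
 then obtain n where n: "(LBINT x. \<bar>F k x - h n x\<bar> ^ p) < e'"
  by (auto simp: eventually_sequentially)
 have inn: "integ (%x. \<bar>F k x - h n x\<bar> ^ p)"
 proof (rule Bi_integrable_bound)
  show "integ (%x. (2 * real k) ^ p * indicator (cball (0::'a) (real k + 1)) x)"
   using emeasure_lborel_cball_finite[of 0 "real k + 1"]
   by (intro integrable_mult_right integrable_real_indicator) auto
  show "AEl x. norm (\<bar>F k x - h n x\<bar> ^ p) <= norm ((2 * real k) ^ p * indicator (cball 0 (real k + 1)) x)"
  proof (rule AE_I2)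
   fix x
   have "\<bar>F k x\<bar> <= real k" by (simp add: F_def)
   then have "\<bar>F k x - h n x\<bar> ^ p <= (2 * real k) ^ p" using hb[of n x] by (intro power_mono) auto
   moreover have "F k x - h n x = 0" if "x \<notin> cball 0 (real k + 1)" using that h0[of x n] by (auto simp: F_def)
   ultimately show "norm (\<bar>F k x - h n x\<bar> ^ p) <= norm ((2 * real k) ^ p * indicator (cball 0 (real k + 1)) x)"
    by (cases "x \<in> cball 0 (real k + 1)") (auto simp: zero_power[OF p])
  qed
 qed measurable
 have "(NN x. ennreal (\<bar>f x - h n x\<bar> ^ p))
  <= (NN x. ennreal (3 ^ p * (\<bar>f x - F k x\<bar> ^ p + \<bar>F k x - h n x\<bar> ^ p)))"
 proof (intro nn_integral_mono ennreal_leI)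
  fix x
  show "\<bar>f x - h n x\<bar> ^ p <= 3 ^ p * (\<bar>f x - F k x\<bar> ^ p + \<bar>F k x - h n x\<bar> ^ p)"
   using abs_power_sum3[of "f x - F k x" "F k x - h n x" 0 p] by (simp add: zero_power[OF p])
 qed
 also have "... = ennreal (LBINT x. 3 ^ p * (\<bar>f x - F k x\<bar> ^ p + \<bar>F k x - h n x\<bar> ^ p))"
  by (intro nn_integral_eq_integral integrable_mult_right Bi_integrable_add ik inn AE_I2) auto
 finally have le: "(NN x. ennreal (\<bar>f x - h n x\<bar> ^ p))
  <= ennreal (LBINT x. 3 ^ p * (\<bar>f x - F k x\<bar> ^ p + \<bar>F k x - h n x\<bar> ^ p))" .
 have "(LBINT x. 3 ^ p * (\<bar>f x - F k x\<bar> ^ p + \<bar>F k x - h n x\<bar> ^ p))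
  = 3 ^ p * ((LBINT x. \<bar>f x - F k x\<bar> ^ p) + (LBINT x. \<bar>F k x - h n x\<bar> ^ p))"
  using ik inn by simp
 also have "... < 3 ^ p * (e' + e')" using k n by (intro mult_strict_left_mono add_strict_mono) auto
 also have "... = e" by (simp add: e'_def field_simps)
 finally have "(NN x. ennreal (\<bar>f x - h n x\<bar> ^ p)) < ennreal e"
  using le ennreal_lessI[OF e] order_le_less_trans by blast
 then show ?thesis using that[OF hc[of n] h0] by blast
qed

lemma ennreal_tendsto_0I:
 assumes "!!e. 0 < e ==> eventually (%n. X n <= ennreal e) F"
 shows "(X \<longlongrightarrow> (0::ennreal)) F"
proof (rule order_tendstoI)
 fix a :: ennreal assume "0 < a"
 then obtain b where b: "0 < b" "b < a" using dense by blast
 then obtain e where e: "b = ennreal e" "0 < e" by (cases b) auto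
 show "eventually (%n. X n < a) F" using assms[OF e(2)] by eventually_elim (use b e in auto)
qed auto

lemma avg_tendsto_continuous:
 fixes h :: "'a::euclidean_space => real"
 assumes mu: "!!n. averaging (mu n)" and small: "!!n. AE y in mu n. norm y <= ep n" "ep ---> 0"
  and h: "continuous_on UNIV h" "!!x. R < norm x ==> h x = 0" and p: "0 < p"
 shows "(%n. NN x. ennreal (\<bar>avg (mu n) h x - h x\<bar> ^ p)) ---> 0"
  and "integrable (mu n) (%y. h (x + y))"
proof -
 have m[measurable]: "h : Bm" using h(1) by (rule borel_measurable_continuous_onI)
 have "compact (h ` cball 0 R)" using h(1) by (intro compact_continuous_image) (auto intro: continuous_on_subset)
 then have "bounded (h ` cball 0 R)" by (rule compact_imp_bounded)
 then obtain B0 where B0: "!!x. x \<in> cball 0 R ==> \<bar>h x\<bar> <= B0"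
  unfolding bounded_iff real_norm_def by blast
 define B where "B = \<bar>B0\<bar>"
 have B: "\<bar>h x\<bar> <= B" for x
 proof (cases "x \<in> cball 0 R")
  case True
  then show ?thesis using B0[OF True] by (simp add: B_def)
 next
  case False
  then show ?thesis using h(2)[of x] by (simp add: B_def)
 qed
 obtain E where E: "!!n. \<bar>ep n\<bar> <= E" using convergent_imp_bounded[OF small(2)] by (auto simp: bounded_iff)
 have int: "integrable (mu n) (%y. h (x + y))" for n x
  by (intro finite_measure.integrable_const_bound[OF averagingD(4)[OF mu], of _ B] AE_I2
    averaging_measurable(1)[OF mu m]) (use B in auto)
 then show "integrable (mu n) (%y. h (x + y))" .
 have const: "integrable (mu n) (%y. c)" "(\<integral>y. c \<partial>mu n) = c" for c :: real and n
  using finite_measure.integrable_const[OF averagingD(4)[OF mu]] averagingD(2,6)[OF mu[of n]] by auto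
 have diff: "avg (mu n) h x - h x = (\<integral>y. h (x + y) - h x \<partial>mu n)" for n x
  using int const by (simp add: avg_def)
 have le: "\<bar>avg (mu n) h x - h x\<bar> <= c" if "AE y in mu n. \<bar>h (x + y) - h x\<bar> <= c" for n x c
 proof -
  have "\<bar>avg (mu n) h x - h x\<bar> <= (\<integral>y. \<bar>h (x + y) - h x\<bar> \<partial>mu n)"
   unfolding diff by (rule integral_abs_bound)
  also have "... <= (\<integral>y. c \<partial>mu n)" using int const that by (intro integral_mono_AE) auto
  finally show ?thesis by (simp only: const)
 qed
 have "(%n. NN x. ennreal (\<bar>avg (mu n) h x - h x\<bar> ^ p)) ---> (\<integral>\<^sup>+x. 0 \<partial>(lborel :: 'a measure))"
 proof (rule nn_integral_dominated_convergence[where w="%x. ennreal ((2 * B) ^ p) * indicator (cball 0 (R + E)) x"])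
  show "(%x. ennreal (\<bar>avg (mu n) h x - h x\<bar> ^ p)) : borel_measurable lborel" for n
   using avg_measurable[OF mu[of n] m] by measurable
  have "(NN x. ennreal ((2 * B) ^ p) * indicator (cball (0::'a) (R + E)) x) = ennreal ((2 * B) ^ p) * emeasure lborel (cball (0::'a) (R + E))"
   by (rule nn_integral_cmult_indicator) auto
  then show "(NN x. ennreal ((2 * B) ^ p) * indicator (cball (0::'a) (R + E)) x) < \<infinity>"
   using emeasure_lborel_cball_finite[of "0::'a" "R + E"] by (simp add: ennreal_mult_less_top)
  show "(%x. ennreal ((2 * B) ^ p) * indicator (cball 0 (R + E)) x) : borel_measurable (lborel :: 'a measure)"
   by (intro borel_measurable_times_ennreal borel_measurable_const borel_measurable_indicator) simp
  show "AEl x. ennreal (\<bar>avg (mu n) h x - h x\<bar> ^ p) <= ennreal ((2 * B) ^ p) * indicator (cball 0 (R + E)) x" for n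
  proof (rule AE_I2)
   fix x
   show "ennreal (\<bar>avg (mu n) h x - h x\<bar> ^ p) <= ennreal ((2 * B) ^ p) * indicator (cball 0 (R + E)) x"
   proof (cases "x \<in> cball 0 (R + E)")
    case True
    have *: "\<bar>h (x + y) - h x\<bar> <= 2 * B" for y using B[of "x + y"] B[of x] by linarith
    have "\<bar>avg (mu n) h x - h x\<bar> <= 2 * B" by (rule le, rule AE_I2, rule *)
    then have "\<bar>avg (mu n) h x - h x\<bar> ^ p <= (2 * B) ^ p" by (intro power_mono) auto
    then show ?thesis using True by (simp add: ennreal_leI)
   next
    case False
    have "AE y in mu n. \<bar>h (x + y) - h x\<bar> <= 0"
     using small(1)[of n]
    proof eventually_elim
     case (elim y)
     have "norm y <= E" using elim E[of n] by linarith
     moreover have "norm x <= norm (x + y) + norm y" using norm_triangle_ineq4[of "x + y" y] by simp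
     ultimately have "R < norm (x + y)" using False by simp
     moreover have "R < norm x" using False E[of n] by simp
     ultimately show ?case using h(2) by simp
    qed
    from le[OF this] have "avg (mu n) h x - h x = 0" by simp
    then show ?thesis by (simp add: zero_power[OF p])
   qed
  qed
  show "AEl x. (%n. ennreal (\<bar>avg (mu n) h x - h x\<bar> ^ p)) ---> 0"
  proof (rule AE_I2)
   fix x
   have "(%n. avg (mu n) h x - h x) ---> 0"
   proof (rule LIMSEQ_I)
    fix r :: real assume "0 < r"
    have "isCont h x" using h(1) by (simp add: continuous_on_eq_continuous_at)
    then obtain d where d: "d > 0" "!!z. norm (z - x) < d ==> \<bar>h z - h x\<bar> < r / 2"
     using \<open>0 < r\<close> unfolding continuous_at_eps_delta dist_norm real_norm_def by (metis half_gt_zero)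
    obtain n0 where n0: "!!n. n >= n0 ==> \<bar>ep n\<bar> < d"
     using LIMSEQ_D[OF small(2) d(1)] by auto
    have "norm (avg (mu n) h x - h x - 0) < r" if "n >= n0" for n
    proof -
     have "AE y in mu n. \<bar>h (x + y) - h x\<bar> <= r / 2"
      using small(1)[of n]
     proof eventually_elim
      case (elim y)
      then show ?case using d(2)[of "x + y"] n0[OF that] by fastforce
     qed
     from le[OF this] show ?thesis using \<open>0 < r\<close> by simp
    qed
    then show "\<exists>no. \<forall>n\<ge>no. norm (avg (mu n) h x - h x - 0) < r" by blast
   qed
   then have "(%n. ennreal (\<bar>avg (mu n) h x - h x\<bar> ^ p)) ---> ennreal (\<bar>0\<bar> ^ p)"
    by (intro tendsto_intros)
   then show "(%n. ennreal (\<bar>avg (mu n) h x - h x\<bar> ^ p)) ---> 0" by (simp add: zero_power[OF p])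
  qed
 qed auto
 then show "(%n. NN x. ennreal (\<bar>avg (mu n) h x - h x\<bar> ^ p)) ---> 0" by simp
qed

text \<open>
 Averages are contractions of the \<open>p\<close>-th power integrals, so it suffices to consider the dense continuous functions of compact support.
\<close>

theorem avg_tendsto_Lp:
 fixes f :: "'a::euclidean_space => real"
 assumes mu: "!!n. averaging (mu n)" and small: "!!n. AE y in mu n. norm y <= ep n" "ep ---> 0"
  and f[measurable]: "f : Bm" and i: "integ (%x. \<bar>f x\<bar> ^ p)"
  and p: "p = 1 \<or> p = 2 \<or> p = (4::nat)"
 shows "(%n. NN x. ennreal (\<bar>avg (mu n) f x - f x\<bar> ^ p)) ---> 0"
proof (rule ennreal_tendsto_0I)
 fix e :: real assume e: "0 < e"
 have p0: "0 < p" using p by auto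
 define e' where "e' = e / (3 ^ p * 3)"
 have e': "e' > 0" using e by (simp add: e'_def)
 obtain h R where h: "continuous_on UNIV h" "!!x. R < norm x ==> h x = 0"
  and fh: "(NN x. ennreal (\<bar>f x - h x\<bar> ^ p)) < ennreal e'"
  using continuous_compact_support_dense[OF f i p0 e'] by metis
 have hm[measurable]: "h : Bm" using h(1) by (rule borel_measurable_continuous_onI)
 have dm: "(%x. f x - h x) : Bm" by measurable
 have di: "integ (%x. \<bar>f x - h x\<bar> ^ p)"
  using fh by (simp add: integrable_iff_bounded order_less_trans)
 have lim: "(%n. NN x. ennreal (\<bar>avg (mu n) h x - h x\<bar> ^ p)) ---> 0"
  by (rule avg_tendsto_continuous(1)[OF mu small h p0])
 have "eventually (%n. (NN x. ennreal (\<bar>avg (mu n) h x - h x\<bar> ^ p)) < ennreal e') sequentially"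
  using order_tendstoD(2)[OF lim, of "ennreal e'"] e' by (simp only: ennreal_less_zero_iff simp_thms)
 then show "eventually (%n. (NN x. ennreal (\<bar>avg (mu n) f x - f x\<bar> ^ p)) <= ennreal e) sequentially"
 proof eventually_elim
  case (elim n)
  have [measurable]: "avg (mu n) f : Bm" "avg (mu n) h : Bm"
   "avg (mu n) (%x. f x - h x) : Bm"
   by (intro avg_measurable mu f hm dm)+
  have "AEl x. avg (mu n) f x = avg (mu n) (%x. f x - h x) x + avg (mu n) h x"
   using avg_AE_integrable[OF mu[of n] f p i]
  proof eventually_elim
   case (elim x)
   then show ?case
    using avg_tendsto_continuous(2)[OF mu small h p0, where n=n and x=x] by (simp add: avg_def)
  qed
  then have "AEl x. ennreal (\<bar>avg (mu n) f x - f x\<bar> ^ p) <= ennreal (3 ^ p) * (ennreal (\<bar>avg (mu n) (%x. f x - h x) x\<bar> ^ p)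
    + ennreal (\<bar>avg (mu n) h x - h x\<bar> ^ p) + ennreal (\<bar>f x - h x\<bar> ^ p))"
  proof eventually_elim
   case (elim x)
   have "\<bar>avg (mu n) f x - f x\<bar> ^ p <= 3 ^ p * (\<bar>avg (mu n) (%x. f x - h x) x\<bar> ^ p
    + \<bar>avg (mu n) h x - h x\<bar> ^ p + \<bar>f x - h x\<bar> ^ p)"
    using abs_power_sum3[of "avg (mu n) (%x. f x - h x) x" "avg (mu n) h x - h x" "h x - f x" p] elim
    by (simp add: abs_minus_commute[of "h x" "f x"] add_diff_eq)
   then show ?case by (simp add: ennreal_leI flip: ennreal_plus ennreal_mult)
  qed
  then have "(NN x. ennreal (\<bar>avg (mu n) f x - f x\<bar> ^ p)) \<le>
   (NN x. ennreal (3 ^ p) * (ennreal (\<bar>avg (mu n) (%x. f x - h x) x\<bar> ^ p)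
    + ennreal (\<bar>avg (mu n) h x - h x\<bar> ^ p) + ennreal (\<bar>f x - h x\<bar> ^ p)))"
   by (rule nn_integral_mono_AE)
  also have "... = ennreal (3 ^ p) * ((NN x. ennreal (\<bar>avg (mu n) (%x. f x - h x) x\<bar> ^ p))
    + (NN x. ennreal (\<bar>avg (mu n) h x - h x\<bar> ^ p)) + (NN x. ennreal (\<bar>f x - h x\<bar> ^ p)))"
   by (simp add: nn_integral_cmult nn_integral_add)
  also have "... <= ennreal (3 ^ p) * (ennreal e' + ennreal e' + ennreal e')"
   using avg_contraction(2)[OF mu[of n] dm p] fh elim by (intro mult_left_mono add_mono) auto
  also have "... = ennreal e" using e' by (simp add: e'_def field_simps flip: ennreal_plus ennreal_mult)
  finally show ?case .
 qed
qed

lemma avg_integrable_power: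
 assumes "averaging mu" and f: "f : Bm" and p: "p = 1 \<or> p = 2 \<or> p = (4::nat)"
  and i: "integ (%x. \<bar>f x\<bar> ^ p)"
 shows "integ (%x. \<bar>avg mu f x\<bar> ^ p)"
  and "(LBINT x. \<bar>avg mu f x\<bar> ^ p) <= (LBINT x. \<bar>f x\<bar> ^ p)"
proof -
 have fl: "f : borel_measurable lborel" "avg mu f : borel_measurable lborel"
  using f avg_measurable[OF assms(1) f] by auto
 have le: "(NN x. ennreal (\<bar>avg mu f x\<bar> ^ p)) <= (NN x. ennreal (\<bar>f x\<bar> ^ p))"
  by (rule avg_contraction(2)[OF assms(1) f p])
 show a: "integ (%x. \<bar>avg mu f x\<bar> ^ p)"
  using i le unfolding integrable_power_iff[OF fl(1)] integrable_power_iff[OF fl(2)] by (rule le_less_trans[rotated])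
 show "(LBINT x. \<bar>avg mu f x\<bar> ^ p) <= (LBINT x. \<bar>f x\<bar> ^ p)"
  using le nn_integral_eq_integral[OF a] nn_integral_eq_integral[OF i] by (simp add: integral_nonneg_AE)
qed

section \<open>Cauchy--Schwarz and convergence of pairings\<close>

lemma CS_integrable:
 fixes f g :: "'a => real"
 assumes [measurable]: "f : borel_measurable M" "g : borel_measurable M"
  and f: "integrable M (%x. (f x)^2)" and g: "integrable M (%x. (g x)^2)"
 shows "integrable M (%x. f x * g x)"
proof (rule Bi_integrable_bound)
 show "integrable M (%x. (f x)^2 + (g x)^2)" using f g by simp
 have "\<bar>f x * g x\<bar> <= (f x)^2 + (g x)^2" for x
 proof -
  have "0 <= \<bar>f x\<bar> * \<bar>g x\<bar>" by simp
  moreover have "2 * (\<bar>f x\<bar> * \<bar>g x\<bar>) <= (f x)^2 + (g x)^2"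
   using sum_squares_bound[of "\<bar>f x\<bar>" "\<bar>g x\<bar>"] by (simp add: mult.assoc)
  ultimately show ?thesis by (simp only: abs_mult)
 qed
 then show "AE x in M. norm (f x * g x) <= norm ((f x)^2 + (g x)^2)" by (auto intro!: AE_I2)
qed measurable

lemma CS_integral:
 fixes f g :: "'a => real"
 assumes [measurable]: "f : borel_measurable M" "g : borel_measurable M"
  and f: "integrable M (%x. (f x)^2)" and g: "integrable M (%x. (g x)^2)"
 shows "(\<integral>x. \<bar>f x * g x\<bar> \<partial>M)^2 <= (\<integral>x. (f x)^2 \<partial>M) * (\<integral>x. (g x)^2 \<partial>M)"
proof -
 have i: "integrable M (%x. \<bar>f x * g x\<bar>)" using CS_integrable[OF assms] by (rule integrable_abs)
 have "(\<integral>\<^sup>+x. ennreal \<bar>f x\<bar> * ennreal \<bar>g x\<bar> \<partial>M)^2 <= (\<integral>\<^sup>+x. (ennreal \<bar>f x\<bar>)^2 \<partial>M) * (\<integral>\<^sup>+x. (ennreal \<bar>g x\<bar>)^2 \<partial>M)"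
  by (rule Cauchy_Schwarz_nn_integral) measurable
 moreover have "(\<integral>\<^sup>+x. ennreal \<bar>f x\<bar> * ennreal \<bar>g x\<bar> \<partial>M) = ennreal (\<integral>x. \<bar>f x * g x\<bar> \<partial>M)"
  unfolding nn_integral_eq_integral[OF i AE_I2[OF abs_ge_zero], symmetric]
  by (simp add: abs_mult ennreal_mult)
 moreover have "(\<integral>\<^sup>+x. (ennreal \<bar>f x\<bar>)^2 \<partial>M) = ennreal (\<integral>x. (f x)^2 \<partial>M)"
  by (subst nn_integral_eq_integral[OF f, symmetric]) (auto simp: ennreal_power)
 moreover have "(\<integral>\<^sup>+x. (ennreal \<bar>g x\<bar>)^2 \<partial>M) = ennreal (\<integral>x. (g x)^2 \<partial>M)"
  by (subst nn_integral_eq_integral[OF g, symmetric]) (auto simp: ennreal_power)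
 ultimately show ?thesis
  by (simp add: ennreal_power ennreal_mult[symmetric] ennreal_le_iff)
qed

lemma CS_integral_sqrt:
 fixes f g :: "'a => real"
 assumes "f : borel_measurable M" "g : borel_measurable M"
  and "integrable M (%x. (f x)^2)" "integrable M (%x. (g x)^2)"
 shows "(\<integral>x. \<bar>f x * g x\<bar> \<partial>M) <= sqrt (\<integral>x. (f x)^2 \<partial>M) * sqrt (\<integral>x. (g x)^2 \<partial>M)"
 using real_le_rsqrt[OF CS_integral[OF assms]] by (simp add: real_sqrt_mult)

lemma pairing_nn_tendsto_0:
 fixes a :: "'a => real" and d :: "nat => 'a => real"
 assumes [measurable]: "a : borel_measurable M" "!!n. d n : borel_measurable M"
  and a: "integrable M (%x. (a x)^2)"
  and d: "(%n. \<integral>\<^sup>+x. ennreal ((d n x)^2) \<partial>M) ---> 0"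
 shows "(%n. \<integral>\<^sup>+x. ennreal \<bar>a x * d n x\<bar> \<partial>M) ---> 0"
proof -
 define A where "A = (\<integral>x. (a x)^2 \<partial>M)"
 have A: "(\<integral>\<^sup>+x. ennreal ((a x)^2) \<partial>M) = ennreal A" unfolding A_def by (rule nn_integral_eq_integral[OF a]) simp
 have le: "(\<integral>\<^sup>+x. ennreal \<bar>a x * d n x\<bar> \<partial>M)^2 <= ennreal A * (\<integral>\<^sup>+x. ennreal ((d n x)^2) \<partial>M)" for n
  using Cauchy_Schwarz_nn_integral[of "%x. ennreal \<bar>a x\<bar>" M "%x. ennreal \<bar>d n x\<bar>"]
  by (simp add: abs_mult ennreal_mult ennreal_power A)
 have lim: "(%n. ennreal A * (\<integral>\<^sup>+x. ennreal ((d n x)^2) \<partial>M)) ---> ennreal A * 0"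
  using d by (intro tendsto_mult_ennreal tendsto_const) auto
 show ?thesis
 proof (rule ennreal_tendsto_0I)
  fix e :: real assume e: "0 < e"
  have "eventually (%n. ennreal A * (\<integral>\<^sup>+x. ennreal ((d n x)^2) \<partial>M) < ennreal (e^2)) sequentially"
   by (rule order_tendstoD(2)[OF lim]) (use e in simp)
  then show "eventually (%n. (\<integral>\<^sup>+x. ennreal \<bar>a x * d n x\<bar> \<partial>M) <= ennreal e) sequentially"
  proof eventually_elim
   case (elim n)
   then have "(\<integral>\<^sup>+x. ennreal \<bar>a x * d n x\<bar> \<partial>M)^2 < (ennreal e)\<^sup>2"
    using le[of n] e by (simp add: ennreal_power)
   then show ?case by (meson not_le power_mono order_less_le leD zero_le)
  qed
 qed
qed

lemma ennreal_power2_le_imp_le: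
 assumes "x^2 <= (ennreal c)^2" "0 <= c"
 shows "x <= ennreal c"
proof (cases x)
 case (real r)
 then have "r^2 <= c^2" using assms by (simp add: ennreal_power ennreal_le_iff)
 then show ?thesis using real assms(2) power2_le_imp_le by (simp add: ennreal_leI)
next
 case top
 then show ?thesis using assms by (simp add: ennreal_power power2_eq_square[of "top::ennreal"] top_unique)
qed

lemma integral_tendsto_of_nn_tendsto_0:
 fixes E :: "nat => 'a => real"
 assumes [measurable]: "!!n. E n : borel_measurable M"
  and 0: "(%n. \<integral>\<^sup>+x. ennreal \<bar>E n x\<bar> \<partial>M) ---> 0"
 shows "(%n. \<integral>x. E n x \<partial>M) ---> 0"
proof (rule LIMSEQ_I)
 fix r :: real assume r: "0 < r"
 have "eventually (%n. (\<integral>\<^sup>+x. ennreal \<bar>E n x\<bar> \<partial>M) < ennreal r) sequentially"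
  by (rule order_tendstoD(2)[OF 0]) (use r in simp)
 then obtain n0 where n0: "!!n. n >= n0 ==> (\<integral>\<^sup>+x. ennreal \<bar>E n x\<bar> \<partial>M) < ennreal r"
  by (auto simp: eventually_sequentially)
 have "norm ((\<integral>x. E n x \<partial>M) - 0) < r" if "n >= n0" for n
 proof -
  have i: "integrable M (E n)"
   using order_less_trans[OF n0[OF that] ennreal_less_top] by (simp add: integrable_iff_bounded)
  have "ennreal (norm (\<integral>x. E n x \<partial>M)) < ennreal r"
   using integral_norm_bound_ennreal[OF i] n0[OF that] by simp
  then show ?thesis using r by (simp add: ennreal_less_iff)
 qed
 then show "\<exists>no. \<forall>n\<ge>no. norm ((\<integral>x. E n x \<partial>M) - 0) < r" by blast
qed

lemma avg_pairing_tendsto_L2: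
 fixes f F :: "'a::euclidean_space => real"
 assumes mu: "!!n. averaging (mu n)" and small: "!!n. AE y in mu n. norm y <= ep n" "ep ---> 0"
  and [measurable]: "f : Bm" "F : Bm"
  and f: "integ (%x. (f x)^2)" and F: "integ (%x. (F x)^2)"
 shows "(%n. LBINT x. F x * avg (mu n) f x) ---> (LBINT x. F x * f x)"
  and "integ (%x. F x * avg (mu n) f x)"
proof -
 have m[measurable]: "avg (mu n) f : Bm" for n by (intro avg_measurable mu) simp
 have i2: "integ (%x. (avg (mu n) f x)^2)" for n
  using avg_integrable_power(1)[OF mu[of n], of f 2] f by simp
 have iF: "integ (%x. F x * avg (mu n) f x)" for n by (intro CS_integrable F i2) auto
 then show "integ (%x. F x * avg (mu n) f x)" .
 have iFf: "integ (%x. F x * f x)" by (intro CS_integrable F f) auto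
 have "(%n. NN x. ennreal \<bar>F x * (avg (mu n) f x - f x)\<bar>) ---> 0"
  using avg_tendsto_Lp[OF mu small, of f 2] f by (intro pairing_nn_tendsto_0[OF _ _ F]) auto
 then have "(%n. LBINT x. F x * (avg (mu n) f x - f x)) ---> 0"
  by (intro integral_tendsto_of_nn_tendsto_0) auto
 then have "(%n. (LBINT x. F x * avg (mu n) f x) - (LBINT x. F x * f x)) ---> 0"
  using iF iFf by (simp add: right_diff_distrib)
 then show "(%n. LBINT x. F x * avg (mu n) f x) ---> (LBINT x. F x * f x)"
  by (rule LIM_zero_cancel)
qed

lemma integrable_L4_product:
 fixes a b :: "'a => real"
 assumes [measurable]: "a : borel_measurable M" "b : borel_measurable M"
  and "integrable M (%x. (a x) ^ 4)" "integrable M (%x. (b x) ^ 4)"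
 shows "integrable M (%x. (a x * b x)^2)"
 using CS_integrable[of "%x. (a x)^2" M "%x. (b x)^2"] assms by (simp add: power_mult_distrib flip: power_mult)

lemma avg_pairing_tendsto_L4:
 fixes f E :: "'a::euclidean_space => real"
 assumes mu: "!!n. averaging (mu n)" and small: "!!n. AE y in mu n. norm y <= ep n" "ep ---> 0"
  and [measurable]: "f : Bm" "E : Bm"
   "a : Bm" "b : Bm"
  and f: "integ (%x. (f x) ^ 4)"
  and a: "integ (%x. (a x)^2)" and b: "integ (%x. (b x) ^ 4)"
  and E: "!!x. \<bar>E x\<bar> <= \<bar>a x * b x\<bar>"
 shows "(%n. LBINT x. E x * avg (mu n) f x) ---> (LBINT x. E x * f x)"
  and "integ (%x. E x * avg (mu n) f x)"
proof -
 have m[measurable]: "avg (mu n) f : Bm" for n by (intro avg_measurable mu) simp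
 have i4: "integ (%x. (avg (mu n) f x) ^ 4)" for n
  using avg_integrable_power(1)[OF mu[of n], of f 4] f by simp
 have dom: "integ (%x. E x * g x)" if [measurable]: "g : Bm" and g: "integ (%x. (g x) ^ 4)" for g
 proof (rule Bi_integrable_bound)
  show "integ (%x. a x * (b x * g x))"
   by (intro CS_integrable a integrable_L4_product b g) auto
  show "AEl x. norm (E x * g x) <= norm (a x * (b x * g x))"
   using E by (intro AE_I2) (auto simp: abs_mult mult.assoc[symmetric] intro!: mult_right_mono)
 qed measurable
 show iE: "integ (%x. E x * avg (mu n) f x)" for n by (intro dom i4) auto
 have iEf: "integ (%x. E x * f x)" by (intro dom f) auto
 have c: "(%n. NN x. ennreal ((b x * (avg (mu n) f x - f x))^2)) ---> 0"
 proof -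
  have "(%n. NN x. ennreal \<bar>(b x)\<^sup>2 * (avg (mu n) f x - f x)^2\<bar>) ---> 0"
   using avg_tendsto_Lp[OF mu small, of f 4] f b
   by (intro pairing_nn_tendsto_0) (auto simp flip: power_mult)
  then show ?thesis by (simp add: power_mult_distrib)
 qed
 have "(%n. NN x. ennreal \<bar>a x * (b x * (avg (mu n) f x - f x))\<bar>) ---> 0"
  by (rule pairing_nn_tendsto_0[OF _ _ a c]) auto
 then have "(%n. NN x. ennreal \<bar>E x * (avg (mu n) f x - f x)\<bar>) ---> 0"
 proof (rule tendsto_sandwich[rotated 3])
  show "\<forall>\<^sub>F n in sequentially. (NN x. ennreal \<bar>E x * (avg (mu n) f x - f x)\<bar>) <= (NN x. ennreal \<bar>a x * (b x * (avg (mu n) f x - f x))\<bar>)"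
   using E by (intro always_eventually allI nn_integral_mono ennreal_leI)
    (auto simp: abs_mult mult.assoc[symmetric] intro!: mult_right_mono)
 qed auto
 then have "(%n. LBINT x. E x * (avg (mu n) f x - f x)) ---> 0"
  by (intro integral_tendsto_of_nn_tendsto_0) auto
 then have "(%n. (LBINT x. E x * avg (mu n) f x) - (LBINT x. E x * f x)) ---> 0"
  using iE iEf by (simp add: right_diff_distrib)
 then show "(%n. LBINT x. E x * avg (mu n) f x) ---> (LBINT x. E x * f x)"
  by (rule LIM_zero_cancel)
qed

lemma avg_AE_subsequence:
 fixes f :: "'a::euclidean_space => real"
 assumes mu: "!!n. averaging (mu n)" and small: "!!n. AE y in mu n. norm y <= ep n" "ep ---> 0"
  and [measurable]: "f : Bm" and f: "integ (%x. (f x)^2)"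
 obtains r :: "nat => nat" where "strict_mono r" "AEl x. (%n. avg (mu (r n)) f x) ---> f x"
proof -
 have m[measurable]: "avg (mu n) f : Bm" for n by (intro avg_measurable mu) simp
 have 0: "(%n. NN x. ennreal ((avg (mu n) f x - f x)^2)) ---> 0"
  using avg_tendsto_Lp[OF mu small, of f 2] f by simp
 have i: "integ (%x. (avg (mu n) f x - f x)^2)" for n
 proof (rule Bi_integrable_bound)
  show "integ (%x. 3 ^ 2 * ((avg (mu n) f x)^2 + (f x)^2))"
   using avg_integrable_power(1)[OF mu[of n], of f 2] f by simp
  show "AEl x. norm ((avg (mu n) f x - f x)^2) <= norm (3 ^ 2 * ((avg (mu n) f x)^2 + (f x)^2))"
   using abs_power_sum3[of "avg (mu n) f _" "- f _" 0 2] by (intro AE_I2) simp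
 qed measurable
 have "(%n. LBINT x. norm ((avg (mu n) f x - f x)^2)) ---> 0"
  using integral_tendsto_of_nn_tendsto_0[of "%n x. (avg (mu n) f x - f x)^2" lborel] 0 by simp
 then obtain r where r: "strict_mono r" "AEl x. (%n. (avg (mu (r n)) f x - f x)^2) ---> 0"
  using tendsto_L1_AE_subseq[of lborel "%n x. (avg (mu n) f x - f x)^2", OF i] by blast
 from r(2) have "AEl x. (%n. avg (mu (r n)) f x) ---> f x"
 proof eventually_elim
  case (elim x)
  then have "(%n. sqrt ((avg (mu (r n)) f x - f x)^2)) ---> sqrt 0" by (rule tendsto_real_sqrt)
  then have "(%n. avg (mu (r n)) f x - f x) ---> 0" by (simp add: tendsto_rabs_zero_iff)
  then show ?case by (rule LIM_zero_cancel)
 qed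
 then show ?thesis using that r(1) by blast
qed

subsection \<open>Smooth averaging kernels\<close>

definition mollifier :: "nat => 'a::euclidean_space => real" where
 "mollifier n x = box_bump 1 (- (One /\<^sub>R real (Suc n))) (One /\<^sub>R real (Suc n)) x /
  (\<integral>y. box_bump 1 (- (One /\<^sub>R real (Suc n))) (One /\<^sub>R real (Suc n)) y \<partial>(lborel :: 'a measure))"

definition mollifier_measure :: "nat => 'a::euclidean_space measure" where
 "mollifier_measure n = density lborel (%y. ennreal (mollifier n y))"

lemma box_bump_integral_pos:
 fixes a b :: "'a::euclidean_space"
 assumes "0 < k" "box a b ~= {}"
 shows "integ (box_bump k a b)" "0 < (LBINT x. box_bump k a b x)"
proof -
 have [measurable]: "box_bump k a b : Bm"
  using test_functions_measurable[OF box_bump_test[of a b UNIV k]] by simp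
 show i: "integ (box_bump k a b)"
 proof (rule Bi_integrable_bound)
  show "integ (indicator (box a b) :: 'a => real)"
   using emeasure_lborel_box_finite[of a b] by (intro integrable_real_indicator) auto
  show "AEl x. norm (box_bump k a b x) <= norm (indicator (box a b) x :: real)"
   using box_bump_nonneg[of k a b] box_bump_le1[of k a b] box_bump_outside[of _ a b k]
   by (intro AE_I2) (auto simp: indicator_def)
 qed measurable
 have "(LBINT x. box_bump k a b x) ~= 0"
 proof
  assume "(LBINT x. box_bump k a b x) = 0"
  then have "AEl x. box_bump k a b x = 0"
   by (subst (asm) integral_nonneg_eq_0_iff_AE[OF i]) (auto intro!: AE_I2 box_bump_nonneg)
  then have "AEl x. x \<notin> box a b"
  proof eventually_elim
   case (elim x)
   then show ?case using box_bump_pos[OF assms(1), of x a b] by force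
  qed
  then have "box a b \<in> null_sets lborel" by (subst AE_iff_null_sets) auto
  then have "emeasure lborel (box a b) = 0" by auto
  moreover have "0 < (\<Prod>i\<in>Basis. (b - a) \<bullet> i)" using assms(2) by (intro prod_pos) (auto simp: box_ne_empty inner_diff_left)
  ultimately show False using assms(2) by (auto simp: emeasure_lborel_box_eq box_ne_empty split: if_splits)
 qed
 moreover have "0 <= (LBINT x. box_bump k a b x)" by (intro integral_nonneg_AE AE_I2 box_bump_nonneg)
 ultimately show "0 < (LBINT x. box_bump k a b x)" by simp
qed

lemma mollifier_test: "(mollifier n :: 'a => real) : tests UNIV"
 and mollifier_nonneg: "0 <= mollifier n x"
 and mollifier_integral: "integ (mollifier n :: 'a => real)" "(LBINT y. mollifier n (y :: 'a)) = 1"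
 and mollifier_support: "mollifier n x ~= 0 ==> norm x <= DIM('a) / real (Suc n)"
 for x :: "'a::euclidean_space"
proof -
 let ?a = "One /\<^sub>R real (Suc n) :: 'a"
 let ?c = "\<integral>y. box_bump 1 (- ?a) ?a y \<partial>(lborel :: 'a measure)"
 have ne: "box (- ?a) ?a ~= {}" by (auto simp: box_ne_empty)
 note c = box_bump_integral_pos[OF zero_less_one ne]
 have eq: "(mollifier n :: 'a => real) = (%x. inverse ?c * box_bump 1 (- ?a) ?a x)"
  by (rule ext) (simp add: mollifier_def divide_inverse)
 have b: "box_bump 1 (- ?a) ?a x = 0" if "x \<notin> cbox (- ?a) ?a" for x
  using that box_subset_cbox[of "- ?a" ?a] by (intro box_bump_outside) auto
 show "(mollifier n :: 'a => real) : tests UNIV"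
  unfolding eq
 proof (rule test_functionsI[of _ "cbox (- ?a) ?a"])
  show "inverse ?c * box_bump 1 (- ?a) ?a x = 0" if "x \<notin> cbox (- ?a) ?a" for x
   by (simp only: b[OF that] mult_zero_right)
  show "Ck k (%x. inverse ?c * box_bump 1 (- ?a) ?a x)" for k by (intro Ck_mult Ck_const Ck_box_bump)
 qed auto
 show "0 <= mollifier n x" unfolding eq using c box_bump_nonneg[of 1 "- ?a" ?a x] by simp
 show "integ (mollifier n :: 'a => real)" unfolding eq by (intro integrable_mult_right c)
 show "(LBINT y. mollifier n (y :: 'a)) = 1" unfolding eq using c by simp
 assume "mollifier n x ~= 0"
 then have "x \<in> box (- ?a) ?a" unfolding eq using box_bump_outside by fastforce
 then have *: "\<bar>x \<bullet> i\<bar> <= 1 / real (Suc n)" if "i \<in> Basis" for i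
  using that unfolding mem_box by (auto simp: abs_le_iff inverse_eq_divide)
 have "norm x <= (\<Sum>i\<in>Basis. \<bar>x \<bullet> i\<bar>)" by (rule norm_le_l1)
 also have "... <= (\<Sum>i\<in>(Basis :: 'a set). 1 / real (Suc n))" by (intro sum_mono *)
 finally show "norm x <= DIM('a) / real (Suc n)" by simp
qed

lemma mollifier_measurable [measurable]: "mollifier n : Bm"
 by (rule test_functions_measurable[OF mollifier_test])

lemma averaging_mollifier: "averaging (mollifier_measure n :: 'a::euclidean_space measure)"
proof -
 have "(NN y. ennreal (mollifier n (y::'a))) = ennreal (LBINT y. mollifier n (y::'a))"
  by (rule nn_integral_eq_integral[OF mollifier_integral(1)]) (simp add: mollifier_nonneg)
 then show ?thesis
  by (simp add: averaging_def mollifier_measure_def emeasure_density mollifier_integral)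
qed

lemma AE_mollifier:
 assumes "AEl y. P y"
 shows "AE y in mollifier_measure n. P y"
 unfolding mollifier_measure_def using assms by (subst AE_density) auto

lemma mollifier_measure_small:
 "AE y in mollifier_measure n. norm (y::'a::euclidean_space) <= DIM('a) / real (Suc n)"
 "(%n. DIM('a) / real (Suc n)) ---> 0"
proof -
 show "AE y in mollifier_measure n. norm (y::'a) <= DIM('a) / real (Suc n)"
  unfolding mollifier_measure_def
  by (subst AE_density) (auto simp del: of_nat_Suc intro!: AE_I2 mollifier_support)
 show "(%n. DIM('a) / real (Suc n)) ---> 0"
  using tendsto_mult_right_zero[OF LIMSEQ_inverse_real_of_nat, of "DIM('a)"] by (simp add: divide_inverse)
qed

lemma avg_mollifier:
 assumes [measurable]: "f : Bm"
 shows "avg (mollifier_measure n) f x = (LBINT y. mollifier n y * f (x + y))"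
  and "avg (mollifier_measure n) f x = (LBINT z. mollifier n (z - x) * f z)"
proof -
 show 1: "avg (mollifier_measure n) f x = (LBINT y. mollifier n y * f (x + y))"
  unfolding avg_def mollifier_measure_def by (subst integral_density) (auto simp: mollifier_nonneg)
 show "avg (mollifier_measure n) f x = (LBINT z. mollifier n (z - x) * f z)"
  unfolding 1 using integral_shift[of "%z. mollifier n (z - x) * f z" x] by (simp add: add.commute)
qed

lemma avg_mollifier_bounded:
 fixes f :: "'a::euclidean_space => real"
 assumes f[measurable]: "f : Bm" and i: "integ (%x. (f x)^2)"
 obtains C where "!!x. (\<integral>\<^sup>+y. ennreal \<bar>f (x + y)\<bar> \<partial>mollifier_measure n) <= ennreal C" "!!x. \<bar>avg (mollifier_measure n) f x\<bar> <= C" "0 <= C"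
proof -
 obtain B where B: "!!x. \<bar>mollifier n (x::'a)\<bar> <= B" "0 <= B"
  using test_functions_bounded[OF mollifier_test] by metis
 define C where "C = sqrt (B * (LBINT x. (f x)^2))"
 have C: "0 <= C" using B(2) by (simp add: C_def)
 have 1: "(\<integral>\<^sup>+y. ennreal \<bar>f (x + y)\<bar> \<partial>mollifier_measure n) <= ennreal C" for x
 proof -
  have [measurable]: "(%y. f (x + y)) : borel_measurable (mollifier_measure n)"
   by (rule averaging_measurable(1)[OF averaging_mollifier f])
  have "(\<integral>\<^sup>+y. ennreal \<bar>f (x + y)\<bar> \<partial>mollifier_measure n)^2 <= (\<integral>\<^sup>+y. (ennreal \<bar>f (x + y)\<bar>)^2 \<partial>mollifier_measure n)"
   by (rule nn_integral_Jensen_power[OF averaging_mollifier]) auto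
  also have "... = (NN y. ennreal (mollifier n y) * ennreal ((f (x + y))^2))"
   unfolding mollifier_measure_def by (subst nn_integral_density) (auto simp: ennreal_power)
  also have "... <= (NN y. ennreal B * ennreal ((f (y + x))^2))"
   using B(1) by (intro nn_integral_mono mult_mono ennreal_leI) (auto simp: add.commute abs_le_iff)
  also have "... = ennreal B * (NN y. ennreal ((f y)^2))"
   using nn_integral_shift[of "%y. ennreal ((f y)^2)" x] by (simp add: nn_integral_cmult)
  also have "... = ennreal (B * (LBINT x. (f x)^2))"
   by (subst nn_integral_eq_integral[OF i]) (auto simp: ennreal_mult B)
  also have "... = (ennreal C)^2" using B(2) by (simp add: C_def ennreal_power)
  finally show ?thesis by (rule ennreal_power2_le_imp_le[OF _ C])
 qed
 have "\<bar>avg (mollifier_measure n) f x\<bar> <= C" for x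
 proof -
  have "ennreal \<bar>avg (mollifier_measure n) f x\<bar> <= (\<integral>\<^sup>+y. ennreal \<bar>f (x + y)\<bar> \<partial>mollifier_measure n)"
   using avg_power_le[OF averaging_mollifier f, of 1 n x] by simp
  also note 1[of x]
  finally show ?thesis using C by (simp add: ennreal_le_iff)
 qed
 then show ?thesis by (rule that[OF 1 _ C])
qed

lemma avg_mollifier_line_ac:
 fixes f g :: "'a::euclidean_space => real"
 assumes l: "AEl x. line_ac (%s. f (x + s *R v)) (%s. g (x + s *R v))"
  and f[measurable]: "f : Bm" and g[measurable]: "g : Bm"
  and f2: "integ (%x. (f x)^2)" and g2: "integ (%x. (g x)^2)"
 shows "line_ac (%s. avg (mollifier_measure n) f (x + s *R v)) (%s. avg (mollifier_measure n) g (x + s *R v))"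
proof -
 let ?mu = "mollifier_measure n :: 'a measure"
 have fm: "(%y. f (z + y)) : borel_measurable ?mu" for z by (rule averaging_measurable(1)[OF averaging_mollifier f])
 have gm: "(%y. g (z + y)) : borel_measurable ?mu" for z by (rule averaging_measurable(1)[OF averaging_mollifier g])
 obtain Cf where Cf: "!!x. (\<integral>\<^sup>+y. ennreal \<bar>f (x + y)\<bar> \<partial>?mu) <= ennreal Cf" using avg_mollifier_bounded[OF f f2] by metis
 obtain Cg where Cg: "!!x. (\<integral>\<^sup>+y. ennreal \<bar>g (x + y)\<bar> \<partial>?mu) <= ennreal Cg" "!!x. \<bar>avg ?mu g x\<bar> <= Cg"
  using avg_mollifier_bounded[OF g g2] by metis
 have ag[measurable]: "avg ?mu g : Bm" by (intro avg_measurable averaging_mollifier g)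
 have fi: "integrable ?mu (%y. f (z + y))" for z
  using order_le_less_trans[OF Cf[of z] ennreal_less_top] fm[of z] by (simp add: integrable_iff_bounded)
 interpret pair_sigma_finite ?mu lborel
  by (intro pair_sigma_finite.intro averagingD(5)[OF averaging_mollifier] sigma_finite_lborel)
 note [measurable_cong] = averagingD(1)[OF averaging_mollifier[of n]]
 have gi: "integrable (?mu \<Otimes>\<^sub>M lborel) (%(y, s). indicator {0..r} s * g (x + y + s *R v))" for r
 proof (rule integrable_prodI')
  show "(%(y, s). indicator {0..r} s * g (x + y + s *R v)) : borel_measurable (?mu \<Otimes>\<^sub>M lborel)" by measurable
  have "(NN s. \<integral>\<^sup>+y. ennreal \<bar>indicator {0..r} s * g (x + y + s *R v)\<bar> \<partial>?mu) <= (NN s. ennreal Cg * indicator {0..r} s)"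
  proof (rule nn_integral_mono)
   fix s
   show "(\<integral>\<^sup>+y. ennreal \<bar>indicator {0..r} s * g (x + y + s *R v)\<bar> \<partial>?mu) <= ennreal Cg * indicator {0..r} s"
    using Cg(1)[of "x + s *R v"] by (cases "s \<in> {0..r}") (auto simp: algebra_simps)
  qed
  also have "... < \<infinity>" by (simp add: nn_integral_cmult_indicator ennreal_mult_less_top emeasure_lborel_Icc_eq)
  finally show "(NN s. \<integral>\<^sup>+y. ennreal \<bar>indicator {0..r} s * g (x + y + s *R v)\<bar> \<partial>?mu) < \<infinity>" .
 qed
 show ?thesis unfolding line_ac_def
 proof (intro conjI allI impI)
  fix r :: real
  show "integ (%s. indicator {0..r} s * avg ?mu g (x + s *R v))"
  proof (rule Bi_integrable_bound)
   show "integ (%s. Cg * indicator {0..r} s :: real)"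
    by (intro integrable_mult_right integrable_real_indicator) (auto simp: emeasure_lborel_Icc_eq)
   show "AEl s. norm (indicator {0..r} s * avg ?mu g (x + s *R v)) <= norm (Cg * indicator {0..r} s :: real)"
    using Cg(2) by (intro AE_I2) (auto simp: indicator_def intro: order_trans[OF _ abs_ge_self])
  qed measurable
 next
  have "AEl r. AEl x. 0 < r --> x \<in> UNIV -->
   f (x + r *R v) = f x + (LBINT s. indicator {0..r} s * g (x + s *R v))"
   by (rule line_ac_AE_commute) (use l in auto)
  then show "AEl r. 0 < r --> avg ?mu f (x + r *R v) =
   avg ?mu f (x + 0 *R v) + (LBINT s. indicator {0..r} s * avg ?mu g (x + s *R v))"
  proof eventually_elim
   case (elim r)
   show ?case
   proof
    assume r: "0 < r"
    have "AEl z. f (z + r *R v) = f z + (LBINT s. indicator {0..r} s * g (z + s *R v))"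
     using elim r by simp
    from AE_mollifier[OF AE_shift[OF this, of x], of n]
    have ae: "AE y in ?mu. f (x + r *R v + y) = f (x + y) + (LBINT s. indicator {0..r} s * g (x + y + s *R v))"
     by eventually_elim (simp add: algebra_simps)
    have "avg ?mu f (x + r *R v) = (\<integral>y. f (x + y) + (LBINT s. indicator {0..r} s * g (x + y + s *R v)) \<partial>?mu)"
     unfolding avg_def by (rule integral_cong_AE[OF _ _ ae]) (use fm gm in measurable)
    also have "... = (\<integral>y. f (x + y) \<partial>?mu) + (\<integral>y. \<integral>s. indicator {0..r} s * g (x + y + s *R v) \<partial>lborel \<partial>?mu)"
     by (intro Bi_integral_add fi integrable_fst[OF gi])
    also have "(\<integral>y. \<integral>s. indicator {0..r} s * g (x + y + s *R v) \<partial>lborel \<partial>?mu) = (LBINT s. \<integral>y. indicator {0..r} s * g (x + y + s *R v) \<partial>?mu)"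
     by (rule Fubini_integral[OF gi, symmetric])
    also have "... = (LBINT s. indicator {0..r} s * avg ?mu g (x + s *R v))"
     unfolding avg_def by (simp add: algebra_simps)
    finally show "avg ?mu f (x + r *R v) = avg ?mu f (x + 0 *R v) + (LBINT s. indicator {0..r} s * avg ?mu g (x + s *R v))"
     by (simp add: avg_def)
   qed
  qed
 qed
qed

section \<open>The Gagliardo--Nirenberg--Sobolev inequality in three dimensions\<close>

definition esqrt :: "ennreal => ennreal" where
 "esqrt x = (if x = top then top else ennreal (sqrt (enn2real x)))"

lemma esqrt_power2: "(esqrt x)^2 = x"
 by (cases x) (auto simp: esqrt_def ennreal_power power2_eq_square[of "top::ennreal"])

lemma esqrt_mono: "x <= y ==> esqrt x <= esqrt y"
 by (cases x; cases y) (auto simp: esqrt_def ennreal_le_iff ennreal_leI top_unique)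

lemma esqrt_power4: "0 <= r ==> esqrt (ennreal (r ^ 4)) = ennreal (r^2)"
proof -
 assume "0 <= r"
 have "sqrt (r ^ 4) = r^2" by (rule real_sqrt_unique) (auto simp flip: power_mult)
 then show ?thesis using \<open>0 <= r\<close> by (simp add: esqrt_def)
qed

lemma esqrt_measurable [measurable]: "f : borel_measurable M ==> (%x. esqrt (f x)) : borel_measurable M"
proof -
 assume f[measurable]: "f : borel_measurable M"
 have "f -` {top} \<inter> space M \<in> sets M" by (rule measurable_sets[OF f]) simp
 moreover have "f -` {top} \<inter> space M = {x \<in> space M. f x = top}" by auto
 ultimately have s: "{x \<in> space M. f x = top} \<in> sets M" by simp
 have "(%x. ennreal (sqrt (enn2real (f x)))) : borel_measurable M" by measurable
 from measurable_If[OF measurable_const this s] show ?thesis unfolding esqrt_def by simp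
qed

definition vec3 :: "real => real => real => real^3" where
 "vec3 a b c = (\<chi> i. if i = 1 then a else if i = 2 then b else c)"

lemma vec3_nth [simp]: "vec3 a b c $ 1 = a" "vec3 a b c $ 2 = b" "vec3 a b c $ 3 = c"
 by (auto simp: vec3_def)

lemma vec3_add_axis:
 "vec3 a b c + s *R axis 1 1 = vec3 (a + s) b c"
 "vec3 a b c + s *R axis 2 1 = vec3 a (b + s) c"
 "vec3 a b c + s *R axis 3 1 = vec3 a b (c + s)"
 by (auto simp: vec_eq_iff forall_3 axis_def)

lemma vec3_measurable [measurable]:
 assumes [measurable]: "f : borel_measurable M" "g : borel_measurable M" "h : borel_measurable M"
 shows "(%x. vec3 (f x) (g x) (h x)) : borel_measurable M"
proof -
 have "continuous_on UNIV (%z::real \<times> real \<times> real. vec3 (fst z) (fst (snd z)) (snd (snd z)))"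
 proof -
  have "continuous_on UNIV (%z::real \<times> real \<times> real. if i = 1 then fst z else if i = 2 then fst (snd z) else snd (snd z))" for i :: 3
   by (cases "i = 1"; cases "i = 2") (auto intro!: continuous_intros)
  then show ?thesis unfolding vec3_def by (intro continuous_on_vec_lambda)
 qed
 then have [measurable]: "(%z::real \<times> real \<times> real. vec3 (fst z) (fst (snd z)) (snd (snd z))) : Bm"
  by (rule borel_measurable_continuous_onI)
 have "(%x. (f x, g x, h x)) : borel_measurable M" by measurable
 from measurable_compose[OF this \<open>(%z::real \<times> real \<times> real. vec3 (fst z) (fst (snd z)) (snd (snd z))) : Bm\<close>]
 show ?thesis by simp
qed

lemma vec3_measurable_prod:
 "(%(a, b, c). vec3 a b c) : borel_measurable (lborel \<Otimes>\<^sub>M lborel)"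
proof -
 have "(%z::real \<times> real \<times> real. vec3 (fst z) (fst (snd z)) (snd (snd z))) : Bm"
  by (intro vec3_measurable borel_measurable_continuous_onI continuous_intros)
 then show ?thesis by (simp add: lborel_prod case_prod_beta)
qed

lemma Basis_real3: "(Basis :: (real^3) set) = {axis 1 1, axis 2 1, axis 3 1}"
 by (auto simp: Basis_vec_def UNIV_3)

lemma lborel_real3:
 "distr (lborel \<Otimes>\<^sub>M lborel) borel (%(a, b, c). vec3 a b c) = lborel" (is "distr ?P _ ?T = _")
proof (rule lborel_eqI[symmetric])
 note [measurable] = vec3_measurable_prod
 fix l u :: "real^3" assume lu: "!!b. b \<in> Basis ==> l \<bullet> b <= u \<bullet> b"
 have le: "l $ i <= u $ i" for i
  using lu[of "axis i 1"] by (auto simp: inner_axis Basis_vec_def)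
 have pre: "?T -` box l u = {l$1<..<u$1} \<times> {l$2<..<u$2} \<times> {l$3<..<u$3}"
  by (auto simp: mem_box_cart forall_3)
 have "emeasure (distr ?P borel ?T) (box l u) = emeasure ?P (?T -` box l u \<inter> space ?P)"
  by (rule emeasure_distr) auto
 also have "... = emeasure ?P ({l$1<..<u$1} \<times> {l$2<..<u$2} \<times> {l$3<..<u$3})"
  by (simp add: pre space_pair_measure)
 also have "... = ennreal (u$1 - l$1) * (ennreal (u$2 - l$2) * ennreal (u$3 - l$3))"
 proof -
  have "{l$2<..<u$2} \<times> {l$3<..<u$3} \<in> sets (lborel :: (real \<times> real) measure)"
   by (simp add: borel_open open_Times)
  moreover have "emeasure (lborel :: (real \<times> real) measure) ({l$2<..<u$2} \<times> {l$3<..<u$3}) = ennreal (u$2 - l$2) * ennreal (u$3 - l$3)"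
   using le by (simp add: lborel_prod[symmetric] lborel.emeasure_pair_measure_Times)
  ultimately show ?thesis using le by (simp add: lborel.emeasure_pair_measure_Times)
 qed
 also have "... = ennreal (\<Prod>b\<in>Basis. (u - l) \<bullet> b)"
  using le by (simp add: Basis_real3 axis_eq_axis inner_axis ennreal_mult mult.assoc)
 finally show "emeasure (distr ?P borel ?T) (box l u) = ennreal (\<Prod>b\<in>Basis. (u - l) \<bullet> b)" .
qed simp

lemma nn_integral_real3:
 assumes [measurable]: "f : borel_measurable (borel :: (real^3) measure)"
 shows "(NN x. f x) = (NN a. NN b. NN c. f (vec3 a b c))"
proof -
 have m: "(%(a, b, c). f (vec3 a b c)) : borel_measurable (lborel \<Otimes>\<^sub>M lborel)"
  using measurable_compose[OF vec3_measurable_prod assms] by (simp add: case_prod_beta)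
 have "(NN x. f x) = (\<integral>\<^sup>+z. (case z of (a, b, c) => f (vec3 a b c)) \<partial>(lborel \<Otimes>\<^sub>M lborel))"
  by (subst lborel_real3[symmetric], subst nn_integral_distr) (auto intro!: nn_integral_cong vec3_measurable_prod)
 also have "... = (NN a. NN y. f (vec3 a (fst y) (snd y)))"
  using lborel.nn_integral_fst[OF m] by (simp add: case_prod_unfold)
 also have "... = (NN a. NN b. NN c. f (vec3 a b c))"
  by (intro nn_integral_cong, subst lborel_prod[symmetric], subst lborel.nn_integral_fst[symmetric]) auto
 finally show ?thesis .
qed

lemma Loomis_Whitney_iterated:
 fixes F1 F2 F3 :: "real => real => ennreal"
 assumes [measurable]: "case_prod F1 : Bm" "case_prod F2 : Bm"
  "case_prod F3 : Bm"
 shows "(NN a. NN b. NN c. F1 b c * F2 a c * F3 a b)^2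
  <= (NN b. NN c. (F1 b c)^2) * (NN a. NN c. (F2 a c)^2) * (NN a. NN b. (F3 a b)^2)"
proof -
 have m: "case_prod F : borel_measurable (lborel \<Otimes>\<^sub>M lborel)" if "case_prod F : Bm" for F :: "real => real => ennreal"
  using that by (simp add: borel_prod[symmetric])
 note [measurable] = m[OF assms(1)] m[OF assms(2)] m[OF assms(3)]
 define G1 where "G1 b = (NN c. (F1 b c)^2)" for b
 define G2 where "G2 a = (NN c. (F2 a c)^2)" for a
 define K where "K a b = (NN c. F1 b c * F2 a c)" for a b
 have [measurable]: "G1 : borel_measurable lborel" "G2 : borel_measurable lborel" unfolding G1_def G2_def by measurable
 have [measurable]: "(%(a, b). K a b) : borel_measurable (lborel \<Otimes>\<^sub>M lborel)" unfolding K_def by measurable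
 have K: "(K a b)^2 <= G1 b * G2 a" for a b
  unfolding K_def G1_def G2_def by (rule Cauchy_Schwarz_nn_integral) measurable
 have "(NN a. NN b. NN c. F1 b c * F2 a c * F3 a b) = (NN a. NN b. K a b * F3 a b)"
  unfolding K_def by (intro nn_integral_cong) (subst nn_integral_multc, auto)
 also have "... = (\<integral>\<^sup>+z. case_prod K z * case_prod F3 z \<partial>(lborel \<Otimes>\<^sub>M lborel))"
  by (subst lborel.nn_integral_fst[symmetric]) auto
 finally have "(NN a. NN b. NN c. F1 b c * F2 a c * F3 a b)^2
  <= (\<integral>\<^sup>+z. (case_prod K z)^2 \<partial>(lborel \<Otimes>\<^sub>M lborel)) * (\<integral>\<^sup>+z. (case_prod F3 z)^2 \<partial>(lborel \<Otimes>\<^sub>M lborel))"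
  using Cauchy_Schwarz_nn_integral[of "case_prod K" "lborel \<Otimes>\<^sub>M lborel" "case_prod F3"] by simp
 also have "(\<integral>\<^sup>+z. (case_prod F3 z)^2 \<partial>(lborel \<Otimes>\<^sub>M lborel)) = (NN a. NN b. (F3 a b)^2)"
  by (subst lborel.nn_integral_fst[symmetric]) auto
 also have "(\<integral>\<^sup>+z. (case_prod K z)^2 \<partial>(lborel \<Otimes>\<^sub>M lborel)) = (NN a. NN b. (K a b)^2)"
  by (subst lborel.nn_integral_fst[symmetric]) auto
 also have "... * (NN a. NN b. (F3 a b)^2)
  <= (NN a. NN b. G1 b * G2 a) * (NN a. NN b. (F3 a b)^2)"
  by (intro mult_right_mono nn_integral_mono K) auto
 also have "(NN a. NN b. G1 b * G2 a) = (NN b. G1 b) * (NN a. G2 a)"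
  by (simp add: nn_integral_multc nn_integral_cmult)
 finally show ?thesis unfolding G1_def G2_def .
qed

lemma Loomis_Whitney_lines:
 fixes w :: "real^3 => real" and H :: "3 => real^3 => ennreal"
 assumes [measurable]: "w : Bm" "!!i. H i : Bm"
  and le: "!!i. AEl x. ennreal (\<bar>w x\<bar> ^ 4) <= (NN s. H i (x + s *R axis i 1))"
 shows "(NN x. ennreal (\<bar>w x\<bar> ^ 6))^2 <= (NN x. H 1 x) * (NN x. H 2 x) * (NN x. H 3 x)"
proof -
 define P where "P i x = esqrt (NN s. H i (x + s *R axis i 1))" for i and x :: "real^3"
 have [measurable]: "P i : Bm" for i unfolding P_def by measurable
 define F1 where "F1 b c = esqrt (NN s. H 1 (vec3 s b c))" for b c
 define F2 where "F2 a c = esqrt (NN s. H 2 (vec3 a s c))" for a c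
 define F3 where "F3 a b = esqrt (NN s. H 3 (vec3 a b s))" for a b
 have F: "case_prod F1 : Bm" "case_prod F2 : Bm" "case_prod F3 : Bm"
  unfolding F1_def F2_def F3_def borel_prod[symmetric] by measurable
 have P: "P 1 (vec3 a b c) = F1 b c" "P 2 (vec3 a b c) = F2 a c" "P 3 (vec3 a b c) = F3 a b" for a b c
  unfolding P_def F1_def F2_def F3_def vec3_add_axis
  using nn_integral_shift[of "%s. H 1 (vec3 s b c)" a] nn_integral_shift[of "%s. H 2 (vec3 a s c)" b]
   nn_integral_shift[of "%s. H 3 (vec3 a b s)" c] by (simp_all add: add.commute)
 have wP: "AEl x. ennreal (\<bar>w x\<bar>\<^sup>2) <= P i x" for i
  using le[of i]
 proof eventually_elim
  case (elim x)
  from esqrt_mono[OF elim] show ?case using esqrt_power4[of "\<bar>w x\<bar>"] by (simp add: P_def)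
 qed
 have "(NN x. ennreal (\<bar>w x\<bar> ^ 6)) <= (NN x. P 1 x * P 2 x * P 3 x)"
 proof (rule nn_integral_mono_AE)
  show "AEl x. ennreal (\<bar>w x\<bar> ^ 6) <= P 1 x * P 2 x * P 3 x"
   using wP[of 1] wP[of 2] wP[of 3]
  proof eventually_elim
   case (elim x)
   have "ennreal (\<bar>w x\<bar> ^ 6) = ennreal (\<bar>w x\<bar>\<^sup>2) * ennreal (\<bar>w x\<bar>\<^sup>2) * ennreal (\<bar>w x\<bar>\<^sup>2)"
    by (simp add: power_add[symmetric] flip: ennreal_mult power_abs)
   also have "... <= P 1 x * P 2 x * P 3 x" using elim by (intro mult_mono) auto
   finally show ?case .
  qed
 qed
 also have "... = (NN a. NN b. NN c. F1 b c * F2 a c * F3 a b)"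
  by (subst nn_integral_real3) (auto simp: P)
 finally have "(NN x. ennreal (\<bar>w x\<bar> ^ 6))^2 <= (NN a. NN b. NN c. F1 b c * F2 a c * F3 a b)^2"
  by (intro power_mono) auto
 also have "... <= (NN b. NN c. (F1 b c)^2) * (NN a. NN c. (F2 a c)^2) * (NN a. NN b. (F3 a b)^2)"
  by (rule Loomis_Whitney_iterated[OF F])
 also have "(NN b. NN c. (F1 b c)^2) = (NN x. H 1 x)"
 proof -
  have "(NN b. NN c. (F1 b c)^2) = (NN b. NN c. NN s. H 1 (vec3 s b c))"
   by (simp add: F1_def esqrt_power2)
  also have "... = (NN b. NN s. NN c. H 1 (vec3 s b c))"
   by (intro nn_integral_cong lborel_pair.Fubini') measurable
  also have "... = (NN s. NN b. NN c. H 1 (vec3 s b c))"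
   by (intro lborel_pair.Fubini') measurable
  finally show ?thesis by (simp add: nn_integral_real3)
 qed
 also have "(NN a. NN c. (F2 a c)^2) = (NN x. H 2 x)"
 proof -
  have "(NN a. NN c. (F2 a c)^2) = (NN a. NN c. NN s. H 2 (vec3 a s c))"
   by (simp add: F2_def esqrt_power2)
  also have "... = (NN a. NN s. NN c. H 2 (vec3 a s c))"
   by (intro nn_integral_cong lborel_pair.Fubini') measurable
  finally show ?thesis by (simp add: nn_integral_real3)
 qed
 also have "(NN a. NN b. (F3 a b)^2) = (NN x. H 3 x)"
  by (simp add: F3_def esqrt_power2 nn_integral_real3)
 finally show ?thesis .
qed

lemma line_ac_fourth_power_bound:
 assumes l: "line_ac F f" and [measurable]: "F : Bm" "f : Bm"
  and fin: "(NN s. ennreal ((F s) ^ 4)) < \<infinity>"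
 shows "ennreal ((F 0) ^ 4) <= (NN s. ennreal (4 * \<bar>F s\<bar> ^ 3 * \<bar>f s\<bar>))"
proof (rule ccontr)
 assume "\<not> ?thesis"
 then have less: "(NN s. ennreal (4 * \<bar>F s\<bar> ^ 3 * \<bar>f s\<bar>)) < ennreal ((F 0) ^ 4)" by simp
 then obtain J where J: "(NN s. ennreal (4 * \<bar>F s\<bar> ^ 3 * \<bar>f s\<bar>)) = ennreal J" "0 <= J"
  by (cases "\<integral>\<^sup>+s. ennreal (4 * \<bar>F s\<bar> ^ 3 * \<bar>f s\<bar>) \<partial>lborel") auto
 define d where "d = (F 0) ^ 4 - J"
 have d: "0 < d" using less J by (simp add: d_def ennreal_less_iff)
 have l2: "line_ac (%s. F s * F s) (%s. F s * f s + f s * F s)" by (rule line_ac_mult[OF l l]) measurable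
 have "line_ac (%s. (F s * F s) * (F s * F s))
  (%s. (F s * F s) * (F s * f s + f s * F s) + (F s * f s + f s * F s) * (F s * F s))"
  by (rule line_ac_mult[OF l2 l2]) measurable
 moreover have "(%s. (F s * F s) * (F s * F s)) = (%s. (F s) ^ 4)" by (simp add: fun_eq_iff power4_eq_xxxx)
 moreover have "(%s. (F s * F s) * (F s * f s + f s * F s) + (F s * f s + f s * F s) * (F s * F s)) = (%s. 4 * (F s) ^ 3 * f s)"
  by (simp add: fun_eq_iff power3_eq_cube)
 ultimately have l4: "line_ac (%s. (F s) ^ 4) (%s. 4 * (F s) ^ 3 * f s)" by simp
 have bound: "\<bar>\<integral>s. indicator {0..r} s * (4 * (F s) ^ 3 * f s) \<partial>lborel\<bar> <= J" for r
 proof -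
  have "ennreal \<bar>\<integral>s. indicator {0..r} s * (4 * (F s) ^ 3 * f s) \<partial>lborel\<bar> <= (NN s. ennreal \<bar>indicator {0..r} s * (4 * (F s) ^ 3 * f s)\<bar>)"
   using integral_norm_bound_ennreal[OF line_ac_integrable[OF l4, of r]] by simp
  also have "... <= (NN s. ennreal (4 * \<bar>F s\<bar> ^ 3 * \<bar>f s\<bar>))"
   by (intro nn_integral_mono ennreal_leI) (auto simp: abs_mult power_abs indicator_def)
  finally show ?thesis using J by (simp add: ennreal_le_iff)
 qed
 have "AEl r. 0 < r --> d <= (F r) ^ 4"
  using l4 unfolding line_ac_def
 proof (elim conjE)
  assume "AEl r. 0 < r --> (F r) ^ 4 = (F 0) ^ 4 + (LBINT s. indicator {0..r} s * (4 * (F s) ^ 3 * f s))"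
  then show ?thesis
  proof eventually_elim
   case (elim r)
   then show ?case using bound[of r] by (auto simp: d_def abs_le_iff)
  qed
 qed
 then have "AEl r. ennreal d * indicator {0<..} r <= ennreal ((F r) ^ 4)"
  by eventually_elim (auto simp: indicator_def intro: ennreal_leI)
 then have "(NN r. ennreal d * indicator {0::real<..} r) <= (NN s. ennreal ((F s) ^ 4))"
  by (rule nn_integral_mono_AE)
 moreover have "(NN r. ennreal d * indicator {0::real<..} r) = \<infinity>"
 proof -
  have "emeasure lborel {0<..<real n} <= emeasure lborel {0::real<..}" for n by (intro emeasure_mono) auto
  then have "ennreal (real n) <= emeasure lborel {0::real<..}" for n by (metis emeasure_lborel_Ioo of_nat_0_le_iff diff_zero)
  then have "emeasure lborel {0::real<..} = \<infinity>"
   by (metis ennreal_Ex_less_of_nat ennreal_of_nat_eq_real_of_nat infinity_ennreal_def leD less_top)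
  then show ?thesis using d by (subst nn_integral_cmult_indicator) (auto simp: ennreal_mult_top)
 qed
 ultimately show False using fin by simp
qed

lemma AE_line_integral_finite:
 fixes f :: "'a::euclidean_space => ennreal"
 assumes [measurable]: "f : Bm" and e: "norm e = 1" and fin: "(NN x. f x) < \<infinity>"
 shows "AEl x. (NN s. f (x + s *R e)) < \<infinity>"
proof -
 have "AEl x. \<forall>n::nat. x \<in> cball 0 (real n) --> (NN s. f (x + s *R e)) < \<infinity>"
 proof (rule AE_all_countable[THEN iffD2], rule allI)
  fix n :: nat
  let ?K = "cball 0 (real n) :: 'a set"
  have [measurable]: "?K \<in> sets borel" by simp
  have inner: "(NN s. indicator ?K (z - s *R e)) <= ennreal (2 * real n)" for z
  proof -
   have "(NN s. indicator ?K (z - s *R e)) <= (NN s. indicator {z \<bullet> e - real n..z \<bullet> e + real n} s)"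
   proof (rule nn_integral_mono)
    fix s
    have "s \<in> {z \<bullet> e - real n..z \<bullet> e + real n}" if "z - s *R e \<in> ?K"
    proof -
     have "\<bar>(z - s *R e) \<bullet> e\<bar> <= norm (z - s *R e) * norm e" by (rule Cauchy_Schwarz_ineq2)
     also have "... <= real n" using that e by simp
     finally show ?thesis using e by (simp add: inner_diff_left norm_eq_1 abs_le_iff)
    qed
    then show "(indicator ?K (z - s *R e) :: ennreal) <= indicator {z \<bullet> e - real n..z \<bullet> e + real n} s"
     by (auto simp: indicator_def)
   qed
   also have "... = ennreal (2 * real n)" by simp
   finally show ?thesis .
  qed
  have "(NN x. indicator ?K x * (NN s. f (x + s *R e)))
   = (NN x. NN s. indicator ?K x * f (x + s *R e))"
   by (intro nn_integral_cong nn_integral_cmult[symmetric]) measurable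
  also have "... = (NN s. NN x. indicator ?K x * f (x + s *R e))"
   by (intro lborel_pair.Fubini') measurable
  also have "... = (NN s. NN z. indicator ?K (z - s *R e) * f z)"
  proof (rule nn_integral_cong)
   fix s :: real
   show "(NN x. indicator ?K x * f (x + s *R e)) = (NN z. indicator ?K (z - s *R e) * f z)"
    using nn_integral_shift[of "%z. indicator ?K (z - s *R e) * f z" "s *R e"] by simp
  qed
  also have "... = (NN z. NN s. indicator ?K (z - s *R e) * f z)"
   by (intro lborel_pair.Fubini') measurable
  also have "... = (NN z. (NN s. indicator ?K (z - s *R e)) * f z)"
   by (intro nn_integral_cong nn_integral_multc) measurable
  also have "... <= (NN z. ennreal (2 * real n) * f z)"
   by (intro nn_integral_mono mult_right_mono inner) auto
  also have "... = ennreal (2 * real n) * (NN z. f z)" by (rule nn_integral_cmult) measurable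
  also have "... < \<infinity>" using fin by (simp add: ennreal_mult_less_top)
  finally have "(NN x. indicator ?K x * (NN s. f (x + s *R e))) ~= \<infinity>" by simp
  then have "AEl x. indicator ?K x * (NN s. f (x + s *R e)) ~= \<infinity>"
   by (intro nn_integral_PInf_AE) measurable
  then show "AEl x. x \<in> ?K --> (NN s. f (x + s *R e)) < \<infinity>"
   by eventually_elim (auto simp: less_top)
 qed
 then show ?thesis
 proof eventually_elim
  case (elim x)
  obtain n :: nat where "norm x <= real n" using real_arch_simple by blast
  then show ?case using elim[rule_format, of n] by simp
 qed
qed

text \<open>
 The fourth power of a bounded function is bounded by the integral of its derivative along each of the three axes; the Loomis--Whitney inequality combines the three bounds. Boundedness ensures that the sixth power integral on both sides is finite and can be cancelled.
\<close>

lemma GNS_bounded: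
 fixes f :: "real^3 => real" and g :: "3 => real^3 => real"
 assumes l: "!!i. AEl x. line_ac (%s. f (x + s *R axis i 1)) (%s. g i (x + s *R axis i 1))"
  and f[measurable]: "f : Bm" and g[measurable]: "!!i. g i : Bm"
  and f2: "integ (%x. (f x)^2)" and g2: "!!i. integ (%x. (g i x)^2)"
  and M: "!!x. \<bar>f x\<bar> <= M" and D: "!!i. (LBINT x. (g i x)^2) <= D"
 shows "integ (%x. (f x) ^ 6)" "(LBINT x. (f x) ^ 6) <= 4096 * D ^ 3"
proof -
 have fpow: "integ (%x. (f x) ^ (2 * k + 2))" for k
 proof (rule Bi_integrable_bound)
  show "integ (%x. M ^ (2 * k) * (f x)^2)" using f2 by simp
  have "norm ((f x) ^ (2 * k + 2)) <= norm (M ^ (2 * k) * (f x)^2)" for x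
  proof -
   have "\<bar>f x\<bar> ^ (2 * k) <= M ^ (2 * k)" using M[of x] by (intro power_mono) auto
   then have "\<bar>f x\<bar> ^ (2 * k) * (f x)^2 <= M ^ (2 * k) * (f x)^2" by (intro mult_right_mono) auto
   then show ?thesis by (simp only: power_add real_norm_def abs_mult power_abs abs_power2) (simp add: power_mult)
  qed
  then show "AEl x. norm ((f x) ^ (2 * k + 2)) <= norm (M ^ (2 * k) * (f x)^2)"
   by (intro AE_I2)
 qed measurable
 show f6: "integ (%x. (f x) ^ 6)" using fpow[of 2] by simp
 have f4: "integ (%x. (f x) ^ 4)" using fpow[of 1] by simp
 define X where "X = (LBINT x. (f x) ^ 6)"
 have X0: "0 <= X" by (simp add: X_def)
 have D0: "0 <= D" using D[of 1] integral_nonneg_AE[of "%x. (g 1 x)^2" lborel] by (smt (verit) AE_I2 zero_le_power2)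
 define H where "H i x = ennreal (4 * \<bar>f x\<bar> ^ 3 * \<bar>g i x\<bar>)" for i x
 have [measurable]: "H i : Bm" for i unfolding H_def by measurable
 have le: "AEl x. ennreal (\<bar>f x\<bar> ^ 4) <= (NN s. H i (x + s *R axis i 1))" for i
 proof -
  have fin: "AEl x. (NN s. ennreal ((f (x + s *R axis i 1)) ^ 4)) < \<infinity>"
   using f4 by (intro AE_line_integral_finite) (auto simp: integrable_iff_bounded)
  from l[of i] fin show ?thesis
  proof eventually_elim
   case (elim x)
   from line_ac_fourth_power_bound[OF elim(1) _ _ elim(2)]
   show ?case by (simp add: H_def)
  qed
 qed
 have H: "(NN x. H i x) <= ennreal (4 * (sqrt X * sqrt D))" for i
 proof -
  have s: "((f x) ^ 3)^2 = (f x) ^ 6" for x by (simp flip: power_mult)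
  have i: "integ (%x. (f x) ^ 3 * g i x)"
   using f6 by (intro CS_integrable g2) (auto simp: s)
  have "(NN x. H i x) = ennreal (LBINT x. 4 * \<bar>(f x) ^ 3 * g i x\<bar>)"
   unfolding H_def using integrable_abs[OF i]
   by (subst nn_integral_eq_integral[symmetric]) (auto simp: abs_mult power_abs mult.assoc)
  also have "(LBINT x. 4 * \<bar>(f x) ^ 3 * g i x\<bar>) <= 4 * (sqrt X * sqrt (LBINT x. (g i x)^2))"
   using CS_integral_sqrt[of "%x. (f x) ^ 3" lborel "g i"] f6 g2[of i] by (simp add: s X_def)
  also have "... <= 4 * (sqrt X * sqrt D)" using D[of i] X0 by (intro mult_left_mono) auto
  finally show ?thesis by (simp add: ennreal_leI)
 qed
 have "(ennreal X)^2 = (NN x. ennreal (\<bar>f x\<bar> ^ 6))^2"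
  unfolding X_def by (subst nn_integral_eq_integral[symmetric, OF f6]) auto
 also have "... <= (NN x. H 1 x) * (NN x. H 2 x) * (NN x. H 3 x)"
  by (rule Loomis_Whitney_lines[OF _ _ le]) auto
 also have "... <= ennreal (4 * (sqrt X * sqrt D)) * ennreal (4 * (sqrt X * sqrt D)) * ennreal (4 * (sqrt X * sqrt D))"
  by (intro mult_mono H) auto
 also have "... = ennreal ((4 * (sqrt X * sqrt D)) ^ 3)"
  using X0 D0 by (simp add: power3_eq_cube flip: ennreal_mult)
 finally have "X^2 <= (4 * (sqrt X * sqrt D)) ^ 3"
  using X0 D0 by (simp add: ennreal_power ennreal_le_iff)
 then have le: "(sqrt X) ^ 4 <= 64 * (sqrt X) ^ 3 * (sqrt D) ^ 3"
 proof -
  have "(sqrt X) ^ 4 = ((sqrt X)^2)^2" by (simp flip: power_mult)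
  then show ?thesis using \<open>X\<^sup>2 <= (4 * (sqrt X * sqrt D)) ^ 3\<close> X0 by (simp add: power_mult_distrib)
 qed
 have "sqrt X <= 64 * (sqrt D) ^ 3"
 proof (cases "X = 0")
  case False
  then have "0 < (sqrt X) ^ 3" using X0 by simp
  moreover have "(sqrt X) ^ 3 * sqrt X <= (sqrt X) ^ 3 * (64 * (sqrt D) ^ 3)"
   using le by (simp add: power4_eq_xxxx power3_eq_cube mult_ac)
  ultimately show ?thesis by (rule mult_left_le_imp_le[rotated])
 qed (use D0 in simp)
 then have "(sqrt X)^2 <= (64 * (sqrt D) ^ 3)^2" using X0 by (intro power_mono) auto
 also have "... = 4096 * ((sqrt D)^2) ^ 3" by (simp add: power_mult_distrib flip: power_mult)
 finally show "(LBINT x. (f x) ^ 6) <= 4096 * D ^ 3" using X0 D0 by (simp add: X_def)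
qed

text \<open>
 Truncated averages reduce the claim to bounded functions.
\<close>

lemma GNS:
 fixes f :: "real^3 => real" and g :: "3 => real^3 => real"
 assumes l: "!!i. AEl x. line_ac (%s. f (x + s *R axis i 1)) (%s. g i (x + s *R axis i 1))"
  and f[measurable]: "f : Bm" and g[measurable]: "!!i. g i : Bm"
  and f2: "integ (%x. (f x)^2)" and g2: "!!i. integ (%x. (g i x)^2)"
  and D: "!!i. (LBINT x. (g i x)^2) <= D"
 shows "integ (%x. (f x) ^ 6)" "(LBINT x. (f x) ^ 6) <= 4096 * D ^ 3"
proof -
 let ?mu = "%n. mollifier_measure n :: (real^3) measure"
 have D0: "0 <= D" by (rule order_trans[OF _ D[of 1]]) simp
 have am: "avg (?mu n) f : Bm" "avg (?mu n) (g i) : Bm" for n i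
  by (intro avg_measurable averaging_mollifier f g)+
 note [measurable] = am
 have bound: "(NN x. ennreal ((avg (?mu n) f x) ^ 6)) <= ennreal (4096 * D ^ 3)" for n
 proof -
  obtain C where C: "!!x. \<bar>avg (?mu n) f x\<bar> <= C" using avg_mollifier_bounded[OF f f2] by metis
  have f2n: "integ (%x. (avg (?mu n) f x)^2)"
   using avg_integrable_power(1)[OF averaging_mollifier f, of 2 n] f2 by simp
  have g2n: "integ (%x. (avg (?mu n) (g i) x)^2)" "(LBINT x. (avg (?mu n) (g i) x)^2) <= D" for i
   using avg_integrable_power[OF averaging_mollifier g, of 2 i n] g2[of i] D[of i] by auto
  have ln: "AEl x. line_ac (%s. avg (?mu n) f (x + s *R axis i 1)) (%s. avg (?mu n) (g i) (x + s *R axis i 1))" for i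
   by (intro AE_I2 avg_mollifier_line_ac[OF l f g f2 g2])
  note b = GNS_bounded[OF ln am(1) am(2) f2n g2n(1) C g2n(2)]
  have "(NN x. ennreal ((avg (?mu n) f x) ^ 6)) = ennreal (LBINT x. (avg (?mu n) f x) ^ 6)"
   by (rule nn_integral_eq_integral[OF b(1)]) simp
  also have "... <= ennreal (4096 * D ^ 3)" by (rule ennreal_leI[OF b(2)])
  finally show ?thesis .
 qed
 obtain r :: "nat => nat" where "strict_mono r" and r: "AEl x. (%n. avg (?mu (r n)) f x) ---> f x"
  by (rule avg_AE_subsequence[of ?mu, OF averaging_mollifier mollifier_measure_small f f2])
 have "(NN x. ennreal ((f x) ^ 6)) = (NN x. liminf (%n. ennreal ((avg (?mu (r n)) f x) ^ 6)))"
 proof (rule nn_integral_cong_AE)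
  show "AEl x. ennreal ((f x) ^ 6) = liminf (%n. ennreal ((avg (?mu (r n)) f x) ^ 6))"
   using r
  proof eventually_elim
   case (elim x)
   then have "(%n. ennreal ((avg (?mu (r n)) f x) ^ 6)) ---> ennreal ((f x) ^ 6)" by (intro tendsto_intros)
   then show ?case using lim_imp_Liminf[OF trivial_limit_sequentially] by metis
  qed
 qed
 also have "... <= liminf (%n. NN x. ennreal ((avg (?mu (r n)) f x) ^ 6))"
  by (rule nn_integral_liminf) measurable
 also have "... <= ennreal (4096 * D ^ 3)"
  by (rule Liminf_le) (auto intro!: always_eventually bound)
 finally have F: "(NN x. ennreal ((f x) ^ 6)) <= ennreal (4096 * D ^ 3)" .
 show i: "integ (%x. (f x) ^ 6)"
  using order_le_less_trans[OF F ennreal_less_top] by (simp add: integrable_iff_bounded)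
 show "(LBINT x. (f x) ^ 6) <= 4096 * D ^ 3"
  using F nn_integral_eq_integral[OF i] D0 by (simp add: ennreal_le_iff)
qed

section \<open>A Morrey estimate\<close>

lemma vec_nth_measurable [measurable (raw)]:
 fixes f :: "'a => real^'n"
 assumes "f : borel_measurable M"
 shows "(%x. f x $ i) : borel_measurable M"
 by (rule measurable_compose[OF assms]) (intro borel_measurable_continuous_onI continuous_intros)

lemma nn_integral_scale:
 fixes h :: "'a::euclidean_space => ennreal"
 assumes [measurable]: "h : Bm" and s: "0 < s"
 shows "ennreal (s ^ DIM('a)) * (NN v. h (x + s *R v)) = (NN v. h v)"
proof -
 have "(NN v. h v) = (\<integral>\<^sup>+v. h v \<partial>density (distr lborel borel (%v. x + s *R v)) (%_. \<bar>s\<bar> ^ DIM('a)))"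
  using lborel_affine[of s x] s by simp
 also have "... = (\<integral>\<^sup>+v. ennreal (\<bar>s\<bar> ^ DIM('a)) * h v \<partial>distr lborel borel (%v. x + s *R v))"
  by (subst nn_integral_density) (auto simp: ennreal_power)
 also have "... = (NN v. ennreal (\<bar>s\<bar> ^ DIM('a)) * h (x + s *R v))"
  by (subst nn_integral_distr) auto
 finally show ?thesis using s by (simp add: nn_integral_cmult)
qed

lemma nn_integral_powr_three_quarters:
 "(NN s. indicator {0..1} s * ennreal (s powr (-3/4))) = ennreal 4"
proof -
 have "((%s::real. s powr (-3/4)) has_integral (1 powr (-3/4 + 1) / (-3/4 + 1))) {0..1}"
  by (rule has_integral_powr_from_0) auto
 then have h: "((%s::real. s powr (-3/4)) has_integral 4) {0..1}" by simp
 have h': "((%s::real. indicator {0..1} s * s powr (-3/4)) has_integral 4) UNIV"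
  by (rule has_integral_eq[OF _ has_integral_restrict_UNIV[THEN iffD2, OF h]]) (auto simp: indicator_def)
 have "(NN s. ennreal (indicator {0..1} s * (s powr (-3/4)))) = ennreal 4"
  by (rule nn_integral_has_integral_lborel[OF _ _ h']) auto
 moreover have "indicator {0..1} s * ennreal (s powr (-3/4)) = ennreal (indicator {0..1} s * (s powr (-3/4)))" for s :: real
  by (auto simp: indicator_def)
 ultimately show ?thesis by simp
qed

lemma cube3:
 fixes r :: real
 assumes "0 <= r"
 shows "emeasure lborel (cbox 0 (vec3 r r r)) = ennreal (r ^ 3)"
  and "v \<in> cbox 0 (vec3 r r r) ==> \<bar>v $ i\<bar> <= r"
proof -
 show "emeasure lborel (cbox 0 (vec3 r r r)) = ennreal (r ^ 3)"
  using assms by (subst emeasure_lborel_cbox) (auto simp: Basis_real3 axis_eq_axis inner_axis power3_eq_cube)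
 assume "v \<in> cbox 0 (vec3 r r r)"
 then show "\<bar>v $ i\<bar> <= r" using exhaust_3[of i] by (auto simp: mem_box_cart forall_3)
qed

lemma cube_Holder2:
 fixes h :: "real^3 => ennreal"
 assumes [measurable]: "h : Bm" and "0 <= r"
 shows "(NN v. indicator (cbox 0 (vec3 r r r)) v * h v)^2 <= ennreal (r ^ 3) * (NN v. indicator (cbox 0 (vec3 r r r)) v * (h v)^2)"
proof -
 let ?Q = "cbox 0 (vec3 r r r)"
 have i: "(indicator ?Q v :: ennreal)^2 = indicator ?Q v" for v by (auto simp: indicator_def)
 have "(NN v. indicator ?Q v * h v) = (NN v. indicator ?Q v * (indicator ?Q v * h v))"
  by (intro nn_integral_cong) (auto simp: indicator_def)
 then have "(NN v. indicator ?Q v * h v)^2 <= (NN v. (indicator ?Q v)^2) * (NN v. (indicator ?Q v * h v)^2)"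
  using Cauchy_Schwarz_nn_integral[of "indicator ?Q" lborel "%v. indicator ?Q v * h v"] by simp
 then show ?thesis using cube3(1)[OF assms(2)] by (simp add: i power_mult_distrib)
qed

text \<open>
 The value at a point is compared with the average over a small cube; along the segments from the point to the cube the gradient is integrated in \<open>L\<^sup>4\<close>, which exceeds the space dimension.
\<close>

lemma Morrey:
 fixes f :: "real^3 => real" and g :: "3 => real^3 => real"
 assumes inc: "!!v. AEl x. f (x + v) = f x + (LBINT s. indicator {0..1} s * (SUM3 i. v $ i * g i (x + s *R v)))"
  and f[measurable]: "f : Bm" and g[measurable]: "!!i. g i : Bm"
  and f2: "integ (%x. (f x)^2)" and g4: "!!i. integ (%x. (g i x) ^ 4)"
  and G: "!!i. (LBINT x. (g i x) ^ 4) <= G ^ 4" "0 <= G" and ro: "0 < ro"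
 shows "AEl x. \<bar>f x\<bar> <= sqrt (LBINT x. (f x)^2) / ro ^ 6 + 12 * ro * G"
proof -
 define A where "A = sqrt (LBINT x. (f x)^2)"
 have A: "0 <= A" by (simp add: A_def)
 define r where "r = ro ^ 4"
 have r: "0 <= r" using ro by (simp add: r_def)
 let ?Q = "cbox 0 (vec3 r r r)"
 have AE2: "AEl x. AEl v. f (x + v) = f x + (LBINT s. indicator {0..1} s * (SUM3 i. v $ i * g i (x + s *R v)))"
 proof (rule lborel_pair.AE_commute[THEN iffD1])
  have "Measurable.pred (lborel \<Otimes>\<^sub>M lborel) (%z. f (snd z + fst z) = f (snd z) + (LBINT s. indicator {0..1} s * (SUM3 i. fst z $ i * g i (snd z + s *R fst z))))"
   by measurable
  then show "{z \<in> space (lborel \<Otimes>\<^sub>M lborel). f (snd z + fst z) = f (snd z) + (LBINT s. indicator {0..1} s * (SUM3 i. fst z $ i * g i (snd z + s *R fst z)))} \<in> sets (lborel \<Otimes>\<^sub>M lborel)"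
   by (simp only: pred_def)
 qed (use inc in auto)
 \<comment> \<open>The first term: the average of \<open>f\<close> over the cube.\<close>
 have T1: "(NN v. indicator ?Q v * ennreal \<bar>f (x + v)\<bar>) <= ennreal (ro ^ 6 * A)" for x
 proof (rule ennreal_power2_le_imp_le)
  have "(NN v. indicator ?Q v * ennreal \<bar>f (x + v)\<bar>)^2 <= ennreal (r ^ 3) * (NN v. indicator ?Q v * (ennreal \<bar>f (x + v)\<bar>)^2)"
   by (rule cube_Holder2) (use r in auto)
  also have "... <= ennreal (r ^ 3) * (NN v. ennreal ((f (v + x))^2))"
   by (intro mult_left_mono nn_integral_mono) (auto simp: ennreal_power indicator_def add.commute)
  also have "... = ennreal (r ^ 3) * ennreal (LBINT x. (f x)^2)"
   using nn_integral_shift[of "%v. ennreal ((f v)^2)" x] nn_integral_eq_integral[OF f2] by simp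
  also have "... = (ennreal (ro ^ 6 * A))^2"
   using r ro by (simp add: A_def r_def ennreal_power ennreal_mult[symmetric] power_mult_distrib flip: power_mult)
  finally show "(NN v. indicator ?Q v * ennreal \<bar>f (x + v)\<bar>)^2 <= (ennreal (ro ^ 6 * A))^2" .
 qed (use ro A in auto)
 \<comment> \<open>The second term: rescaling the cube costs only the integrable factor \<open>s powr (-3/4)\<close>.\<close>
 have T2: "(NN v. indicator ?Q v * ennreal \<bar>g i (x + s *R v)\<bar>) <= ennreal (ro ^ 9 * G * s powr (-3/4))" if s: "0 < s" for s x i
 proof -
  let ?h = "%v. ennreal \<bar>g i (x + s *R v)\<bar>"
  have "((NN v. indicator ?Q v * ?h v)^2)^2 <= (ennreal (r ^ 3) * (NN v. indicator ?Q v * (?h v)^2))^2"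
   by (intro power_mono cube_Holder2) (use r in auto)
  also have "... = (ennreal (r ^ 3))^2 * (NN v. indicator ?Q v * (?h v)^2)^2"
   by (simp add: power_mult_distrib)
  also have "... <= (ennreal (r ^ 3))^2 * (ennreal (r ^ 3) * (NN v. indicator ?Q v * ((?h v)^2)^2))"
   by (intro mult_left_mono cube_Holder2) (use r in auto)
  also have "... <= (ennreal (r ^ 3))^2 * (ennreal (r ^ 3) * (NN v. ennreal ((g i (x + s *R v)) ^ 4)))"
   by (intro mult_left_mono nn_integral_mono) (auto simp: ennreal_power indicator_def simp flip: power_mult)
  also have "(NN v. ennreal ((g i (x + s *R v)) ^ 4)) = ennreal ((1 / s ^ 3) * (LBINT x. (g i x) ^ 4))"
  proof -
   have "ennreal (s ^ 3) * (NN v. ennreal ((g i (x + s *R v)) ^ 4)) = ennreal (LBINT x. (g i x) ^ 4)"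
    using nn_integral_scale[of "%v. ennreal ((g i v) ^ 4)" s x] s nn_integral_eq_integral[OF g4[of i]] by simp
   then have "ennreal (1 / s ^ 3) * (ennreal (s ^ 3) * (NN v. ennreal ((g i (x + s *R v)) ^ 4))) = ennreal (1 / s ^ 3) * ennreal (LBINT x. (g i x) ^ 4)" by simp
   moreover have "ennreal (1 / s ^ 3) * ennreal (s ^ 3) = 1" using s by (simp flip: ennreal_mult)
   ultimately have "(NN v. ennreal ((g i (x + s *R v)) ^ 4)) = ennreal (1 / s ^ 3) * ennreal (LBINT x. (g i x) ^ 4)"
    by (simp add: mult.assoc[symmetric])
   also have "... = ennreal ((1 / s ^ 3) * (LBINT x. (g i x) ^ 4))"
    by (rule ennreal_mult[symmetric]) (use s in auto)
   finally show ?thesis .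
  qed
  also have "(ennreal (r ^ 3))^2 * (ennreal (r ^ 3) * ennreal ((1 / s ^ 3) * (LBINT x. (g i x) ^ 4)))
   <= (ennreal (r ^ 3))^2 * (ennreal (r ^ 3) * ennreal ((1 / s ^ 3) * G ^ 4))"
   using G(1)[of i] s by (intro mult_left_mono ennreal_leI) auto
  also have "... = ennreal ((r ^ 3)^2 * (r ^ 3 * ((1 / s ^ 3) * G ^ 4)))"
  proof -
   have X: "0 <= (1 / s ^ 3) * G ^ 4" using s by simp
   show ?thesis
    by (simp only: ennreal_power[OF zero_le_power[OF r]] ennreal_mult[OF zero_le_power[OF r] X]
      ennreal_mult[OF zero_le_power[OF zero_le_power[OF r]] mult_nonneg_nonneg[OF zero_le_power[OF r] X]])
  qed
  also have "(r ^ 3)^2 * (r ^ 3 * ((1 / s ^ 3) * G ^ 4)) = ((ro ^ 9 * G * s powr (-3/4))^2)^2"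
  proof -
   have "(s powr (-3/4)) ^ 4 = s powr (-3)" using s by (simp add: powr_power)
   also have "... = 1 / s ^ 3" using s by (simp add: powr_minus_divide)
   finally have "(s powr (-3/4)) ^ 4 = 1 / s ^ 3" .
   then show ?thesis by (simp add: r_def power_mult_distrib flip: power_mult power_add)
  qed
  finally have "((NN v. indicator ?Q v * ?h v)^2)^2 <= (ennreal ((ro ^ 9 * G * s powr (-3/4))^2))^2"
   by (simp add: ennreal_power)
  then have "(NN v. indicator ?Q v * ?h v)^2 <= ennreal ((ro ^ 9 * G * s powr (-3/4))^2)"
   by (rule ennreal_power2_le_imp_le) simp
  also have "... = (ennreal (ro ^ 9 * G * s powr (-3/4)))^2" using ro G(2) by (simp add: ennreal_power)
  finally show ?thesis by (rule ennreal_power2_le_imp_le) (use ro G(2) in simp)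
 qed
 have T2i: "(NN v. indicator ?Q v * (NN s. indicator {0..1} s * ennreal \<bar>g i (x + s *R v)\<bar>)) <= ennreal (4 * (ro ^ 9 * G))" for x i
 proof -
  have "(NN v. indicator ?Q v * (NN s. indicator {0..1} s * ennreal \<bar>g i (x + s *R v)\<bar>))
   = (NN v. NN s. indicator ?Q v * (indicator {0..1} s * ennreal \<bar>g i (x + s *R v)\<bar>))"
   by (intro nn_integral_cong nn_integral_cmult[symmetric]) measurable
  also have "... = (NN s. NN v. indicator ?Q v * (indicator {0..1} s * ennreal \<bar>g i (x + s *R v)\<bar>))"
   by (intro lborel_pair.Fubini') measurable
  also have "... = (NN s. indicator {0..1} s * (NN v. indicator ?Q v * ennreal \<bar>g i (x + s *R v)\<bar>))"
   by (intro nn_integral_cong) (subst nn_integral_cmult[symmetric], auto simp: mult.left_commute)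
  also have "... <= (NN s. ennreal (ro ^ 9 * G) * (indicator {0..1} s * ennreal (s powr (-3/4))))"
  proof (rule nn_integral_mono_AE)
   show "AEl s. indicator {0..1} s * (NN v. indicator ?Q v * ennreal \<bar>g i (x + s *R v)\<bar>) <= ennreal (ro ^ 9 * G) * (indicator {0..1} s * ennreal (s powr (-3/4)))"
    using AE_lborel_singleton[of 0]
   proof eventually_elim
    case (elim s)
    show ?case
    proof (cases "s \<in> {0..1}")
     case True
     then have "0 < s" using elim by auto
     from T2[OF this, of i x] True show ?thesis using ro G(2) by (simp add: ennreal_mult)
    qed simp
   qed
  qed
  also have "... = ennreal (ro ^ 9 * G) * ennreal 4"
   by (subst nn_integral_cmult, measurable) (simp only: nn_integral_powr_three_quarters)
  also have "... = ennreal (ro ^ 9 * G * 4)" by (rule ennreal_mult[symmetric]) (use ro G(2) in auto)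
  also have "ro ^ 9 * G * 4 = 4 * (ro ^ 9 * G)" by simp
  finally show ?thesis .
 qed
 show ?thesis
  using AE2
 proof eventually_elim
  case (elim x)
  have "AEl v. indicator ?Q v * ennreal \<bar>f x\<bar> <= indicator ?Q v * ennreal \<bar>f (x + v)\<bar>
    + (SUM3 i. ennreal r * (indicator ?Q v * (NN s. indicator {0..1} s * ennreal \<bar>g i (x + s *R v)\<bar>)))"
   using elim
  proof eventually_elim
   case (elim v)
   show ?case
   proof (cases "v \<in> ?Q")
    case True
    let ?I = "\<integral>s. indicator {0..1} s * (SUM3 i. v $ i * g i (x + s *R v)) \<partial>lborel"
    have "\<bar>f x\<bar> <= \<bar>f (x + v)\<bar> + \<bar>?I\<bar>" using elim by linarith
    then have "ennreal \<bar>f x\<bar> <= ennreal \<bar>f (x + v)\<bar> + ennreal \<bar>?I\<bar>" by (simp add: ennreal_leI flip: ennreal_plus)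
    also have "ennreal \<bar>?I\<bar> <= (NN s. ennreal \<bar>indicator {0..1} s * (SUM3 i. v $ i * g i (x + s *R v))\<bar>)"
    proof (cases "integ (%s. indicator {0..1} s * (SUM3 i. v $ i * g i (x + s *R v)))")
     case i: True
     from integral_norm_bound_ennreal[OF i] show ?thesis by simp
    qed (simp add: not_integrable_integral_eq)
    also have "... <= (NN s. (SUM3 i. ennreal r * (indicator {0..1} s * ennreal \<bar>g i (x + s *R v)\<bar>)))"
    proof (rule nn_integral_mono)
     fix s :: real
     have "\<bar>SUM3 i. v $ i * g i (x + s *R v)\<bar> <= (SUM3 i. r * \<bar>g i (x + s *R v)\<bar>)"
      by (rule order_trans[OF sum_abs]) (auto intro!: sum_mono mult_right_mono cube3(2)[OF r True] simp: abs_mult)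
     then show "ennreal \<bar>indicator {0..1} s * (SUM3 i. v $ i * g i (x + s *R v))\<bar> <= (SUM3 i. ennreal r * (indicator {0..1} s * ennreal \<bar>g i (x + s *R v)\<bar>))"
      using r by (cases "s \<in> {0..1}") (auto simp: ennreal_mult[symmetric] sum_ennreal intro!: ennreal_leI)
    qed
    also have "... = (SUM3 i. ennreal r * (NN s. indicator {0..1} s * ennreal \<bar>g i (x + s *R v)\<bar>))"
     by (subst nn_integral_sum) (auto simp: nn_integral_cmult)
    finally show ?thesis using True by (simp add: add_left_mono)
   qed simp
  qed
  then have "(NN v. indicator ?Q v * ennreal \<bar>f x\<bar>) <= (NN v. indicator ?Q v * ennreal \<bar>f (x + v)\<bar>
    + (SUM3 i. ennreal r * (indicator ?Q v * (NN s. indicator {0..1} s * ennreal \<bar>g i (x + s *R v)\<bar>))))"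
   by (rule nn_integral_mono_AE)
  also have "... = (NN v. indicator ?Q v * ennreal \<bar>f (x + v)\<bar>)
    + (SUM3 i. ennreal r * (NN v. indicator ?Q v * (NN s. indicator {0..1} s * ennreal \<bar>g i (x + s *R v)\<bar>)))"
   by (simp add: nn_integral_add nn_integral_sum nn_integral_cmult)
  also have "... <= ennreal (ro ^ 6 * A) + (\<Sum>i\<in>(UNIV::3 set). ennreal r * ennreal (4 * (ro ^ 9 * G)))"
   by (intro add_mono T1 sum_mono mult_left_mono T2i) auto
  also have "... = ennreal (ro ^ 6 * A + 12 * (r * (ro ^ 9 * G)))"
  proof -
   have X: "0 <= 4 * (ro ^ 9 * G)" using ro G(2) by simp
   have "(\<Sum>i\<in>(UNIV::3 set). ennreal r * ennreal (4 * (ro ^ 9 * G))) = ennreal (\<Sum>i\<in>(UNIV::3 set). r * (4 * (ro ^ 9 * G)))"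
    unfolding ennreal_mult[OF r X, symmetric] by (rule sum_ennreal) (rule mult_nonneg_nonneg[OF r X])
   also have "(\<Sum>i\<in>(UNIV::3 set). r * (4 * (ro ^ 9 * G))) = 12 * (r * (ro ^ 9 * G))" by simp
   finally show ?thesis
    using ennreal_plus[of "ro ^ 6 * A" "12 * (r * (ro ^ 9 * G))"] r ro A G(2) by simp
  qed
  also have "(NN v. indicator ?Q v * ennreal \<bar>f x\<bar>) = ennreal (r ^ 3 * \<bar>f x\<bar>)"
   using cube3(1)[OF r] r by (subst nn_integral_multc) (auto simp: ennreal_mult)
  finally have "r ^ 3 * \<bar>f x\<bar> <= ro ^ 6 * A + 12 * (r * (ro ^ 9 * G))"
   using r ro A G(2) by (subst (asm) ennreal_le_iff) auto
  then have "ro ^ 12 * \<bar>f x\<bar> <= ro ^ 12 * (A / ro ^ 6 + 12 * ro * G)"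
  proof -
   have e0: "ro ^ 12 * (A / ro ^ 6 + 12 * ro * G) = ro ^ 6 * A + 12 * (ro ^ 13 * G)"
    using ro by (simp add: distrib_left power_add[symmetric] field_simps) (simp add: power_add[symmetric] flip: power_Suc power_Suc2)
   have e: "r ^ 3 = ro ^ 12" "r * (ro ^ 9 * G) = ro ^ 13 * G"
    by (simp_all add: r_def flip: power_mult)
   show ?thesis using \<open>r ^ 3 * \<bar>f x\<bar> <= ro ^ 6 * A + 12 * (r * (ro ^ 9 * G))\<close>
    unfolding e0 e .
  qed
  then show ?case using ro by (simp add: A_def)
 qed
qed

section \<open>Interpolation inequalities for twice weakly differentiable functions\<close>

lemma wder_UNIV_line_ac:
 "wder UNIV v f g ==> AEl x. line_ac (%s. f (x + s *R v)) (%s. g (x + s *R v))"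
 using wder_line_ac[of UNIV v f g] by simp

lemma wder_measurable: "wder Om v f g ==> f : Bm" "wder Om v f g ==> g : Bm"
 by (auto simp: wder_def intro: loc_int_measurable)

lemma wder_test_pairing:
 "wder Om v f g ==> phi : tests Om ==>
  (LBINT x. FD phi (at x) v * f x) = - (LBINT x. phi x * g x)"
 by (simp add: wder_def)

lemma wder_diff:
 assumes "wder Om v f g" "wder Om v f' g'"
 shows "wder Om v (%x. f x - f' x) (%x. g x - g' x)"
 unfolding wder_def
proof (intro conjI ballI)
 show "loc_int Om (%x. f x - f' x)" "loc_int Om (%x. g x - g' x)"
  using assms by (auto simp: wder_def intro: loc_int_diff)
 fix phi assume phi: "phi : tests Om"
 note d = test_functions_frechet[OF phi, of v]
 have i: "integ (%x. phi x * g x)" "integ (%x. phi x * g' x)"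
  "integ (%x. FD phi (at x) v * f x)" "integ (%x. FD phi (at x) v * f' x)"
  using assms loc_int_mult_test[OF _ phi] loc_int_mult_test[OF _ d] by (auto simp: wder_def)
 show "(LBINT x. FD phi (at x) v * (f x - f' x)) = - (LBINT x. phi x * (g x - g' x))"
  using i wder_test_pairing[OF assms(1) phi] wder_test_pairing[OF assms(2) phi] by (simp add: right_diff_distrib)
qed

lemma loc_int_of_square_integrable:
 assumes [measurable]: "f : Bm" and i: "integ (%x. (f x :: real)^2)"
 shows "loc_int Om f"
 unfolding loc_int_def
proof (intro conjI allI impI)
 fix K :: "'a::euclidean_space set" assume K: "compact K \<and> K \<subseteq> Om"
 then have [measurable]: "K \<in> sets borel" by (auto intro: borel_compact)
 have e: "(indicator K x :: real)^2 = indicator K x" for x by (auto simp: indicator_def)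
 show "integ (%x. indicator K x * f x)"
  using K emeasure_compact_finite[of K] by (intro CS_integrable i) (auto simp: e intro!: integrable_real_indicator)
qed fact

text \<open>A twice weakly differentiable scalar function together with its derivatives, all square integrable.\<close>

definition H2f :: "(real^3 => real) => (3 => real^3 => real) => (3 => 3 => real^3 => real) => bool" where
 "H2f u D DD \<longleftrightarrow> integ (%x. (u x)^2) \<and> (\<forall>k. integ (%x. (D k x)^2)) \<and>
  (\<forall>l k. integ (%x. (DD l k x)^2)) \<and>
  (\<forall>k. wder UNIV (axis k 1) u (D k)) \<and> (\<forall>l k. wder UNIV (axis l 1) (D k) (DD l k))"

lemma H2f_measurable:
 assumes "H2f u D DD"
 shows "u : Bm" "D k : Bm" "DD l k : Bm"
proof -
 have w: "wder UNIV (axis k 1) u (D k)" "wder UNIV (axis l 1) (D k) (DD l k)" using assms by (auto simp: H2f_def)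
 show "u : Bm" "D k : Bm" "DD l k : Bm"
  by (rule wder_measurable[OF w(1)] wder_measurable[OF w(2)])+
qed

lemma H2fD:
 assumes "H2f u D DD"
 shows "integ (%x. (u x)^2)" "integ (%x. (D k x)^2)"
  "integ (%x. (DD l k x)^2)" "wder UNIV (axis k 1) u (D k)" "wder UNIV (axis l 1) (D k) (DD l k)"
 using assms by (auto simp: H2f_def)

lemma integrable_square_diff:
 fixes f g :: "'a => real"
 assumes [measurable]: "f : borel_measurable M" "g : borel_measurable M"
  and "integrable M (%x. (f x)^2)" "integrable M (%x. (g x)^2)"
 shows "integrable M (%x. (f x - g x)^2)"
 using assms(3,4) CS_integrable[OF assms] by (simp add: power2_diff mult.assoc)

lemma H2f_diff:
 assumes "H2f u D DD" "H2f u' D' DD'"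
 shows "H2f (%x. u x - u' x) (%k x. D k x - D' k x) (%l k x. DD l k x - DD' l k x)"
 using H2fD[OF assms(1)] H2fD[OF assms(2)] H2f_measurable[OF assms(1)] H2f_measurable[OF assms(2)]
 by (auto simp: H2f_def intro!: wder_diff integrable_square_diff)

lemma wder_test:
 assumes "phi : tests UNIV"
 shows "wder UNIV v phi (%x. FD phi (at x) v)" "integ (%x. (phi x)^2)"
proof -
 have loc: "loc_int UNIV psi" if "psi : tests UNIV" for psi :: "'a => real"
 proof -
  have "continuous_on K psi" for K using test_functions_continuous[OF that] continuous_on_subset by blast
  then show ?thesis using borel_integrable_compact[of _ psi] test_functions_measurable[OF that]
   by (auto simp: loc_int_def)
 qed
 note d = test_functions_frechet[OF assms, of v]
 show "integ (%x. (phi x)^2)"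
  using loc_int_mult_test[OF loc[OF assms] assms] by (simp add: power2_eq_square)
 show "wder UNIV v phi (%x. FD phi (at x) v)"
  unfolding wder_def
 proof (intro conjI ballI loc assms d)
  fix psi :: "'a => real" assume psi: "psi : tests UNIV"
  note m = test_functions_measurable[OF psi] test_functions_measurable[OF assms] test_functions_measurable[OF d]
   test_functions_measurable[OF test_functions_frechet[OF psi, of v]]
  note [measurable] = m
  have i: "integ (%x. psi x * phi x)" "integ (%x. psi x * FD phi (at x) v)"
   "integ (%x. FD psi (at x) v * phi x)"
   using loc_int_mult_test[OF loc[OF assms] psi] loc_int_mult_test[OF loc[OF d] psi]
    loc_int_mult_test[OF loc[OF assms] test_functions_frechet[OF psi]] by auto
  have "(LBINT x. psi x * FD phi (at x) v + FD psi (at x) v * phi x) = 0"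
  proof (rule integral_line_derivative_zero[where f="%x. psi x * phi x" and v=v])
   show "AEl x. line_ac (%s. psi (x + s *R v) * phi (x + s *R v))
    (%s. psi (x + s *R v) * FD phi (at (x + s *R v)) v + FD psi (at (x + s *R v)) v * phi (x + s *R v))"
    by (intro AE_I2 line_ac_mult line_ac_test[OF psi] line_ac_test[OF assms] measurable_compose[OF _ m(1)]
      measurable_compose[OF _ m(2)] measurable_compose[OF _ m(3)] measurable_compose[OF _ m(4)]) measurable
  qed (use i in auto)
  then show "(LBINT x. FD psi (at x) v * phi x) = - (LBINT x. psi x * FD phi (at x) v)"
   using i by simp
 qed
qed

subsection \<open>The Hessian is controlled by the Laplacian\<close>

definition segment_measure :: "real => real => 'a::euclidean_space => 'a measure" where
 "segment_measure a r q = distr (density lborel (%s. ennreal (indicator {0..r} s / r))) borel (%s. (s - a) *R q)"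

lemma segment_measure:
 assumes r: "0 < r"
 shows "averaging (segment_measure a r q)"
  and "a \<in> {0..r} ==> AE y in segment_measure a r q. norm y <= r * norm q"
  and "f : Bm ==> r * avg (segment_measure a r q) f x = (LBINT s. indicator {0..r} s * f (x + (s - a) *R q))"
proof -
 let ?d = "density lborel (%s. ennreal (indicator {0..r} s / r))"
 have "emeasure ?d UNIV = (NN s. ennreal (1 / r) * indicator {0..r} s)"
  by (subst emeasure_density) (auto intro!: nn_integral_cong simp: indicator_def)
 also have "... = ennreal (1 / r) * ennreal r" using r by (simp add: nn_integral_cmult_indicator)
 also have "... = 1" using r by (simp add: ennreal_mult[symmetric])
 finally show "averaging (segment_measure a r q)"
  by (simp add: averaging_def segment_measure_def emeasure_distr)
 show "AE y in segment_measure a r q. norm y <= r * norm q" if "a \<in> {0..r}"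
  unfolding segment_measure_def
  by (subst AE_distr_iff, simp, simp, subst AE_density)
   (use that in \<open>auto intro!: AE_I2 mult_right_mono simp: indicator_def split: if_splits\<close>)
 show "r * avg (segment_measure a r q) f x = (LBINT s. indicator {0..r} s * f (x + (s - a) *R q))"
  if [measurable]: "f : Bm"
 proof -
  have "avg (segment_measure a r q) f x = (\<integral>s. f (x + (s - a) *R q) \<partial>?d)"
   unfolding avg_def segment_measure_def by (subst integral_distr) auto
  also have "... = (LBINT s. (indicator {0..r} s / r) * f (x + (s - a) *R q))"
   using r by (subst integral_density) auto
  also have "... = (LBINT s. (1 / r) * (indicator {0..r} s * f (x + (s - a) *R q)))" by simp
  finally show ?thesis using r by (simp del: times_divide_eq_left divide_inverse)
 qed
qed

text \<open>
 Summation by parts for difference quotients: in the limit it exchanges the two directions of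
 differentiation without using any third derivative.
\<close>

lemma exchange_derivatives:
 fixes F G :: "'a::euclidean_space => real"
 assumes w: "wder UNIV p F Fp" "wder UNIV q F Fq" "wder UNIV p G Gp" "wder UNIV q G Gq"
  and i: "integ (%x. (F x)^2)" "integ (%x. (G x)^2)"
   "integ (%x. (Fp x)^2)" "integ (%x. (Fq x)^2)"
   "integ (%x. (Gp x)^2)" "integ (%x. (Gq x)^2)"
 shows "(LBINT x. Fp x * Gq x) = (LBINT x. Fq x * Gp x)"
proof -
 note [measurable] = wder_measurable[OF w(1)] wder_measurable[OF w(2)] wder_measurable[OF w(3)] wder_measurable[OF w(4)]
 define r where "r n = 1 / real (Suc n)" for n
 have r: "0 < r n" for n by (simp add: r_def)
 have [measurable]: "avg (segment_measure a (r n) q) f : Bm" if "f : Bm" for a n f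
  by (rule avg_measurable[OF segment_measure(1)[OF r] that])
 have step: "(LBINT x. Fp x * avg (segment_measure 0 (r n) q) Gq x) = (LBINT x. Gp x * avg (segment_measure (r n) (r n) q) Fq x)" for n
 proof -
  let ?c = "r n *R q"
  define H where "H x = G (x + ?c) - G x" for x
  define Hp where "Hp x = Gp (x + ?c) - Gp x" for x
  have [measurable]: "H : Bm" "Hp : Bm" unfolding H_def Hp_def by measurable
  have sh: "integ (%x. (G (x + ?c))^2)" "integ (%x. (Gp (x + ?c))^2)"
   using integrable_shift[OF i(2), of ?c] integrable_shift[OF i(5), of ?c] by auto
  have H2: "integ (%x. (H x)^2)" "integ (%x. (Hp x)^2)"
   unfolding H_def Hp_def by (intro integrable_square_diff sh i; measurable)+
  have "AEl x. line_ac (%s. G (x + s *R p)) (%s. Gp (x + s *R p))" by (rule wder_UNIV_line_ac[OF w(3)])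
  with AE_shift[OF this, of ?c] have "AEl x. line_ac (%s. H (x + s *R p)) (%s. Hp (x + s *R p))"
   by eventually_elim (auto simp: H_def Hp_def algebra_simps intro: line_ac_diff)
  with wder_UNIV_line_ac[OF w(1)]
  have l: "AEl x. line_ac (%s. F (x + s *R p) * H (x + s *R p)) (%s. F (x + s *R p) * Hp (x + s *R p) + Fp (x + s *R p) * H (x + s *R p))"
   by eventually_elim (intro line_ac_mult; measurable)
  have ii: "integ (%x. F x * H x)" "integ (%x. F x * Hp x)" "integ (%x. Fp x * H x)"
   by (intro CS_integrable i H2; measurable)+
  have "(LBINT x. F x * Hp x + Fp x * H x) = 0"
   by (rule integral_line_derivative_zero[OF l]) (use ii in auto)
  then have 0: "(LBINT x. Fp x * H x) = - (LBINT x. F x * Hp x)" using ii by simp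
  have FG: "integ (%x. F x * Gp (x + ?c))" "integ (%x. F x * Gp x)"
   by (intro CS_integrable i sh; measurable)+
  have FG': "integ (%x. F (x - ?c) * Gp x)" using integrable_shift[OF FG(1), of "- ?c"] by simp
  have "(LBINT x. F x * Hp x) = (LBINT x. F x * Gp (x + ?c)) - (LBINT x. F x * Gp x)"
   unfolding Hp_def using FG by (simp add: right_diff_distrib)
  also have "(LBINT x. F x * Gp (x + ?c)) = (LBINT x. F (x - ?c) * Gp x)"
   using integral_shift[of "%x. F (x - ?c) * Gp x" ?c] by simp
  finally have 1: "(LBINT x. Fp x * H x) = (LBINT x. Gp x * (F x - F (x - ?c)))"
   using 0 FG FG' by (simp add: right_diff_distrib mult.commute)
  have "AEl x. H x = r n * avg (segment_measure 0 (r n) q) Gq x"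
   using wder_forward_increment[OF open_UNIV _ w(4), where r="r n"] r[of n]
   by (auto simp: H_def segment_measure(3) less_imp_le)
  then have 2: "(LBINT x. Fp x * H x) = (LBINT x. Fp x * (r n * avg (segment_measure 0 (r n) q) Gq x))"
   by (intro integral_cong_AE) (measurable, auto elim!: eventually_mono)
  have "AEl x. F (x + ?c) = F x + (LBINT s. indicator {0..r n} s * Fq (x + s *R q))"
   using wder_forward_increment[OF open_UNIV _ w(2), where r="r n"] r[of n] by (auto simp: less_imp_le)
  from AE_shift[OF this, of "- ?c"] have "AEl x. F x - F (x - ?c) = r n * avg (segment_measure (r n) (r n) q) Fq x"
   by eventually_elim (simp add: segment_measure(3)[OF r] algebra_simps)
  then have 3: "(LBINT x. Gp x * (F x - F (x - ?c))) = (LBINT x. Gp x * (r n * avg (segment_measure (r n) (r n) q) Fq x))"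
   by (intro integral_cong_AE) (measurable, auto elim!: eventually_mono)
  have "r n * (LBINT x. Fp x * avg (segment_measure 0 (r n) q) Gq x) = r n * (LBINT x. Gp x * avg (segment_measure (r n) (r n) q) Fq x)"
   using 1 2 3 by (simp add: mult.left_commute[of _ "r n"])
  then show ?thesis using r[of n] by simp
 qed
 have lim: "(%n. r n * norm q) ---> 0"
  unfolding r_def using tendsto_mult_left_zero[OF LIMSEQ_inverse_real_of_nat, of "norm q"] by (simp add: inverse_eq_divide)
 have small: "AE y in segment_measure a (r n) q. norm y <= r n * norm q" if "a \<in> {0..r n}" for a n
  by (rule segment_measure(2)[OF r that])
 have "(%n. LBINT x. Fp x * avg (segment_measure 0 (r n) q) Gq x) ---> (LBINT x. Fp x * Gq x)"
  by (rule avg_pairing_tendsto_L2(1)[where mu="%n. segment_measure 0 (r n) q", OF segment_measure(1)[OF r] small lim _ _ i(6,3)])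
   (use r in \<open>auto simp: less_imp_le\<close>)
 moreover have "(%n. LBINT x. Gp x * avg (segment_measure (r n) (r n) q) Fq x) ---> (LBINT x. Gp x * Fq x)"
  by (rule avg_pairing_tendsto_L2(1)[where mu="%n. segment_measure (r n) (r n) q", OF segment_measure(1)[OF r] small lim _ _ i(4,5)])
   (use r in \<open>auto simp: less_imp_le\<close>)
 ultimately show ?thesis using LIMSEQ_unique unfolding step by (metis (no_types, lifting) Bi_integral_cong mult.commute)
qed

lemma H2f_mixed_symmetric:
 assumes H: "H2f u D DD"
 shows "AEl x. DD k l x = DD l k x"
proof -
 note [measurable] = H2f_measurable[OF H]
 have lk: "loc_int UNIV (DD a b)" for a b using H2fD(3)[OF H] by (intro loc_int_of_square_integrable) auto
 have "AEl x. x \<in> UNIV --> DD k l x - DD l k x = 0"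
 proof (rule zero_if_test_integrals_zero[OF open_UNIV loc_int_diff[OF lk lk]])
  fix phi :: "real^3 => real" assume phi: "phi : tests UNIV"
  note d = test_functions_frechet[OF phi]
  have "(LBINT x. FD phi (at x) (axis k 1) * D l x) = (LBINT x. FD phi (at x) (axis l 1) * D k x)"
   by (rule exchange_derivatives[OF wder_test(1)[OF phi] wder_test(1)[OF phi] H2fD(4)[OF H] H2fD(4)[OF H]
     wder_test(2)[OF phi] H2fD(1)[OF H] wder_test(2)[OF d] wder_test(2)[OF d] H2fD(2)[OF H] H2fD(2)[OF H]])
  then have "(LBINT x. phi x * DD k l x) = (LBINT x. phi x * DD l k x)"
   using wder_test_pairing[OF H2fD(5)[OF H] phi] by simp
  then show "(LBINT x. phi x * (DD k l x - DD l k x)) = 0"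
   using loc_int_mult_test[OF lk phi] by (simp add: right_diff_distrib)
 qed
 then show ?thesis by eventually_elim auto
qed

lemma H2f_laplacian_integrable:
 assumes H: "H2f u D DD"
 shows "integ (%x. (SUM3 k. DD k k x)^2)"
proof -
 note [measurable] = H2f_measurable[OF H]
 show ?thesis unfolding power2_eq_square sum_product
  by (intro Bi_integrable_sum CS_integrable H2fD[OF H]) measurable
qed

lemma H2f_hessian_le_laplacian:
 assumes H: "H2f u D DD"
 shows "(LBINT x. (DD l k x)^2) <= (LBINT x. (SUM3 k. DD k k x)^2)"
proof -
 note [measurable] = H2f_measurable[OF H]
 have p: "integ (%x. DD a b x * DD c d x)" for a b c d
  by (intro CS_integrable H2fD[OF H]) measurable
 have ex: "(LBINT x. DD k k x * DD l l x) = (LBINT x. (DD l k x)^2)" for k l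
 proof -
  have "(LBINT x. DD k k x * DD l l x) = (LBINT x. DD l k x * DD k l x)"
   by (rule exchange_derivatives[OF H2fD(5)[OF H] H2fD(5)[OF H] H2fD(5)[OF H] H2fD(5)[OF H]
     H2fD(2)[OF H] H2fD(2)[OF H] H2fD(3)[OF H] H2fD(3)[OF H] H2fD(3)[OF H] H2fD(3)[OF H]])
  also have "... = (LBINT x. (DD l k x)^2)"
   using H2f_mixed_symmetric[OF H, of k l] by (intro integral_cong_AE) (auto simp: power2_eq_square elim!: eventually_mono)
  finally show ?thesis .
 qed
 have "(LBINT x. (DD l k x)^2) <= (SUM3 k. LBINT x. (DD l k x)^2)"
  by (rule member_le_sum) auto
 also have "... <= (SUM3 l. SUM3 k. LBINT x. (DD l k x)^2)"
  by (rule member_le_sum[where f="%l. SUM3 k. \<integral>x. (DD l k x)^2 \<partial>lborel"]) (auto intro: sum_nonneg)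
 also have "... = (SUM3 l. SUM3 k. LBINT x. DD l l x * DD k k x)"
  by (intro sum.cong refl) (simp add: ex[symmetric] mult.commute)
 also have "... = (LBINT x. (SUM3 k. DD k k x)^2)"
  unfolding power2_eq_square sum_product using p by (subst Bi_integral_sum; (intro Bi_integrable_sum)?) auto
 finally show ?thesis .
qed

text \<open>
 Integration by parts of \<open>u \<partial>\<^sub>k u\<close>.
\<close>

lemma H2f_gradient_L2:
 assumes H: "H2f u D DD"
 shows "(LBINT x. (D k x)^2) <= sqrt (LBINT x. (u x)^2) * sqrt (LBINT x. (SUM3 k. DD k k x)^2)"
proof -
 note [measurable] = H2f_measurable[OF H]
 have i: "integ (%x. u x * D k x)" "integ (%x. u x * DD k k x)" "integ (%x. D k x * D k x)"
  by (intro CS_integrable H2fD[OF H]; measurable)+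
 have l: "AEl x. line_ac (%s. u (x + s *R axis k 1) * D k (x + s *R axis k 1))
  (%s. u (x + s *R axis k 1) * DD k k (x + s *R axis k 1) + D k (x + s *R axis k 1) * D k (x + s *R axis k 1))"
  using wder_UNIV_line_ac[OF H2fD(4)[OF H, of k]] wder_UNIV_line_ac[OF H2fD(5)[OF H, of k k]]
  by eventually_elim (intro line_ac_mult; measurable)
 have "(LBINT x. u x * DD k k x + D k x * D k x) = 0"
  by (rule integral_line_derivative_zero[OF l]) (use i in auto)
 then have "(LBINT x. (D k x)^2) = - (LBINT x. u x * DD k k x)" using i by (simp add: power2_eq_square)
 also have "... <= (LBINT x. \<bar>u x * DD k k x\<bar>)" using integral_abs_bound[of lborel "%x. u x * DD k k x"] by linarith
 also have "... <= sqrt (LBINT x. (u x)^2) * sqrt (LBINT x. (DD k k x)^2)"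
  by (intro CS_integral_sqrt H2fD[OF H]) auto
 also have "... <= sqrt (LBINT x. (u x)^2) * sqrt (LBINT x. (SUM3 k. DD k k x)^2)"
  using H2f_hessian_le_laplacian[OF H] by (intro mult_left_mono) auto
 finally show ?thesis .
qed

lemma H2f_gradient_L6:
 assumes H: "H2f u D DD"
 shows "integ (%x. (D k x) ^ 6)" "(LBINT x. (D k x) ^ 6) <= 4096 * (LBINT x. (SUM3 k. DD k k x)^2) ^ 3"
 using GNS[OF wder_UNIV_line_ac[OF H2fD(5)[OF H]] H2f_measurable(2)[OF H] H2f_measurable(3)[OF H] H2fD(2)[OF H] H2fD(3)[OF H]
   H2f_hessian_le_laplacian[OF H]] by auto

lemma H2f_gradient_L4:
 assumes H: "H2f u D DD"
 shows "integ (%x. (D k x) ^ 4)"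
  "(LBINT x. (D k x) ^ 4) <= sqrt (LBINT x. (D k x)^2) * sqrt (LBINT x. (D k x) ^ 6)"
proof -
 note [measurable] = H2f_measurable[OF H]
 have e: "((D k x) ^ 3)^2 = (D k x) ^ 6" "D k x * (D k x) ^ 3 = (D k x) ^ 4" for x by (simp_all flip: power_mult power_Suc)
 have i6: "integ (%x. ((D k x) ^ 3)^2)" using H2f_gradient_L6[OF H] by (simp add: e)
 show "integ (%x. (D k x) ^ 4)"
  using CS_integrable[of "D k" lborel "%x. (D k x) ^ 3"] i6 H2fD(2)[OF H, of k] by (simp only: e) simp
 show "(LBINT x. (D k x) ^ 4) <= sqrt (LBINT x. (D k x)^2) * sqrt (LBINT x. (D k x) ^ 6)"
  using CS_integral_sqrt[of "D k" lborel "%x. (D k x) ^ 3"] i6 H2fD(2)[OF H, of k] by (simp only: e) simp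
qed

lemma frechet_axis_expansion:
 fixes phi :: "real^3 => real"
 assumes "phi : tests Om"
 shows "FD phi (at x) v = (SUM3 i. v $ i * FD phi (at x) (axis i 1))"
proof -
 interpret linear "FD phi (at x)"
  by (rule linear_frechet_derivative[OF test_functions_differentiable[OF assms]])
 have "v = (SUM3 i. v $ i *R axis i 1)" using basis_expansion[of v] by (simp add: scalar_mult_eq_scaleR)
 then have "FD phi (at x) v = FD phi (at x) (SUM3 i. v $ i *R axis i 1)" by simp
 also have "... = (SUM3 i. v $ i * FD phi (at x) (axis i 1))" by (simp add: sum scale)
 finally show ?thesis .
qed

lemma wder_direction:
 fixes f :: "real^3 => real"
 assumes w: "!!i. wder UNIV (axis i 1) f (g i)"
 shows "wder UNIV v f (%x. SUM3 i. v $ i * g i x)"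
 unfolding wder_def
proof (intro conjI ballI)
 have g: "loc_int UNIV (g i)" for i using w by (simp add: wder_def)
 show "loc_int UNIV f" using w by (simp add: wder_def)
 then have f: "loc_int UNIV f" .
 have "loc_int UNIV (%x. v $ 1 * g 1 x + v $ 2 * g 2 x + v $ 3 * g 3 x)"
  by (intro loc_int_add loc_int_cmult g)
 then show "loc_int UNIV (%x. SUM3 i. v $ i * g i x)" by (simp add: sum_3)
 fix phi :: "real^3 => real" assume phi: "phi : tests UNIV"
 have "(LBINT x. FD phi (at x) v * f x) = (LBINT x. (SUM3 i. v $ i * (FD phi (at x) (axis i 1) * f x)))"
  unfolding frechet_axis_expansion[OF phi, of _ v] by (simp add: sum_distrib_right mult.assoc)
 also have "... = (SUM3 i. v $ i * (LBINT x. FD phi (at x) (axis i 1) * f x))"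
  by (subst Bi_integral_sum) (auto intro!: integrable_mult_right loc_int_mult_test[OF f] test_functions_frechet[OF phi])
 also have "... = (SUM3 i. v $ i * - (LBINT x. phi x * g i x))"
  by (simp only: wder_test_pairing[OF w phi])
 also have "... = - (SUM3 i. v $ i * (LBINT x. phi x * g i x))"
  by (simp add: sum_negf)
 also have "(SUM3 i. v $ i * (LBINT x. phi x * g i x)) = (LBINT x. (SUM3 i. v $ i * (phi x * g i x)))"
  by (subst Bi_integral_sum) (auto intro!: integrable_mult_right loc_int_mult_test[OF g] phi)
 also have "... = (LBINT x. phi x * (SUM3 i. v $ i * g i x))"
  by (simp add: sum_distrib_left mult.left_commute)
 finally show "(LBINT x. FD phi (at x) v * f x) = - (LBINT x. phi x * (SUM3 i. v $ i * g i x))" .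
qed

lemma H2f_sup:
 assumes H: "H2f u D DD" and G: "!!k. (LBINT x. (D k x) ^ 4) <= G ^ 4" "0 <= G" and ro: "0 < ro"
 shows "AEl x. \<bar>u x\<bar> <= sqrt (LBINT x. (u x)^2) / ro ^ 6 + 12 * ro * G"
proof (rule Morrey[OF _ H2f_measurable(1,2)[OF H] H2fD(1)[OF H] H2f_gradient_L4(1)[OF H] G ro])
 fix v :: "real^3"
 show "AEl x. u (x + v) = u x + (LBINT s. indicator {0..1} s * (SUM3 i. v $ i * D i (x + s *R v)))"
  using wder_forward_increment[OF open_UNIV _ wder_direction[OF H2fD(4)[OF H], of v], where r=1] by simp
qed

text \<open>
 The gradient is interpolated in \<open>L\<^sup>4\<close> between \<open>L\<^sup>2\<close> and \<open>L\<^sup>6\<close>, and the supremum is bounded by the Morrey estimate. Both leave a power of the Laplacian below one, so its coefficient can be made small; this smallness lets the dissipation absorb it later.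
\<close>

theorem H2f_interpolation:
 assumes "0 < de"
 obtains C where "0 <= C"
  "!!u D DD k. H2f u D DD ==> sqrt (LBINT x. (D k x) ^ 4) <= de * (LBINT x. (SUM3 k. DD k k x)^2) + C * (LBINT x. (u x)^2)"
  "!!u D DD. H2f u D DD ==> AEl x. (u x)^2 <= de * (LBINT x. (SUM3 k. DD k k x)^2) + C * (LBINT x. (u x)^2)"
proof -
 have grad: "\<exists>C\<ge>0. \<forall>u D DD k. H2f u D DD --> sqrt (LBINT x. (D k x) ^ 4) <= ep * (LBINT x. (SUM3 k. DD k k x)^2) + C * (LBINT x. (u x)^2)"
  if ep: "0 < ep" for ep :: real
 proof -
  define ta where "ta = min 1 ((ep / 8)^2)"
  have ta: "0 < ta" "ta <= 1" "ta <= (ep / 8)^2" using ep by (auto simp: ta_def)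
  define C where "C = 8 / ta ^ 4"
  have C: "0 <= C" using ta by (simp add: C_def)
  have arith: "sqrt I <= ep * b^2 + C * a^2" if I: "I <= sqrt (a * b) * sqrt (4096 * (b^2) ^ 3)" and ab: "0 <= a" "0 <= b" for I a b :: real
  proof -
   have s: "sqrt (4096 * (b^2) ^ 3) = 64 * b ^ 3"
    by (rule real_sqrt_unique) (use ab in \<open>auto simp: power_mult_distrib simp flip: power_mult\<close>)
   show ?thesis
   proof (cases "a <= ta^2 * b")
    case True
    have "sqrt (a * b) <= sqrt ((ta * b)^2)"
     using mult_right_mono[OF True ab(2)] by (intro real_sqrt_le_mono) (simp add: power2_eq_square mult_ac)
    then have "sqrt (a * b) <= ta * b" using ta ab by simp
    moreover have "ta * b <= (ep / 8)^2 * b" using ta ab by (intro mult_right_mono)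
    ultimately have "sqrt (a * b) * (64 * b ^ 3) <= ((ep / 8)^2 * b) * (64 * b ^ 3)" using ab by (intro mult_right_mono) auto
    also have "... = (ep * b^2)^2" by (simp add: power2_eq_square power3_eq_cube)
    finally have "sqrt I <= ep * b^2" using ep I s by (intro real_le_lsqrt) auto
    moreover have "0 <= C * a^2" using C by simp
    ultimately show ?thesis by linarith
   next
    case False
    then have b: "b <= a / ta^2" using ta by (simp add: field_simps)
    have "sqrt (a * b) <= sqrt ((a / ta)^2)"
     using mult_left_mono[OF b ab(1)] by (intro real_sqrt_le_mono) (simp add: power2_eq_square)
    then have "sqrt (a * b) <= a / ta" using ta ab by simp
    also have "... <= a / ta^2"
     using ta ab by (intro divide_left_mono) (auto simp: power2_eq_square mult_left_le_one_le)
    finally have "sqrt (a * b) <= a / ta^2" .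
    moreover have "64 * b ^ 3 <= 64 * (a / ta^2) ^ 3" using b ab by (intro mult_left_mono power_mono) auto
    ultimately have "sqrt (a * b) * (64 * b ^ 3) <= (a / ta^2) * (64 * (a / ta^2) ^ 3)"
     using ab ta by (intro mult_mono) auto
    also have "... = 64 * (a / ta^2) ^ 4"
     unfolding power4_eq_xxxx power3_eq_cube by (simp only: mult_ac)
    also have "... = (C * a^2)^2" by (simp add: C_def power_mult_distrib power_divide flip: power_mult)
    finally have "sqrt I <= C * a^2" using I s C by (intro real_le_lsqrt) auto
    moreover have "0 <= ep * b^2" using ep by simp
    ultimately show ?thesis by linarith
   qed
  qed
  show ?thesis
  proof (intro exI[of _ C] conjI C allI impI)
   fix u :: "real^3 => real" and D DD and k :: 3 assume H: "H2f u D DD"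
   define a where "a = sqrt (LBINT x. (u x)^2)"
   define b where "b = sqrt (LBINT x. (SUM3 k. DD k k x)^2)"
   have ab: "0 <= a" "0 <= b" by (simp_all add: a_def b_def)
   have ab2: "a^2 = (LBINT x. (u x)^2)" "b^2 = (LBINT x. (SUM3 k. DD k k x)^2)"
    by (simp_all add: a_def b_def)
   have "(LBINT x. (D k x) ^ 4) <= sqrt (LBINT x. (D k x)^2) * sqrt (LBINT x. (D k x) ^ 6)"
    by (rule H2f_gradient_L4(2)[OF H])
   also have "... <= sqrt (a * b) * sqrt (4096 * (b^2) ^ 3)"
    using H2f_gradient_L2[OF H, of k] H2f_gradient_L6(2)[OF H, of k] unfolding ab2
    by (intro mult_mono real_sqrt_le_mono) (auto simp: a_def b_def)
   finally show "sqrt (LBINT x. (D k x) ^ 4) <= ep * (LBINT x. (SUM3 k. DD k k x)^2) + C * (LBINT x. (u x)^2)"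
    unfolding ab2[symmetric] by (rule arith[OF _ ab])
  qed
 qed
 obtain C1 where C1: "0 <= C1" "!!u D DD k. H2f u D DD ==> sqrt (LBINT x. (D k x) ^ 4) <= 1 * (LBINT x. (SUM3 k. DD k k x)^2) + C1 * (LBINT x. (u x)^2)"
  using grad[of 1] by auto
 obtain C2 where C2: "0 <= C2" "!!u D DD k. H2f u D DD ==> sqrt (LBINT x. (D k x) ^ 4) <= de * (LBINT x. (SUM3 k. DD k k x)^2) + C2 * (LBINT x. (u x)^2)"
  using grad[OF assms] by auto
 define ro where "ro = sqrt (de / 288)"
 have ro: "0 < ro" "288 * ro^2 = de" using assms by (auto simp: ro_def)
 define C3 where "C3 = 2 / ro ^ 12 + de * C1"
 have C3: "0 <= C3" using ro(1) C1(1) assms by (simp add: C3_def)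
 show ?thesis
 proof (rule that[of "C2 + C3"])
  show "0 <= C2 + C3" using C2(1) C3 by simp
  fix u :: "real^3 => real" and D DD assume H: "H2f u D DD"
  define A where "A = (LBINT x. (u x)^2)"
  define B where "B = (LBINT x. (SUM3 k. DD k k x)^2)"
  have AB: "0 <= A" "0 <= B" by (simp_all add: A_def B_def)
  show "sqrt (LBINT x. (D k x) ^ 4) <= de * (LBINT x. (SUM3 k. DD k k x)^2) + (C2 + C3) * (LBINT x. (u x)^2)" for k
  proof -
   have "0 <= C3 * A" using C3 AB by simp
   then show ?thesis using C2(2)[OF H, of k] unfolding A_def[symmetric] B_def[symmetric] by (simp add: distrib_right)
  qed
  define G where "G = sqrt (B + C1 * A)"
  have BA: "0 <= B + C1 * A" using AB C1(1) by simp
  have G: "0 <= G" "G^2 = B + C1 * A" using BA by (simp_all add: G_def)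
  have G4: "(LBINT x. (D k x) ^ 4) <= G ^ 4" for k
  proof -
   have "sqrt (LBINT x. (D k x) ^ 4) <= G^2" using C1(2)[OF H, of k] by (simp add: G(2) A_def B_def)
   from sqrt_le_D[OF this] show ?thesis by (simp flip: power_mult)
  qed
  from H2f_sup[OF H G4 G(1) ro(1)]
  have "AEl x. (u x)^2 <= de * B + (C2 + C3) * A"
  proof eventually_elim
   case (elim x)
   then have "\<bar>u x\<bar> <= sqrt A / ro ^ 6 + 12 * ro * G" by (simp add: A_def)
   then have "\<bar>u x\<bar>\<^sup>2 <= (sqrt A / ro ^ 6 + 12 * ro * G)^2" by (intro power_mono) auto
   also have "... <= 2 * (sqrt A / ro ^ 6)^2 + 2 * (12 * ro * G)^2"
    using sum_squares_bound[of "sqrt A / ro ^ 6" "12 * ro * G"] by (simp add: power2_sum)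
   also have "... = 2 * (A / ro ^ 12) + 288 * ro^2 * (B + C1 * A)"
    using AB by (simp add: power_divide power_mult_distrib G(2) flip: power_mult)
   also have "... = de * B + C3 * A" unfolding ro(2) by (simp add: C3_def algebra_simps)
   also have "... <= de * B + (C2 + C3) * A" using C2(1) AB by (simp add: distrib_right)
   finally show ?case by simp
  qed
  then show "AEl x. (u x)^2 <= de * (LBINT x. (SUM3 k. DD k k x)^2) + (C2 + C3) * (LBINT x. (u x)^2)"
   unfolding A_def B_def .
 qed
qed

section \<open>Testing a mollified equation with a function of low regularity\<close>

lemma loc_int_UNIV_const: "loc_int Om (%x::'a::euclidean_space. c)"
 unfolding loc_int_def
proof (intro conjI allI impI)
 fix K :: "'a set" assume K: "compact K \<and> K \<subseteq> Om"
 then show "integ (%x. indicator K x * c)"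
  using emeasure_compact_finite[of K]
  by (intro integrable_mult_left integrable_real_indicator) (auto intro: borel_compact)
qed simp

lemma test_integrable:
 assumes "phi : tests Om"
 shows "integ phi"
 using loc_int_mult_test[OF loc_int_UNIV_const assms, of 1] by simp

lemma kernel_integrable:
 fixes ka :: "'a::euclidean_space => real"
 assumes ka: "ka : tests UNIV" and w: "integ w"
 shows "integrable (lborel \<Otimes>\<^sub>M lborel) (%(y, x). ka (y - x) * w x)"
  and "integrable (lborel \<Otimes>\<^sub>M lborel) (%(y, x). ka (y - x) * w y)"
proof -
 have [measurable]: "ka : Bm" by (rule test_functions_measurable[OF ka])
 have [measurable]: "w : Bm" using w by auto
 define N where "N = (NN z. ennreal \<bar>ka z\<bar>)"
 have N: "N < \<infinity>" using test_integrable[OF ka] by (simp add: N_def integrable_iff_bounded)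
 have W: "(NN x. ennreal \<bar>w x\<bar>) < \<infinity>" using w by (simp add: integrable_iff_bounded)
 have 1: "(NN y. ennreal \<bar>ka (y - x) * c\<bar>) = N * ennreal \<bar>c\<bar>" for x c
  using nn_integral_shift[of "%z. ennreal \<bar>ka z\<bar>" "- x"]
  by (simp add: abs_mult ennreal_mult nn_integral_multc N_def)
 have 2: "(NN x. ennreal \<bar>ka (y - x) * c\<bar>) = N * ennreal \<bar>c\<bar>" for y c
  using nn_integral_reflect[of "%z. ennreal \<bar>ka z\<bar>" y]
  by (simp add: abs_mult ennreal_mult nn_integral_multc N_def)
 have NW: "N * (NN x. ennreal \<bar>w x\<bar>) < \<infinity>" using N W by (simp add: ennreal_mult_less_top)
 show "integrable (lborel \<Otimes>\<^sub>M lborel) (%(y, x). ka (y - x) * w x)"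
 proof (rule lborel_pair.integrable_prodI')
  show "(NN x. NN y. ennreal \<bar>ka (y - x) * w x\<bar>) < \<infinity>"
   unfolding 1 using NW by (simp add: nn_integral_cmult)
 qed measurable
 show "integrable (lborel \<Otimes>\<^sub>M lborel) (%(y, x). ka (y - x) * w y)"
 proof (rule lborel_pair.integrable_prodI)
  show "(NN y. NN x. ennreal \<bar>ka (y - x) * w y\<bar>) < \<infinity>"
   unfolding 2 using NW by (simp add: nn_integral_cmult)
 qed measurable
qed

lemma kernel_Fubini:
 fixes ka V E :: "'a::euclidean_space => real"
 assumes ka: "ka : tests UNIV"
  and [measurable]: "V : Bm" "E : Bm"
  and V: "!!x. \<bar>V x\<bar> <= S" "integ (%x. (V x)^2)"
  and e: "integ e1" "integ (%x. (e2 x)^2)" "!!x. \<bar>E x\<bar> <= \<bar>e1 x\<bar> + \<bar>e2 x\<bar>"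
 shows "(LBINT y. V y * (LBINT x. ka (y - x) * E x)) = (LBINT x. E x * (LBINT y. ka (y - x) * V y))"
  and "integ (%y. V y * (LBINT x. ka (y - x) * E x))"
proof -
 have [measurable]: "ka : Bm" by (rule test_functions_measurable[OF ka])
 have S: "0 <= S" using V(1)[of 0] by linarith
 have i: "integrable (lborel \<Otimes>\<^sub>M lborel) (%(y, x). V y * (ka (y - x) * E x))"
 proof (rule Bi_integrable_bound)
  show "integrable (lborel \<Otimes>\<^sub>M lborel) (%z. \<bar>case z of (y, x) => ka (y - x) * (S * \<bar>e1 x\<bar> + (e2 x)^2)\<bar> + \<bar>case z of (y, x) => ka (y - x) * (V y)^2\<bar>)"
   using e V by (intro Bi_integrable_add integrable_abs kernel_integrable[OF ka] integrable_mult_right) auto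
  show "(%(y, x). V y * (ka (y - x) * E x)) : borel_measurable (lborel \<Otimes>\<^sub>M lborel)" by measurable
  have "\<bar>V y * (k * E x)\<bar> <= \<bar>k * (S * \<bar>e1 x\<bar> + (e2 x)^2)\<bar> + \<bar>k * (V y)^2\<bar>" for x y k
  proof -
   have "\<bar>V y\<bar> * \<bar>E x\<bar> <= \<bar>V y\<bar> * (\<bar>e1 x\<bar> + \<bar>e2 x\<bar>)" by (intro mult_left_mono e) simp
   also have "... <= S * \<bar>e1 x\<bar> + ((V y)^2 + (e2 x)^2)"
   proof -
    have "\<bar>V y\<bar> * \<bar>e1 x\<bar> <= S * \<bar>e1 x\<bar>" by (intro mult_right_mono V) simp
    moreover have "0 <= \<bar>V y\<bar> * \<bar>e2 x\<bar>" by simp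
    moreover have "2 * (\<bar>V y\<bar> * \<bar>e2 x\<bar>) <= (V y)^2 + (e2 x)^2"
     using sum_squares_bound[of "\<bar>V y\<bar>" "\<bar>e2 x\<bar>"] by (simp add: mult.assoc)
    ultimately show ?thesis unfolding distrib_left by linarith
   qed
   finally have "\<bar>k\<bar> * (\<bar>V y\<bar> * \<bar>E x\<bar>) <= \<bar>k\<bar> * (S * \<bar>e1 x\<bar> + ((V y)^2 + (e2 x)^2))" by (rule mult_left_mono) simp
   moreover have e: "\<bar>S * \<bar>e1 x\<bar> + (e2 x)^2\<bar> = S * \<bar>e1 x\<bar> + (e2 x)^2" using S by simp
   moreover have "\<bar>V y * (k * E x)\<bar> = \<bar>k\<bar> * (\<bar>V y\<bar> * \<bar>E x\<bar>)" by (simp only: abs_mult mult.left_commute)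
   moreover have "\<bar>k * (S * \<bar>e1 x\<bar> + (e2 x)^2)\<bar> + \<bar>k * (V y)^2\<bar> = \<bar>k\<bar> * (S * \<bar>e1 x\<bar> + ((V y)^2 + (e2 x)^2))"
    unfolding abs_mult e abs_power2 by (simp only: distrib_left add_ac)
   ultimately show ?thesis by linarith
  qed
  then show "AE z in lborel \<Otimes>\<^sub>M lborel. norm (case z of (y, x) => V y * (ka (y - x) * E x)) <= norm (\<bar>case z of (y, x) => ka (y - x) * (S * \<bar>e1 x\<bar> + (e2 x)^2)\<bar> + \<bar>case z of (y, x) => ka (y - x) * (V y)^2\<bar>)"
   by (intro AE_I2) (simp add: case_prod_beta)
 qed
 have "(LBINT y. V y * (LBINT x. ka (y - x) * E x)) = (LBINT y. LBINT x. V y * (ka (y - x) * E x))" by simp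
 also have "... = (LBINT x. LBINT y. V y * (ka (y - x) * E x))"
  by (rule lborel_pair.Fubini_integral[OF i, symmetric])
 also have "... = (LBINT x. LBINT y. E x * (ka (y - x) * V y))" by (simp add: mult_ac)
 finally show "(LBINT y. V y * (LBINT x. ka (y - x) * E x)) = (LBINT x. E x * (LBINT y. ka (y - x) * V y))" by simp
 show "integ (%y. V y * (LBINT x. ka (y - x) * E x))"
  using lborel_pair.integrable_fst[OF i] by simp
qed

lemma integration_by_parts_test:
 fixes V W :: "'a::euclidean_space => real"
 assumes psi: "psi : tests UNIV"
  and l: "AEl x. line_ac (%s. V (x + s *R v)) (%s. W (x + s *R v))"
  and [measurable]: "V : Bm" "W : Bm"
  and V: "integ (%x. (V x)^2)" and W: "integ (%x. (W x)^2)"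
 shows "(LBINT y. FD psi (at y) v * V y) = - (LBINT y. psi y * W y)"
proof -
 note d = test_functions_frechet[OF psi, of v]
 have m: "psi : Bm" "(%x. FD psi (at x) v) : Bm"
  by (rule test_functions_measurable[OF psi] test_functions_measurable[OF d])+
 note [measurable] = m
 have i: "integ (%x. psi x * W x)" "integ (%x. FD psi (at x) v * V x)" "integ (%x. psi x * V x)"
  using loc_int_mult_test[OF loc_int_of_square_integrable[OF _ W] psi] loc_int_mult_test[OF loc_int_of_square_integrable[OF _ V] d]
   loc_int_mult_test[OF loc_int_of_square_integrable[OF _ V] psi] by auto
 have "(LBINT x. psi x * W x + FD psi (at x) v * V x) = 0"
 proof (rule integral_line_derivative_zero[where f="%x. psi x * V x" and v=v])
  show "AEl x. line_ac (%s. psi (x + s *R v) * V (x + s *R v))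
   (%s. psi (x + s *R v) * W (x + s *R v) + FD psi (at (x + s *R v)) v * V (x + s *R v))"
   using l
  proof eventually_elim
   case (elim x)
   show ?case
    by (rule line_ac_mult[OF line_ac_test[OF psi] elim]; (rule measurable_compose[OF _ m(1)] measurable_compose[OF _ m(2)])?; measurable)
  qed
 qed (use i in auto)
 then show ?thesis using i by simp
qed

lemma frechet_translate:
 "phi : tests Om ==> FD (%y. phi (y - x)) (at y) v = FD phi (at (y - x)) v"
 using frechet_affine[of "%y. y" phi y "- x" v] test_functions_differentiable[of phi Om]
 by (simp add: bounded_linear_ident)

lemma test_translate: "phi : tests UNIV ==> (%y. phi (y - x)) : tests UNIV"
 by (rule test_functions_shift_back) auto

text \<open>
 A pointwise equation for mollified quantities is multiplied by \<open>V\<close> and integrated; the derivatives move from the kernel to \<open>V\<close>, and the kernels then concentrate. This admits multipliers that are not smooth, such as those built from the solutions themselves.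
\<close>

theorem test_mollified_equation:
 fixes V :: "real^3 => real" and V1 V2 :: "3 => real^3 => real" and E2 :: "3 => real^3 => real"
 assumes eq: "!!n. AEl y. (LBINT x. mollifier n (y - x) * (Ea x + Eb x)) =
   (SUM3 k. LBINT x. FD (%z. FD (mollifier n) (at z) (axis k 1)) (at (y - x)) (axis k 1) * E1 x)
   - 2 * (SUM3 k. LBINT x. FD (mollifier n) (at (y - x)) (axis k 1) * E2 k x)"
  and mE[measurable]: "Ea : Bm" "Eb : Bm" "E1 : Bm" "!!k. E2 k : Bm"
   "a : Bm" "!!k. b k : Bm"
  and Ea: "integ Ea" and Eb: "integ (%x. (Eb x)^2)" and E1: "integ (%x. (E1 x)^2)"
  and E2: "!!k x. \<bar>E2 k x\<bar> <= \<bar>a x * b k x\<bar>" and a: "integ (%x. (a x)^2)"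
  and b: "!!k. integ (%x. (b k x)^2)" "!!k. integ (%x. (b k x) ^ 4)"
  and mV[measurable]: "V : Bm" "!!k. V1 k : Bm" "!!k. V2 k : Bm"
  and VS: "!!x. \<bar>V x\<bar> <= S" and V: "integ (%x. (V x)^2)"
  and V1: "!!k. integ (%x. (V1 k x)^2)" "!!k. integ (%x. (V1 k x) ^ 4)"
  and V2: "!!k. integ (%x. (V2 k x)^2)"
  and l1: "!!k. AEl x. line_ac (%s. V (x + s *R axis k 1)) (%s. V1 k (x + s *R axis k 1))"
  and l2: "!!k. AEl x. line_ac (%s. V1 k (x + s *R axis k 1)) (%s. V2 k (x + s *R axis k 1))"
 shows "(LBINT x. Ea x * V x) + (LBINT x. Eb x * V x) = (SUM3 k. LBINT x. E1 x * V2 k x) + 2 * (SUM3 k. LBINT x. E2 k x * V1 k x)"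
proof -
 let ?mu = "%n. mollifier_measure n :: (real^3) measure"
 let ?k1 = "%n k z. FD (mollifier n :: real^3 => real) (at z) (axis k 1)"
 let ?k2 = "%n k z. FD (?k1 n k) (at z) (axis k 1)"
 have t1: "?k1 n k : tests UNIV" for n k by (rule test_functions_frechet[OF mollifier_test])
 have t2: "?k2 n k : tests UNIV" for n k by (rule test_functions_frechet[OF t1])
 have iE2: "integ (%x. a x * b k x)" for k by (intro CS_integrable a b) auto
 have parts1: "(LBINT y. ?k1 n k (y - x) * V y) = - avg (?mu n) (V1 k) x" for n k x
  using integration_by_parts_test[OF test_translate[OF mollifier_test[of n], of x] l1[of k] _ _ V V1(1)]
  by (simp add: frechet_translate[OF mollifier_test] avg_mollifier(2))
 have parts2: "(LBINT y. ?k2 n k (y - x) * V y) = avg (?mu n) (V2 k) x" for n k x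
 proof -
  have "(LBINT y. ?k2 n k (y - x) * V y) = - (LBINT y. ?k1 n k (y - x) * V1 k y)"
   using integration_by_parts_test[OF test_translate[OF t1[of n k], of x] l1[of k] _ _ V V1(1)]
   by (simp add: frechet_translate[OF t1])
  also have "(LBINT y. ?k1 n k (y - x) * V1 k y) = - avg (?mu n) (V2 k) x"
   using integration_by_parts_test[OF test_translate[OF mollifier_test[of n], of x] l2[of k] _ _ V1(1) V2]
   by (simp add: frechet_translate[OF mollifier_test] avg_mollifier(2))
  finally show ?thesis by simp
 qed
 have av: "(LBINT y. mollifier n (y - x) * V y) = avg (?mu n) V x" for n x
  by (simp add: avg_mollifier(2))
 have [measurable]: "avg (?mu n) V : Bm" "avg (?mu n) (V1 k) : Bm" "avg (?mu n) (V2 k) : Bm" for n k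
  by (intro avg_measurable averaging_mollifier mV)+
 note pair2 = avg_pairing_tendsto_L2[where mu="?mu", OF averaging_mollifier mollifier_measure_small]
 note pair4 = avg_pairing_tendsto_L4[where mu="?mu", OF averaging_mollifier mollifier_measure_small]
 have avS: "\<bar>avg (?mu n) V x\<bar> <= S" for n x
 proof -
  have S: "0 <= S" using VS[of 0] by linarith
  have "ennreal \<bar>avg (?mu n) V x\<bar> <= (\<integral>\<^sup>+y. ennreal \<bar>V (x + y)\<bar> \<partial>?mu n)"
   using avg_power_le[OF averaging_mollifier mV(1), of 1 n x] by simp
  also have "... <= (\<integral>\<^sup>+y. ennreal S \<partial>?mu n)" by (intro nn_integral_mono ennreal_leI VS)
  also have "... = ennreal S" using averagingD(2,3)[OF averaging_mollifier[of n, where 'a="real^3"]] by simp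
  finally show ?thesis using S by (simp add: ennreal_le_iff)
 qed
 have id: "(LBINT x. Ea x * avg (?mu n) V x) + (LBINT x. Eb x * avg (?mu n) V x)
  = (SUM3 k. LBINT x. E1 x * avg (?mu n) (V2 k) x) + 2 * (SUM3 k. LBINT x. E2 k x * avg (?mu n) (V1 k) x)" for n
 proof -
  note KE = kernel_Fubini[OF mollifier_test[of n] mV(1) _ VS V, where ?E="%x. Ea x + Eb x" and ?e1.0=Ea and ?e2.0=Eb]
  note K1 = kernel_Fubini[OF t2[of n] mV(1) mE(3) VS V, where ?e1.0="%x. 0" and ?e2.0=E1]
  note K2 = kernel_Fubini[OF t1[of n] mV(1) mE(4) VS V iE2, where ?e2.0="%x. 0"]
  have iEa: "integ (%x. Ea x * avg (?mu n) V x)"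
  proof (rule Bi_integrable_bound)
   show "integ (%x. S * Ea x)" using Ea by simp
   show "AEl x. norm (Ea x * avg (?mu n) V x) <= norm (S * Ea x)"
    using avS[of n] by (intro AE_I2) (auto simp: abs_mult mult.commute[of "\<bar>S\<bar>"] intro!: mult_left_mono intro: order_trans[OF _ abs_ge_self])
  qed measurable
  have iEb: "integ (%x. Eb x * avg (?mu n) V x)" by (rule pair2(2)[OF mV(1) mE(2) V Eb])
  have "(LBINT x. Ea x * avg (?mu n) V x) + (LBINT x. Eb x * avg (?mu n) V x) = (LBINT x. (Ea x + Eb x) * avg (?mu n) V x)"
   using iEa iEb by (simp add: distrib_right)
  also have "... = (LBINT y. V y * (LBINT x. mollifier n (y - x) * (Ea x + Eb x)))"
   unfolding av[symmetric] by (rule KE(1)[symmetric]) (use Ea Eb in \<open>auto simp: abs_triangle_ineq\<close>)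
  also have "... = (LBINT y. (SUM3 k. V y * (LBINT x. ?k2 n k (y - x) * E1 x)) - 2 * (SUM3 k. V y * (LBINT x. ?k1 n k (y - x) * E2 k x)))"
  proof (rule integral_cong_AE)
   show "AEl y. V y * (LBINT x. mollifier n (y - x) * (Ea x + Eb x))
    = (SUM3 k. V y * (LBINT x. ?k2 n k (y - x) * E1 x)) - 2 * (SUM3 k. V y * (LBINT x. ?k1 n k (y - x) * E2 k x))"
    using eq[of n] by eventually_elim (simp add: right_diff_distrib sum_distrib_left mult.left_commute[of "V _" 2])
   show "(%y. V y * (LBINT x. mollifier n (y - x) * (Ea x + Eb x))) : borel_measurable lborel"
    by (rule borel_measurable_integrable[OF KE(2)]) (use Ea Eb in \<open>auto simp: abs_triangle_ineq\<close>)
   show "(%y. (SUM3 k. V y * (LBINT x. ?k2 n k (y - x) * E1 x)) - 2 * (SUM3 k. V y * (LBINT x. ?k1 n k (y - x) * E2 k x))) : borel_measurable lborel"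
    by (intro borel_measurable_diff borel_measurable_times borel_measurable_sum borel_measurable_const
      borel_measurable_integrable[OF K1(2)] borel_measurable_integrable[OF K2(2)]) (use E1 E2 in auto)
  qed
  also have "... = (SUM3 k. LBINT y. V y * (LBINT x. ?k2 n k (y - x) * E1 x)) - 2 * (SUM3 k. LBINT y. V y * (LBINT x. ?k1 n k (y - x) * E2 k x))"
  proof -
   have a: "integ (%y. V y * (LBINT x. ?k2 n k (y - x) * E1 x))" for k by (rule K1(2)) (use E1 in auto)
   have b: "integ (%y. V y * (LBINT x. ?k1 n k (y - x) * E2 k x))" for k by (rule K2(2)) (use E2 in auto)
   have "(LBINT y. (SUM3 k. V y * (LBINT x. ?k2 n k (y - x) * E1 x)) - 2 * (SUM3 k. V y * (LBINT x. ?k1 n k (y - x) * E2 k x)))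
    = (LBINT y. (SUM3 k. V y * (LBINT x. ?k2 n k (y - x) * E1 x))) - (LBINT y. 2 * (SUM3 k. V y * (LBINT x. ?k1 n k (y - x) * E2 k x)))"
    by (intro Bi_integral_diff Bi_integrable_sum integrable_mult_right a b)
   also have "(LBINT y. (SUM3 k. V y * (LBINT x. ?k2 n k (y - x) * E1 x))) = (SUM3 k. LBINT y. V y * (LBINT x. ?k2 n k (y - x) * E1 x))"
    by (rule Bi_integral_sum[OF a])
   also have "(LBINT y. 2 * (SUM3 k. V y * (LBINT x. ?k1 n k (y - x) * E2 k x))) = 2 * (SUM3 k. LBINT y. V y * (LBINT x. ?k1 n k (y - x) * E2 k x))"
    unfolding integral_mult_right_zero by (simp only: Bi_integral_sum[OF b])
   finally show ?thesis .
  qed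
  also have "(SUM3 k. LBINT y. V y * (LBINT x. ?k2 n k (y - x) * E1 x)) = (SUM3 k. LBINT x. E1 x * avg (?mu n) (V2 k) x)"
   unfolding parts2[symmetric] by (intro sum.cong refl K1(1)) (use E1 in auto)
  also have "(SUM3 k. LBINT y. V y * (LBINT x. ?k1 n k (y - x) * E2 k x)) = (SUM3 k. LBINT x. E2 k x * (LBINT y. ?k1 n k (y - x) * V y))"
   by (intro sum.cong refl K2(1)) (use E2 in auto)
  also have "... = - (SUM3 k. LBINT x. E2 k x * avg (?mu n) (V1 k) x)"
   unfolding parts1 by (simp add: sum_negf)
  finally show ?thesis by simp
 qed
 obtain r :: "nat => nat" where r: "strict_mono r" and ae: "AEl x. (%n. avg (?mu (r n)) V x) ---> V x"
  by (rule avg_AE_subsequence[of ?mu, OF averaging_mollifier mollifier_measure_small mV(1) V])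
 have La: "(%n. LBINT x. Ea x * avg (?mu (r n)) V x) ---> (LBINT x. Ea x * V x)"
 proof (rule integral_dominated_convergence[where w="%x. S * \<bar>Ea x\<bar>"])
  show "AEl x. (%n. Ea x * avg (?mu (r n)) V x) ---> Ea x * V x"
   using ae by eventually_elim (intro tendsto_intros)
  show "AEl x. norm (Ea x * avg (?mu (r n)) V x) <= S * \<bar>Ea x\<bar>" for n
   using avS[of "r n"] by (intro AE_I2) (auto simp: abs_mult mult.commute[of S] intro!: mult_left_mono)
 qed (use Ea in auto)
 have Lb: "(%n. LBINT x. Eb x * avg (?mu (r n)) V x) ---> (LBINT x. Eb x * V x)"
  by (rule LIMSEQ_subseq_LIMSEQ[OF pair2(1)[OF mV(1) mE(2) V Eb] r, unfolded comp_def])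
 have L1: "(%n. LBINT x. E1 x * avg (?mu (r n)) (V2 k) x) ---> (LBINT x. E1 x * V2 k x)" for k
  by (rule LIMSEQ_subseq_LIMSEQ[OF pair2(1)[OF mV(3) mE(3) V2 E1] r, unfolded comp_def])
 have L2: "(%n. LBINT x. E2 k x * avg (?mu (r n)) (V1 k) x) ---> (LBINT x. E2 k x * V1 k x)" for k
  by (rule LIMSEQ_subseq_LIMSEQ[OF pair4(1)[OF mV(2) mE(4) mE(5) mE(6) V1(2) a b(2) E2] r, unfolded comp_def])
 have R: "(%n. (SUM3 k. LBINT x. E1 x * avg (?mu (r n)) (V2 k) x) + 2 * (SUM3 k. LBINT x. E2 k x * avg (?mu (r n)) (V1 k) x))
  ---> (SUM3 k. LBINT x. E1 x * V2 k x) + 2 * (SUM3 k. LBINT x. E2 k x * V1 k x)"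
  by (intro tendsto_add tendsto_mult tendsto_const tendsto_sum L1 L2)
 show ?thesis
  by (rule LIMSEQ_unique[OF tendsto_add[OF La Lb]]) (unfold id, rule R)
qed

section \<open>Pointwise algebra of the difference of two solutions\<close>

text \<open>
 A function that is absolutely continuous along lines and almost everywhere constant has zero derivative. This gives the identities that follow from a pointwise constraint.
\<close>

lemma line_derivative_of_constant_zero:
 fixes F f :: "'a::euclidean_space => real"
 assumes op: "open Om" and fwd: "!!x s. x \<in> Om ==> 0 <= s ==> x + s *R v \<in> Om"
  and l: "AEl x. x \<in> Om --> line_ac (%s. F (x + s *R v)) (%s. f (x + s *R v))"
  and [measurable]: "F : Bm" "f : Bm"
  and c: "AEl x. x \<in> Om --> F x = c"
 shows "AEl x. x \<in> Om --> f x = 0"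
proof -
 have [measurable]: "Om \<in> sets borel" using op by simp
 have "AEl s. AEl x. 0 < s --> x \<in> Om --> F (x + s *R v) = c"
 proof (rule AE_I2)
  fix s :: real
  from AE_shift[OF c, of "s *R v"]
  show "AEl x. 0 < s --> x \<in> Om --> F (x + s *R v) = c"
   by eventually_elim (use fwd in auto)
 qed
 then have cs: "AEl x. AEl s. 0 < s --> x \<in> Om --> F (x + s *R v) = c"
  by (rule lborel_pair.AE_commute[THEN iffD1, rotated]) measurable
 have "AEl x. AEl s. 0 < s --> x \<in> Om --> f (x + s *R v) = 0"
  using l cs c
 proof eventually_elim
  case (elim x)
  show ?case
  proof (cases "x \<in> Om")
   case True
   then have L: "line_ac (%s. F (x + s *R v)) (%s. f (x + s *R v))" and Fx: "F x = c" using elim by auto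
   have "AEl s. 0 < s --> f (x + s *R v) = 0"
   proof (rule zero_if_segment_integrals_zero[OF line_ac_integrable[OF L]])
    have "AEl r. 0 < r --> F (x + r *R v) = F (x + 0 *R v) + (LBINT s. indicator {0..r} s * f (x + s *R v))"
     using L by (simp add: line_ac_def)
    with elim(2) show "AEl r. 0 < r --> (LBINT s. indicator {0..r} s * f (x + s *R v)) = 0"
     by eventually_elim (use True Fx in auto)
   qed measurable
   then show ?thesis by eventually_elim auto
  qed simp
 qed
 then have "AEl s. AEl x. 0 < s --> x \<in> Om --> f (x + s *R v) = 0"
  by (rule lborel_pair.AE_commute[THEN iffD1, rotated]) measurable
 then have s: "AEl s. 0 < s --> (AEl x. x \<in> Om --> f (x + s *R v) = 0)"
  by eventually_elim auto
 have "\<exists>s>0. s < e \<and> (AEl x. x \<in> Om --> f (x + s *R v) = 0)" if e: "0 < e" for e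
 proof (rule ccontr)
  assume *: "\<not> ?thesis"
  have "AEl s. s \<notin> {0<..<e}" using s by eventually_elim (use * in auto)
  then have "{0<..<e} \<in> null_sets lborel" by (subst AE_iff_null_sets) auto
  then show False using e by (auto simp: null_sets_def)
 qed
 then have "\<forall>n. \<exists>s>0. s < 1 / real (Suc n) \<and> (AEl x. x \<in> Om --> f (x + s *R v) = 0)" by simp
 then obtain si where si: "!!n. 0 < si n" "!!n. si n < 1 / real (Suc n)"
  "!!n. AEl x. x \<in> Om --> f (x + si n *R v) = 0" by metis
 have "AEl x. \<forall>n. x - si n *R v \<in> Om --> f x = 0"
  using AE_shift[OF si(3), of "- (si n *R v)" n for n] by (subst AE_all_countable) simp
 then show ?thesis
 proof eventually_elim
  case (elim x)
  show ?case
  proof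
   assume "x \<in> Om"
   have "si ---> 0"
   proof (rule tendsto_sandwich[OF _ _ tendsto_const])
    show "\<forall>\<^sub>F n in sequentially. 0 <= si n" using si(1) by (simp add: less_imp_le)
    show "\<forall>\<^sub>F n in sequentially. si n <= inverse (real (Suc n))" using si(2) by (simp add: less_imp_le inverse_eq_divide del: of_nat_Suc)
   qed (rule LIMSEQ_inverse_real_of_nat)
   then have "(%n. x - si n *R v) ---> x - 0 *R v" by (intro tendsto_intros)
   then have "eventually (%n. x - si n *R v \<in> Om) sequentially"
    using topological_tendstoD[OF _ op] \<open>x \<in> Om\<close> by simp
   then obtain n where "x - si n *R v \<in> Om" by (auto simp: eventually_sequentially)
   then show "f x = 0" using elim by blast
  qed
 qed
qed

lemma norm_cross_le: "norm (cross3 a b) <= norm a * norm b"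
proof (rule power2_le_imp_le)
 show "(norm (cross3 a b))^2 <= (norm a * norm b)^2"
  using norm_cross_dot[of a b] zero_le_power2[of "a \<bullet> b"] by linarith
qed simp

lemma inner_cross_le: "\<bar>cross3 a b \<bullet> c\<bar> <= norm a * norm b * norm c"
 using order_trans[OF Cauchy_Schwarz_ineq2 mult_right_mono[OF norm_cross_le norm_ge_zero]] .

lemma dot_cross3: "cross3 a b \<bullet> cross3 c d = (a \<bullet> c) * (b \<bullet> d) - (a \<bullet> d) * (b \<bullet> c)"
 by (simp add: cross3_def inner_vec_def sum_3 algebra_simps)

lemma cross_diff_diff: "cross3 a b - cross3 a' b' = cross3 a (b - b') + cross3 (a - a') b'"
 by (simp add: cross3_def vec_eq_iff forall_3 algebra_simps)

text \<open>
 The multiplier \<open>u + alpha m\<^sub>1 \<times> m\<^sub>2\<close> turns the damping terms into a multiple of \<open>\<partial>\<^sub>t u \<bullet> u\<close>, because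
 \<open>u \<times> m\<^sub>1 = u \<times> m\<^sub>2 = m\<^sub>1 \<times> m\<^sub>2\<close>.
\<close>

lemma multiplier_identity:
 fixes m1 m2 p1 p2 :: "real^3"
 assumes "m1 \<bullet> m1 = 1" "m2 \<bullet> m2 = 1" "p1 \<bullet> m1 = 0" "p2 \<bullet> m2 = 0"
 shows "((p1 - alpha *R cross3 m1 p1) - (p2 - alpha *R cross3 m2 p2)) \<bullet> ((m1 - m2) + alpha *R cross3 m1 m2) = (1 + alpha^2) * ((p1 - p2) \<bullet> (m1 - m2))"
proof -
 define T1 where "T1 = p1 \<bullet> cross3 m1 m2"
 define T2 where "T2 = p2 \<bullet> cross3 m1 m2"
 have 1: "cross3 m1 p1 \<bullet> m2 = - T1" "cross3 m2 p2 \<bullet> m1 = T2" "cross3 m1 p1 \<bullet> m1 = 0" "cross3 m2 p2 \<bullet> m2 = 0"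
  by (simp_all add: T1_def T2_def cross3_def inner_vec_def sum_3 algebra_simps)
 have 2: "cross3 m1 p1 \<bullet> cross3 m1 m2 = p1 \<bullet> m2" "cross3 m2 p2 \<bullet> cross3 m1 m2 = - (p2 \<bullet> m1)"
  unfolding dot_cross3 using assms by simp_all
 show ?thesis
  unfolding inner_diff_left inner_add_right inner_diff_right inner_scaleR_left inner_scaleR_right 1 2 assms T1_def[symmetric] T2_def[symmetric]
  by (simp add: algebra_simps power2_eq_square)
qed

lemma sum_mult_le_mult_sum:
 fixes a b :: "'i => real"
 assumes "finite I" "!!i. i \<in> I ==> 0 <= a i" "!!i. i \<in> I ==> 0 <= b i"
 shows "(\<Sum>i\<in>I. a i * b i) <= (\<Sum>i\<in>I. a i) * (\<Sum>i\<in>I. b i)"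
proof -
 have "(\<Sum>i\<in>I. a i * b i) <= (\<Sum>i\<in>I. a i * (\<Sum>i\<in>I. b i))"
  using assms by (intro sum_mono mult_left_mono member_le_sum) auto
 then show ?thesis by (simp add: sum_distrib_right)
qed

lemma young_quarter:
 fixes alpha l t :: real
 assumes "0 < alpha"
 shows "l * t <= alpha / 4 * l^2 + t^2 / alpha"
proof -
 have "0 <= (alpha / 2 * l - t)^2" by simp
 then have "alpha * (l * t) <= alpha^2 / 4 * l^2 + t^2" by (simp add: power2_eq_square algebra_simps)
 then have "alpha * (l * t) <= alpha * (alpha / 4 * l^2 + t^2 / alpha)" using assms by (simp add: distrib_left power2_eq_square)
 then show ?thesis using assms by simp
qed

definition energy_const :: "real => real => real" where
 "energy_const alpha h = 5 * alpha + (5 * alpha + 3)^2 / alpha + (1 + alpha)^2 / alpha + 2 * (1 + alpha) + \<bar>h\<bar> * (1 + alpha)"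

text \<open>
 The leading term \<open>(m \<times> Lu) \<bullet> (u + alpha m1 \<times> m2)\<close> dissipates the component of \<open>Lu\<close> orthogonal to the sphere's normal; the normal component is of lower order by the constraint. The rest contains \<open>l\<close> at most linearly and is absorbed by Young's inequality.
\<close>

lemma difference_energy_pointwise:
 fixes m1 m2 L1 L2 :: "real^3" and D1 D2 :: "3 => real^3"
 assumes alpha: "0 < alpha" and n1: "norm m1 = 1" and n2: "norm m2 = 1"
  and c1: "m1 \<bullet> L1 = - (SUM3 k. D1 k \<bullet> D1 k)" and c2: "m2 \<bullet> L2 = - (SUM3 k. D2 k \<bullet> D2 k)"
  and V: "V = (m1 - m2) + alpha *R cross3 m1 m2"
  and V1: "!!k. V1 k = (D1 k - D2 k) + alpha *R (cross3 (D1 k) m2 + cross3 m1 (D2 k))"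
  and LV: "LV = (L1 - L2) + alpha *R (cross3 L1 m2 + 2 *R (SUM3 k. cross3 (D1 k) (D2 k)) + cross3 m1 L2)"
  and nu: "nu = norm (m1 - m2)" and l: "l = norm (L1 - L2)" and N: "N = norm L1 + norm L2"
  and g: "g = (SUM3 k. norm (D1 k - D2 k))" and d: "d = (SUM3 k. norm (D1 k) + norm (D2 k))"
  and X: "X = nu * N + g * d + nu * d^2"
 shows "(cross3 m1 L1 - cross3 m2 L2) \<bullet> LV + 2 * (SUM3 k. (cross3 (D1 k) L1 - cross3 (D2 k) L2) \<bullet> V1 k)
   + (cross3 m1 L1 - cross3 m2 L2) \<bullet> V - h * (cross3 (m1 - m2) e3 \<bullet> V)
  <= - (alpha / 2) * l^2 + energy_const alpha h * (X^2 + N * g^2 + nu^2)" (is "?Q1 + ?Q2 + ?Q3 - ?Q4 <= _")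
  and "norm V <= (1 + alpha) * nu"
proof -
 define u where "u = m1 - m2"
 define Lu where "Lu = L1 - L2"
 define Du where "Du k = D1 k - D2 k" for k
 define gk where "gk k = norm (Du k)" for k
 define dk where "dk k = norm (D1 k) + norm (D2 k)" for k
 define R where "R = 2 *R (SUM3 k. cross3 (Du k) (D1 k)) + cross3 u L1"
 have gk0: "0 <= gk k" and dk0: "0 <= dk k" for k by (simp_all add: gk_def dk_def)
 have g': "g = (SUM3 k. gk k)" and d': "d = (SUM3 k. dk k)" by (simp_all add: g d gk_def Du_def dk_def)
 have nonneg: "0 <= nu" "0 <= l" "0 <= N" "0 <= g" "0 <= d" by (auto simp: nu l N g d intro!: sum_nonneg)
 have gd: "(SUM3 k. gk k * dk k) <= g * d" unfolding g' d' by (rule sum_mult_le_mult_sum) (auto simp: gk0 dk0)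
 have gg: "(SUM3 k. gk k * gk k) <= g^2" unfolding g' power2_eq_square by (rule sum_mult_le_mult_sum) (auto simp: gk0)
 have dd: "(SUM3 k. dk k * dk k) <= d^2" unfolding d' power2_eq_square by (rule sum_mult_le_mult_sum) (auto simp: dk0)
 have X0: "0 <= nu * N" "0 <= g * d" "0 <= nu * d^2" using nonneg by auto
 have X1: "nu * N <= X" "g * d + nu * N <= X" "g * d + nu * d^2 <= X" "g * d <= X" "0 <= X" using X0 by (auto simp: X)
 have Dn: "norm (D1 k) <= dk k" "norm (D2 k) <= dk k" for k by (simp_all add: dk_def)
 have Ln: "norm L1 <= N" "norm L2 <= N" by (simp_all add: N)
 have un: "norm u = nu" "norm Lu = l" by (simp_all add: u_def nu Lu_def l)
 have mm: "m1 \<bullet> m1 = 1" using n1 by (simp add: norm_eq_1)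
 \<comment> \<open>the multiplier and its derivatives in terms of the difference\<close>
 have cu: "cross3 m1 m2 = cross3 u m1"
  by (simp add: u_def cross3_def vec_eq_iff forall_3 algebra_simps)
 have V': "V = u + alpha *R cross3 u m1" by (simp add: V cu u_def)
 have "norm V <= norm u + alpha * norm (cross3 u m1)"
  unfolding V' by (rule order_trans[OF norm_triangle_ineq]) (use alpha in simp)
 also have "... <= nu + alpha * (nu * 1)" using norm_cross_le[of u m1] alpha by (simp add: un n1)
 finally show nV: "norm V <= (1 + alpha) * nu" by (simp add: distrib_right)
 have cD: "cross3 (D1 k) m2 + cross3 m1 (D2 k) = cross3 (Du k) m1 + cross3 u (D1 k)" for k
  by (simp add: u_def Du_def cross3_def vec_eq_iff forall_3 algebra_simps)
 have nV1: "norm (V1 k) <= (1 + alpha) * gk k + alpha * (nu * dk k)" for k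
 proof -
  have "norm (V1 k) <= norm (Du k) + alpha * norm (cross3 (Du k) m1 + cross3 u (D1 k))"
   unfolding V1 cD Du_def by (rule order_trans[OF norm_triangle_ineq]) (use alpha in simp)
  also have "norm (cross3 (Du k) m1 + cross3 u (D1 k)) <= gk k * 1 + nu * dk k"
  proof (rule order_trans[OF norm_triangle_ineq add_mono])
   show "norm (cross3 (Du k) m1) <= gk k * 1" using norm_cross_le[of "Du k" m1] by (simp add: gk_def n1)
   show "norm (cross3 u (D1 k)) <= nu * dk k"
    by (rule order_trans[OF norm_cross_le]) (simp add: un mult_left_mono Dn nonneg)
  qed
  finally show ?thesis using alpha by (simp add: gk_def algebra_simps)
 qed
 have "cross3 L1 m2 + 2 *R (SUM3 k. cross3 (D1 k) (D2 k)) + cross3 m1 L2 = cross3 Lu m1 + R"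
  by (simp add: R_def u_def Lu_def Du_def cross3_def vec_eq_iff forall_3 sum_3 algebra_simps)
 then have LV': "LV = Lu + alpha *R (cross3 Lu m1 + R)" by (simp add: LV Lu_def)
 have nR: "norm R <= 2 * X"
 proof -
  have "norm (SUM3 k. cross3 (Du k) (D1 k)) <= (SUM3 k. gk k * dk k)"
  proof (rule order_trans[OF norm_sum sum_mono])
   fix k show "norm (cross3 (Du k) (D1 k)) <= gk k * dk k"
    by (rule order_trans[OF norm_cross_le]) (simp add: gk_def mult_left_mono Dn)
  qed
  then have 1: "norm (2 *R (SUM3 k. cross3 (Du k) (D1 k))) <= 2 * (g * d)" using gd by simp
  have 2: "norm (cross3 u L1) <= nu * N" by (rule order_trans[OF norm_cross_le]) (simp add: un mult_left_mono Ln nonneg)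
  have "norm R <= 2 * (g * d) + nu * N" unfolding R_def by (rule order_trans[OF norm_triangle_ineq add_mono[OF 1 2]])
  then show ?thesis using X1 X0 by linarith
 qed
 have nLV: "norm LV <= l + alpha * (l + 2 * X)"
 proof -
  have 1: "norm (cross3 Lu m1) <= l" using norm_cross_le[of Lu m1] by (simp add: un n1)
  have "norm (cross3 Lu m1 + R) <= l + 2 * X" by (rule order_trans[OF norm_triangle_ineq add_mono[OF 1 nR]])
  then have "norm (alpha *R (cross3 Lu m1 + R)) <= alpha * (l + 2 * X)" using alpha by simp
  then show ?thesis unfolding LV' using norm_triangle_ineq[of Lu "alpha *R (cross3 Lu m1 + R)"] un by linarith
 qed
 have m1Lu: "\<bar>m1 \<bullet> Lu\<bar> <= X"
 proof -
  have "m1 \<bullet> Lu = m1 \<bullet> L1 - m2 \<bullet> L2 - u \<bullet> L2" by (simp add: Lu_def u_def inner_diff_left inner_diff_right)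
  also have "... = - (SUM3 k. Du k \<bullet> (D1 k + D2 k)) - u \<bullet> L2"
  proof -
   have "Du k \<bullet> (D1 k + D2 k) = D1 k \<bullet> D1 k - D2 k \<bullet> D2 k" for k
    by (simp add: Du_def inner_diff_left inner_add_right inner_commute[of "D2 k" "D1 k"])
   then show ?thesis unfolding c1 c2 by (simp add: sum_subtractf)
  qed
  finally have "\<bar>m1 \<bullet> Lu\<bar> <= \<bar>SUM3 k. Du k \<bullet> (D1 k + D2 k)\<bar> + \<bar>u \<bullet> L2\<bar>" by linarith
  moreover have "\<bar>SUM3 k. Du k \<bullet> (D1 k + D2 k)\<bar> <= (SUM3 k. gk k * dk k)"
  proof (rule order_trans[OF sum_abs sum_mono])
   fix k
   have "\<bar>Du k \<bullet> (D1 k + D2 k)\<bar> <= norm (Du k) * norm (D1 k + D2 k)" by (rule Cauchy_Schwarz_ineq2)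
   also have "... <= gk k * dk k" unfolding gk_def dk_def by (intro mult_left_mono norm_triangle_ineq) simp
   finally show "\<bar>Du k \<bullet> (D1 k + D2 k)\<bar> <= gk k * dk k" .
  qed
  moreover have "\<bar>u \<bullet> L2\<bar> <= nu * N"
   by (rule order_trans[OF Cauchy_Schwarz_ineq2]) (simp add: un mult_left_mono Ln nonneg)
  ultimately show ?thesis using gd X1(2) by linarith
 qed
 \<comment> \<open>the dissipative term\<close>
 have diss: "cross3 m1 Lu \<bullet> LV <= - alpha * l^2 + alpha * X^2 + 2 * alpha * (l * X)"
 proof -
  have e: "cross3 m1 Lu \<bullet> LV = alpha * ((m1 \<bullet> Lu)^2 - Lu \<bullet> Lu) + alpha * (cross3 m1 Lu \<bullet> R)"
   unfolding LV' inner_add_right inner_scaleR_right dot_cross3 mm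
   by (simp add: dot_cross_self power2_eq_square inner_commute algebra_simps)
  have "(m1 \<bullet> Lu)^2 <= X^2" using m1Lu X1(5) by (simp add: abs_le_square_iff[symmetric])
  then have a1: "alpha * (m1 \<bullet> Lu)^2 <= alpha * X^2" using alpha by simp
  have "cross3 m1 Lu \<bullet> R <= norm m1 * norm Lu * norm R" using inner_cross_le[of m1 Lu R] by linarith
  also have "... <= l * (2 * X)" using nR by (simp add: n1 un mult_left_mono nonneg)
  finally have "alpha * (cross3 m1 Lu \<bullet> R) <= alpha * (l * (2 * X))" using alpha by simp
  moreover have "Lu \<bullet> Lu = l^2" by (simp add: un[symmetric] power2_norm_eq_inner)
  ultimately show ?thesis unfolding e using a1 by (simp add: algebra_simps)
 qed
 have q2: "cross3 u L2 \<bullet> LV <= X * (l + alpha * (l + 2 * X))"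
 proof -
  have "cross3 u L2 \<bullet> LV <= norm u * norm L2 * norm LV" using inner_cross_le[of u L2 LV] by linarith
  also have "... <= (nu * N) * (l + alpha * (l + 2 * X))"
   by (intro mult_mono nLV) (auto simp: un nonneg Ln mult_left_mono)
  also have "... <= X * (l + alpha * (l + 2 * X))" using X1 nonneg alpha by (intro mult_right_mono) auto
  finally show ?thesis .
 qed
 have Q1: "?Q1 <= - alpha * l^2 + alpha * X^2 + 2 * alpha * (l * X) + X * (l + alpha * (l + 2 * X))"
  unfolding cross_diff_diff inner_add_left Lu_def[symmetric] u_def[symmetric] using diss q2 by linarith
 have Q2: "?Q2 <= 2 * ((1 + alpha) * (l * X)) + (2 * (1 + alpha) * (N * g^2) + 2 * alpha * X^2)"
 proof -
  have s1: "(SUM3 k. cross3 (D1 k) Lu \<bullet> V1 k) <= (1 + alpha) * (l * X)"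
  proof -
   have "(SUM3 k. cross3 (D1 k) Lu \<bullet> V1 k) <= (SUM3 k. l * ((1 + alpha) * (gk k * dk k) + alpha * nu * (dk k * dk k)))"
   proof (rule sum_mono)
    fix k
    have "cross3 (D1 k) Lu \<bullet> V1 k <= norm (D1 k) * norm Lu * norm (V1 k)" using inner_cross_le[of "D1 k" Lu "V1 k"] by linarith
    also have "... <= (dk k * l) * ((1 + alpha) * gk k + alpha * (nu * dk k))"
     by (intro mult_mono nV1) (auto simp: un nonneg Dn dk0 mult_right_mono)
    finally show "cross3 (D1 k) Lu \<bullet> V1 k <= l * ((1 + alpha) * (gk k * dk k) + alpha * nu * (dk k * dk k))" by (simp add: algebra_simps)
   qed
   also have "... = l * ((1 + alpha) * (SUM3 k. gk k * dk k) + alpha * nu * (SUM3 k. dk k * dk k))"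
    by (simp only: sum_distrib_left sum.distrib[symmetric] distrib_left)
   also have "... <= l * ((1 + alpha) * (g * d) + alpha * nu * d^2)"
    using gd dd alpha nonneg by (intro mult_left_mono add_mono) auto
   also have "... <= l * ((1 + alpha) * (g * d + nu * d^2))" using X0 nonneg by (intro mult_left_mono) (auto simp: algebra_simps)
   also have "... <= l * ((1 + alpha) * X)" using X1(3) alpha nonneg by (intro mult_left_mono) auto
   finally show ?thesis by (simp add: mult.left_commute)
  qed
  have s2: "(SUM3 k. cross3 (Du k) L2 \<bullet> V1 k) <= (1 + alpha) * (N * g^2) + alpha * X^2"
  proof -
   have "(SUM3 k. cross3 (Du k) L2 \<bullet> V1 k) <= (SUM3 k. N * ((1 + alpha) * (gk k * gk k) + alpha * nu * (gk k * dk k)))"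
   proof (rule sum_mono)
    fix k
    have "cross3 (Du k) L2 \<bullet> V1 k <= norm (Du k) * norm L2 * norm (V1 k)" using inner_cross_le[of "Du k" L2 "V1 k"] by linarith
    also have "... <= (gk k * N) * ((1 + alpha) * gk k + alpha * (nu * dk k))"
     by (intro mult_mono nV1) (auto simp: gk_def[symmetric] nonneg Ln gk0 mult_left_mono)
    finally show "cross3 (Du k) L2 \<bullet> V1 k <= N * ((1 + alpha) * (gk k * gk k) + alpha * nu * (gk k * dk k))" by (simp add: algebra_simps)
   qed
   also have "... = N * ((1 + alpha) * (SUM3 k. gk k * gk k) + alpha * nu * (SUM3 k. gk k * dk k))"
    by (simp only: sum_distrib_left sum.distrib[symmetric] distrib_left)
   also have "... <= N * ((1 + alpha) * g^2 + alpha * nu * (g * d))"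
    using gd gg alpha nonneg by (intro mult_left_mono add_mono) auto
   also have "... = (1 + alpha) * (N * g^2) + alpha * ((nu * N) * (g * d))" by (simp add: algebra_simps)
   also have "(nu * N) * (g * d) <= X * X" using X1 X0 by (intro mult_mono) auto
   finally show ?thesis using alpha by (simp add: power2_eq_square)
  qed
  have "?Q2 = 2 * (SUM3 k. cross3 (D1 k) Lu \<bullet> V1 k) + 2 * (SUM3 k. cross3 (Du k) L2 \<bullet> V1 k)"
   unfolding cross_diff_diff Lu_def[symmetric] Du_def[symmetric] inner_add_left by (simp add: sum.distrib distrib_left)
  then show ?thesis using s1 s2 by (simp add: algebra_simps)
 qed
 have Q3: "?Q3 <= (1 + alpha) * (l * nu) + (1 + alpha) * (X * nu)"
 proof -
  have 1: "cross3 m1 Lu \<bullet> V <= l * ((1 + alpha) * nu)"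
  proof -
   have "cross3 m1 Lu \<bullet> V <= norm m1 * norm Lu * norm V" using inner_cross_le[of m1 Lu V] by linarith
   also have "... <= l * ((1 + alpha) * nu)" using nV by (simp add: n1 un mult_left_mono nonneg)
   finally show ?thesis .
  qed
  have 2: "cross3 u L2 \<bullet> V <= X * ((1 + alpha) * nu)"
  proof -
   have "cross3 u L2 \<bullet> V <= norm u * norm L2 * norm V" using inner_cross_le[of u L2 V] by linarith
   also have "... <= (nu * N) * ((1 + alpha) * nu)" by (intro mult_mono nV) (auto simp: un nonneg Ln mult_left_mono)
   also have "... <= X * ((1 + alpha) * nu)" using X1 nonneg alpha by (intro mult_right_mono) auto
   finally show ?thesis .
  qed
  show ?thesis unfolding cross_diff_diff inner_add_left Lu_def[symmetric] u_def[symmetric] using 1 2 by (simp add: algebra_simps)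
 qed
 have Q4: "- ?Q4 <= \<bar>h\<bar> * (1 + alpha) * nu^2"
 proof -
  have "norm e3 = 1" by (simp add: e3_def norm_eq_1 inner_vec_def sum_3)
  then have "\<bar>cross3 (m1 - m2) e3 \<bullet> V\<bar> <= nu * norm V" using inner_cross_le[of "m1 - m2" e3 V] by (simp add: nu)
  also have "... <= nu * ((1 + alpha) * nu)" using nV nonneg by (intro mult_left_mono)
  finally have "\<bar>h\<bar> * \<bar>cross3 (m1 - m2) e3 \<bullet> V\<bar> <= \<bar>h\<bar> * (nu * ((1 + alpha) * nu))" by (intro mult_left_mono) auto
  moreover have "- ?Q4 <= \<bar>h\<bar> * \<bar>cross3 (m1 - m2) e3 \<bullet> V\<bar>" by (simp add: abs_mult[symmetric])
  ultimately show ?thesis by (simp add: power2_eq_square algebra_simps)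
 qed
 have Y1: "l * ((5 * alpha + 3) * X) <= alpha / 4 * l^2 + (5 * alpha + 3)^2 / alpha * X^2"
  using young_quarter[OF alpha, of l "(5 * alpha + 3) * X"] by (simp add: power_mult_distrib)
 have Y2: "l * ((1 + alpha) * nu) <= alpha / 4 * l^2 + (1 + alpha)^2 / alpha * nu^2"
  using young_quarter[OF alpha, of l "(1 + alpha) * nu"] by (simp add: power_mult_distrib)
 have Y3: "(1 + alpha) * (X * nu) <= (1 + alpha) * (X^2 + nu^2)"
 proof -
  have "0 <= X * nu" using X1(5) nonneg by simp
  then have "X * nu <= X^2 + nu^2" using sum_squares_bound[of X nu] by (simp add: mult.assoc)
  then show ?thesis using alpha by (intro mult_left_mono) auto
 qed
 define c1 where "c1 = (5 * alpha + 3)^2 / alpha"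
 define c2 where "c2 = (1 + alpha)^2 / alpha"
 define c3 where "c3 = \<bar>h\<bar> * (1 + alpha)"
 have cc: "0 <= c1" "0 <= c2" "0 <= c3" using alpha by (auto simp: c1_def c2_def c3_def)
 have Ng: "0 <= N * g^2" using nonneg by simp
 have "?Q1 + ?Q2 + ?Q3 - ?Q4 <= - (alpha / 2) * l^2 + (5 * alpha * X^2 + c1 * X^2 + 2 * (1 + alpha) * (N * g^2) + c2 * nu^2 + (1 + alpha) * (X^2 + nu^2) + c3 * nu^2)"
 proof -
  have "?Q1 + ?Q2 + ?Q3 - ?Q4 <= - alpha * l^2 + 5 * alpha * X^2 + l * ((5 * alpha + 3) * X) + 2 * (1 + alpha) * (N * g^2) + l * ((1 + alpha) * nu) + (1 + alpha) * (X * nu) + c3 * nu^2"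
   using Q1 Q2 Q3 Q4 by (simp add: c3_def algebra_simps power2_eq_square)
  then show ?thesis using Y1 Y2 Y3 unfolding c1_def[symmetric] c2_def[symmetric] by linarith
 qed
 also have "... <= - (alpha / 2) * l^2 + energy_const alpha h * (X^2 + N * g^2 + nu^2)"
 proof -
  have z: "0 <= alpha * X^2" "0 <= c1 * X^2" "0 <= c2 * X^2" "0 <= c3 * X^2" "0 <= alpha * nu^2" "0 <= c1 * nu^2"
   "0 <= alpha * (N * g^2)" "0 <= c1 * (N * g^2)" "0 <= c2 * (N * g^2)" "0 <= c3 * (N * g^2)" "0 <= X^2" "0 <= nu^2"
   using cc Ng alpha by auto
  show ?thesis unfolding energy_const_def c1_def[symmetric] c2_def[symmetric] c3_def[symmetric]
   using z Ng by (simp add: algebra_simps)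
 qed
 finally show "?Q1 + ?Q2 + ?Q3 - ?Q4 <= - (alpha / 2) * l^2 + energy_const alpha h * (X^2 + N * g^2 + nu^2)" .
qed

section \<open>The energy estimate at a fixed time\<close>

subsection \<open>Vector-valued integrability\<close>

lemma norm_power2_vec3: "(norm v)^2 = (SUM3 a. (v $ a)^2)" for v :: "real^3"
 unfolding power2_norm_eq_inner inner_vec_def by (simp add: power2_eq_square)

lemma sum3_squared_le: "(x + y + z)^2 <= 3 * (x^2 + y^2 + z^2)" for x y z :: real
proof -
 have "0 <= (x - y)^2 + (y - z)^2 + (x - z)^2" by simp
 then show ?thesis by (simp add: power2_eq_square algebra_simps)
qed

lemma sum3_fourth_le: "(x + y + z) ^ 4 <= 27 * (x ^ 4 + y ^ 4 + z ^ 4)" for x y z :: real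
proof -
 have "(x + y + z) ^ 4 = ((x + y + z)^2)^2" by (simp flip: power_mult)
 also have "... <= (3 * (x^2 + y^2 + z^2))^2" by (intro power_mono sum3_squared_le) auto
 also have "... = 9 * (x^2 + y^2 + z^2)^2" unfolding power_mult_distrib by simp
 also have "... <= 9 * (3 * ((x^2)^2 + (y^2)^2 + (z^2)^2))" by (intro mult_left_mono sum3_squared_le) auto
 finally show ?thesis by (simp flip: power_mult)
qed

lemma sum2_fourth_le: "(x + y) ^ 4 <= 8 * (x ^ 4 + y ^ 4)" for x y :: real
proof -
 have s: "(p + q)^2 <= 2 * (p^2 + q^2)" for p q :: real
  using sum_squares_bound[of p q] by (simp add: power2_sum)
 have "(x + y) ^ 4 = ((x + y)^2)^2" by (simp flip: power_mult)
 also have "... <= (2 * (x^2 + y^2))^2" by (intro power_mono s) auto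
 also have "... = 4 * (x^2 + y^2)^2" unfolding power_mult_distrib by simp
 also have "... <= 4 * (2 * ((x^2)^2 + (y^2)^2))" by (intro mult_left_mono s) auto
 finally show ?thesis by (simp flip: power_mult)
qed

lemma norm_power4_vec3: "(norm v) ^ 4 <= 3 * (SUM3 a. (v $ a) ^ 4)" for v :: "real^3"
proof -
 have "(norm v) ^ 4 = ((norm v)^2)^2" by (simp flip: power_mult)
 also have "... = ((v $ 1)^2 + (v $ 2)^2 + (v $ 3)^2)^2" unfolding norm_power2_vec3 sum_3 ..
 also have "... <= 3 * (((v $ 1)^2)^2 + ((v $ 2)^2)^2 + ((v $ 3)^2)^2)" by (rule sum3_squared_le)
 finally show ?thesis by (simp add: sum_3 flip: power_mult)
qed

lemma vec_L2:
 fixes f :: "'b => real^3"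
 assumes "!!a. integrable M (%x. (f x $ a)^2)"
 shows "integrable M (%x. (norm (f x))^2)" "(\<integral>x. (norm (f x))^2 \<partial>M) = (SUM3 a. \<integral>x. (f x $ a)^2 \<partial>M)"
 unfolding norm_power2_vec3 using assms by (auto intro!: Bi_integral_sum)

lemma vec_L4:
 fixes f :: "'b => real^3"
 assumes [measurable]: "f : borel_measurable M" and i: "!!a. integrable M (%x. (f x $ a) ^ 4)"
 shows "integrable M (%x. (norm (f x)) ^ 4)" "(\<integral>x. (norm (f x)) ^ 4 \<partial>M) <= 3 * (SUM3 a. \<integral>x. (f x $ a) ^ 4 \<partial>M)"
proof -
 have s: "integrable M (%x. 3 * (SUM3 a. (f x $ a) ^ 4))"
  by (intro integrable_mult_right Bi_integrable_sum i)
 show 1: "integrable M (%x. (norm (f x)) ^ 4)"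
  by (rule Bi_integrable_bound[OF s]) (auto intro!: AE_I2 order_trans[OF norm_power4_vec3])
 have "(\<integral>x. (norm (f x)) ^ 4 \<partial>M) <= (\<integral>x. 3 * (SUM3 a. (f x $ a) ^ 4) \<partial>M)"
  by (intro integral_mono 1 s norm_power4_vec3)
 also have "... = 3 * (SUM3 a. \<integral>x. (f x $ a) ^ 4 \<partial>M)"
  using i by (simp add: Bi_integral_sum)
 finally show "(\<integral>x. (norm (f x)) ^ 4 \<partial>M) <= 3 * (SUM3 a. \<integral>x. (f x $ a) ^ 4 \<partial>M)" .
qed

lemma integrable_power_bound:
 fixes f g :: "'b => real"
 assumes "f : borel_measurable M" "integrable M (%x. (g x) ^ p)" "!!x. \<bar>f x\<bar> <= c * g x"
 shows "integrable M (%x. (f x) ^ p)"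
proof (rule Bi_integrable_bound[where f="%x. c ^ p * (g x) ^ p"])
 show "integrable M (%x. c ^ p * (g x) ^ p)" using assms(2) by simp
 show "(%x. (f x) ^ p) : borel_measurable M" using assms(1) by simp
 have "norm ((f x) ^ p) <= norm (c ^ p * (g x) ^ p)" for x
 proof -
  have "\<bar>f x\<bar> ^ p <= (c * g x) ^ p" by (intro power_mono assms) simp
  then show ?thesis by (simp add: power_abs power_mult_distrib)
 qed
 then show "AE x in M. norm ((f x) ^ p) <= norm (c ^ p * (g x) ^ p)" by (intro AE_I2)
qed

text \<open>
 Young's inequality for the exponents \<open>6/5\<close> and \<open>6\<close>, up to constants.
\<close>

lemma young_six_fifths:
 fixes x y :: real
 assumes "0 <= x" "0 <= y"
 shows "x * y <= x powr (6/5) + y ^ 6"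
proof (cases "x <= y ^ 5")
 case True
 then have "x * y <= y ^ 5 * y" using assms by (intro mult_right_mono)
 also have "... = y ^ 6" by (simp flip: power_Suc2)
 finally show ?thesis by (simp add: add_increasing)
next
 case False
 then have x: "0 < x" using assms zero_le_power[of y 5] by linarith
 have "y <= x powr (1/5)"
 proof (rule power_le_imp_le_base[of _ 4])
  have "(x powr (1/5)) ^ 5 = x" using x by (simp add: powr_power)
  then show "y ^ Suc 4 <= (x powr (1/5)) ^ Suc 4" using False by simp
 qed simp
 then have "x * y <= x * x powr (1/5)" using x by simp
 also have "... = x powr (6/5)" using x by (simp add: powr_mult_base)
 finally show ?thesis using assms by (simp add: add_increasing2)
qed

lemma current_gradient_integral:
 fixes J f :: "'b => real"
 assumes [measurable]: "J : borel_measurable M" "f : borel_measurable M" and J0: "!!x. 0 <= J x"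
  and J: "integrable M (%x. J x powr (6/5))" "(\<integral>x. J x powr (6/5) \<partial>M) <= K"
  and f: "integrable M (%x. (f x) ^ 6)" "(\<integral>x. (f x) ^ 6 \<partial>M) <= 4096 * b ^ 6" and b: "0 <= b"
 shows "integrable M (%x. J x * \<bar>f x\<bar>)" "(\<integral>x. J x * \<bar>f x\<bar> \<partial>M) <= (K + 4096) * b"
proof -
 have i: "integrable M (%x. J x powr (6/5) + (f x) ^ 6)" using J f by simp
 show ii: "integrable M (%x. J x * \<bar>f x\<bar>)"
 proof (rule Bi_integrable_bound[OF i])
  show "AE x in M. norm (J x * \<bar>f x\<bar>) <= norm (J x powr (6/5) + (f x) ^ 6)"
  proof (rule AE_I2)
   fix x
   show "norm (J x * \<bar>f x\<bar>) <= norm (J x powr (6/5) + (f x) ^ 6)"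
    using young_six_fifths[of "J x" "\<bar>f x\<bar>"] J0[of x] by (simp add: power_even_abs)
  qed
 qed measurable
 show "(\<integral>x. J x * \<bar>f x\<bar> \<partial>M) <= (K + 4096) * b"
 proof (cases "b = 0")
  case True
  have "0 <= (\<integral>x. (f x) ^ 6 \<partial>M)" by (intro integral_nonneg_AE AE_I2) simp
  moreover have "(\<integral>x. (f x) ^ 6 \<partial>M) <= 0" using f(2) True by simp
  ultimately have "(\<integral>x. (f x) ^ 6 \<partial>M) = 0" by (rule antisym[rotated])
  then have "AE x in M. (f x) ^ 6 = 0" by (subst (asm) integral_nonneg_eq_0_iff_AE[OF f(1)]) auto
  then have "(\<integral>x. J x * \<bar>f x\<bar> \<partial>M) = (\<integral>x. 0 \<partial>M)" by (intro integral_cong_AE) (auto elim: eventually_mono)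
  then show ?thesis using True by simp
 next
  case False
  then have b: "0 < b" using b by simp
  have le: "J x * \<bar>f x\<bar> <= b * (J x powr (6/5)) + (f x) ^ 6 / b ^ 5" for x
  proof -
   have "J x * (\<bar>f x\<bar> / b) <= J x powr (6/5) + (\<bar>f x\<bar> / b) ^ 6" using J0[of x] b by (intro young_six_fifths) auto
   then have "b * (J x * (\<bar>f x\<bar> / b)) <= b * (J x powr (6/5) + (\<bar>f x\<bar> / b) ^ 6)" using b by (intro mult_left_mono) auto
   moreover have "b * (\<bar>f x\<bar> / b) ^ 6 = (f x) ^ 6 / b ^ 5"
    using b by (simp add: power_divide power_even_abs field_simps) (simp flip: power_Suc2 power_Suc)
   ultimately show ?thesis using b by (simp add: distrib_left)
  qed
  have "(\<integral>x. J x * \<bar>f x\<bar> \<partial>M) <= (\<integral>x. b * (J x powr (6/5)) + (f x) ^ 6 / b ^ 5 \<partial>M)"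
   using J f by (intro integral_mono ii le) auto
  also have "... = b * (\<integral>x. J x powr (6/5) \<partial>M) + (\<integral>x. (f x) ^ 6 \<partial>M) / b ^ 5" using J f by simp
  also have "... <= b * K + 4096 * b ^ 6 / b ^ 5" using J f b by (intro add_mono mult_left_mono divide_right_mono) auto
  also have "4096 * b ^ 6 / b ^ 5 = 4096 * b" using b by (simp add: field_simps flip: power_Suc2 power_Suc)
  finally show ?thesis by (simp add: algebra_simps)
 qed
qed

lemma cross3_nth: "cross3 v w $ a = v $ (a + 1) * w $ (a + 2) - v $ (a + 2) * w $ (a + 1)"
proof -
 have 4: "(4::3) = 1" and 5: "(5::3) = 2" by simp_all
 show ?thesis using exhaust_3[of a] by (auto simp: cross3_def 4 5)
qed

lemma cross3_measurable [measurable (raw)]: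
 assumes [measurable]: "f : borel_measurable M" "g : borel_measurable M"
 shows "(%x. cross3 (f x) (g x)) : borel_measurable M"
proof -
 have "cross3 (f x) (g x) = vec3 (cross3 (f x) (g x) $ 1) (cross3 (f x) (g x) $ 2) (cross3 (f x) (g x) $ 3)" for x
  by (simp add: vec_eq_iff forall_3)
 moreover have "(%x. vec3 (cross3 (f x) (g x) $ 1) (cross3 (f x) (g x) $ 2) (cross3 (f x) (g x) $ 3)) : borel_measurable M"
  unfolding cross3_nth by measurable
 ultimately show ?thesis by simp
qed

lemma line_ac_cross3:
 fixes F F' G G' :: "real => real^3"
 assumes l: "!!a. line_ac (%s. F s $ a) (%s. F' s $ a)" "!!a. line_ac (%s. G s $ a) (%s. G' s $ a)"
  and [measurable]: "F : Bm" "F' : Bm" "G : Bm" "G' : Bm"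
 shows "line_ac (%s. cross3 (F s) (G s) $ a) (%s. (cross3 (F' s) (G s) + cross3 (F s) (G' s)) $ a)"
proof -
 have "line_ac (%s. F s $ (a + 1) * G s $ (a + 2) - F s $ (a + 2) * G s $ (a + 1))
  (%s. (F s $ (a + 1) * G' s $ (a + 2) + F' s $ (a + 1) * G s $ (a + 2)) - (F s $ (a + 2) * G' s $ (a + 1) + F' s $ (a + 2) * G s $ (a + 1)))"
  by (intro line_ac_diff line_ac_mult l) measurable
 moreover have "(%s. (F s $ (a + 1) * G' s $ (a + 2) + F' s $ (a + 1) * G s $ (a + 2)) - (F s $ (a + 2) * G' s $ (a + 1) + F' s $ (a + 2) * G s $ (a + 1)))
  = (%s. (cross3 (F' s) (G s) + cross3 (F s) (G' s)) $ a)"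
  by (simp add: fun_eq_iff cross3_nth)
 ultimately show ?thesis by (simp add: cross3_nth)
qed

subsection \<open>Solutions at a fixed time\<close>

text \<open>
 A sphere-valued map with its space derivatives and its time derivative \<open>p\<close> at one fixed time,
 satisfying the equation against all translates of the mollifiers.
\<close>

definition slice_sol ::
 "real => real => (real^3 => real^3) => (real^3 => real^3) => (3 => real^3 => real^3) => (3 => 3 => real^3 => real^3) => (real^3 => real^3) => bool" where
 "slice_sol alpha h j m D DD p \<longleftrightarrow>
  (\<forall>x. norm (m x) = 1) \<and> m : Bm \<and> (\<forall>k. D k : Bm) \<and>
  (\<forall>l k. DD l k : Bm) \<and> p : Bm \<and>
  (\<forall>a. H2f (%x. (m x - e3) $ a) (%k x. D k x $ a) (%l k x. DD l k x $ a)) \<and>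
  integ (%x. (norm (p x))^2) \<and> (AEl x. p x \<bullet> m x = 0) \<and>
  (\<forall>n a. AEl y. (LBINT x. mollifier n (y - x) * ((SUM3 k. j x $ k *R D k x) $ a
     + (p x - cross3 (m x) (alpha *R p x + (SUM3 k. DD k k x) - h *R e3)) $ a)) =
   (SUM3 k. LBINT x. FD (%z. FD (mollifier n) (at z) (axis k 1)) (at (y - x)) (axis k 1) * cross3 (m x) (SUM3 k. DD k k x) $ a)
   - 2 * (SUM3 k. LBINT x. FD (mollifier n) (at (y - x)) (axis k 1) * cross3 (D k x) (SUM3 k. DD k k x) $ a))"

lemma slice_solD:
 assumes "slice_sol alpha h j m D DD p"
 shows "norm (m x) = 1" "m : Bm" "D k : Bm"
  "DD l k : Bm" "p : Bm"
  "H2f (%x. (m x - e3) $ a) (%k x. D k x $ a) (%l k x. DD l k x $ a)"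
  "integ (%x. (norm (p x))^2)" "AEl x. p x \<bullet> m x = 0"
 using assms by (auto simp: slice_sol_def)

lemma slice_sol_lines:
 assumes S: "slice_sol alpha h j m D DD p"
 shows "AEl x. \<forall>a. line_ac (%s. m (x + s *R axis k 1) $ a) (%s. D k (x + s *R axis k 1) $ a)"
  and "AEl x. \<forall>a. line_ac (%s. D k (x + s *R axis l 1) $ a) (%s. DD l k (x + s *R axis l 1) $ a)"
proof -
 note H = slice_solD(6)[OF S]
 show "AEl x. \<forall>a. line_ac (%s. m (x + s *R axis k 1) $ a) (%s. D k (x + s *R axis k 1) $ a)"
 proof (subst AE_all_countable, intro allI)
  fix a
  show "AEl x. line_ac (%s. m (x + s *R axis k 1) $ a) (%s. D k (x + s *R axis k 1) $ a)"
   using wder_UNIV_line_ac[OF H2fD(4)[OF H[of a], of k]]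
  proof eventually_elim
   case (elim x)
   from line_ac_add[OF elim line_ac_const[of "e3 $ a"]] show ?case by simp
  qed
 qed
 show "AEl x. \<forall>a. line_ac (%s. D k (x + s *R axis l 1) $ a) (%s. DD l k (x + s *R axis l 1) $ a)"
  by (subst AE_all_countable) (intro allI wder_UNIV_line_ac[OF H2fD(5)[OF H]])
qed

text \<open>The sphere constraint, differentiated twice.\<close>

lemma slice_sol_constraint:
 assumes S: "slice_sol alpha h j m D DD p"
 shows "AEl x. m x \<bullet> (SUM3 k. DD k k x) = - (SUM3 k. D k x \<bullet> D k x)"
proof -
 note mm = slice_solD(2-4)[OF S]
 note [measurable] = mm
 have k: "AEl x. m x \<bullet> DD k k x + D k x \<bullet> D k x = 0" for k
 proof -
  let ?v = "axis k 1 :: real^3"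
  have "AEl x. x \<in> UNIV --> line_ac (%s. SUM3 a. m (x + s *R ?v) $ a * m (x + s *R ?v) $ a)
    (%s. SUM3 a. m (x + s *R ?v) $ a * D k (x + s *R ?v) $ a + D k (x + s *R ?v) $ a * m (x + s *R ?v) $ a)"
   using slice_sol_lines(1)[OF S, of k] by eventually_elim (intro impI line_ac_sum line_ac_mult; (measurable | blast))
  then have "AEl x. x \<in> UNIV --> (SUM3 a. m x $ a * D k x $ a + D k x $ a * m x $ a) = 0"
  proof (rule line_derivative_of_constant_zero[where c=1, rotated 2])
   show "AEl x. x \<in> UNIV --> (SUM3 a. m x $ a * m x $ a) = 1"
    using slice_solD(1)[OF S] by (auto intro!: AE_I2 simp: norm_eq_1 inner_vec_def)
  qed auto
  then have 0: "AEl x. x \<in> UNIV --> (SUM3 a. m x $ a * D k x $ a) = 0"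
   by eventually_elim (simp add: mult.commute flip: sum_distrib_left)
  have "AEl x. x \<in> UNIV --> line_ac (%s. SUM3 a. m (x + s *R ?v) $ a * D k (x + s *R ?v) $ a)
    (%s. SUM3 a. m (x + s *R ?v) $ a * DD k k (x + s *R ?v) $ a + D k (x + s *R ?v) $ a * D k (x + s *R ?v) $ a)"
   using slice_sol_lines(1)[OF S, of k] slice_sol_lines(2)[OF S, of k k]
   by eventually_elim (intro impI line_ac_sum line_ac_mult; (measurable | blast))
  then have "AEl x. x \<in> UNIV --> (SUM3 a. m x $ a * DD k k x $ a + D k x $ a * D k x $ a) = 0"
   by (rule line_derivative_of_constant_zero[where c=0, rotated 2]) (use 0 in auto)
  then show ?thesis by eventually_elim (simp add: inner_vec_def sum.distrib)
 qed
 have "AEl x. \<forall>k. m x \<bullet> DD k k x + D k x \<bullet> D k x = 0" by (subst AE_all_countable) (intro allI k)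
 then show ?thesis
 proof eventually_elim
  case (elim x)
  have "m x \<bullet> (SUM3 k. DD k k x) + (SUM3 k. D k x \<bullet> D k x) = (SUM3 k. m x \<bullet> DD k k x + D k x \<bullet> D k x)"
   by (simp add: inner_sum_right sum.distrib)
  also have "... = 0" using elim by simp
  finally show ?case by linarith
 qed
qed

lemma slice_sol_integrable:
 assumes S: "slice_sol alpha h j m D DD p"
 shows "integ (%x. (norm (m x - e3))^2)" "integ (%x. (norm (D k x))^2)" "integ (%x. (norm (D k x)) ^ 4)"
  "integ (%x. (norm (DD l k x))^2)" "integ (%x. (norm (SUM3 k. DD k k x))^2)"
proof -
 note H = slice_solD(6)[OF S]
 note mm = slice_solD(2-5)[OF S]
 note [measurable] = mm
 show "integ (%x. (norm (m x - e3))^2)" by (rule vec_L2) (rule H2fD(1)[OF H])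
 show "integ (%x. (norm (D k x))^2)" by (rule vec_L2) (rule H2fD(2)[OF H])
 show "integ (%x. (norm (DD l k x))^2)" by (rule vec_L2) (rule H2fD(3)[OF H])
 show "integ (%x. (norm (D k x)) ^ 4)" by (rule vec_L4) (auto intro: H2f_gradient_L4(1)[OF H])
 show "integ (%x. (norm (SUM3 k. DD k k x))^2)"
  by (rule vec_L2) (use H2f_laplacian_integrable[OF H] in simp)
qed

lemma integrable_inner_L2:
 fixes f g :: "'b => real^3"
 assumes [measurable]: "f : borel_measurable M" "g : borel_measurable M"
  and "integrable M (%x. (norm (f x))^2)" "integrable M (%x. (norm (g x))^2)"
 shows "integrable M (%x. f x \<bullet> g x)"
proof (rule Bi_integrable_bound)
 show "integrable M (%x. norm (f x) * norm (g x))" by (intro CS_integrable assms) measurable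
 show "AE x in M. norm (f x \<bullet> g x) <= norm (norm (f x) * norm (g x))"
  by (auto intro!: AE_I2 Cauchy_Schwarz_ineq2)
qed measurable

text \<open>
 The equation tested with a multiplier that has two derivatives in the space directions, component by component.
\<close>

lemma slice_sol_tested:
 fixes V :: "real^3 => real^3" and V1 V2 :: "3 => real^3 => real^3"
 assumes S: "slice_sol alpha h j m D DD p"
  and jm[measurable]: "j : Bm" and ji: "integ (%x. norm (j x) powr (6/5))"
  and Vm[measurable]: "V : Bm" "!!k. V1 k : Bm" "!!k. V2 k : Bm"
  and VS: "!!x. norm (V x) <= S" and V: "integ (%x. (norm (V x))^2)"
  and V1: "!!k. integ (%x. (norm (V1 k x))^2)" "!!k. integ (%x. (norm (V1 k x)) ^ 4)"
  and V2: "!!k. integ (%x. (norm (V2 k x))^2)"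
  and l1: "!!k. AEl x. \<forall>a. line_ac (%s. V (x + s *R axis k 1) $ a) (%s. V1 k (x + s *R axis k 1) $ a)"
  and l2: "!!k. AEl x. \<forall>a. line_ac (%s. V1 k (x + s *R axis k 1) $ a) (%s. V2 k (x + s *R axis k 1) $ a)"
 defines "W \<equiv> %x. cross3 (m x) (SUM3 k. DD k k x) \<bullet> (SUM3 k. V2 k x)
   + 2 * (SUM3 k. cross3 (D k x) (SUM3 k. DD k k x) \<bullet> V1 k x)
   - ((SUM3 k. j x $ k *R D k x) + (p x - cross3 (m x) (alpha *R p x + (SUM3 k. DD k k x) - h *R e3))) \<bullet> V x"
 shows "integ W" "(LBINT x. W x) = 0"
proof -
 note mm = slice_solD(2-5)[OF S]
 note [measurable] = mm
 note SI = slice_sol_integrable[OF S]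
 note H = slice_solD(6)[OF S]
 define L where "L x = (SUM3 k. DD k k x)" for x
 define Ea where "Ea x = (SUM3 k. j x $ k *R D k x)" for x
 define Eb where "Eb x = p x - cross3 (m x) (alpha *R p x + L x - h *R e3)" for x
 define E1 where "E1 x = cross3 (m x) (L x)" for x
 define E2 where "E2 k x = cross3 (D k x) (L x)" for k x
 have [measurable]: "L : Bm" "Ea : Bm" "Eb : Bm" "E1 : Bm" "E2 k : Bm" for k
  unfolding L_def[abs_def] Ea_def[abs_def] Eb_def[abs_def] E1_def[abs_def] E2_def[abs_def] by measurable
 have L2: "integ (%x. (norm (L x))^2)" using SI(5) by (simp add: L_def)
 have comp: "integ (%x. (f x $ a) ^ q)" if [measurable]: "f : Bm" and "integ (%x. (norm (f x)) ^ q)" for f :: "real^3 => real^3" and a q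
  by (rule integrable_power_bound[OF _ that(2), where c=1]) (auto simp: component_le_norm_cart)
 have Ea: "integ (%x. Ea x $ a)" for a
 proof -
  have t: "integ (%x. j x $ k * D k x $ a)" for k
  proof (rule Bi_integrable_bound)
   show "integ (%x. norm (j x) powr (6/5) + (D k x $ a) ^ 6)"
    using ji H2f_gradient_L6(1)[OF H] by simp
   have "\<bar>j x $ k * D k x $ a\<bar> <= norm (j x) powr (6/5) + (D k x $ a) ^ 6" for x
   proof -
    have "\<bar>j x $ k * D k x $ a\<bar> <= norm (j x) * \<bar>D k x $ a\<bar>" unfolding abs_mult by (intro mult_right_mono component_le_norm_cart) simp
    also have "... <= norm (j x) powr (6/5) + \<bar>D k x $ a\<bar> ^ 6" by (rule young_six_fifths) auto
    finally show ?thesis by (simp add: power_even_abs)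
   qed
   then show "AEl x. norm (j x $ k * D k x $ a) <= norm (norm (j x) powr (6/5) + (D k x $ a) ^ 6)"
    by (intro AE_I2) (simp add: add_nonneg_nonneg)
  qed measurable
  show ?thesis using t by (simp add: Ea_def)
 qed
 have Eb: "integ (%x. (norm (Eb x))^2)"
 proof (rule Bi_integrable_bound)
  show "integ (%x. 3 * (((1 + \<bar>alpha\<bar>) * norm (p x))^2 + (norm (L x))^2 + (\<bar>h\<bar> * norm (m x - e3))^2))"
   using slice_solD(7)[OF S] L2 SI(1) by (simp add: power_mult_distrib)
  have "norm (Eb x) <= (1 + \<bar>alpha\<bar>) * norm (p x) + norm (L x) + \<bar>h\<bar> * norm (m x - e3)" for x
  proof -
   have e: "Eb x = p x - alpha *R cross3 (m x) (p x) - cross3 (m x) (L x) + h *R cross3 (m x - e3) e3"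
    by (simp add: Eb_def cross3_def vec_eq_iff forall_3 algebra_simps)
   have n: "norm (cross3 (m x) y) <= norm y" for y using norm_cross_le[of "m x" y] slice_solD(1)[OF S] by simp
   have "norm e3 = 1" by (simp add: e3_def norm_eq_1 inner_vec_def sum_3)
   then have "norm (cross3 (m x - e3) e3) <= norm (m x - e3)" using norm_cross_le[of "m x - e3" e3] by simp
   then have 1: "norm (h *R cross3 (m x - e3) e3) <= \<bar>h\<bar> * norm (m x - e3)" by (simp add: mult_left_mono)
   have 2: "norm (alpha *R cross3 (m x) (p x)) <= \<bar>alpha\<bar> * norm (p x)" using n by (simp add: mult_left_mono)
   have "norm (Eb x) <= ((norm (p x) + norm (alpha *R cross3 (m x) (p x))) + norm (cross3 (m x) (L x))) + norm (h *R cross3 (m x - e3) e3)"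
    unfolding e by (intro norm_triangle_le norm_triangle_le_diff add_right_mono order_trans[OF norm_triangle_ineq4] order_refl)
   then show ?thesis using 1 2 n[of "L x"] by (simp add: distrib_right)
  qed
  then have "(norm (Eb x))^2 <= ((1 + \<bar>alpha\<bar>) * norm (p x) + norm (L x) + \<bar>h\<bar> * norm (m x - e3))^2" for x by (intro power_mono) auto
  then have "(norm (Eb x))^2 <= 3 * (((1 + \<bar>alpha\<bar>) * norm (p x))^2 + (norm (L x))^2 + (\<bar>h\<bar> * norm (m x - e3))^2)" for x
   using order_trans[OF _ sum3_squared_le] by blast
  then show "AEl x. norm ((norm (Eb x))^2) <= norm (3 * (((1 + \<bar>alpha\<bar>) * norm (p x))^2 + (norm (L x))^2 + (\<bar>h\<bar> * norm (m x - e3))^2))"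
   by (intro AE_I2) simp
 qed measurable
 have E1: "integ (%x. (norm (E1 x))^2)"
 proof (rule integrable_power_bound[OF _ L2, where c=1])
  show "\<bar>norm (E1 x)\<bar> <= 1 * norm (L x)" for x
   using norm_cross_le[of "m x" "L x"] slice_solD(1)[OF S] by (simp add: E1_def)
 qed measurable
 have E2le: "\<bar>E2 k x $ a\<bar> <= \<bar>norm (L x) * norm (D k x)\<bar>" for k x a
  using order_trans[OF component_le_norm_cart norm_cross_le[of "D k x" "L x"]] by (simp add: E2_def mult.commute)
 have VSa: "\<bar>V x $ a\<bar> <= S" for x a using order_trans[OF component_le_norm_cart VS] .
 have eqa: "AEl y. (LBINT x. mollifier n (y - x) * (Ea x $ a + Eb x $ a)) =
   (SUM3 k. LBINT x. FD (%z. FD (mollifier n) (at z) (axis k 1)) (at (y - x)) (axis k 1) * E1 x $ a)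
   - 2 * (SUM3 k. LBINT x. FD (mollifier n) (at (y - x)) (axis k 1) * E2 k x $ a)" for n a
  using S unfolding slice_sol_def Ea_def Eb_def E1_def E2_def L_def by blast
 have l1': "AEl x. line_ac (%s. V (x + s *R axis k 1) $ a) (%s. V1 k (x + s *R axis k 1) $ a)" for k a
  using l1[of k] by (auto elim: eventually_mono)
 have l2': "AEl x. line_ac (%s. V1 k (x + s *R axis k 1) $ a) (%s. V2 k (x + s *R axis k 1) $ a)" for k a
  using l2[of k] by (auto elim: eventually_mono)
 have tested: "(LBINT x. Ea x $ a * V x $ a) + (LBINT x. Eb x $ a * V x $ a)
  = (SUM3 k. LBINT x. E1 x $ a * V2 k x $ a) + 2 * (SUM3 k. LBINT x. E2 k x $ a * V1 k x $ a)" for a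
  by (rule test_mollified_equation[OF eqa, where a="%x. norm (L x)" and b="%k x. norm (D k x)" and S=S])
   (use Ea Eb E1 E2le L2 SI VSa V V1 V2 l1' l2' in \<open>auto intro!: comp\<close>)
 have i: "integ (%x. Ea x $ a * V x $ a)" "integ (%x. Eb x $ a * V x $ a)"
  "integ (%x. E1 x $ a * V2 k x $ a)" "integ (%x. E2 k x $ a * V1 k x $ a)" for a k
 proof -
  show "integ (%x. Ea x $ a * V x $ a)"
  proof (rule Bi_integrable_bound)
   show "integ (%x. S * Ea x $ a)" using Ea by simp
   show "AEl x. norm (Ea x $ a * V x $ a) <= norm (S * Ea x $ a)"
    using VSa by (intro AE_I2) (auto simp: abs_mult mult.commute[of "\<bar>S\<bar>"] intro!: mult_left_mono intro: order_trans[OF _ abs_ge_self])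
  qed measurable
  show "integ (%x. Eb x $ a * V x $ a)" by (intro CS_integrable comp Eb V) measurable
  show "integ (%x. E1 x $ a * V2 k x $ a)" by (intro CS_integrable comp E1 V2) measurable
  show "integ (%x. E2 k x $ a * V1 k x $ a)"
  proof (rule Bi_integrable_bound)
   show "integ (%x. norm (L x) * (norm (D k x) * norm (V1 k x)))"
    by (intro CS_integrable L2 integrable_L4_product SI V1) measurable
   have "\<bar>E2 k x $ a * V1 k x $ a\<bar> <= norm (L x) * (norm (D k x) * norm (V1 k x))" for x
    unfolding abs_mult mult.assoc[symmetric] using E2le[of k x a] by (intro mult_mono component_le_norm_cart) auto
   then show "AEl x. norm (E2 k x $ a * V1 k x $ a) <= norm (norm (L x) * (norm (D k x) * norm (V1 k x)))"
    by (intro AE_I2) simp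
  qed measurable
 qed
 have W: "W x = (SUM3 a. (SUM3 k. E1 x $ a * V2 k x $ a) + 2 * (SUM3 k. E2 k x $ a * V1 k x $ a) - (Ea x $ a * V x $ a + Eb x $ a * V x $ a))" for x
  unfolding W_def L_def[symmetric] Ea_def[symmetric] Eb_def[symmetric] E1_def[symmetric] E2_def[symmetric]
  by (simp add: inner_vec_def sum_3 algebra_simps)
 show "integ W" unfolding W[abs_def] using i by simp
 have "(LBINT x. W x) = (SUM3 a. ((SUM3 k. LBINT x. E1 x $ a * V2 k x $ a) + 2 * (SUM3 k. LBINT x. E2 k x $ a * V1 k x $ a))
  - ((LBINT x. Ea x $ a * V x $ a) + (LBINT x. Eb x $ a * V x $ a)))"
  unfolding W using i by (simp add: Bi_integral_sum Bi_integral_diff Bi_integral_add)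
 then show "(LBINT x. W x) = 0" by (simp add: tested)
qed

subsection \<open>Bounds for the difference of two solutions\<close>

lemma slice_difference_H2f:
 assumes S1: "slice_sol alpha h j m1 D1 DD1 p1" and S2: "slice_sol alpha h j m2 D2 DD2 p2"
 shows "H2f (%x. (m1 x - m2 x) $ a) (%k x. (D1 k x - D2 k x) $ a) (%l k x. (DD1 l k x - DD2 l k x) $ a)"
 using H2f_diff[OF slice_solD(6)[OF S1, of a] slice_solD(6)[OF S2, of a]] by simp

lemma slice_difference_bounds:
 assumes S1: "slice_sol alpha h j m1 D1 DD1 p1" and S2: "slice_sol alpha h j m2 D2 DD2 p2"
  and ip: "\<forall>u D DD k. H2f u D DD --> sqrt (LBINT x. (D k x) ^ 4) <= de * (LBINT x. (SUM3 k. DD k k x)^2) + C * (LBINT x. (u x)^2)"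
  and isup: "\<forall>u D DD. H2f u D DD --> (AEl x. (u x)^2 <= de * (LBINT x. (SUM3 k. DD k k x)^2) + C * (LBINT x. (u x)^2))"
  and pos: "0 <= de" "0 <= C"
  and jm[measurable]: "j : Bm" and ji: "integ (%x. norm (j x) powr (6/5))" and jK: "(LBINT x. norm (j x) powr (6/5)) <= K"
  and A: "A = (LBINT x. (norm (m1 x - m2 x))^2)"
  and B: "B = (LBINT x. (norm ((SUM3 k. DD1 k k x) - (SUM3 k. DD2 k k x)))^2)"
 shows "integ (%x. (norm (m1 x - m2 x))^2)"
  and "integ (%x. (norm ((SUM3 k. DD1 k k x) - (SUM3 k. DD2 k k x)))^2)"
  and "AEl x. (norm (m1 x - m2 x))^2 <= de * B + C * A"
  and "integ (%x. (SUM3 k. norm (D1 k x - D2 k x)) ^ 4)"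
  and "(LBINT x. (SUM3 k. norm (D1 k x - D2 k x)) ^ 4) <= (27 * (de * B + C * A))^2"
  and "integ (%x. norm (j x) * (SUM3 k. norm (D1 k x - D2 k x)))"
  and "(LBINT x. norm (j x) * (SUM3 k. norm (D1 k x - D2 k x))) <= 9 * (K + 4096) * sqrt B"
proof -
 note mm = slice_solD(2-5)[OF S1] slice_solD(2-5)[OF S2]
 note [measurable] = mm
 note H = slice_difference_H2f[OF S1 S2]
 define Aa where "Aa a = (LBINT x. ((m1 x - m2 x) $ a)^2)" for a
 define Ba where "Ba a = (LBINT x. (SUM3 k. (DD1 k k x - DD2 k k x) $ a)^2)" for a
 have c: "(SUM3 k. (DD1 k k x - DD2 k k x) $ a) = ((SUM3 k. DD1 k k x) - (SUM3 k. DD2 k k x)) $ a" for x a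
  by (simp add: sum_subtractf)
 show iA: "integ (%x. (norm (m1 x - m2 x))^2)" by (rule vec_L2) (rule H2fD(1)[OF H])
 have AS: "A = (SUM3 a. Aa a)" unfolding A Aa_def by (rule vec_L2) (rule H2fD(1)[OF H])
 have iBa: "integ (%x. (((SUM3 k. DD1 k k x) - (SUM3 k. DD2 k k x)) $ a)^2)" for a
  using H2f_laplacian_integrable[OF H, of a] unfolding c .
 show iB: "integ (%x. (norm ((SUM3 k. DD1 k k x) - (SUM3 k. DD2 k k x)))^2)" by (rule vec_L2) (rule iBa)
 have BS: "B = (SUM3 a. Ba a)" unfolding B Ba_def c by (rule vec_L2) (rule iBa)
 have A0: "0 <= Aa a" and B0: "0 <= Ba a" for a unfolding Aa_def Ba_def by (auto intro!: integral_nonneg_AE)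
 have AB0: "0 <= A" "0 <= B" unfolding AS BS by (auto intro!: sum_nonneg A0 B0)
 have AaA: "Aa a <= A" for a unfolding AS by (rule member_le_sum) (auto simp: A0)
 have BaB: "Ba a <= B" for a unfolding BS by (rule member_le_sum) (auto simp: B0)
 have S0: "0 <= de * B + C * A" using pos AB0 by simp
 have Sa: "de * Ba a + C * Aa a <= de * B + C * A" for a by (intro add_mono mult_left_mono AaA BaB pos)
 have "AEl x. \<forall>a. ((m1 x - m2 x) $ a)^2 <= de * Ba a + C * Aa a"
  by (subst AE_all_countable) (use isup[rule_format, OF H] in \<open>simp add: Aa_def Ba_def\<close>)
 then show "AEl x. (norm (m1 x - m2 x))^2 <= de * B + C * A"
 proof eventually_elim
  case (elim x)
  have "(norm (m1 x - m2 x))^2 = (SUM3 a. ((m1 x - m2 x) $ a)^2)" by (rule norm_power2_vec3)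
  also have "... <= (SUM3 a. de * Ba a + C * Aa a)" by (intro sum_mono) (use elim in blast)
  also have "... = de * B + C * A" unfolding AS BS by (simp add: sum.distrib sum_distrib_left)
  finally show ?case .
 qed
 have i4: "integ (%x. ((D1 k x - D2 k x) $ a) ^ 4)" for k a by (rule H2f_gradient_L4(1)[OF H])
 have b4: "(LBINT x. ((D1 k x - D2 k x) $ a) ^ 4) <= (de * B + C * A)^2" for k a
 proof -
  have "sqrt (LBINT x. ((D1 k x - D2 k x) $ a) ^ 4) <= de * B + C * A"
   using ip[rule_format, OF H, of k a] Sa[of a] unfolding Aa_def Ba_def by linarith
  then show ?thesis using S0 real_sqrt_le_iff[of _ "(de * B + C * A)^2"] by simp
 qed
 have v4: "integ (%x. (norm (D1 k x - D2 k x)) ^ 4)" "(LBINT x. (norm (D1 k x - D2 k x)) ^ 4) <= 9 * (de * B + C * A)^2" for k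
 proof -
  show "integ (%x. (norm (D1 k x - D2 k x)) ^ 4)" by (rule vec_L4(1)[OF _ i4]) measurable
  have "(LBINT x. (norm (D1 k x - D2 k x)) ^ 4) <= 3 * (SUM3 a. LBINT x. ((D1 k x - D2 k x) $ a) ^ 4)"
   by (rule vec_L4(2)[OF _ i4]) measurable
  also have "... <= 3 * (\<Sum>a\<in>(UNIV::3 set). (de * B + C * A)^2)" by (intro mult_left_mono sum_mono b4) simp
  finally show "(LBINT x. (norm (D1 k x - D2 k x)) ^ 4) <= 9 * (de * B + C * A)^2" by simp
 qed
 have is4: "integ (%x. 27 * (SUM3 k. (norm (D1 k x - D2 k x)) ^ 4))"
  using v4(1) by simp
 have le4: "(SUM3 k. norm (D1 k x - D2 k x)) ^ 4 <= 27 * (SUM3 k. (norm (D1 k x - D2 k x)) ^ 4)" for x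
  using sum3_fourth_le by (simp add: sum_3)
 show ig: "integ (%x. (SUM3 k. norm (D1 k x - D2 k x)) ^ 4)"
  by (rule Bi_integrable_bound[OF is4]) (auto intro!: AE_I2 order_trans[OF le4] simp: sum_nonneg)
 have "(LBINT x. (SUM3 k. norm (D1 k x - D2 k x)) ^ 4) <= (LBINT x. 27 * (SUM3 k. (norm (D1 k x - D2 k x)) ^ 4))"
  by (intro integral_mono ig is4 le4)
 also have "... = 27 * (SUM3 k. LBINT x. (norm (D1 k x - D2 k x)) ^ 4)"
  using v4(1) by (simp add: Bi_integral_sum)
 also have "... <= 27 * (\<Sum>k\<in>(UNIV::3 set). 9 * (de * B + C * A)^2)" by (intro mult_left_mono sum_mono v4(2)) simp
 also have "... = (27 * (de * B + C * A))^2" unfolding power_mult_distrib by simp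
 finally show "(LBINT x. (SUM3 k. norm (D1 k x - D2 k x)) ^ 4) <= (27 * (de * B + C * A))^2" .
 have cur: "integ (%x. norm (j x) * \<bar>(D1 k x - D2 k x) $ a\<bar>)" "(LBINT x. norm (j x) * \<bar>(D1 k x - D2 k x) $ a\<bar>) <= (K + 4096) * sqrt B" for k a
 proof -
  have e: "(sqrt B) ^ 6 = B ^ 3"
  proof -
   have "(sqrt B) ^ 6 = ((sqrt B)^2) ^ 3" by (simp flip: power_mult)
   then show ?thesis using AB0 by simp
  qed
  have "(LBINT x. ((D1 k x - D2 k x) $ a) ^ 6) <= 4096 * Ba a ^ 3" unfolding Ba_def by (rule H2f_gradient_L6(2)[OF H])
  also have "... <= 4096 * (sqrt B) ^ 6" unfolding e by (intro mult_left_mono power_mono BaB B0) simp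
  finally have 6: "(LBINT x. ((D1 k x - D2 k x) $ a) ^ 6) <= 4096 * (sqrt B) ^ 6" .
  have mj: "(%x. norm (j x)) : borel_measurable lborel" "(%x. (D1 k x - D2 k x) $ a) : borel_measurable lborel" by measurable
  show "integ (%x. norm (j x) * \<bar>(D1 k x - D2 k x) $ a\<bar>)" "(LBINT x. norm (j x) * \<bar>(D1 k x - D2 k x) $ a\<bar>) <= (K + 4096) * sqrt B"
   by (rule current_gradient_integral[OF mj norm_ge_zero ji jK H2f_gradient_L6(1)[OF H] 6]; use AB0 in simp)+
 qed
 have is6: "integ (%x. SUM3 k. SUM3 a. norm (j x) * \<bar>(D1 k x - D2 k x) $ a\<bar>)" by (intro Bi_integrable_sum cur)
 have le6: "norm (j x) * (SUM3 k. norm (D1 k x - D2 k x)) <= (SUM3 k. SUM3 a. norm (j x) * \<bar>(D1 k x - D2 k x) $ a\<bar>)" for x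
  unfolding sum_distrib_left[symmetric] by (intro mult_left_mono sum_mono norm_le_l1_cart) simp
 show ic: "integ (%x. norm (j x) * (SUM3 k. norm (D1 k x - D2 k x)))"
 proof (rule Bi_integrable_bound[OF is6])
  show "AEl x. norm (norm (j x) * (SUM3 k. norm (D1 k x - D2 k x))) <= norm (SUM3 k. SUM3 a. norm (j x) * \<bar>(D1 k x - D2 k x) $ a\<bar>)"
  proof (rule AE_I2)
   fix x
   have "0 <= norm (j x) * (SUM3 k. norm (D1 k x - D2 k x))" by (simp add: sum_nonneg)
   then show "norm (norm (j x) * (SUM3 k. norm (D1 k x - D2 k x))) <= norm (SUM3 k. SUM3 a. norm (j x) * \<bar>(D1 k x - D2 k x) $ a\<bar>)"
    using le6[of x] unfolding real_norm_def by linarith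
  qed
 qed measurable
 have "(LBINT x. norm (j x) * (SUM3 k. norm (D1 k x - D2 k x))) <= (LBINT x. (SUM3 k. SUM3 a. norm (j x) * \<bar>(D1 k x - D2 k x) $ a\<bar>))"
  by (intro integral_mono ic is6 le6)
 also have "... = (SUM3 k. SUM3 a. LBINT x. norm (j x) * \<bar>(D1 k x - D2 k x) $ a\<bar>)"
  by (subst Bi_integral_sum, intro Bi_integrable_sum cur, intro sum.cong refl Bi_integral_sum cur)
 also have "... <= (\<Sum>k\<in>(UNIV::3 set). \<Sum>a\<in>(UNIV::3 set). (K + 4096) * sqrt B)" by (intro sum_mono cur)
 also have "... = 9 * (K + 4096) * sqrt B" by simp
 finally show "(LBINT x. norm (j x) * (SUM3 k. norm (D1 k x - D2 k x))) <= 9 * (K + 4096) * sqrt B" .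
qed

text \<open>
 Both solutions are tested with the same multiplier; the time derivatives enter only through the
 inner product with the difference.
\<close>

lemma slice_energy_identity:
 assumes alpha: "0 < alpha" and S1: "slice_sol alpha h j m1 D1 DD1 p1" and S2: "slice_sol alpha h j m2 D2 DD2 p2"
  and jm[measurable]: "j : Bm" and ji: "integ (%x. norm (j x) powr (6/5))"
 obtains W where "integ W" "(LBINT x. W x) = 0"
  "AEl x. (1 + alpha^2) * ((p1 x - p2 x) \<bullet> (m1 x - m2 x)) + W x \<le>
   - (alpha / 2) * (norm ((SUM3 k. DD1 k k x) - (SUM3 k. DD2 k k x)))^2
   + energy_const alpha h * ((norm (m1 x - m2 x) * (norm (SUM3 k. DD1 k k x) + norm (SUM3 k. DD2 k k x))
     + (SUM3 k. norm (D1 k x - D2 k x)) * (SUM3 k. norm (D1 k x) + norm (D2 k x))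
     + norm (m1 x - m2 x) * (SUM3 k. norm (D1 k x) + norm (D2 k x))^2)^2
    + (norm (SUM3 k. DD1 k k x) + norm (SUM3 k. DD2 k k x)) * (SUM3 k. norm (D1 k x - D2 k x))^2
    + (norm (m1 x - m2 x))^2)
   + (1 + alpha) * norm (m1 x - m2 x) * (norm (j x) * (SUM3 k. norm (D1 k x - D2 k x)))"
proof -
 note mm = slice_solD(2-5)[OF S1] slice_solD(2-5)[OF S2]
 note [measurable] = mm
 define V where "V x = (m1 x - m2 x) + alpha *R cross3 (m1 x) (m2 x)" for x
 define V1 where "V1 k x = (D1 k x - D2 k x) + alpha *R (cross3 (D1 k x) (m2 x) + cross3 (m1 x) (D2 k x))" for k x
 define V2 where "V2 k x = (DD1 k k x - DD2 k k x) + alpha *R ((cross3 (DD1 k k x) (m2 x) + cross3 (D1 k x) (D2 k x)) + (cross3 (D1 k x) (D2 k x) + cross3 (m1 x) (DD2 k k x)))" for k x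
 have Vm[measurable]: "V : Bm" "V1 k : Bm" "V2 k : Bm" for k
  unfolding V_def[abs_def] V1_def[abs_def] V2_def[abs_def] by measurable
 have n1: "norm (m1 x) = 1" and n2: "norm (m2 x) = 1" for x using slice_solD(1)[OF S1] slice_solD(1)[OF S2] by auto
 have Vn: "norm (V x) <= (1 + alpha) * norm (m1 x - m2 x)" for x
 proof -
  have e: "cross3 (m1 x) (m2 x) = cross3 (m1 x - m2 x) (m2 x)"
   by (simp add: cross3_def vec_eq_iff forall_3 algebra_simps)
  have "norm (V x) <= norm (m1 x - m2 x) + alpha * norm (cross3 (m1 x - m2 x) (m2 x))"
   unfolding V_def e by (rule order_trans[OF norm_triangle_ineq]) (use alpha in simp)
  also have "... <= norm (m1 x - m2 x) + alpha * norm (m1 x - m2 x)"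
   using norm_cross_le[of "m1 x - m2 x" "m2 x"] alpha by (simp add: n2)
  finally show ?thesis by (simp add: distrib_right)
 qed
 have Vb: "norm (V x) <= (1 + alpha) * 2" for x
 proof (rule order_trans[OF Vn mult_left_mono])
  show "norm (m1 x - m2 x) <= 2" using norm_triangle_ineq4[of "m1 x" "m2 x"] by (simp add: n1 n2)
 qed (use alpha in simp)
 have nu2: "integ (%x. (norm (m1 x - m2 x))^2)"
  by (rule vec_L2) (rule H2fD(1)[OF slice_difference_H2f[OF S1 S2]])
 have V2i: "integ (%x. (norm (V x))^2)"
  by (rule integrable_power_bound[OF _ nu2, where c="1 + alpha"]) (use Vn in auto)
 have V1n: "norm (V1 k x) <= (1 + alpha) * (norm (D1 k x) + norm (D2 k x))" for k x
 proof -
  have "norm (cross3 (D1 k x) (m2 x) + cross3 (m1 x) (D2 k x)) <= norm (D1 k x) + norm (D2 k x)"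
   using norm_cross_le[of "D1 k x" "m2 x"] norm_cross_le[of "m1 x" "D2 k x"]
   by (intro norm_triangle_le add_mono) (auto simp: n1 n2)
  then have "norm (alpha *R (cross3 (D1 k x) (m2 x) + cross3 (m1 x) (D2 k x))) <= alpha * (norm (D1 k x) + norm (D2 k x))"
   using alpha by simp
  then have "norm (V1 k x) <= (norm (D1 k x) + norm (D2 k x)) + alpha * (norm (D1 k x) + norm (D2 k x))"
   unfolding V1_def by (intro norm_triangle_le add_mono norm_triangle_ineq4)
  then show ?thesis by (simp add: distrib_right)
 qed
 note SI1 = slice_sol_integrable[OF S1] and SI2 = slice_sol_integrable[OF S2]
 have D2s: "integ (%x. (norm (D1 k x) + norm (D2 k x))^2)" for k
 proof -
  have "integ (%x. norm (D1 k x) * norm (D2 k x))" by (intro CS_integrable SI1 SI2) measurable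
  then show ?thesis using SI1(2)[of k] SI2(2)[of k] by (simp add: power2_sum mult.assoc)
 qed
 have D4s: "integ (%x. (norm (D1 k x) + norm (D2 k x)) ^ 4)" for k
 proof (rule Bi_integrable_bound)
  show "integ (%x. 8 * ((norm (D1 k x)) ^ 4 + (norm (D2 k x)) ^ 4))" using SI1(3) SI2(3) by simp
  show "AEl x. norm ((norm (D1 k x) + norm (D2 k x)) ^ 4) <= norm (8 * ((norm (D1 k x)) ^ 4 + (norm (D2 k x)) ^ 4))"
   by (intro AE_I2) (use sum2_fourth_le in simp)
 qed measurable
 have V1i: "integ (%x. (norm (V1 k x))^2)" "integ (%x. (norm (V1 k x)) ^ 4)" for k
  by (rule integrable_power_bound[OF _ D2s[of k], where c="1 + alpha"] integrable_power_bound[OF _ D4s[of k], where c="1 + alpha"]; use V1n in auto)+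
 have V2n: "(norm (V2 k x))^2 <= 3 * (((1 + alpha) * norm (DD1 k k x))^2 + ((1 + alpha) * norm (DD2 k k x))^2 + (2 * alpha * (norm (D1 k x) * norm (D2 k x)))^2)" for k x
 proof -
  have "norm ((cross3 (DD1 k k x) (m2 x) + cross3 (D1 k x) (D2 k x)) + (cross3 (D1 k x) (D2 k x) + cross3 (m1 x) (DD2 k k x)))
    <= (norm (DD1 k k x) + norm (D1 k x) * norm (D2 k x)) + (norm (D1 k x) * norm (D2 k x) + norm (DD2 k k x))"
   using norm_cross_le[of "DD1 k k x" "m2 x"] norm_cross_le[of "m1 x" "DD2 k k x"] norm_cross_le[of "D1 k x" "D2 k x"]
   by (intro norm_triangle_le add_mono) (auto simp: n1 n2)
  then have "norm (alpha *R ((cross3 (DD1 k k x) (m2 x) + cross3 (D1 k x) (D2 k x)) + (cross3 (D1 k x) (D2 k x) + cross3 (m1 x) (DD2 k k x))))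
    <= alpha * ((norm (DD1 k k x) + norm (D1 k x) * norm (D2 k x)) + (norm (D1 k x) * norm (D2 k x) + norm (DD2 k k x)))"
   using alpha by simp
  then have "norm (V2 k x) <= (norm (DD1 k k x) + norm (DD2 k k x)) + alpha * ((norm (DD1 k k x) + norm (D1 k x) * norm (D2 k x)) + (norm (D1 k x) * norm (D2 k x) + norm (DD2 k k x)))"
   unfolding V2_def by (intro norm_triangle_le add_mono norm_triangle_ineq4)
  also have "... = (1 + alpha) * norm (DD1 k k x) + (1 + alpha) * norm (DD2 k k x) + 2 * alpha * (norm (D1 k x) * norm (D2 k x))"
   by (simp add: algebra_simps)
  finally have "(norm (V2 k x))^2 <= ((1 + alpha) * norm (DD1 k k x) + (1 + alpha) * norm (DD2 k k x) + 2 * alpha * (norm (D1 k x) * norm (D2 k x)))^2"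
   by (rule power_mono) simp
  then show ?thesis using sum3_squared_le order_trans by blast
 qed
 have V2i': "integ (%x. (norm (V2 k x))^2)" for k
 proof (rule Bi_integrable_bound)
  have "integ (%x. (norm (D1 k x) * norm (D2 k x))^2)" by (intro integrable_L4_product SI1 SI2) measurable
  then show "integ (%x. 3 * (((1 + alpha) * norm (DD1 k k x))^2 + ((1 + alpha) * norm (DD2 k k x))^2 + (2 * alpha * (norm (D1 k x) * norm (D2 k x)))^2))"
   unfolding power_mult_distrib[of "1 + alpha"] power_mult_distrib[of "2 * alpha"] using SI1(4) SI2(4)
   by (intro integrable_mult_right Bi_integrable_add) auto
  show "AEl x. norm ((norm (V2 k x))^2) <= norm (3 * (((1 + alpha) * norm (DD1 k k x))^2 + ((1 + alpha) * norm (DD2 k k x))^2 + (2 * alpha * (norm (D1 k x) * norm (D2 k x)))^2))"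
   using V2n by (intro AE_I2) (simp add: order_trans[OF _ abs_ge_self])
 qed measurable
 have l1: "AEl x. \<forall>a. line_ac (%s. V (x + s *R axis k 1) $ a) (%s. V1 k (x + s *R axis k 1) $ a)" for k
  using slice_sol_lines(1)[OF S1, of k] slice_sol_lines(1)[OF S2, of k]
 proof eventually_elim
  case (elim x)
  let ?y = "%s. x + s *R axis k 1 :: real^3"
  show ?case
  proof
   fix a
   have c: "line_ac (%s. cross3 (m1 (?y s)) (m2 (?y s)) $ a) (%s. (cross3 (D1 k (?y s)) (m2 (?y s)) + cross3 (m1 (?y s)) (D2 k (?y s))) $ a)"
    by (rule line_ac_cross3[OF elim(1)[rule_format] elim(2)[rule_format]]) measurable
   from line_ac_add[OF line_ac_diff[OF elim(1)[rule_format, of a] elim(2)[rule_format, of a]] line_ac_cmult[OF c, of alpha]]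
   show "line_ac (%s. V (?y s) $ a) (%s. V1 k (?y s) $ a)" by (simp add: V_def V1_def)
  qed
 qed
 have l2: "AEl x. \<forall>a. line_ac (%s. V1 k (x + s *R axis k 1) $ a) (%s. V2 k (x + s *R axis k 1) $ a)" for k
  using slice_sol_lines(1)[OF S1, of k] slice_sol_lines(1)[OF S2, of k] slice_sol_lines(2)[OF S1, of k k] slice_sol_lines(2)[OF S2, of k k]
 proof eventually_elim
  case (elim x)
  let ?y = "%s. x + s *R axis k 1 :: real^3"
  show ?case
  proof
   fix a
   have c1: "line_ac (%s. cross3 (D1 k (?y s)) (m2 (?y s)) $ a) (%s. (cross3 (DD1 k k (?y s)) (m2 (?y s)) + cross3 (D1 k (?y s)) (D2 k (?y s))) $ a)"
    by (rule line_ac_cross3[OF elim(3)[rule_format] elim(2)[rule_format]]) measurable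
   have c2: "line_ac (%s. cross3 (m1 (?y s)) (D2 k (?y s)) $ a) (%s. (cross3 (D1 k (?y s)) (D2 k (?y s)) + cross3 (m1 (?y s)) (DD2 k k (?y s))) $ a)"
    by (rule line_ac_cross3[OF elim(1)[rule_format] elim(4)[rule_format]]) measurable
   from line_ac_add[OF line_ac_diff[OF elim(3)[rule_format, of a] elim(4)[rule_format, of a]] line_ac_cmult[OF line_ac_add[OF c1 c2], of alpha]]
   show "line_ac (%s. V1 k (?y s) $ a) (%s. V2 k (?y s) $ a)" by (simp add: V1_def V2_def)
  qed
 qed
 note T1 = slice_sol_tested[OF S1 jm ji Vm Vb V2i V1i V2i' l1 l2]
 note T2 = slice_sol_tested[OF S2 jm ji Vm Vb V2i V1i V2i' l1 l2]
 show thesis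
 proof (rule that[OF Bi_integrable_diff[OF T1(1) T2(1)]])
  show "(LBINT x. (cross3 (m1 x) (SUM3 k. DD1 k k x) \<bullet> (SUM3 k. V2 k x)
   + 2 * (SUM3 k. cross3 (D1 k x) (SUM3 k. DD1 k k x) \<bullet> V1 k x)
   - ((SUM3 k. j x $ k *R D1 k x) + (p1 x - cross3 (m1 x) (alpha *R p1 x + (SUM3 k. DD1 k k x) - h *R e3))) \<bullet> V x)
  - (cross3 (m2 x) (SUM3 k. DD2 k k x) \<bullet> (SUM3 k. V2 k x)
   + 2 * (SUM3 k. cross3 (D2 k x) (SUM3 k. DD2 k k x) \<bullet> V1 k x)
   - ((SUM3 k. j x $ k *R D2 k x) + (p2 x - cross3 (m2 x) (alpha *R p2 x + (SUM3 k. DD2 k k x) - h *R e3))) \<bullet> V x)) = 0"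
   unfolding Bi_integral_diff[OF T1(1) T2(1)] T1(2) T2(2) by simp
  show "AEl x. (1 + alpha^2) * ((p1 x - p2 x) \<bullet> (m1 x - m2 x)) +
   ((cross3 (m1 x) (SUM3 k. DD1 k k x) \<bullet> (SUM3 k. V2 k x)
   + 2 * (SUM3 k. cross3 (D1 k x) (SUM3 k. DD1 k k x) \<bullet> V1 k x)
   - ((SUM3 k. j x $ k *R D1 k x) + (p1 x - cross3 (m1 x) (alpha *R p1 x + (SUM3 k. DD1 k k x) - h *R e3))) \<bullet> V x)
  - (cross3 (m2 x) (SUM3 k. DD2 k k x) \<bullet> (SUM3 k. V2 k x)
   + 2 * (SUM3 k. cross3 (D2 k x) (SUM3 k. DD2 k k x) \<bullet> V1 k x)
   - ((SUM3 k. j x $ k *R D2 k x) + (p2 x - cross3 (m2 x) (alpha *R p2 x + (SUM3 k. DD2 k k x) - h *R e3))) \<bullet> V x)) \<le>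
   - (alpha / 2) * (norm ((SUM3 k. DD1 k k x) - (SUM3 k. DD2 k k x)))^2
   + energy_const alpha h * ((norm (m1 x - m2 x) * (norm (SUM3 k. DD1 k k x) + norm (SUM3 k. DD2 k k x))
     + (SUM3 k. norm (D1 k x - D2 k x)) * (SUM3 k. norm (D1 k x) + norm (D2 k x))
     + norm (m1 x - m2 x) * (SUM3 k. norm (D1 k x) + norm (D2 k x))^2)^2
    + (norm (SUM3 k. DD1 k k x) + norm (SUM3 k. DD2 k k x)) * (SUM3 k. norm (D1 k x - D2 k x))^2
    + (norm (m1 x - m2 x))^2)
   + (1 + alpha) * norm (m1 x - m2 x) * (norm (j x) * (SUM3 k. norm (D1 k x - D2 k x)))"
   using slice_sol_constraint[OF S1] slice_sol_constraint[OF S2] slice_solD(8)[OF S1] slice_solD(8)[OF S2]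
  proof eventually_elim
   case (elim x)
   define L1 where "L1 = (SUM3 k. DD1 k k x)"
   define L2 where "L2 = (SUM3 k. DD2 k k x)"
   define LV where "LV = (SUM3 k. V2 k x)"
   define E1 where "E1 = (SUM3 k. j x $ k *R D1 k x)"
   define E2 where "E2 = (SUM3 k. j x $ k *R D2 k x)"
   have LV: "LV = (L1 - L2) + alpha *R (cross3 L1 (m2 x) + 2 *R (SUM3 k. cross3 (D1 k x) (D2 k x)) + cross3 (m1 x) L2)"
    unfolding LV_def V2_def L1_def L2_def sum_3
    by (simp add: cross3_def vec_eq_iff forall_3 algebra_simps)
   note pw = difference_energy_pointwise(1)[OF alpha n1 n2 elim(1)[folded L1_def] elim(2)[folded L2_def] V_def V1_def LV refl refl refl refl refl refl, of h]
   have mi: "((p1 x - alpha *R cross3 (m1 x) (p1 x)) - (p2 x - alpha *R cross3 (m2 x) (p2 x))) \<bullet> V x = (1 + alpha^2) * ((p1 x - p2 x) \<bullet> (m1 x - m2 x))"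
    unfolding V_def by (rule multiplier_identity) (use n1 n2 elim in \<open>auto simp: norm_eq_1\<close>)
   have jb: "\<bar>(E1 - E2) \<bullet> V x\<bar> <= (1 + alpha) * norm (m1 x - m2 x) * (norm (j x) * (SUM3 k. norm (D1 k x - D2 k x)))"
   proof -
    have "E1 - E2 = (SUM3 k. j x $ k *R (D1 k x - D2 k x))" by (simp add: E1_def E2_def scaleR_diff_right sum_subtractf)
    then have "norm (E1 - E2) <= (SUM3 k. \<bar>j x $ k\<bar> * norm (D1 k x - D2 k x))" using norm_sum[of "%k. j x $ k *R (D1 k x - D2 k x)" UNIV] by simp
    also have "... <= norm (j x) * (SUM3 k. norm (D1 k x - D2 k x))"
     unfolding sum_distrib_left by (intro sum_mono mult_right_mono component_le_norm_cart) simp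
    finally have n: "norm (E1 - E2) <= norm (j x) * (SUM3 k. norm (D1 k x - D2 k x))" .
    have "\<bar>(E1 - E2) \<bullet> V x\<bar> <= norm (V x) * norm (E1 - E2)" using Cauchy_Schwarz_ineq2[of "E1 - E2" "V x"] by (simp add: mult.commute)
    also have "... <= ((1 + alpha) * norm (m1 x - m2 x)) * (norm (j x) * (SUM3 k. norm (D1 k x - D2 k x)))"
     using Vn alpha by (intro mult_mono n) auto
    finally show ?thesis .
   qed
   have split: "(p1 x - cross3 (m1 x) (alpha *R p1 x + L1 - h *R e3)) - (p2 x - cross3 (m2 x) (alpha *R p2 x + L2 - h *R e3))
    = ((p1 x - alpha *R cross3 (m1 x) (p1 x)) - (p2 x - alpha *R cross3 (m2 x) (p2 x))) - (cross3 (m1 x) L1 - cross3 (m2 x) L2) + h *R cross3 (m1 x - m2 x) e3"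
    by (simp add: cross3_def vec_eq_iff forall_3 algebra_simps)
   have "(p1 x - cross3 (m1 x) (alpha *R p1 x + L1 - h *R e3)) \<bullet> V x - (p2 x - cross3 (m2 x) (alpha *R p2 x + L2 - h *R e3)) \<bullet> V x
    = (1 + alpha^2) * ((p1 x - p2 x) \<bullet> (m1 x - m2 x)) - (cross3 (m1 x) L1 - cross3 (m2 x) L2) \<bullet> V x + h * (cross3 (m1 x - m2 x) e3 \<bullet> V x)"
   proof -
    have g: "(P - Q + h *R R) \<bullet> v = P \<bullet> v - Q \<bullet> v + h * (R \<bullet> v)" for P Q R v :: "real^3" by (simp add: inner_add_left inner_diff_left)
    show ?thesis
     unfolding inner_diff_left[of "p1 x - cross3 (m1 x) (alpha *R p1 x + L1 - h *R e3)", symmetric] split g mi ..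
   qed
   moreover have "(cross3 (m1 x) L1 - cross3 (m2 x) L2) \<bullet> LV = cross3 (m1 x) L1 \<bullet> LV - cross3 (m2 x) L2 \<bullet> LV" by (simp add: inner_diff_left)
   moreover have "(SUM3 k. (cross3 (D1 k x) L1 - cross3 (D2 k x) L2) \<bullet> V1 k x) = (SUM3 k. cross3 (D1 k x) L1 \<bullet> V1 k x) - (SUM3 k. cross3 (D2 k x) L2 \<bullet> V1 k x)"
    by (simp add: inner_diff_left sum_subtractf)
   moreover have "(E1 - E2) \<bullet> V x = E1 \<bullet> V x - E2 \<bullet> V x" by (simp add: inner_diff_left)
   ultimately show ?case
    using pw jb unfolding L1_def[symmetric] L2_def[symmetric] LV_def[symmetric] E1_def[symmetric] E2_def[symmetric] inner_add_left
    by linarith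
  qed
 qed
qed

lemma three_term_bound:
 fixes p q r :: real
 assumes "s <= 3 * (p + q + r)" "p <= p'" "r <= r'"
 shows "s <= 3 * p' + 3 * q + 3 * r'"
proof -
 have "3 * (p + q + r) = 3 * p + 3 * q + 3 * r" by (simp add: distrib_left)
 moreover have "3 * p <= 3 * p'" "3 * r <= 3 * r'" using assms by simp_all
 ultimately show ?thesis using assms(1) by linarith
qed

text \<open>
 After integration every error term is a small multiple of the squared norm of the difference of the Laplacians, which the dissipation absorbs, plus a multiple of the squared norm of the difference. The constant depends only on the bound \<open>K\<close>, hence not on time.
\<close>

theorem slice_energy_estimate:
 assumes alpha: "0 < alpha" and K: "0 <= K"
 obtains C where "0 <= C"
  "!!j m1 D1 DD1 p1 m2 D2 DD2 p2. [|slice_sol alpha h j m1 D1 DD1 p1; slice_sol alpha h j m2 D2 DD2 p2; j : Bm;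
   integ (%x. norm (j x) powr (6/5)); (LBINT x. norm (j x) powr (6/5)) <= K;
   (LBINT x. (norm (SUM3 k. DD1 k k x))^2) <= K; (LBINT x. (norm (SUM3 k. DD2 k k x))^2) <= K;
   !!k. (LBINT x. (norm (D1 k x)) ^ 4) <= K; !!k. (LBINT x. (norm (D2 k x)) ^ 4) <= K|]
   ==> (LBINT x. (p1 x - p2 x) \<bullet> (m1 x - m2 x)) <= C * (LBINT x. (norm (m1 x - m2 x))^2)"
proof -
 define C0 where "C0 = energy_const alpha h"
 have C0: "0 <= C0" using alpha by (simp add: C0_def energy_const_def)
 define c where "c = 9 * (1 + alpha) * (K + 4096)"
 define M where "M = C0 * (3900 * K + 2970 * sqrt K) + c^2 / alpha"
 have M: "0 <= M" using alpha K C0 by (simp add: M_def)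
 define de where "de = alpha / (4 * (M + 1))"
 have de: "0 < de" using alpha M by (simp add: de_def)
 have Mde: "M * de <= alpha / 4" using alpha M by (simp add: de_def field_simps)
 obtain C where C: "0 <= C"
  "!!u D DD k. H2f u D DD ==> sqrt (LBINT x. (D k x) ^ 4) <= de * (LBINT x. (SUM3 k. DD k k x)^2) + C * (LBINT x. (u x)^2)"
  "!!u D DD. H2f u D DD ==> AEl x. (u x)^2 <= de * (LBINT x. (SUM3 k. DD k k x)^2) + C * (LBINT x. (u x)^2)"
  by (rule H2f_interpolation[OF de]) blast
 show thesis
 proof (rule that[of "M * C + C0"])
  show "0 <= M * C + C0" using M C C0 by simp
  fix j m1 D1 DD1 p1 m2 D2 DD2 p2
  assume S1: "slice_sol alpha h j m1 D1 DD1 p1" and S2: "slice_sol alpha h j m2 D2 DD2 p2" and jm[measurable]: "j : Bm"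
   and ji: "integ (%x. norm (j x) powr (6/5))" and jK: "(LBINT x. norm (j x) powr (6/5)) <= K"
   and LK1: "(LBINT x. (norm (SUM3 k. DD1 k k x))^2) <= K" and LK2: "(LBINT x. (norm (SUM3 k. DD2 k k x))^2) <= K"
   and DK1: "!!k. (LBINT x. (norm (D1 k x)) ^ 4) <= K" and DK2: "!!k. (LBINT x. (norm (D2 k x)) ^ 4) <= K"
  note mm = slice_solD(2-5)[OF S1] slice_solD(2-5)[OF S2]
  note [measurable] = mm
  note SI1 = slice_sol_integrable[OF S1] and SI2 = slice_sol_integrable[OF S2]
  obtain W where W: "integ W" "(LBINT x. W x) = 0"
   and ineq: "AEl x. (1 + alpha^2) * ((p1 x - p2 x) \<bullet> (m1 x - m2 x)) + W x \<le>
   - (alpha / 2) * (norm ((SUM3 k. DD1 k k x) - (SUM3 k. DD2 k k x)))^2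
   + energy_const alpha h * ((norm (m1 x - m2 x) * (norm (SUM3 k. DD1 k k x) + norm (SUM3 k. DD2 k k x))
     + (SUM3 k. norm (D1 k x - D2 k x)) * (SUM3 k. norm (D1 k x) + norm (D2 k x))
     + norm (m1 x - m2 x) * (SUM3 k. norm (D1 k x) + norm (D2 k x))^2)^2
    + (norm (SUM3 k. DD1 k k x) + norm (SUM3 k. DD2 k k x)) * (SUM3 k. norm (D1 k x - D2 k x))^2
    + (norm (m1 x - m2 x))^2)
   + (1 + alpha) * norm (m1 x - m2 x) * (norm (j x) * (SUM3 k. norm (D1 k x - D2 k x)))"
   by (rule slice_energy_identity[OF alpha S1 S2 jm ji])
  define nu where "nu x = norm (m1 x - m2 x)" for x
  define l where "l x = norm ((SUM3 k. DD1 k k x) - (SUM3 k. DD2 k k x))" for x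
  define N where "N x = norm (SUM3 k. DD1 k k x) + norm (SUM3 k. DD2 k k x)" for x
  define g where "g x = (SUM3 k. norm (D1 k x - D2 k x))" for x
  define d where "d x = (SUM3 k. norm (D1 k x) + norm (D2 k x))" for x
  have [measurable]: "nu : Bm" "l : Bm" "N : Bm" "g : Bm" "d : Bm"
   unfolding nu_def[abs_def] l_def[abs_def] N_def[abs_def] g_def[abs_def] d_def[abs_def] by measurable
  define A where "A = (LBINT x. (nu x)^2)"
  define B where "B = (LBINT x. (l x)^2)"
  define S where "S = de * B + C * A"
  have AB: "0 <= A" "0 <= B" unfolding A_def B_def by (auto intro!: integral_nonneg_AE)
  have S0: "0 <= S" using AB de C by (simp add: S_def)
  have ip: "\<forall>u D DD k. H2f u D DD --> sqrt (LBINT x. (D k x) ^ 4) <= de * (LBINT x. (SUM3 k. DD k k x)^2) + C * (LBINT x. (u x)^2)"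
   and isup: "\<forall>u D DD. H2f u D DD --> (AEl x. (u x)^2 <= de * (LBINT x. (SUM3 k. DD k k x)^2) + C * (LBINT x. (u x)^2))"
   using C(2,3) by blast+
  note bd = slice_difference_bounds[OF S1 S2 ip isup less_imp_le[OF de] C(1) jm ji jK A_def[unfolded nu_def] B_def[unfolded l_def], folded nu_def l_def g_def, folded S_def]
  have inu: "integ (%x. (nu x)^2)" and il: "integ (%x. (l x)^2)" and nuS: "AEl x. (nu x)^2 <= S"
   and ig: "integ (%x. (g x) ^ 4)" and gS: "(LBINT x. (g x) ^ 4) <= (27 * S)^2"
   and ij: "integ (%x. norm (j x) * g x)" and jB: "(LBINT x. norm (j x) * g x) <= 9 * (K + 4096) * sqrt B"
   by (rule bd | assumption)+
  have pos: "0 <= nu x" "0 <= l x" "0 <= N x" "0 <= g x" "0 <= d x" for x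
   by (auto simp: nu_def l_def N_def g_def d_def intro!: sum_nonneg)
  have iN: "integ (%x. (N x)^2)" and NK: "(LBINT x. (N x)^2) <= 4 * K"
  proof -
   have i: "integ (%x. 2 * ((norm (SUM3 k. DD1 k k x))^2 + (norm (SUM3 k. DD2 k k x))^2))" using SI1(5) SI2(5) by simp
   have le: "(N x)^2 <= 2 * ((norm (SUM3 k. DD1 k k x))^2 + (norm (SUM3 k. DD2 k k x))^2)" for x
    unfolding N_def using sum_squares_bound[of "norm (SUM3 k. DD1 k k x)" "norm (SUM3 k. DD2 k k x)"] by (simp add: power2_sum)
   show iN: "integ (%x. (N x)^2)"
    by (rule Bi_integrable_bound[OF i]) (auto intro!: AE_I2 order_trans[OF le])
   have "(LBINT x. (N x)^2) <= (LBINT x. 2 * ((norm (SUM3 k. DD1 k k x))^2 + (norm (SUM3 k. DD2 k k x))^2))"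
    by (intro integral_mono iN i le)
   then show "(LBINT x. (N x)^2) <= 4 * K" using LK1 LK2 SI1(5) SI2(5) by simp
  qed
  have idd: "integ (%x. (d x) ^ 4)" and dK: "(LBINT x. (d x) ^ 4) <= 1296 * K"
  proof -
   have i: "integ (%x. 216 * (SUM3 k. (norm (D1 k x)) ^ 4 + (norm (D2 k x)) ^ 4))" using SI1(3) SI2(3) by simp
   have le: "(d x) ^ 4 <= 216 * (SUM3 k. (norm (D1 k x)) ^ 4 + (norm (D2 k x)) ^ 4)" for x
   proof -
    have "(d x) ^ 4 <= 27 * (SUM3 k. (norm (D1 k x) + norm (D2 k x)) ^ 4)" using sum3_fourth_le by (simp add: sum_3 d_def)
    also have "... <= 27 * (SUM3 k. 8 * ((norm (D1 k x)) ^ 4 + (norm (D2 k x)) ^ 4))" by (intro mult_left_mono sum_mono sum2_fourth_le) simp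
    finally show ?thesis by (simp add: sum_3)
   qed
   show idd: "integ (%x. (d x) ^ 4)"
    by (rule Bi_integrable_bound[OF i]) (auto intro!: AE_I2 order_trans[OF le] simp: sum_nonneg)
   have "(LBINT x. (d x) ^ 4) <= (LBINT x. 216 * (SUM3 k. (norm (D1 k x)) ^ 4 + (norm (D2 k x)) ^ 4))"
    by (intro integral_mono idd i le)
   also have "... = 216 * (SUM3 k. (LBINT x. (norm (D1 k x)) ^ 4) + (LBINT x. (norm (D2 k x)) ^ 4))"
    using SI1(3) SI2(3) by (simp add: Bi_integral_sum)
   also have "... <= 216 * (\<Sum>k\<in>(UNIV::3 set). K + K)" by (intro mult_left_mono sum_mono add_mono DK1 DK2) simp
   finally show "(LBINT x. (d x) ^ 4) <= 1296 * K" by simp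
  qed
  have sq4: "((f x)^2)^2 = (f x) ^ 4" for f :: "real^3 => real" and x by (simp flip: power_mult)
  have ig2: "integ (%x. ((g x)^2)^2)" and id2: "integ (%x. ((d x)^2)^2)" using ig idd by (simp_all add: sq4)
  have sg: "sqrt (LBINT x. ((g x)^2)^2) <= 27 * S" using gS S0 by (intro real_le_lsqrt) (simp_all add: sq4)
  have sd: "sqrt (LBINT x. ((d x)^2)^2) <= 36 * sqrt K"
   using dK K by (intro real_le_lsqrt) (simp_all add: sq4 power_mult_distrib)
  have sN: "sqrt (LBINT x. (N x)^2) <= 2 * sqrt K"
   using NK K by (intro real_le_lsqrt) (simp_all add: power_mult_distrib)
  have m2: "(%x. (g x)^2) : borel_measurable lborel" "(%x. (d x)^2) : borel_measurable lborel" "N : borel_measurable lborel" by measurable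
  have igd: "integ (%x. (g x)^2 * (d x)^2)" by (rule CS_integrable[OF m2(1,2) ig2 id2])
  have gdS: "(LBINT x. (g x)^2 * (d x)^2) <= 972 * sqrt K * S"
  proof -
   have "(LBINT x. \<bar>(g x)\<^sup>2 * (d x)^2\<bar>) <= (27 * S) * (36 * sqrt K)"
    by (rule order_trans[OF CS_integral_sqrt[OF m2(1,2) ig2 id2] mult_mono[OF sg sd]]) (use S0 in auto)
   then show ?thesis by (simp add: mult.commute)
  qed
  have iNg: "integ (%x. N x * (g x)^2)" by (rule CS_integrable[OF m2(3,1) iN ig2])
  have NgS: "(LBINT x. N x * (g x)^2) <= 54 * sqrt K * S"
  proof -
   have "(LBINT x. \<bar>N x * (g x)^2\<bar>) <= (2 * sqrt K) * (27 * S)"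
    by (rule order_trans[OF CS_integral_sqrt[OF m2(3,1) iN ig2] mult_mono[OF sN sg]]) (use K in auto)
   then show ?thesis using pos by (simp add: abs_mult)
  qed
  define R where "R x = - (alpha / 2) * (l x)^2 + C0 * (3 * S * (N x)^2 + 3 * ((g x)^2 * (d x)^2) + 3 * S * (d x) ^ 4 + N x * (g x)^2 + (nu x)^2) + (1 + alpha) * sqrt S * (norm (j x) * g x)" for x
  have iR: "integ R" unfolding R_def[abs_def] using il iN igd idd iNg inu ij by simp
  have le: "AEl x. (1 + alpha^2) * ((p1 x - p2 x) \<bullet> (m1 x - m2 x)) + W x <= R x"
   using ineq nuS
  proof eventually_elim
   case (elim x)
   have 1: "(nu x * N x + g x * d x + nu x * (d x)^2)^2 <= 3 * S * (N x)^2 + 3 * ((g x)^2 * (d x)^2) + 3 * S * (d x) ^ 4"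
   proof -
    have n: "(nu x)^2 * (N x)^2 <= S * (N x)^2" by (intro mult_right_mono elim) simp
    have e: "(nu x)^2 * (d x) ^ 4 <= S * (d x) ^ 4" by (intro mult_right_mono elim) simp
    show ?thesis unfolding mult.assoc[of 3]
     by (rule three_term_bound[OF sum3_squared_le[of "nu x * N x" "g x * d x" "nu x * (d x)^2", unfolded power_mult_distrib sq4] n e])
   qed
   have "nu x <= sqrt S" using elim(2) by (rule real_le_rsqrt)
   then have 2: "(1 + alpha) * nu x * (norm (j x) * g x) <= (1 + alpha) * sqrt S * (norm (j x) * g x)"
    using alpha pos by (intro mult_right_mono mult_left_mono) auto
   have 3: "C0 * ((nu x * N x + g x * d x + nu x * (d x)^2)^2 + N x * (g x)^2 + (nu x)^2)
    <= C0 * (3 * S * (N x)^2 + 3 * ((g x)^2 * (d x)^2) + 3 * S * (d x) ^ 4 + N x * (g x)^2 + (nu x)^2)"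
    using 1 C0 by (intro mult_left_mono) auto
   show ?case
    using elim(1)[folded nu_def l_def N_def g_def d_def C0_def] 2 3 unfolding R_def by linarith
  qed
  have ipu: "integ (%x. (p1 x - p2 x) \<bullet> (m1 x - m2 x))"
  proof (rule integrable_inner_L2)
   have "integ (%x. ((p1 x - p2 x) $ a)^2)" for a
    unfolding vector_minus_component
    by (intro integrable_square_diff integrable_power_bound[OF _ slice_solD(7)[OF S1], where c=1] integrable_power_bound[OF _ slice_solD(7)[OF S2], where c=1])
     (auto simp: component_le_norm_cart)
   then show "integ (%x. (norm (p1 x - p2 x))^2)" by (rule vec_L2)
  qed (use inu in \<open>simp_all add: nu_def\<close>)
  define I where "I = (LBINT x. (p1 x - p2 x) \<bullet> (m1 x - m2 x))"
  have "(LBINT x. (1 + alpha^2) * ((p1 x - p2 x) \<bullet> (m1 x - m2 x)) + W x) <= (LBINT x. R x)"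
   using ipu W iR le by (intro integral_mono_AE) auto
  then have "(1 + alpha^2) * I <= (LBINT x. R x)" using ipu W by (simp add: I_def)
  also have "(LBINT x. R x) = - (alpha / 2) * B + C0 * (3 * S * (LBINT x. (N x)^2) + 3 * (LBINT x. (g x)^2 * (d x)^2) + 3 * S * (LBINT x. (d x) ^ 4) + (LBINT x. N x * (g x)^2) + A)
    + (1 + alpha) * sqrt S * (LBINT x. norm (j x) * g x)"
   unfolding R_def A_def B_def using il iN igd idd iNg inu ij by simp
  also have "... <= - (alpha / 2) * B + C0 * (3 * S * (4 * K) + 3 * (972 * sqrt K * S) + 3 * S * (1296 * K) + 54 * sqrt K * S + A)
    + (1 + alpha) * sqrt S * (9 * (K + 4096) * sqrt B)"
   using NK gdS dK NgS jB S0 C0 alpha by (intro add_mono mult_left_mono order_refl) auto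
  also have "... = - (alpha / 2) * B + C0 * ((3900 * K + 2970 * sqrt K) * S + A) + sqrt B * (c * sqrt S)"
   by (simp add: c_def algebra_simps)
  also have "... <= - (alpha / 2) * B + C0 * ((3900 * K + 2970 * sqrt K) * S + A) + (alpha / 4 * B + c^2 * S / alpha)"
  proof (rule add_left_mono)
   show "sqrt B * (c * sqrt S) <= alpha / 4 * B + c^2 * S / alpha"
    using young_quarter[OF alpha, of "sqrt B" "c * sqrt S"] AB S0 unfolding power_mult_distrib by simp
  qed
  also have "... = - (alpha / 4) * B + M * S + C0 * A"
   using alpha by (simp add: M_def algebra_simps)
  also have "... = - (alpha / 4) * B + (M * de) * B + (M * C + C0) * A" by (simp add: S_def algebra_simps)
  also have "... <= (M * C + C0) * A"
   using mult_right_mono[OF Mde AB(2)] by simp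
  finally have fin: "(1 + alpha^2) * I <= (M * C + C0) * A" .
  have "0 <= (M * C + C0) * A" using M C C0 AB by simp
  moreover have "I <= (1 + alpha^2) * I" if "0 <= I" using that by (simp add: distrib_right)
  ultimately have "I <= (M * C + C0) * A" using fin by linarith
  then show "(LBINT x. (p1 x - p2 x) \<bullet> (m1 x - m2 x)) <= (M * C + C0) * (LBINT x. (norm (m1 x - m2 x))^2)"
   by (simp add: I_def A_def nu_def)
 qed
qed

section \<open>Borel representatives\<close>

definition borel_rep :: "'a::euclidean_space set => ('a => 'b::euclidean_space) => ('a => 'b) => bool" where
 "borel_rep Om f f' \<longleftrightarrow> f' : Bm \<and> (AEl x. x \<in> Om --> f x = f' x)"

lemma borel_repD: "borel_rep Om f f' ==> f' : Bm" "borel_rep Om f f' ==> AEl x. x \<in> Om --> f x = f' x"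
 by (simp_all add: borel_rep_def)

lemma lebesgue_rep:
 fixes f f' :: "'a::euclidean_space => 'b::euclidean_space"
 assumes m: "f' : Bm" and e: "AEl x. f x = f' x"
 shows "f : borel_measurable lebesgue" "integrable lebesgue f \<longleftrightarrow> integ f'" "(\<integral>x. f x \<partial>lebesgue) = (LBINT x. f' x)"
proof -
 have m': "f' : borel_measurable lborel" using m by simp
 have mc: "f' : borel_measurable lebesgue" by (rule measurable_completion[OF m'])
 have e': "AE x in lebesgue. f x = f' x" using e by (rule AE_completion)
 then have e2: "AE x in lebesgue. f' x = f x" by (auto elim: eventually_mono)
 show mf: "f : borel_measurable lebesgue" by (rule borel_measurable_AE[OF mc e2])
 have "integrable lebesgue f \<longleftrightarrow> integrable lebesgue f'" by (rule integrable_cong_AE[OF mf mc e'])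
 then show "integrable lebesgue f \<longleftrightarrow> integ f'" using integrable_completion[OF m'] by simp
 show "(\<integral>x. f x \<partial>lebesgue) = (LBINT x. f' x)"
  using integral_cong_AE[OF mf mc e'] integral_completion[OF m'] by simp
qed

lemma loc_int_rep:
 fixes f f' :: "'a::euclidean_space => real^3"
 assumes l: "locally_integrable_on Om f" and r: "borel_rep Om f f'"
 shows "loc_int Om (%x. f' x $ a)"
 unfolding loc_int_def
proof (intro conjI allI impI)
 have [measurable]: "f' : Bm" using r by (rule borel_repD)
 show "(%x. f' x $ a) : Bm" by measurable
 fix K assume K: "compact K \<and> K \<subseteq> Om"
 then have K': "K \<in> sets borel" by (auto intro: borel_compact)
 note [measurable] = K'
 have "integrable (lebesgue_on K) f" using l K by (simp add: locally_integrable_on_def)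
 then have k: "integrable lebesgue (%x. indicator K x *R f x)" using K' by (subst (asm) integrable_restrict_space) auto
 have e: "AEl x. indicator K x *R f x = indicator K x *R f' x"
  using borel_repD(2)[OF r] by eventually_elim (use K in \<open>auto simp: indicator_def\<close>)
 have m: "(%x. indicator K x *R f' x) : Bm" by measurable
 have i: "integ (%x. indicator K x *R f' x)" by (rule lebesgue_rep(2)[OF m e, THEN iffD1, OF k])
 have "integ (%x. (indicator K x *R f' x) $ a)" by (rule integrable_bounded_linear[OF bounded_linear_vec_nth i])
 then show "integ (%x. indicator K x * f' x $ a)" by simp
qed

lemma dist_of_rep:
 fixes f f' :: "'a::euclidean_space => real^3"
 assumes Om: "open Om" and r: "borel_rep Om f f'" and phi: "phi : tests Om" and l: "!!a. loc_int Om (%x. f' x $ a)"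
 shows "dist_of Om f phi $ a = (LBINT x. phi x * f' x $ a)"
proof -
 have [measurable]: "f' : Bm" using r by (rule borel_repD)
 have [measurable]: "phi : Bm" by (rule test_functions_measurable[OF phi])
 obtain K where K: "K \<subseteq> Om" "!!x. x \<notin> K ==> phi x = 0" using test_functionsD[OF phi] by metis
 have "AEl x. indicator Om x *R (phi x *R f x) = phi x *R f' x"
  using borel_repD(2)[OF r]
 proof eventually_elim
  case (elim x)
  show ?case
  proof (cases "x \<in> Om")
   case False
   then have "phi x = 0" using K by blast
   then show ?thesis by simp
  qed (use elim in simp)
 qed
 moreover have "(%x. phi x *R f' x) : Bm" by measurable
 ultimately have "(\<integral>x. indicator Om x *R (phi x *R f x) \<partial>lebesgue) = (LBINT x. phi x *R f' x)" by (intro lebesgue_rep(3))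
 then have d: "dist_of Om f phi = (LBINT x. phi x *R f' x)"
  unfolding dist_of_def using Om by (subst integral_restrict_space) auto
 have c: "integ (%x. phi x * f' x $ b)" for b by (rule loc_int_mult_test[OF l phi])
 have i: "integ (%x. phi x *R f' x)"
 proof (rule Bi_integrable_bound)
  show "integ (%x. SUM3 b. \<bar>phi x * f' x $ b\<bar>)" using c by (intro Bi_integrable_sum integrable_abs)
  show "AEl x. norm (phi x *R f' x) <= norm (SUM3 b. \<bar>phi x * f' x $ b\<bar>)"
   by (intro AE_I2) (use norm_le_l1_cart[of "phi _ *R f' _"] in \<open>simp add: abs_of_nonneg[OF sum_nonneg]\<close>)
 qed measurable
 have "dist_of Om f phi $ a = (LBINT x. (phi x *R f' x) $ a)"
  unfolding d by (rule integral_bounded_linear[OF bounded_linear_vec_nth i, symmetric])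
 then show ?thesis by simp
qed

lemma weak_deriv_rep:
 fixes u w :: "'a::euclidean_space => real^3"
 assumes Om: "open Om" and w: "has_weak_deriv Om v u w" and u': "borel_rep Om u u'" and w': "borel_rep Om w w'"
 shows "wder Om v (%x. u' x $ a) (%x. w' x $ a)"
 unfolding wder_def
proof (intro conjI ballI)
 have l: "loc_int Om (%x. u' x $ a)" "loc_int Om (%x. w' x $ a)" for a
  using w u' w' by (auto simp: has_weak_deriv_def intro: loc_int_rep)
 show "loc_int Om (%x. u' x $ a)" "loc_int Om (%x. w' x $ a)" by (rule l)+
 fix phi assume phi: "phi : tests Om"
 have "dist_deriv v (dist_of Om u) phi $ a = dist_of Om w phi $ a" using w phi by (simp add: has_weak_deriv_def)
 then show "(LBINT x. FD phi (at x) v * u' x $ a) = - (LBINT x. phi x * w' x $ a)"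
  unfolding dist_deriv_def vector_uminus_component
   dist_of_rep[OF Om u' test_functions_frechet[OF phi] l(1)] dist_of_rep[OF Om w' phi l(2)] by simp
qed

lemma ex_borel_rep_measurable:
 fixes f :: "'a::euclidean_space => real^3"
 assumes Om: "open Om" and f: "(%x. indicator Om x *R f x) : borel_measurable lebesgue"
 obtains f' where "borel_rep Om f f'"
proof -
 have "\<exists>g\<in>borel_measurable lborel. AEl x. (indicator Om x *R f x) $ a = g x" for a
 proof (rule completion_ex_borel_measurable_real)
  show "(%x. (indicator Om x *R f x) $ a) : borel_measurable lebesgue" using f by measurable
 qed
 then obtain g where g: "!!a. g a : borel_measurable lborel" "!!a. AEl x. (indicator Om x *R f x) $ a = g a x" by metis
 have "borel_rep Om f (%x. vec3 (g 1 x) (g 2 x) (g 3 x))"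
  unfolding borel_rep_def
 proof
  have [measurable]: "g a : Bm" for a using g(1) by simp
  show "(%x. vec3 (g 1 x) (g 2 x) (g 3 x)) : Bm" by measurable
  show "AEl x. x \<in> Om --> f x = vec3 (g 1 x) (g 2 x) (g 3 x)"
   using g(2)[of 1] g(2)[of 2] g(2)[of 3] by eventually_elim (auto simp: vec_eq_iff forall_3)
 qed
 then show thesis by (rule that)
qed

lemma ex_borel_rep:
 fixes f :: "'a::euclidean_space => real^3"
 assumes Om: "open Om" and f: "f : borel_measurable (lebesgue_on Om)"
 obtains f' where "borel_rep Om f f'"
proof (rule ex_borel_rep_measurable[OF Om])
 show "(%x. indicator Om x *R f x) : borel_measurable lebesgue"
  using f Om by (subst (asm) borel_measurable_restrict_space_iff) auto
qed (rule that)

lemma ex_borel_rep_locally_integrable: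
 fixes f :: "'a::euclidean_space => real^3"
 assumes Om: "open Om" and f: "locally_integrable_on Om f"
 obtains f' where "borel_rep Om f f'"
proof (rule ex_borel_rep_measurable[OF Om])
 obtain C where C: "!!n. compact (C n)" "!!n. C n \<subseteq> Om" "!!n. C n \<subseteq> interior (C (Suc n))" "\<Union>(range C) = Om"
  "!!K. compact K ==> K \<subseteq> Om ==> \<exists>N. \<forall>n\<ge>N. K \<subseteq> C n"
  by (rule open_Union_compact_subsets[OF Om]) blast
 show "(%x. indicator Om x *R f x) : borel_measurable lebesgue"
 proof (rule borel_measurable_LIMSEQ_metric)
  show "(%x. indicator (C n) x *R f x) : borel_measurable lebesgue" for n
  proof -
   have "integrable (lebesgue_on (C n)) f" using f C by (simp add: locally_integrable_on_def)
   then show ?thesis using borel_compact[OF C(1)[of n]] by (subst (asm) integrable_restrict_space) auto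
  qed
  fix x
  show "(%n. indicator (C n) x *R f x) ---> indicator Om x *R f x"
  proof (cases "x \<in> Om")
   case True
   then obtain N where "\<forall>n\<ge>N. {x} \<subseteq> C n" using C(5)[of "{x}"] by auto
   then have "eventually (%n. indicator (C n) x *R f x = indicator Om x *R f x) sequentially"
    using True unfolding eventually_sequentially by (auto simp: indicator_def)
   then show ?thesis by (rule tendsto_eventually)
  next
   case False
   then have "x \<notin> C n" for n using C(2) by blast
   then show ?thesis using False by simp
  qed
 qed
qed (rule that)

lemma Lp2_rep:
 fixes f f' :: "'a::euclidean_space => 'b::euclidean_space"
 assumes f: "f \<in> Lp 2 lebesgue" and r: "borel_rep UNIV f f'"
 shows "integ (%x. (norm (f' x))^2)" "(LBINT x. (norm (f' x))^2) = (Lp_norm 2 lebesgue f)^2"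
proof -
 have [measurable]: "f' : Bm" using r by (rule borel_repD)
 have e: "AEl x. (norm (f x))^2 = (norm (f' x))^2" using borel_repD(2)[OF r] by eventually_elim simp
 have m: "(%x. (norm (f' x))^2) : Bm" by measurable
 show "integ (%x. (norm (f' x))^2)" using f lebesgue_rep(2)[OF m e] by (simp add: Lp_def)
 have "0 <= (LBINT x. (norm (f' x))^2)" by (rule integral_nonneg_AE) simp
 then show "(LBINT x. (norm (f' x))^2) = (Lp_norm 2 lebesgue f)^2"
  using lebesgue_rep(3)[OF m e] by (simp add: Lp_norm_def powr_half_sqrt)
qed

lemma weak_deriv_is_weak_deriv: "weakly_differentiable Om v u ==> has_weak_deriv Om v u (weak_deriv Om v u)"
 unfolding weakly_differentiable_def weak_deriv_def by (erule someI_ex)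

text \<open>
 The derivatives chosen by \<open>weak_deriv\<close> are replaced by Borel functions, to which the calculus along lines applies.
\<close>

lemma H2_representatives:
 fixes v v' :: "real^3 => real^3"
 assumes v: "v \<in> H2" and C: "H2_norm v <= C" and r: "borel_rep UNIV v v'"
 obtains D DD where "!!a. H2f (%x. v' x $ a) (%k x. D k x $ a) (%l k x. DD l k x $ a)"
  "!!k. D k : Bm" "!!l k. DD l k : Bm"
  "(LBINT x. (norm (v' x))^2) <= C^2" "!!k. (LBINT x. (norm (D k x))^2) <= C^2" "!!l k. (LBINT x. (norm (DD l k x))^2) <= C^2"
proof -
 define W where "W k = weak_deriv UNIV (axis k 1) v" for k :: 3
 define WW where "WW l k = weak_deriv UNIV (axis l 1) (W k)" for l k :: 3
 have B: "axis k 1 \<in> (Basis :: (real^3) set)" for k by simp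
 have d: "has_weak_deriv UNIV (axis k 1) v (W k)" "W k \<in> Lp 2 lebesgue"
  "has_weak_deriv UNIV (axis l 1) (W k) (WW l k)" "WW l k \<in> Lp 2 lebesgue" for l k
 proof -
  have 1: "weakly_differentiable UNIV (axis k 1) v \<and> W k \<in> Lp 2 lebesgue \<and>
   (\<forall>j\<in>Basis. weakly_differentiable UNIV j (W k) \<and> weak_deriv UNIV j (W k) \<in> Lp 2 lebesgue)"
   using v B[of k] unfolding H2_def W_def by blast
  then have 2: "weakly_differentiable UNIV (axis l 1) (W k)" "WW l k \<in> Lp 2 lebesgue" using B[of l] unfolding WW_def by blast+
  show "has_weak_deriv UNIV (axis k 1) v (W k)" "W k \<in> Lp 2 lebesgue"
   "has_weak_deriv UNIV (axis l 1) (W k) (WW l k)" "WW l k \<in> Lp 2 lebesgue"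
   using 1 2 unfolding W_def WW_def by (auto intro: weak_deriv_is_weak_deriv)
 qed
 have "\<exists>f'. borel_rep UNIV (W k) f'" for k
  using ex_borel_rep_locally_integrable[of UNIV "W k"] d(1)[of k] by (auto simp: has_weak_deriv_def)
 then obtain D where D: "!!k. borel_rep UNIV (W k) (D k)" by metis
 have "\<exists>f'. borel_rep UNIV (WW l k) f'" for l k
  using ex_borel_rep_locally_integrable[of UNIV "WW l k"] d(3)[of l k] by (auto simp: has_weak_deriv_def)
 then obtain DD where DD: "!!l k. borel_rep UNIV (WW l k) (DD l k)" by metis
 have v2: "v \<in> Lp 2 lebesgue" using v by (simp add: H2_def)
 note [measurable] = borel_repD(1)[OF r] borel_repD(1)[OF D] borel_repD(1)[OF DD]
 have comp: "integ (%x. (f x $ a)^2)" if [measurable]: "f : Bm" and "integ (%x. (norm (f x))^2)" for f :: "real^3 => real^3" and a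
  by (rule integrable_power_bound[OF _ that(2), where c=1]) (auto simp: component_le_norm_cart)
 show thesis
 proof (rule that[of D DD])
  show "H2f (%x. v' x $ a) (%k x. D k x $ a) (%l k x. DD l k x $ a)" for a
   unfolding H2f_def
   by (intro conjI allI comp Lp2_rep(1)[OF v2 r] Lp2_rep(1)[OF d(2) D] Lp2_rep(1)[OF d(4) DD]
     weak_deriv_rep[OF open_UNIV d(1) r D] weak_deriv_rep[OF open_UNIV d(3) D DD]) measurable
  have n: "0 <= (Lp_norm 2 lebesgue v)^2" "0 <= (\<Sum>i\<in>Basis. (Lp_norm 2 lebesgue (weak_deriv UNIV i v))^2)"
   "0 <= (\<Sum>i\<in>Basis. \<Sum>j\<in>Basis. (Lp_norm 2 lebesgue (weak_deriv UNIV j (weak_deriv UNIV i v)))^2)" by (simp_all add: sum_nonneg)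
  define s where "s = (Lp_norm 2 lebesgue v)^2 + (\<Sum>i\<in>Basis. (Lp_norm 2 lebesgue (weak_deriv UNIV i v))^2)
   + (\<Sum>i\<in>Basis. \<Sum>j\<in>Basis. (Lp_norm 2 lebesgue (weak_deriv UNIV j (weak_deriv UNIV i v)))^2)"
  have "sqrt s <= C" using C by (simp add: H2_norm_def s_def)
  then have "s <= C^2" by (rule sqrt_le_D)
  then show "(LBINT x. (norm (v' x))^2) <= C^2" unfolding Lp2_rep(2)[OF v2 r] using n by (simp add: s_def)
  show "(LBINT x. (norm (D k x))^2) <= C^2" for k
  proof -
   have "(Lp_norm 2 lebesgue (W k))^2 <= (\<Sum>i\<in>Basis. (Lp_norm 2 lebesgue (weak_deriv UNIV i v))^2)"
    unfolding W_def by (rule member_le_sum[OF B[of k]]) auto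
   then show ?thesis unfolding Lp2_rep(2)[OF d(2) D] using \<open>s <= C^2\<close> n unfolding s_def by linarith
  qed
  fix l k :: 3
  have "(Lp_norm 2 lebesgue (WW l k))^2 <= (\<Sum>j\<in>Basis. (Lp_norm 2 lebesgue (weak_deriv UNIV j (weak_deriv UNIV (axis k 1) v)))^2)"
   unfolding WW_def W_def by (rule member_le_sum[OF B[of l]]) auto
  also have "... <= (\<Sum>i\<in>Basis. \<Sum>j\<in>Basis. (Lp_norm 2 lebesgue (weak_deriv UNIV j (weak_deriv UNIV i v)))^2)"
   by (rule member_le_sum[OF B[of k]]) (auto simp: sum_nonneg)
  also have "... <= C^2" using \<open>s <= C^2\<close> n unfolding s_def by linarith
  finally show "(LBINT x. (norm (DD l k x))^2) <= C^2" unfolding Lp2_rep(2)[OF d(4) DD] .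
 qed measurable
qed

section \<open>Space-time and its slices\<close>

lemma open_spacetime: "open spacetime"
 unfolding spacetime_def by (intro open_Times) auto

lemma mem_spacetime [simp]: "(t, x) \<in> spacetime \<longleftrightarrow> 0 < t"
 by (simp add: spacetime_def)

lemma spacetime_borel [measurable]: "spacetime \<in> sets borel"
 using open_spacetime by simp

lemma spacetime_forward:
 assumes "z \<in> spacetime" "0 <= s"
 shows "z + s *R space_dir k \<in> spacetime" "z + s *R time_dir \<in> spacetime"
 using assms by (cases z; simp)+

lemma AE_slices:
 fixes P :: "real \<times> (real^3) => bool"
 assumes "AEl z. P z"
 shows "AEl t. AEl x. P (t, x)"
proof -
 have "AE z in lborel \<Otimes>\<^sub>M lborel. P z" unfolding lborel_prod by (rule assms)
 then show ?thesis by (rule lborel_pair.AE_pair)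
qed

lemma wder_space_slices:
 assumes w: "wder spacetime (space_dir k) f g"
 shows "AEl t. 0 < t --> (AEl x. line_ac (%s. f (t, x + s *R axis k 1)) (%s. g (t, x + s *R axis k 1)))"
proof -
 have "AEl z. z \<in> spacetime --> line_ac (%s. f (z + s *R space_dir k)) (%s. g (z + s *R space_dir k))"
  by (rule wder_line_ac[OF open_spacetime spacetime_forward(1) w])
 from AE_slices[OF this] show ?thesis by eventually_elim (auto elim: eventually_mono)
qed

text \<open>
 Tonelli: a compact set meets only a bounded interval of times.
\<close>

lemma loc_int_if_slice_bounded:
 fixes f :: "real \<times> (real^3) => real"
 assumes [measurable]: "f : Bm"
  and b: "AEl t. 0 < t --> integ (%x. f (t, x)) \<and> (LBINT x. \<bar>f (t, x)\<bar>) <= K"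
 shows "loc_int spacetime f"
 unfolding loc_int_def
proof (intro conjI allI impI)
 show "f : Bm" by fact
 fix A assume A: "compact A \<and> A \<subseteq> spacetime"
 then have [measurable]: "A \<in> sets borel" by (auto intro: borel_compact)
 have "bounded (fst ` A)" using A by (intro compact_imp_bounded compact_continuous_image continuous_intros) auto
 then obtain a where a: "fst ` A \<subseteq> cbox (- a) a" using bounded_subset_cbox_symmetric by blast
 define F where "F t x = indicator A (t, x) * f (t, x)" for t x
 have e: "case_prod F = (%z. indicator A z * f z)" by (auto simp: F_def fun_eq_iff)
 have "integrable (lborel \<Otimes>\<^sub>M lborel) (case_prod F)"
 proof (rule lborel_pair.integrable_prodI)
  show "case_prod F : borel_measurable (lborel \<Otimes>\<^sub>M lborel)" unfolding e lborel_prod by measurable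
  have "(NN t. NN x. ennreal \<bar>F t x\<bar>) <= (NN t. ennreal (max K 0) * indicator (cbox (- a) a) t)"
  proof (rule nn_integral_mono_AE)
   show "AEl t. (NN x. ennreal \<bar>F t x\<bar>) <= ennreal (max K 0) * indicator (cbox (- a) a) t"
    using b
   proof eventually_elim
    case (elim t)
    show ?case
    proof (cases "t \<in> fst ` A")
     case False
     then have "F t x = 0" for x by (force simp: F_def indicator_def)
     then show ?thesis by simp
    next
     case True
     then have t: "0 < t" "t \<in> cbox (- a) a" using A a by force+
     have "(NN x. ennreal \<bar>F t x\<bar>) <= (NN x. ennreal \<bar>f (t, x)\<bar>)"
      by (intro nn_integral_mono) (auto simp: F_def indicator_def)
     also have "... = ennreal (LBINT x. \<bar>f (t, x)\<bar>)" using elim t by (intro nn_integral_eq_integral integrable_abs) auto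
     also have "... <= ennreal (max K 0)" using elim t by (intro ennreal_leI) auto
     finally show ?thesis using t by simp
    qed
   qed
  qed
  also have "... < \<infinity>" using emeasure_lborel_cbox_finite[of "- a" a] by (simp add: nn_integral_cmult_indicator ennreal_mult_less_top)
  finally show "(NN t. NN x. ennreal \<bar>F t x\<bar>) < \<infinity>" .
 qed
 then show "integ (%z. indicator A z * f z)" unfolding e lborel_prod .
qed

lemma loc_int_bounded_mult:
 assumes f: "loc_int Om f" and [measurable]: "g : Bm" and g: "!!x. \<bar>g x\<bar> <= B"
 shows "loc_int Om (%x. g x * f x)"
 unfolding loc_int_def
proof (intro conjI allI impI)
 have [measurable]: "f : Bm" using f by (rule loc_int_measurable)
 show "(%x. g x * f x) : Bm" by measurable
 fix K assume K: "compact K \<and> K \<subseteq> Om"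
 then have [measurable]: "K \<in> sets borel" by (auto intro: borel_compact)
 show "integ (%x. indicator K x * (g x * f x))"
 proof (rule Bi_integrable_bound)
  show "integ (%x. B * (indicator K x * f x))" using f K by (intro integrable_mult_right) (simp add: loc_int_def)
  have "\<bar>g x\<bar> <= \<bar>B\<bar>" for x using g[of x] by linarith
  then show "AEl x. norm (indicator K x * (g x * f x)) <= norm (B * (indicator K x * f x))"
   by (intro AE_I2) (auto simp: indicator_def abs_mult intro: mult_right_mono)
 qed measurable
qed

lemma loc_int_cross_unit:
 fixes m w :: "'a::euclidean_space => real^3"
 assumes [measurable]: "m : Bm" and m: "!!x. norm (m x) <= 1" and w: "!!a. loc_int Om (%x. w x $ a)"
 shows "loc_int Om (%x. cross3 (m x) (w x) $ a)"
 unfolding cross3_nth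
 by (intro loc_int_diff loc_int_bounded_mult[where B=1] w order_trans[OF component_le_norm_cart m]) measurable

lemma slice_derivative_unique:
 fixes f f' g g' :: "'a::euclidean_space => real"
 assumes [measurable]: "f : Bm" "f' : Bm" "g : Bm" "g' : Bm"
  and e: "AEl x. f x = f' x"
  and l: "AEl x. line_ac (%s. f (x + s *R v)) (%s. g (x + s *R v))"
  and l': "AEl x. line_ac (%s. f' (x + s *R v)) (%s. g' (x + s *R v))"
 shows "AEl x. g x = g' x"
proof -
 have d: "AEl x. x \<in> UNIV --> line_ac (%s. f (x + s *R v) - f' (x + s *R v)) (%s. g (x + s *R v) - g' (x + s *R v))"
  using l l' by eventually_elim (intro impI line_ac_diff)
 have z: "AEl x. x \<in> UNIV --> f x - f' x = 0" using e by eventually_elim simp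
 have "AEl x. x \<in> UNIV --> g x - g' x = 0"
  by (rule line_derivative_of_constant_zero[OF open_UNIV UNIV_I d _ _ z]) measurable
 then show ?thesis by eventually_elim simp
qed

definition sphere_slice :: "real => (real^3 => real^3) => (3 => real^3 => real^3) => (3 => 3 => real^3 => real^3) => bool" where
 "sphere_slice K m D DD \<longleftrightarrow>
  (\<forall>a. H2f (%x. (m x - e3) $ a) (%k x. D k x $ a) (%l k x. DD l k x $ a)) \<and>
  (\<forall>k. D k : Bm) \<and> (\<forall>l k. DD l k : Bm) \<and>
  (LBINT x. (norm (m x - e3))^2) <= K \<and> (\<forall>k. (LBINT x. (norm (D k x))^2) <= K) \<and>
  (\<forall>k. (LBINT x. (norm (D k x)) ^ 4) <= K) \<and> (\<forall>k a. (LBINT x. (D k x $ a) ^ 6) <= K) \<and>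
  (LBINT x. (norm (SUM3 k. DD k k x))^2) <= K"

lemma sphere_sliceD:
 assumes "sphere_slice K m D DD"
 shows "H2f (%x. (m x - e3) $ a) (%k x. D k x $ a) (%l k x. DD l k x $ a)"
  "D k : Bm" "DD l k : Bm"
  "(LBINT x. (norm (m x - e3))^2) <= K" "(LBINT x. (norm (D k x))^2) <= K"
  "(LBINT x. (norm (D k x)) ^ 4) <= K" "(LBINT x. (D k x $ a) ^ 6) <= K"
  "(LBINT x. (norm (SUM3 k. DD k k x))^2) <= K"
 using assms by (simp_all add: sphere_slice_def)

lemma H2_sphere_slice:
 obtains K where "0 <= K" "!!v m. [|v \<in> H2; H2_norm v <= C; borel_rep UNIV v (%x. m x - e3)|] ==> \<exists>D DD. sphere_slice K m D DD"
proof -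
 obtain c where c: "0 <= c"
  "!!u D DD k. H2f u D DD ==> sqrt (LBINT x. (D k x) ^ 4) <= 1 * (LBINT x. (SUM3 k. DD k k x)^2) + c * (LBINT x. (u x)^2)"
  by (rule H2f_interpolation[of 1]) (simp, blast)
 define b where "b = 9 * C^2"
 define K where "K = b + 9 * (b + c * C^2)^2 + 4096 * b ^ 3"
 have b: "0 <= b" "C^2 <= b" by (simp_all add: b_def)
 have p: "0 <= 9 * (b + c * C^2)^2" "0 <= 4096 * b ^ 3" using b by simp_all
 show thesis
 proof (rule that[of K])
  show "0 <= K" using b p by (simp add: K_def)
  fix v m :: "real^3 => real^3" assume v: "v \<in> H2" "H2_norm v <= C" "borel_rep UNIV v (%x. m x - e3)"
  obtain D DD where H: "!!a. H2f (%x. (m x - e3) $ a) (%k x. D k x $ a) (%l k x. DD l k x $ a)"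
   and [measurable]: "!!k. D k : Bm" "!!l k. DD l k : Bm"
   and u2: "(LBINT x. (norm (m x - e3))^2) <= C^2" and D2: "!!k. (LBINT x. (norm (D k x))^2) <= C^2"
   and DD2: "!!l k. (LBINT x. (norm (DD l k x))^2) <= C^2"
   by (rule H2_representatives[OF v]) blast
  have m1: "(%x. m x - e3) : Bm" using borel_repD(1)[OF v(3)] .
  have iDD: "integ (%x. (norm (DD l k x))^2)" for l k by (rule vec_L2) (rule H2fD(3)[OF H])
  have iu: "integ (%x. (norm (m x - e3))^2)" by (rule vec_L2) (rule H2fD(1)[OF H])
  have iL: "integ (%x. (norm (SUM3 k. DD k k x))^2)" by (rule vec_L2) (use H2f_laplacian_integrable[OF H] in simp)
  have L2: "(LBINT x. (norm (SUM3 k. DD k k x))^2) <= b"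
  proof -
   have le: "(norm (SUM3 k. DD k k x))^2 <= 3 * (SUM3 k. (norm (DD k k x))^2)" for x
   proof -
    have "(norm (SUM3 k. DD k k x))^2 <= (SUM3 k. norm (DD k k x))^2" by (intro power_mono norm_sum) simp
    also have "... <= 3 * (SUM3 k. (norm (DD k k x))^2)"
     unfolding sum_3 by (rule sum3_squared_le)
    finally show ?thesis .
   qed
   have "(LBINT x. (norm (SUM3 k. DD k k x))^2) <= (LBINT x. 3 * (SUM3 k. (norm (DD k k x))^2))"
    using iDD by (intro integral_mono iL le) simp
   also have "... = 3 * (SUM3 k. LBINT x. (norm (DD k k x))^2)" using iDD by (simp add: Bi_integral_sum)
   also have "... <= 3 * (\<Sum>k\<in>(UNIV::3 set). C^2)" by (intro mult_left_mono sum_mono DD2) simp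
   finally show ?thesis by (simp add: b_def)
  qed
  have La: "(LBINT x. (SUM3 k. DD k k x $ a)^2) <= b" for a
  proof -
   have "(LBINT x. (SUM3 k. DD k k x $ a)^2) <= (LBINT x. (norm (SUM3 k. DD k k x))^2)"
   proof (intro integral_mono H2f_laplacian_integrable[OF H] iL)
    fix x
    have "\<bar>(SUM3 k. DD k k x) $ a\<bar> <= norm (SUM3 k. DD k k x)" by (rule component_le_norm_cart)
    then show "(SUM3 k. DD k k x $ a)^2 <= (norm (SUM3 k. DD k k x))^2" by (simp add: abs_le_square_iff[symmetric])
   qed
   then show ?thesis using L2 by linarith
  qed
  have ua: "(LBINT x. ((m x - e3) $ a)^2) <= C^2" for a
  proof -
   have "(LBINT x. ((m x - e3) $ a)^2) <= (LBINT x. (norm (m x - e3))^2)"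
   proof (intro integral_mono H2fD(1)[OF H] iu)
    fix x
    show "((m x - e3) $ a)^2 <= (norm (m x - e3))^2"
     using component_le_norm_cart[of "m x - e3" a] by (simp only: abs_le_square_iff[symmetric] abs_norm_cancel)
   qed
   then show ?thesis using u2 by linarith
  qed
  have D4a: "(LBINT x. (D k x $ a) ^ 4) <= (b + c * C^2)^2" for k a
  proof -
   have "sqrt (LBINT x. (D k x $ a) ^ 4) <= b + c * C^2"
    using c(2)[OF H, of k a] La[of a] mult_left_mono[OF ua[of a] c(1)] by linarith
   then show ?thesis by (rule sqrt_le_D)
  qed
  have D4: "(LBINT x. (norm (D k x)) ^ 4) <= 9 * (b + c * C^2)^2" for k
  proof -
   have "(LBINT x. (norm (D k x)) ^ 4) <= 3 * (SUM3 a. LBINT x. (D k x $ a) ^ 4)"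
    by (rule vec_L4(2)[OF _ H2f_gradient_L4(1)[OF H]]) measurable
   also have "... <= 3 * (\<Sum>a\<in>(UNIV::3 set). (b + c * C^2)^2)" by (intro mult_left_mono sum_mono D4a) simp
   finally show ?thesis by simp
  qed
  have D6: "(LBINT x. (D k x $ a) ^ 6) <= 4096 * b ^ 3" for k a
  proof (rule order_trans[OF H2f_gradient_L6(2)[OF H]])
   show "4096 * (LBINT x. (SUM3 k. DD k k x $ a)^2) ^ 3 <= 4096 * b ^ 3"
    by (intro mult_left_mono power_mono La integral_nonneg_AE) auto
  qed
  have kle: "b <= K" "9 * (b + c * C^2)^2 <= K" "4096 * b ^ 3 <= K" using b p unfolding K_def by linarith+
  have u2b: "(LBINT x. (norm (m x - e3))^2) <= b" using u2 b(2) by linarith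
  have D2b: "(LBINT x. (norm (D k x))^2) <= b" for k by (rule order_trans[OF D2 b(2)])
  have "sphere_slice K m D DD"
   unfolding sphere_slice_def
   by (intro conjI allI H order_trans[OF u2b kle(1)] order_trans[OF D2b kle(1)] order_trans[OF D4 kle(2)] order_trans[OF D6 kle(3)] order_trans[OF L2 kle(1)]) measurable
  then show "\<exists>D DD. sphere_slice K m D DD" by blast
 qed
qed

text \<open>
 Borel representatives of a solution, of its derivatives and of the current, on all of space-time;
 only the equation itself is left out.
\<close>

definition st_data ::
 "real => (real \<times> (real^3) => real^3) => (real \<times> (real^3) => real^3) => (3 => real \<times> (real^3) => real^3)
  => (3 => real \<times> (real^3) => real^3) => (real \<times> (real^3) => real^3) => bool" where
 "st_data K j m D DD p \<longleftrightarrow>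
  j : Bm \<and> m : Bm \<and> (\<forall>k. D k : Bm) \<and>
  (\<forall>k. DD k : Bm) \<and> p : Bm \<and> (\<forall>z. norm (m z) = 1) \<and>
  (\<forall>a. wder spacetime time_dir (%z. m z $ a) (%z. p z $ a)) \<and>
  (\<forall>k a. wder spacetime (space_dir k) (%z. m z $ a) (%z. D k z $ a)) \<and>
  (\<forall>k a. wder spacetime (space_dir k) (%z. D k z $ a) (%z. DD k z $ a)) \<and>
  integ (%z. indicator spacetime z * (norm (p z))^2) \<and>
  (AEl t. 0 < t --> integ (%x. norm (j (t, x)) powr (6/5)) \<and> (LBINT x. norm (j (t, x)) powr (6/5)) <= K) \<and>
  (AEl t. 0 < t --> (\<exists>D' DD'. sphere_slice K (%x. m (t, x)) D' DD'))"

lemma st_dataD: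
 assumes "st_data K j m D DD p"
 shows "j : Bm" "m : Bm" "D k : Bm"
  "DD k : Bm" "p : Bm" "norm (m z) = 1"
  "wder spacetime time_dir (%z. m z $ a) (%z. p z $ a)"
  "wder spacetime (space_dir k) (%z. m z $ a) (%z. D k z $ a)"
  "wder spacetime (space_dir k) (%z. D k z $ a) (%z. DD k z $ a)"
  "integ (%z. indicator spacetime z * (norm (p z))^2)"
  "AEl t. 0 < t --> integ (%x. norm (j (t, x)) powr (6/5)) \<and> (LBINT x. norm (j (t, x)) powr (6/5)) <= K"
  "AEl t. 0 < t --> (\<exists>D' DD'. sphere_slice K (%x. m (t, x)) D' DD')"
 by (insert assms, unfold st_data_def, (elim conjE, blast)+)

text \<open>
 The space derivatives on space-time and those of a slice both are derivatives along almost every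
 line parallel to a coordinate axis, so they agree.
\<close>

lemma st_data_slices:
 assumes S: "st_data K j m D DD p"
 shows "AEl t. 0 < t --> (\<exists>D' DD'. sphere_slice K (%x. m (t, x)) D' DD' \<and>
  (AEl x. \<forall>k. D k (t, x) = D' k x \<and> DD k (t, x) = DD' k k x))"
proof -
 note mm = st_dataD(2-5)[OF S]
 note [measurable] = mm
 have l1: "AEl t. \<forall>k a. 0 < t --> (AEl x. line_ac (%s. m (t, x + s *R axis k 1) $ a) (%s. D k (t, x + s *R axis k 1) $ a))"
  unfolding AE_all_countable by (intro allI wder_space_slices[OF st_dataD(8)[OF S]])
 have l2: "AEl t. \<forall>k a. 0 < t --> (AEl x. line_ac (%s. D k (t, x + s *R axis k 1) $ a) (%s. DD k (t, x + s *R axis k 1) $ a))"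
  unfolding AE_all_countable by (intro allI wder_space_slices[OF st_dataD(9)[OF S]])
 show ?thesis using st_dataD(12)[OF S] l1 l2
 proof eventually_elim
  case (elim t)
  show ?case
  proof
   assume t: "0 < t"
   then obtain D' DD' where SS: "sphere_slice K (%x. m (t, x)) D' DD'" using elim(1) by blast
   note H = sphere_sliceD(1)[OF SS]
   note ms = sphere_sliceD(2,3)[OF SS]
   note [measurable] = ms
   have 1: "AEl x. D k (t, x) $ a = D' k x $ a" for k a
   proof (rule slice_derivative_unique)
    show "AEl x. m (t, x) $ a = m (t, x) $ a" by simp
    show "AEl x. line_ac (%s. m (t, x + s *R axis k 1) $ a) (%s. D k (t, x + s *R axis k 1) $ a)" using elim(2) t by blast
    show "AEl x. line_ac (%s. m (t, x + s *R axis k 1) $ a) (%s. D' k (x + s *R axis k 1) $ a)"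
     using wder_UNIV_line_ac[OF H2fD(4)[OF H[of a], of k]]
    proof eventually_elim
     case (elim x)
     from line_ac_add[OF elim line_ac_const[of "e3 $ a"]] show ?case by simp
    qed
   qed measurable
   have 2: "AEl x. DD k (t, x) $ a = DD' k k x $ a" for k a
   proof (rule slice_derivative_unique[OF _ _ _ _ 1])
    show "AEl x. line_ac (%s. D k (t, x + s *R axis k 1) $ a) (%s. DD k (t, x + s *R axis k 1) $ a)" using elim(3) t by blast
    show "AEl x. line_ac (%s. D' k (x + s *R axis k 1) $ a) (%s. DD' k k (x + s *R axis k 1) $ a)"
     by (rule wder_UNIV_line_ac[OF H2fD(5)[OF H]])
   qed measurable
   have "AEl x. \<forall>k a. D k (t, x) $ a = D' k x $ a \<and> DD k (t, x) $ a = DD' k k x $ a"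
    unfolding AE_all_countable by (intro allI AE_conjI 1 2)
   then have "AEl x. \<forall>k. D k (t, x) = D' k x \<and> DD k (t, x) = DD' k k x"
    by eventually_elim (simp add: vec_eq_iff)
   with SS show "\<exists>D' DD'. sphere_slice K (%x. m (t, x)) D' DD' \<and> (AEl x. \<forall>k. D k (t, x) = D' k x \<and> DD k (t, x) = DD' k k x)" by blast
  qed
 qed
qed

lemma integrable_abs_le:
 fixes f g :: "'b => real"
 assumes "integrable M g" "f : borel_measurable M" "AE x in M. \<bar>f x\<bar> <= g x" "(\<integral>x. g x \<partial>M) <= c"
 shows "integrable M f \<and> (\<integral>x. \<bar>f x\<bar> \<partial>M) <= c"
proof
 show i: "integrable M f" by (rule Bi_integrable_bound[OF assms(1,2)]) (use assms(3) in eventually_elim, auto)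
 have "(\<integral>x. \<bar>f x\<bar> \<partial>M) <= (\<integral>x. g x \<partial>M)" by (intro integral_mono_AE integrable_abs i assms)
 then show "(\<integral>x. \<bar>f x\<bar> \<partial>M) <= c" using assms(4) by linarith
qed

lemma st_data_loc_int:
 assumes S: "st_data K j m D DD p"
 shows "loc_int spacetime (%z. p z $ a)" "loc_int spacetime (%z. m z $ a)"
  and "loc_int spacetime (%z. cross3 (m z) (SUM3 k. DD k z) $ a)"
  and "loc_int spacetime (%z. cross3 (m z) (alpha *R p z + (SUM3 k. DD k z) - h *R e3) $ a)"
  and "loc_int spacetime (%z. cross3 (D k z) (SUM3 k. DD k z) $ a)"
  and "loc_int spacetime (%z. (SUM3 k. (j z $ k) *R D k z) $ a)"
proof -
 note mm = st_dataD(1-5)[OF S]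
 note [measurable] = mm
 show p: "loc_int spacetime (%z. p z $ a)" and "loc_int spacetime (%z. m z $ a)" for a
  using st_dataD(7)[OF S, of a] by (auto simp: wder_def)
 have L: "loc_int spacetime (%z. (SUM3 k. DD k z) $ a)" for a
  using st_dataD(9)[OF S, of _ a] by (auto simp: wder_def sum_3 intro!: loc_int_add)
 have m1: "norm (m z) <= 1" for z using st_dataD(6)[OF S] by simp
 show "loc_int spacetime (%z. cross3 (m z) (SUM3 k. DD k z) $ a)" by (rule loc_int_cross_unit[OF mm(2) m1 L])
 have "loc_int spacetime (%z. (alpha *R p z + (SUM3 k. DD k z) - h *R e3) $ a)" for a
  unfolding vector_minus_component vector_add_component vector_scaleR_component real_scaleR_def
  by (intro loc_int_diff loc_int_add L loc_int_cmult p loc_int_UNIV_const)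
 then show "loc_int spacetime (%z. cross3 (m z) (alpha *R p z + (SUM3 k. DD k z) - h *R e3) $ a)" by (rule loc_int_cross_unit[OF mm(2) m1])
 show "loc_int spacetime (%z. cross3 (D k z) (SUM3 k. DD k z) $ a)"
 proof (rule loc_int_if_slice_bounded[where K="K + K"])
  show "AEl t. 0 < t --> integ (%x. cross3 (D k (t, x)) (SUM3 k. DD k (t, x)) $ a) \<and>
   (LBINT x. \<bar>cross3 (D k (t, x)) (SUM3 k. DD k (t, x)) $ a\<bar>) <= K + K"
   using st_data_slices[OF S]
  proof eventually_elim
   case (elim t)
   show ?case
   proof
    assume "0 < t"
    then obtain D' DD' where SS: "sphere_slice K (%x. m (t, x)) D' DD'"
     and e: "AEl x. \<forall>k. D k (t, x) = D' k x \<and> DD k (t, x) = DD' k k x" using elim by blast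
    note H = sphere_sliceD(1)[OF SS]
    have i: "integ (%x. (norm (D' k x))^2)" by (rule vec_L2) (rule H2fD(2)[OF H])
    have i': "integ (%x. (norm (SUM3 k. DD' k k x))^2)" by (rule vec_L2) (use H2f_laplacian_integrable[OF H] in simp)
    show "integ (%x. cross3 (D k (t, x)) (SUM3 k. DD k (t, x)) $ a) \<and>
     (LBINT x. \<bar>cross3 (D k (t, x)) (SUM3 k. DD k (t, x)) $ a\<bar>) <= K + K"
    proof (rule integrable_abs_le[where g="%x. (norm (D' k x))^2 + (norm (SUM3 k. DD' k k x))^2"])
     show "AEl x. \<bar>cross3 (D k (t, x)) (SUM3 k. DD k (t, x)) $ a\<bar> <= (norm (D' k x))^2 + (norm (SUM3 k. DD' k k x))^2"
      using e
     proof eventually_elim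
      case (elim x)
      have "\<bar>cross3 (D k (t, x)) (SUM3 k. DD k (t, x)) $ a\<bar> <= norm (D' k x) * norm (SUM3 k. DD' k k x)"
       using order_trans[OF component_le_norm_cart norm_cross_le] elim by simp
      also have "... <= (norm (D' k x))^2 + (norm (SUM3 k. DD' k k x))^2"
       using sum_squares_bound[of "norm (D' k x)" "norm (SUM3 k. DD' k k x)"]
       by (simp add: mult.assoc) (use mult_nonneg_nonneg[OF norm_ge_zero norm_ge_zero, of "D' k x" "SUM3 k. DD' k k x"] in linarith)
      finally show ?case .
     qed
     show "(LBINT x. (norm (D' k x))^2 + (norm (SUM3 k. DD' k k x))^2) <= K + K"
      using sphere_sliceD(5)[OF SS, of k] sphere_sliceD(8)[OF SS] by (simp add: Bi_integral_add[OF i i'])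
    qed (use i i' in simp, measurable)
   qed
  qed
 qed measurable
 have t: "loc_int spacetime (%z. j z $ k * D k z $ a)" for k
 proof (rule loc_int_if_slice_bounded[where K="K + K"])
  show "AEl t. 0 < t --> integ (%x. j (t, x) $ k * D k (t, x) $ a) \<and> (LBINT x. \<bar>j (t, x) $ k * D k (t, x) $ a\<bar>) <= K + K"
   using st_data_slices[OF S] st_dataD(11)[OF S]
  proof eventually_elim
   case (elim t)
   show ?case
   proof
    assume "0 < t"
    then obtain D' DD' where SS: "sphere_slice K (%x. m (t, x)) D' DD'"
     and e: "AEl x. \<forall>k. D k (t, x) = D' k x \<and> DD k (t, x) = DD' k k x" using elim by blast
    have J: "integ (%x. norm (j (t, x)) powr (6/5))" "(LBINT x. norm (j (t, x)) powr (6/5)) <= K" using elim \<open>0 < t\<close> by auto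
    note H = sphere_sliceD(1)[OF SS]
    have i: "integ (%x. (D' k x $ a) ^ 6)" by (rule H2f_gradient_L6(1)[OF H])
    show "integ (%x. j (t, x) $ k * D k (t, x) $ a) \<and> (LBINT x. \<bar>j (t, x) $ k * D k (t, x) $ a\<bar>) <= K + K"
    proof (rule integrable_abs_le[where g="%x. norm (j (t, x)) powr (6/5) + (D' k x $ a) ^ 6"])
     show "AEl x. \<bar>j (t, x) $ k * D k (t, x) $ a\<bar> <= norm (j (t, x)) powr (6/5) + (D' k x $ a) ^ 6"
      using e
     proof eventually_elim
      case (elim x)
      have "\<bar>j (t, x) $ k * D k (t, x) $ a\<bar> <= norm (j (t, x)) * \<bar>D' k x $ a\<bar>"
       using elim by (simp add: abs_mult mult_right_mono component_le_norm_cart)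
      also have "... <= norm (j (t, x)) powr (6/5) + \<bar>D' k x $ a\<bar> ^ 6" by (rule young_six_fifths) auto
      finally show ?case by (simp add: power_even_abs)
     qed
     show "(LBINT x. norm (j (t, x)) powr (6/5) + (D' k x $ a) ^ 6) <= K + K"
      using J(2) sphere_sliceD(7)[OF SS, of k a] by (simp add: Bi_integral_add[OF J(1) i])
    qed (use i J in simp, measurable)
   qed
  qed
 qed measurable
 show "loc_int spacetime (%z. (SUM3 k. (j z $ k) *R D k z) $ a)"
  using t by (auto simp: sum_3 intro!: loc_int_add)
qed

section \<open>From the distributional equation to its slices\<close>

lemma AE_positive_times:
 fixes P :: "real => bool"
 assumes "AE t in lebesgue_on {0<..}. P t"
 shows "AEl t. 0 < t --> P t"
proof -
 have "AE t in lebesgue. t \<in> {0<..} --> P t" using assms by (subst (asm) AE_restrict_space_iff) auto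
 then show ?thesis by (subst (asm) AE_completion_iff) simp
qed

lemma e3_norm: "norm e3 = 1"
 by (simp add: e3_def norm_eq_1 inner_vec_def sum_3)

lemma sphere_representative:
 assumes m: "m \<in> Linf_H2_sphere"
 obtains K m' where "0 <= K" "borel_rep spacetime m m'" "!!z. norm (m' z) = 1"
  "AEl t. 0 < t --> (\<exists>D DD. sphere_slice K (%x. m' (t, x)) D DD)"
proof -
 have "m : borel_measurable (lebesgue_on spacetime)" using m by (simp add: Linf_H2_sphere_def)
 then obtain m0 where m0: "borel_rep spacetime m m0" by (rule ex_borel_rep[OF open_spacetime])
 note [measurable] = borel_repD(1)[OF m0]
 obtain C where "AE t in lebesgue_on {0<..}. (%x. m (t, x)) \<in> H2_sphere \<and> H2_norm (%x. m (t, x) - e3) <= C"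
  using m by (auto simp: Linf_H2_sphere_def)
 from AE_positive_times[OF this] have C: "AEl t. 0 < t --> (%x. m (t, x)) \<in> H2_sphere \<and> H2_norm (%x. m (t, x) - e3) <= C" .
 have eq0: "AEl t. AEl x. (t, x) \<in> spacetime --> m (t, x) = m0 (t, x)"
  by (rule AE_slices[OF borel_repD(2)[OF m0]])
 define m' where "m' z = (if norm (m0 z) = 1 then m0 z else e3)" for z
 have m'm[measurable]: "m' : Bm" unfolding m'_def[abs_def] by measurable
 have "AEl t. AEl x. (t, x) \<in> spacetime --> norm (m0 (t, x)) = 1"
  using C eq0
 proof eventually_elim
  case (elim t)
  show ?case
  proof (cases "0 < t")
   case True
   then have "AE x in lebesgue. m (t, x) \<in> sphere 0 1" using elim by (simp add: H2_sphere_def)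
   then have "AEl x. m (t, x) \<in> sphere 0 1" by (subst (asm) AE_completion_iff)
   then show ?thesis using elim(2) by eventually_elim auto
  qed simp
 qed
 then have "AE z in lborel \<Otimes>\<^sub>M lborel. z \<in> spacetime --> norm (m0 z) = 1"
  by (intro lborel_pair.AE_pair_measure) (unfold lborel_prod, measurable)
 then have "AEl z. z \<in> spacetime --> norm (m0 z) = 1" unfolding lborel_prod .
 then have "AEl z. z \<in> spacetime --> m z = m' z"
  using borel_repD(2)[OF m0] by eventually_elim (simp add: m'_def)
 then have rep: "borel_rep spacetime m m'" using m'm by (simp add: borel_rep_def)
 obtain K where K: "0 <= K" "!!v m. [|v \<in> H2; H2_norm v <= C; borel_rep UNIV v (%x. m x - e3)|] ==> \<exists>D DD. sphere_slice K m D DD"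
  by (rule H2_sphere_slice[of C]) blast
 show thesis
 proof (rule that[OF K(1) rep])
  show "norm (m' z) = 1" for z by (simp add: m'_def e3_norm)
  show "AEl t. 0 < t --> (\<exists>D DD. sphere_slice K (%x. m' (t, x)) D DD)"
   using C AE_slices[OF borel_repD(2)[OF rep]]
  proof eventually_elim
   case (elim t)
   show ?case
   proof
    assume t: "0 < t"
    have b: "borel_rep UNIV (%x. m (t, x) - e3) (%x. m' (t, x) - e3)"
     unfolding borel_rep_def
    proof
     show "AEl x. x \<in> UNIV --> m (t, x) - e3 = m' (t, x) - e3" using elim(2) by eventually_elim (use t in simp)
    qed measurable
    show "\<exists>D DD. sphere_slice K (%x. m' (t, x)) D DD"
     by (rule K(2)[OF _ _ b]) (use elim(1) t in \<open>auto simp: H2_sphere_def\<close>)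
   qed
  qed
 qed
qed

lemma current_representative:
 assumes j: "j \<in> Linf_Lp (6/5)"
 obtains K j' where "0 <= K" "borel_rep spacetime j j'"
  "AEl t. 0 < t --> integ (%x. norm (j' (t, x)) powr (6/5)) \<and> (LBINT x. norm (j' (t, x)) powr (6/5)) <= K"
proof -
 have "j : borel_measurable (lebesgue_on spacetime)" using j by (simp add: Linf_Lp_def)
 then obtain j' where j': "borel_rep spacetime j j'" by (rule ex_borel_rep[OF open_spacetime])
 note [measurable] = borel_repD(1)[OF j']
 obtain C where "AE t in lebesgue_on {0<..}. (%x. j (t, x)) \<in> Lp (6/5) lebesgue \<and> Lp_norm (6/5) lebesgue (%x. j (t, x)) <= C"
  using j by (auto simp: Linf_Lp_def)
 from AE_positive_times[OF this] have C: "AEl t. 0 < t --> (%x. j (t, x)) \<in> Lp (6/5) lebesgue \<and> Lp_norm (6/5) lebesgue (%x. j (t, x)) <= C" .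
 show thesis
 proof (rule that[OF _ j'])
  show "0 <= \<bar>C\<bar> powr (6/5)" by simp
  show "AEl t. 0 < t --> integ (%x. norm (j' (t, x)) powr (6/5)) \<and> (LBINT x. norm (j' (t, x)) powr (6/5)) <= \<bar>C\<bar> powr (6/5)"
   using C AE_slices[OF borel_repD(2)[OF j']]
  proof eventually_elim
   case (elim t)
   show ?case
   proof
    assume t: "0 < t"
    define I where "I = (LBINT x. norm (j' (t, x)) powr (6/5))"
    have e: "AEl x. norm (j (t, x)) powr (6/5) = norm (j' (t, x)) powr (6/5)" using elim(2) by eventually_elim (use t in simp)
    have m: "(%x. norm (j' (t, x)) powr (6/5)) : Bm" by measurable
    have i: "integ (%x. norm (j' (t, x)) powr (6/5))" using elim(1) t lebesgue_rep(2)[OF m e] by (simp add: Lp_def)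
    have I0: "0 <= I" unfolding I_def by (rule integral_nonneg_AE) simp
    have "I powr (5/6) <= C" using elim(1) t lebesgue_rep(3)[OF m e] by (simp add: Lp_norm_def I_def)
    then have "(I powr (5/6)) powr (6/5) <= \<bar>C\<bar> powr (6/5)" by (intro powr_mono2) auto
    then have "I <= \<bar>C\<bar> powr (6/5)" using I0 by (simp add: powr_powr)
    then show "integ (%x. norm (j' (t, x)) powr (6/5)) \<and> (LBINT x. norm (j' (t, x)) powr (6/5)) <= \<bar>C\<bar> powr (6/5)"
     using i by (simp add: I_def)
   qed
  qed
 qed
qed

lemma sphere_slice_mono:
 assumes S: "sphere_slice K m D DD" and le: "K <= K'"
 shows "sphere_slice K' m D DD"
 unfolding sphere_slice_def
 by (intro conjI allI sphere_sliceD(1-3)[OF S] order_trans[OF sphere_sliceD(4)[OF S] le] order_trans[OF sphere_sliceD(5)[OF S] le]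
   order_trans[OF sphere_sliceD(6)[OF S] le] order_trans[OF sphere_sliceD(7)[OF S] le] order_trans[OF sphere_sliceD(8)[OF S] le])

lemma wder_unique:
 assumes Om: "open Om" and w: "wder Om v f g" "wder Om v f g'"
 shows "AEl x. x \<in> Om --> g x = g' x"
proof -
 have l: "loc_int Om g" "loc_int Om g'" using w by (auto simp: wder_def)
 have "AEl x. x \<in> Om --> g x - g' x = 0"
 proof (rule zero_if_test_integrals_zero[OF Om loc_int_diff[OF l]])
  fix phi assume phi: "phi : tests Om"
  have "(LBINT x. phi x * g x) = (LBINT x. phi x * g' x)" using w phi by (simp add: wder_def)
  then show "(LBINT x. phi x * (g x - g' x)) = 0"
   using loc_int_mult_test[OF l(1) phi] loc_int_mult_test[OF l(2) phi] by (simp add: right_diff_distrib)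
 qed
 then show ?thesis by eventually_elim simp
qed

text \<open>
 The equation in terms of Borel representatives, with the time derivative moved off the test
 function.
\<close>

definition st_equation ::
 "real => real => (real \<times> (real^3) => real^3) => (real \<times> (real^3) => real^3) => (3 => real \<times> (real^3) => real^3)
  => (3 => real \<times> (real^3) => real^3) => (real \<times> (real^3) => real^3) => bool" where
 "st_equation alpha h j m D DD p \<longleftrightarrow> (\<forall>phi\<in>tests spacetime. \<forall>a.
  (LBINT z. phi z * ((SUM3 k. j z $ k *R D k z) $ a + (p z - cross3 (m z) (alpha *R p z + (SUM3 k. DD k z) - h *R e3)) $ a)) =
  (SUM3 k. LBINT z. FD (%z. FD phi (at z) (space_dir k)) (at z) (space_dir k) * cross3 (m z) (SUM3 k. DD k z) $ a)
  + 2 * (SUM3 k. LBINT z. FD phi (at z) (space_dir k) * cross3 (D k z) (SUM3 k. DD k z) $ a))"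

text \<open>
 The derivatives in the equation are only locally integrable by definition; uniqueness of weak derivatives and the bounds on the slices supply the integrability of all products.
\<close>

lemma solution_representatives:
 assumes j': "borel_rep spacetime j j'"
  and jK: "AEl t. 0 < t --> integ (%x. norm (j' (t, x)) powr (6/5)) \<and> (LBINT x. norm (j' (t, x)) powr (6/5)) <= K"
  and m': "borel_rep spacetime m m'" and m1: "!!z. norm (m' z) = 1"
  and mK: "AEl t. 0 < t --> (\<exists>D DD. sphere_slice K (%x. m' (t, x)) D DD)"
  and H: "m \<in> Hdot1_L2" and sol: "distributional_solution alpha h j m"
 obtains D DD p where "st_data K j' m' D DD p" "st_equation alpha h j' m' D DD p"
proof -
 obtain w where w: "w \<in> Lp 2 (lebesgue_on spacetime)" "has_weak_deriv spacetime time_dir m w" using H by (auto simp: Hdot1_L2_def)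
 obtain Dt D0 DD0 where t0: "has_weak_deriv spacetime time_dir m Dt"
  and d0: "!!k. has_weak_deriv spacetime (space_dir k) m (D0 k)" and dd0: "!!k. has_weak_deriv spacetime (space_dir k) (D0 k) (DD0 k)"
  and eq: "!!phi. phi : tests spacetime ==> dist_deriv time_dir (dist_of spacetime m) phi =
      dist_of spacetime (%z. cross3 (m z) (alpha *R Dt z + (SUM3 k. DD0 k z) - h *R e3)) phi
      + cross_bilaplacian m D0 (%z. SUM3 k. DD0 k z) phi
      - dist_of spacetime (%z. SUM3 k. (j z $ k) *R D0 k z) phi"
  using sol unfolding distributional_solution_def Let_def by blast
 have li: "locally_integrable_on spacetime w" "locally_integrable_on spacetime Dt" "locally_integrable_on spacetime (D0 k)" "locally_integrable_on spacetime (DD0 k)" for k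
  using w(2) t0 d0[of k] dd0[of k] by (auto simp: has_weak_deriv_def)
 obtain p where p: "borel_rep spacetime w p" by (rule ex_borel_rep_locally_integrable[OF open_spacetime li(1)])
 obtain q where q: "borel_rep spacetime Dt q" by (rule ex_borel_rep_locally_integrable[OF open_spacetime li(2)])
 have "\<exists>f. borel_rep spacetime (D0 k) f" for k using ex_borel_rep_locally_integrable[OF open_spacetime li(3)[of k]] by blast
 then obtain D where D: "!!k. borel_rep spacetime (D0 k) (D k)" by metis
 have "\<exists>f. borel_rep spacetime (DD0 k) f" for k using ex_borel_rep_locally_integrable[OF open_spacetime li(4)[of k]] by blast
 then obtain DD where DD: "!!k. borel_rep spacetime (DD0 k) (DD k)" by metis
 note [measurable] = borel_repD(1)[OF p] borel_repD(1)[OF D] borel_repD(1)[OF DD] borel_repD(1)[OF m'] borel_repD(1)[OF j']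
 have wt: "wder spacetime time_dir (%z. m' z $ a) (%z. p z $ a)" for a by (rule weak_deriv_rep[OF open_spacetime w(2) m' p])
 have wq: "wder spacetime time_dir (%z. m' z $ a) (%z. q z $ a)" for a by (rule weak_deriv_rep[OF open_spacetime t0 m' q])
 have "AEl z. \<forall>a. z \<in> spacetime --> p z $ a = q z $ a"
  unfolding AE_all_countable by (intro allI wder_unique[OF open_spacetime wt wq])
 then have tp: "AEl z. z \<in> spacetime --> Dt z = p z" using borel_repD(2)[OF q] by eventually_elim (simp add: vec_eq_iff)
 have pL2: "integ (%z. indicator spacetime z * (norm (p z))^2)"
 proof -
  have "integrable (lebesgue_on spacetime) (%z. norm (w z) powr 2)" using w(1) by (simp add: Lp_def)
  then have i: "integrable lebesgue (%z. indicator spacetime z *R (norm (w z) powr 2))"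
   by (subst (asm) integrable_restrict_space) auto
  have m: "(%z. indicator spacetime z * (norm (p z))^2) : Bm" by measurable
  have e: "AEl z. indicator spacetime z *R (norm (w z) powr 2) = indicator spacetime z * (norm (p z))^2"
   using borel_repD(2)[OF p] by eventually_elim (auto simp: indicator_def)
  show ?thesis by (rule lebesgue_rep(2)[OF m e, THEN iffD1, OF i])
 qed
 have S: "st_data K j' m' D DD p"
  unfolding st_data_def
  by (intro conjI allI m1 wt weak_deriv_rep[OF open_spacetime d0 m' D] weak_deriv_rep[OF open_spacetime dd0 D DD] pL2 jK mK) measurable
 note li' = st_data_loc_int[OF S]
 have all: "AEl z. z \<in> spacetime --> m z = m' z \<and> Dt z = p z \<and> j z = j' z \<and> (\<forall>k. D0 k z = D k z) \<and> (\<forall>k. DD0 k z = DD k z)"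
 proof -
  have "AEl z. \<forall>k. z \<in> spacetime --> D0 k z = D k z" "AEl z. \<forall>k. z \<in> spacetime --> DD0 k z = DD k z"
   unfolding AE_all_countable by (intro allI borel_repD(2) D DD)+
  then show ?thesis using borel_repD(2)[OF m'] borel_repD(2)[OF j'] tp by eventually_elim blast
 qed
 have r1: "borel_rep spacetime (%z. cross3 (m z) (alpha *R Dt z + (SUM3 k. DD0 k z) - h *R e3)) (%z. cross3 (m' z) (alpha *R p z + (SUM3 k. DD k z) - h *R e3))"
  unfolding borel_rep_def
 proof
  show "AEl z. z \<in> spacetime --> cross3 (m z) (alpha *R Dt z + (SUM3 k. DD0 k z) - h *R e3) = cross3 (m' z) (alpha *R p z + (SUM3 k. DD k z) - h *R e3)"
   using all by eventually_elim simp
 qed measurable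
 have r2: "borel_rep spacetime (%z. cross3 (m z) (SUM3 k. DD0 k z)) (%z. cross3 (m' z) (SUM3 k. DD k z))"
  unfolding borel_rep_def
 proof
  show "AEl z. z \<in> spacetime --> cross3 (m z) (SUM3 k. DD0 k z) = cross3 (m' z) (SUM3 k. DD k z)"
   using all by eventually_elim simp
 qed measurable
 have r3: "borel_rep spacetime (%z. cross3 (D0 k z) (SUM3 k. DD0 k z)) (%z. cross3 (D k z) (SUM3 k. DD k z))" for k
  unfolding borel_rep_def
 proof
  show "AEl z. z \<in> spacetime --> cross3 (D0 k z) (SUM3 k. DD0 k z) = cross3 (D k z) (SUM3 k. DD k z)"
   using all by eventually_elim simp
 qed measurable
 have r4: "borel_rep spacetime (%z. SUM3 k. (j z $ k) *R D0 k z) (%z. SUM3 k. (j' z $ k) *R D k z)"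
  unfolding borel_rep_def
 proof
  show "AEl z. z \<in> spacetime --> (SUM3 k. (j z $ k) *R D0 k z) = (SUM3 k. (j' z $ k) *R D k z)"
   using all by eventually_elim simp
 qed measurable
 have E: "st_equation alpha h j' m' D DD p"
  unfolding st_equation_def
 proof (intro ballI allI)
  fix phi a assume phi: "phi : tests spacetime"
  note d = test_functions_frechet[OF phi]
  note i1 = loc_int_mult_test[OF li'(6) phi, of a] and i2 = loc_int_mult_test[OF li'(1) phi, of a]
   and i3 = loc_int_mult_test[OF li'(4) phi, of alpha h a]
  have T: "dist_deriv time_dir (dist_of spacetime m) phi $ a = (LBINT z. phi z * p z $ a)"
   using wt[of a] phi unfolding dist_deriv_def vector_uminus_component dist_of_rep[OF open_spacetime m' d li'(2)] by (simp add: wder_def)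
  have B: "cross_bilaplacian m D0 (%z. SUM3 k. DD0 k z) phi $ a =
   (SUM3 k. LBINT z. FD (%z. FD phi (at z) (space_dir k)) (at z) (space_dir k) * cross3 (m' z) (SUM3 k. DD k z) $ a)
  + 2 * (SUM3 k. LBINT z. FD phi (at z) (space_dir k) * cross3 (D k z) (SUM3 k. DD k z) $ a)"
   unfolding cross_bilaplacian_def dist_deriv_def vector_minus_component vector_scaleR_component sum_component vector_uminus_component
    dist_of_rep[OF open_spacetime r2 test_functions_frechet[OF d] li'(3)] dist_of_rep[OF open_spacetime r3 d li'(5)]
   by (simp add: sum_negf)
  have "(LBINT z. phi z * p z $ a) = (LBINT z. phi z * cross3 (m' z) (alpha *R p z + (SUM3 k. DD k z) - h *R e3) $ a)
   + cross_bilaplacian m D0 (%z. SUM3 k. DD0 k z) phi $ a - (LBINT z. phi z * (SUM3 k. (j' z $ k) *R D k z) $ a)"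
   unfolding T[symmetric] eq[OF phi] vector_minus_component vector_add_component
    dist_of_rep[OF open_spacetime r1 phi li'(4)] dist_of_rep[OF open_spacetime r4 phi li'(6)] ..
  moreover have "(LBINT z. phi z * ((SUM3 k. j' z $ k *R D k z) $ a + (p z - cross3 (m' z) (alpha *R p z + (SUM3 k. DD k z) - h *R e3)) $ a))
   = (LBINT z. phi z * (SUM3 k. (j' z $ k) *R D k z) $ a) + ((LBINT z. phi z * p z $ a) - (LBINT z. phi z * cross3 (m' z) (alpha *R p z + (SUM3 k. DD k z) - h *R e3) $ a))"
   unfolding vector_minus_component distrib_left right_diff_distrib
   by (rule trans[OF Bi_integral_add[OF i1 Bi_integrable_diff[OF i2 i3]]])
    (simp only: Bi_integral_diff[OF i2 i3])
  ultimately show "(LBINT z. phi z * ((SUM3 k. j' z $ k *R D k z) $ a + (p z - cross3 (m' z) (alpha *R p z + (SUM3 k. DD k z) - h *R e3)) $ a)) =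
  (SUM3 k. LBINT z. FD (%z. FD phi (at z) (space_dir k)) (at z) (space_dir k) * cross3 (m' z) (SUM3 k. DD k z) $ a)
  + 2 * (SUM3 k. LBINT z. FD phi (at z) (space_dir k) * cross3 (D k z) (SUM3 k. DD k z) $ a)"
   unfolding B by linarith
 qed
 show thesis by (rule that[OF S E])
qed

subsection \<open>Tensor test functions\<close>

lemma tensor_slice:
 fixes f :: "real \<times> (real^3) => real"
 assumes f: "loc_int spacetime f" and ka: "ka : tests UNIV"
 shows "loc_int {0<..} (%t. LBINT x. ka x * f (t, x))"
  and "psi : tests {0<..} ==> (LBINT z. psi (fst z) * ka (snd z) * f z) = (LBINT t. psi t * (LBINT x. ka x * f (t, x)))"
proof -
 have [measurable]: "f : Bm" using f by (rule loc_int_measurable)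
 have [measurable]: "ka : Bm" by (rule test_functions_measurable[OF ka])
 have pairI: "integrable (lborel \<Otimes>\<^sub>M lborel) g" if "integ g" for g :: "real \<times> (real^3) => real"
  unfolding lborel_prod by (rule that)
 show "loc_int {0<..} (%t. LBINT x. ka x * f (t, x))"
  unfolding loc_int_def
 proof (intro conjI allI impI)
  show "(%t. LBINT x. ka x * f (t, x)) : Bm" by measurable
  fix A :: "real set" assume A: "compact A \<and> A \<subseteq> {0<..}"
  then have [measurable]: "A \<in> sets borel" by (auto intro: borel_compact)
  obtain L B where L: "compact L" "L \<subseteq> UNIV" "!!x. x \<notin> L ==> ka x = 0" "!!x. \<bar>ka x\<bar> <= B"
   using test_functions_bounded[OF ka] by metis
  have "integ (%z. (indicator A (fst z) * ka (snd z)) * f z)"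
  proof (rule loc_int_mult_bounded[OF f, where K="A \<times> L" and B="\<bar>B\<bar>"])
   show "compact (A \<times> L)" using A L by (intro compact_Times) auto
   show "A \<times> L \<subseteq> spacetime" using A by auto
   show "indicator A (fst z) * ka (snd z) = 0" if "z \<notin> A \<times> L" for z
    using that L(3) by (cases z) (auto simp: indicator_def)
   show "\<bar>indicator A (fst z) * ka (snd z)\<bar> <= \<bar>B\<bar>" for z
    using L(4)[of "snd z"] by (auto simp: indicator_def)
   show "(%z. indicator A (fst z) * ka (snd z)) : Bm"
    unfolding borel_prod[symmetric] by measurable
  qed
  from lborel_pair.integrable_fst'[OF pairI[OF this]]
  show "integ (%t. indicator A t * (LBINT x. ka x * f (t, x)))" by (simp add: mult.assoc)
 qed
 assume psi: "psi : tests {0<..}"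
 have "integ (%z. (psi (fst z) * ka (snd z)) * f z)"
  by (rule loc_int_mult_test[OF f]) (use test_functions_tensor[OF psi ka] in \<open>simp add: spacetime_def\<close>)
 from lborel_pair.integral_fst'[OF pairI[OF this]]
 show "(LBINT z. psi (fst z) * ka (snd z) * f z) = (LBINT t. psi t * (LBINT x. ka x * f (t, x)))"
  by (simp add: lborel_prod mult.assoc)
qed

lemma frechet_tensor_space:
 assumes psi: "psi : tests {0<..}" and ka: "ka : tests UNIV"
 shows "FD (%z. psi (fst z) * ka (snd z)) (at z) (space_dir k) = psi (fst z) * FD ka (at (snd z)) (axis k 1)"
proof -
 have "FD psi (at (fst z)) 0 = 0"
  by (rule linear_0[OF linear_frechet_derivative[OF test_functions_differentiable[OF psi]]])
 then show ?thesis
  using frechet_tensor[OF test_functions_differentiable[OF psi] test_functions_differentiable[OF ka], of z "space_dir k"] by simp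
qed

text \<open>
 Products of a function of time and a function of space as test functions yield the equation at almost every time.
\<close>

lemma tested_slices:
 fixes G M :: "real \<times> (real^3) => real" and N :: "3 => real \<times> (real^3) => real"
 assumes l: "loc_int spacetime G" "loc_int spacetime M" "!!k. loc_int spacetime (N k)" and ka: "ka : tests UNIV"
  and eq: "\<forall>phi\<in>tests spacetime. (LBINT z. phi z * G z) =
   (SUM3 k. LBINT z. FD (%z. FD phi (at z) (space_dir k)) (at z) (space_dir k) * M z)
   + 2 * (SUM3 k. LBINT z. FD phi (at z) (space_dir k) * N k z)"
 shows "AEl t. 0 < t --> (LBINT x. ka x * G (t, x)) =
   (SUM3 k. LBINT x. FD (%x. FD ka (at x) (axis k 1)) (at x) (axis k 1) * M (t, x))
   + 2 * (SUM3 k. LBINT x. FD ka (at x) (axis k 1) * N k (t, x))"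
proof -
 define ka1 where "ka1 k x = FD ka (at x) (axis k 1)" for k x
 define ka2 where "ka2 k x = FD (ka1 k) (at x) (axis k 1)" for k x
 have t1: "ka1 k : tests UNIV" for k unfolding ka1_def[abs_def] by (rule test_functions_frechet[OF ka])
 have t2: "ka2 k : tests UNIV" for k unfolding ka2_def[abs_def] by (rule test_functions_frechet[OF t1])
 define g where "g t = (LBINT x. ka x * G (t, x))" for t
 define gm where "gm k t = (LBINT x. ka2 k x * M (t, x))" for k t
 define gn where "gn k t = (LBINT x. ka1 k x * N k (t, x))" for k t
 have lg: "loc_int {0<..} g" "loc_int {0<..} (gm k)" "loc_int {0<..} (gn k)" for k
  unfolding g_def[abs_def] gm_def[abs_def] gn_def[abs_def]
  by (rule tensor_slice(1)[OF l(1) ka] tensor_slice(1)[OF l(2) t2] tensor_slice(1)[OF l(3) t1])+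
 define R where "R t = g t - ((gm 1 t + gm 2 t + gm 3 t) + 2 * (gn 1 t + gn 2 t + gn 3 t))" for t
 have lR: "loc_int {0<..} R" unfolding R_def[abs_def] by (intro loc_int_diff loc_int_add loc_int_cmult lg)
 have "AEl t. t \<in> {0<..} --> R t = 0"
 proof (rule zero_if_test_integrals_zero[OF open_greaterThan lR])
  fix psi :: "real => real" assume psi: "psi : tests {0<..}"
  have phi: "(%z. psi (fst z) * ka (snd z)) : tests spacetime"
   using test_functions_tensor[OF psi ka] by (simp add: spacetime_def)
  have d1: "(%z. FD (%z. psi (fst z) * ka (snd z)) (at z) (space_dir k)) = (%z. psi (fst z) * ka1 k (snd z))" for k
   by (rule ext) (simp only: frechet_tensor_space[OF psi ka] ka1_def)
  have d2: "FD (%z. psi (fst z) * ka1 k (snd z)) (at z) (space_dir k) = psi (fst z) * ka2 k (snd z)" for k z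
   by (simp only: frechet_tensor_space[OF psi t1] ka2_def)
  note e = bspec[OF eq phi, unfolded d1 d2 fun_cong[OF d1] tensor_slice(2)[OF l(1) ka psi] tensor_slice(2)[OF l(2) t2 psi] tensor_slice(2)[OF l(3) t1 psi],
    folded g_def gm_def gn_def]
  have i: "integ (%t. psi t * g t)" "integ (%t. psi t * gm k t)" "integ (%t. psi t * gn k t)" for k
   by (rule loc_int_mult_test[OF lg(1) psi] loc_int_mult_test[OF lg(2) psi] loc_int_mult_test[OF lg(3) psi])+
  have "(LBINT t. psi t * R t) = (LBINT t. psi t * g t - ((psi t * gm 1 t + psi t * gm 2 t + psi t * gm 3 t) + 2 * (psi t * gn 1 t + psi t * gn 2 t + psi t * gn 3 t)))"
   by (simp add: R_def algebra_simps)
  also have "... = 0" using i e by (simp add: sum_3)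
  finally show "(LBINT t. psi t * R t) = 0" .
 qed
 then show ?thesis
  by eventually_elim (auto simp: R_def g_def gm_def gn_def ka2_def ka1_def[abs_def] sum_3)
qed

lemma frechet_reflect:
 fixes phi :: "'a::euclidean_space => real"
 assumes phi: "phi : tests UNIV"
 shows "(%x. phi (y - x)) : tests UNIV" "FD (%x. phi (y - x)) (at x) v = - FD phi (at (y - x)) v"
  "FD (%x. - phi (y - x)) (at x) v = FD phi (at (y - x)) v"
proof -
 have e: "(%x. phi (y - x)) = (%x. phi ((- 1) *R x + y))" by (simp add: algebra_simps)
 show t: "(%x. phi (y - x)) : tests UNIV" unfolding e by (rule test_functions_affine[OF phi]) auto
 have "FD (%x. phi ((- 1) *R x + y)) (at x) v = FD phi (at ((- 1) *R x + y)) ((- 1) *R v)" for v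
  by (rule frechet_affine[OF bounded_linear_scaleR_right test_functions_differentiable[OF phi]])
 then show d: "FD (%x. phi (y - x)) (at x) v = - FD phi (at (y - x)) v" for v
  unfolding e frechet_scaled_dir[OF phi] by (simp add: algebra_simps)
 from has_derivative_minus[OF test_functions_has_derivative[OF t]]
 have "((%x. - phi (y - x)) has_derivative (%h. - FD (%x. phi (y - x)) (at x) h)) (at x)" .
 from frechet_derivative_at[OF this, symmetric] show "FD (%x. - phi (y - x)) (at x) v = FD phi (at (y - x)) v"
  by (simp add: d)
qed

lemma mollified_slices:
 fixes G M :: "real \<times> (real^3) => real" and N :: "3 => real \<times> (real^3) => real"
 assumes l: "loc_int spacetime G" "loc_int spacetime M" "!!k. loc_int spacetime (N k)"
  and eq: "\<forall>phi\<in>tests spacetime. (LBINT z. phi z * G z) =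
   (SUM3 k. LBINT z. FD (%z. FD phi (at z) (space_dir k)) (at z) (space_dir k) * M z)
   + 2 * (SUM3 k. LBINT z. FD phi (at z) (space_dir k) * N k z)"
 shows "AEl t. AEl y. 0 < t --> (LBINT x. mollifier n (y - x) * G (t, x)) =
   (SUM3 k. LBINT x. FD (%z. FD (mollifier n) (at z) (axis k 1)) (at (y - x)) (axis k 1) * M (t, x))
   - 2 * (SUM3 k. LBINT x. FD (mollifier n) (at (y - x)) (axis k 1) * N k (t, x))"
proof -
 have [measurable]: "G : Bm" "M : Bm" "N k : Bm" for k
  by (rule loc_int_measurable[OF l(1)] loc_int_measurable[OF l(2)] loc_int_measurable[OF l(3)])+
 define ka1 where "ka1 k = (%x::real^3. FD (mollifier n) (at x) (axis k 1))" for k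
 define ka2 where "ka2 k = (%x::real^3. FD (ka1 k) (at x) (axis k 1))" for k
 note mt = mollifier_test[of n, where ?'a="real^3"]
 have t1: "ka1 k : tests UNIV" for k unfolding ka1_def by (rule test_functions_frechet[OF mt])
 have t2: "ka2 k : tests UNIV" for k unfolding ka2_def by (rule test_functions_frechet[OF t1])
 note [measurable] = test_functions_measurable[OF t1] test_functions_measurable[OF t2]
 have "AEl y. AEl t. 0 < t --> (LBINT x. mollifier n (y - x) * G (t, x)) =
   (SUM3 k. LBINT x. ka2 k (y - x) * M (t, x)) - 2 * (SUM3 k. LBINT x. ka1 k (y - x) * N k (t, x))"
 proof (rule AE_I2)
  fix y :: "real^3"
  have f1: "(%x. FD (%x. mollifier n (y - x)) (at x) (axis k 1)) = (%x. - ka1 k (y - x))" for k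
   unfolding frechet_reflect(2)[OF mt] ka1_def ..
  have f2: "FD (%x. - ka1 k (y - x)) (at x) (axis k 1) = ka2 k (y - x)" for k x
   unfolding frechet_reflect(3)[OF t1] ka2_def ..
  show "AEl t. 0 < t --> (LBINT x. mollifier n (y - x) * G (t, x)) =
   (SUM3 k. LBINT x. ka2 k (y - x) * M (t, x)) - 2 * (SUM3 k. LBINT x. ka1 k (y - x) * N k (t, x))"
   using tested_slices[OF l frechet_reflect(1)[OF mt] eq, of y, unfolded f1 f2 fun_cong[OF f1]]
   by eventually_elim (simp add: sum_negf)
 qed
 then have "AEl t. AEl y. 0 < t --> (LBINT x. mollifier n (y - x) * G (t, x)) =
   (SUM3 k. LBINT x. ka2 k (y - x) * M (t, x)) - 2 * (SUM3 k. LBINT x. ka1 k (y - x) * N k (t, x))"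
  by (rule lborel_pair.AE_commute[THEN iffD1, rotated]) measurable
 then show ?thesis unfolding ka2_def ka1_def .
qed

text \<open>Almost every slice of a solution on space-time is a solution at a fixed time.\<close>

theorem solution_slices:
 assumes S: "st_data K j m D DD p" and E: "st_equation alpha h j m D DD p"
 shows "AEl t. 0 < t --> (\<exists>D' DD'. sphere_slice K (%x. m (t, x)) D' DD' \<and>
  slice_sol alpha h (%x. j (t, x)) (%x. m (t, x)) D' DD' (%x. p (t, x)))"
proof -
 note mm = st_dataD(1-5)[OF S]
 note [measurable] = mm
 note li = st_data_loc_int[OF S]
 have lG: "loc_int spacetime (%z. (SUM3 k. j z $ k *R D k z) $ a + (p z - cross3 (m z) (alpha *R p z + (SUM3 k. DD k z) - h *R e3)) $ a)" for a
  unfolding vector_minus_component by (intro loc_int_add loc_int_diff li)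
 have moll: "AEl t. \<forall>n a. AEl y. 0 < t --> (LBINT x. mollifier n (y - x) * ((SUM3 k. j (t, x) $ k *R D k (t, x)) $ a
    + (p (t, x) - cross3 (m (t, x)) (alpha *R p (t, x) + (SUM3 k. DD k (t, x)) - h *R e3)) $ a)) =
   (SUM3 k. LBINT x. FD (%z. FD (mollifier n) (at z) (axis k 1)) (at (y - x)) (axis k 1) * cross3 (m (t, x)) (SUM3 k. DD k (t, x)) $ a)
   - 2 * (SUM3 k. LBINT x. FD (mollifier n) (at (y - x)) (axis k 1) * cross3 (D k (t, x)) (SUM3 k. DD k (t, x)) $ a)"
  unfolding AE_all_countable
  by (intro allI mollified_slices[OF lG li(3) li(5)]) (use E[unfolded st_equation_def] in blast)
 have orth: "AEl t. AEl x. 0 < t --> p (t, x) \<bullet> m (t, x) = 0"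
 proof -
  have lines: "AEl z. \<forall>a. z \<in> spacetime --> line_ac (%s. m (z + s *R time_dir) $ a) (%s. p (z + s *R time_dir) $ a)"
   unfolding AE_all_countable by (intro allI wder_line_ac[OF open_spacetime spacetime_forward(2) st_dataD(7)[OF S]])
  have "AEl z. z \<in> spacetime --> line_ac (%s. SUM3 a. m (z + s *R time_dir) $ a * m (z + s *R time_dir) $ a)
    (%s. SUM3 a. m (z + s *R time_dir) $ a * p (z + s *R time_dir) $ a + p (z + s *R time_dir) $ a * m (z + s *R time_dir) $ a)"
   using lines by eventually_elim (intro impI line_ac_sum line_ac_mult; (measurable | blast))
  then have "AEl z. z \<in> spacetime --> (SUM3 a. m z $ a * p z $ a + p z $ a * m z $ a) = 0"
  proof (rule line_derivative_of_constant_zero[where c=1, rotated 2])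
   show "open spacetime" by (rule open_spacetime)
   show "z + s *R time_dir \<in> spacetime" if "z \<in> spacetime" "0 <= s" for z s by (rule spacetime_forward(2)[OF that])
   show "AEl z. z \<in> spacetime --> (SUM3 a. m z $ a * m z $ a) = 1"
    using st_dataD(6)[OF S] by (auto intro!: AE_I2 simp: norm_eq_1 inner_vec_def)
  qed auto
  then have "AEl z. z \<in> spacetime --> p z \<bullet> m z = 0"
  proof eventually_elim
   case (elim z)
   have "(SUM3 a. m z $ a * p z $ a + p z $ a * m z $ a) = 2 * (p z \<bullet> m z)"
    by (simp add: inner_vec_def sum_3 algebra_simps)
   then show ?case using elim by simp
  qed
  from AE_slices[OF this] show ?thesis by simp
 qed
 have p2: "AEl t. 0 < t --> integ (%x. (norm (p (t, x)))^2)"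
 proof -
  have "integrable (lborel \<Otimes>\<^sub>M lborel) (%z. indicator spacetime z * (norm (p z))^2)"
   unfolding lborel_prod by (rule st_dataD(10)[OF S])
  from lborel_pair.AE_integrable_fst'[OF this] show ?thesis
   by eventually_elim (auto simp: indicator_def)
 qed
 show ?thesis using st_data_slices[OF S] moll orth p2
 proof eventually_elim
  case (elim t)
  show ?case
  proof
   assume t: "0 < t"
   obtain D' DD' where SS: "sphere_slice K (%x. m (t, x)) D' DD'"
    and e: "AEl x. \<forall>k. D k (t, x) = D' k x \<and> DD k (t, x) = DD' k k x" using elim(1) t by blast
   note ms = sphere_sliceD(2,3)[OF SS]
   note [measurable] = ms
   have [measurable]: "(%x::real^3. FD (mollifier n) (at x) v) : Bm"
    "(%x::real^3. FD (%z. FD (mollifier n) (at z) v) (at x) w) : Bm" for n v w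
    by (rule test_functions_measurable[OF test_functions_frechet[OF mollifier_test]]
      test_functions_measurable[OF test_functions_frechet[OF test_functions_frechet[OF mollifier_test]]])+
   have c1: "(LBINT x. mollifier n (y - x) * ((SUM3 k. j (t, x) $ k *R D k (t, x)) $ a
     + (p (t, x) - cross3 (m (t, x)) (alpha *R p (t, x) + (SUM3 k. DD k (t, x)) - h *R e3)) $ a)) =
     (LBINT x. mollifier n (y - x) * ((SUM3 k. j (t, x) $ k *R D' k x) $ a
     + (p (t, x) - cross3 (m (t, x)) (alpha *R p (t, x) + (SUM3 k. DD' k k x) - h *R e3)) $ a))" for n a and y :: "real^3"
   proof (rule integral_cong_AE)
    show "AEl x. mollifier n (y - x) * ((SUM3 k. j (t, x) $ k *R D k (t, x)) $ a
     + (p (t, x) - cross3 (m (t, x)) (alpha *R p (t, x) + (SUM3 k. DD k (t, x)) - h *R e3)) $ a) =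
     mollifier n (y - x) * ((SUM3 k. j (t, x) $ k *R D' k x) $ a
     + (p (t, x) - cross3 (m (t, x)) (alpha *R p (t, x) + (SUM3 k. DD' k k x) - h *R e3)) $ a)"
     using e by eventually_elim simp
   qed measurable
   have c2: "(LBINT x. q x * cross3 (m (t, x)) (SUM3 k. DD k (t, x)) $ a) = (LBINT x. q x * cross3 (m (t, x)) (SUM3 k. DD' k k x) $ a)"
    if [measurable]: "q : Bm" for q a
   proof (rule integral_cong_AE)
    show "AEl x. q x * cross3 (m (t, x)) (SUM3 k. DD k (t, x)) $ a = q x * cross3 (m (t, x)) (SUM3 k. DD' k k x) $ a"
     using e by eventually_elim simp
   qed measurable
   have c3: "(LBINT x. q x * cross3 (D k (t, x)) (SUM3 k. DD k (t, x)) $ a) = (LBINT x. q x * cross3 (D' k x) (SUM3 k. DD' k k x) $ a)"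
    if [measurable]: "q : Bm" for q k a
   proof (rule integral_cong_AE)
    show "AEl x. q x * cross3 (D k (t, x)) (SUM3 k. DD k (t, x)) $ a = q x * cross3 (D' k x) (SUM3 k. DD' k k x) $ a"
     using e by eventually_elim simp
   qed measurable
   have "slice_sol alpha h (%x. j (t, x)) (%x. m (t, x)) D' DD' (%x. p (t, x))"
    unfolding slice_sol_def
   proof (intro conjI allI)
    show "norm (m (t, x)) = 1" for x by (rule st_dataD(6)[OF S])
    show "H2f (%x. (m (t, x) - e3) $ a) (%k x. D' k x $ a) (%l k x. DD' l k x $ a)" for a by (rule sphere_sliceD(1)[OF SS])
    show "integ (%x. (norm (p (t, x)))^2)" using elim(4) t by blast
    show "AEl x. p (t, x) \<bullet> m (t, x) = 0" using elim(3) by eventually_elim (use t in simp)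
    fix n a
    have "AEl y. 0 < t --> (LBINT x. mollifier n (y - x) * ((SUM3 k. j (t, x) $ k *R D k (t, x)) $ a
    + (p (t, x) - cross3 (m (t, x)) (alpha *R p (t, x) + (SUM3 k. DD k (t, x)) - h *R e3)) $ a)) =
   (SUM3 k. LBINT x. FD (%z. FD (mollifier n) (at z) (axis k 1)) (at (y - x)) (axis k 1) * cross3 (m (t, x)) (SUM3 k. DD k (t, x)) $ a)
   - 2 * (SUM3 k. LBINT x. FD (mollifier n) (at (y - x)) (axis k 1) * cross3 (D k (t, x)) (SUM3 k. DD k (t, x)) $ a)"
     using elim(2) by blast
    then show "AEl y. (LBINT x. mollifier n (y - x) * ((SUM3 k. j (t, x) $ k *R D' k x) $ a
     + (p (t, x) - cross3 (m (t, x)) (alpha *R p (t, x) + (SUM3 k. DD' k k x) - h *R e3)) $ a)) =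
   (SUM3 k. LBINT x. FD (%z. FD (mollifier n) (at z) (axis k 1)) (at (y - x)) (axis k 1) * cross3 (m (t, x)) (SUM3 k. DD' k k x) $ a)
   - 2 * (SUM3 k. LBINT x. FD (mollifier n) (at (y - x)) (axis k 1) * cross3 (D' k x) (SUM3 k. DD' k k x) $ a)"
    proof eventually_elim
     case (elim y)
     have q: "(%x. FD (%z. FD (mollifier n) (at z) (axis k 1)) (at (y - x)) (axis k 1)) : Bm"
      "(%x. FD (mollifier n) (at (y - x)) (axis k 1)) : Bm" for k by measurable
     show ?case using elim t unfolding c1 c2[OF q(1)] c3[OF q(2)] by blast
    qed
   qed measurable
   with SS show "\<exists>D' DD'. sphere_slice K (%x. m (t, x)) D' DD' \<and> slice_sol alpha h (%x. j (t, x)) (%x. m (t, x)) D' DD' (%x. p (t, x))" by blast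
  qed
 qed
qed

section \<open>Growth of the difference in time\<close>

text \<open>
 Gronwall's lemma for an inequality that holds at almost every time: against the weight
 \<open>exp (2 c t)\<close> each application of the inequality halves the bound.
\<close>

lemma gronwall_AE:
 fixes A :: "real => real"
 assumes [measurable]: "A : Bm" and A0: "!!t. 0 <= A t" and b: "0 <= b" "AEl t. 0 < t --> A t <= b"
  and c: "0 < c" and g: "AEl t. 0 < t --> A t <= c * (LBINT s. indicator {0..t} s * A s)"
 shows "AEl t. 0 < t --> A t = 0"
proof -
 have step: "AEl t. 0 < t --> A t <= b / 2 ^ n * exp (2 * c * t)" for n
 proof (induction n)
  case 0
  show ?case using b(2)
  proof eventually_elim
   case (elim t)
   show ?case
   proof
    assume "0 < t"
    then have "b * 1 <= b * exp (2 * c * t)" using b(1) c by (intro mult_left_mono) auto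
    then show "A t <= b / 2 ^ 0 * exp (2 * c * t)" using elim \<open>0 < t\<close> by simp
   qed
  qed
 next
  case (Suc n)
  show ?case using g
  proof eventually_elim
   case (elim t)
   show ?case
   proof
    assume t: "0 < t"
    let ?w = "%s. b / 2 ^ n * exp (2 * c * s)"
    have ae: "AEl s. \<bar>indicator {0..t} s * A s\<bar> <= indicator {0..t} s * ?w s"
     using Suc.IH AE_lborel_singleton[of 0] by eventually_elim (use A0 in \<open>auto simp: indicator_def\<close>)
    have hb: "has_bochner_integral lborel (%s. ?w s * indicator {0..t} s) (b / 2 ^ n * exp (2 * c * t) / (2 * c) - b / 2 ^ n * exp (2 * c * 0) / (2 * c))"
     by (rule has_bochner_integral_FTC_Icc_real) (use t c in \<open>auto intro!: derivative_eq_intros continuous_intros\<close>)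
    have iw: "integ (%s. indicator {0..t} s * ?w s)" and Iw: "(LBINT s. indicator {0..t} s * ?w s) = b / 2 ^ n * exp (2 * c * t) / (2 * c) - b / 2 ^ n / (2 * c)"
     using hb unfolding has_bochner_integral_iff by (simp_all add: mult.commute[of "indicator {0..t} _"])
    have "integ (%s. indicator {0..t} s * A s) \<and> (LBINT s. \<bar>indicator {0..t} s * A s\<bar>) <= b / 2 ^ n * exp (2 * c * t) / (2 * c)"
     by (rule integrable_abs_le[OF iw _ ae]) (use Iw b c in auto)
    then have "(LBINT s. indicator {0..t} s * A s) <= b / 2 ^ n * exp (2 * c * t) / (2 * c)" using A0 by (simp add: abs_mult)
    then have "c * (LBINT s. indicator {0..t} s * A s) <= c * (b / 2 ^ n * exp (2 * c * t) / (2 * c))" using c by (intro mult_left_mono) auto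
    also have "... = b / 2 ^ Suc n * exp (2 * c * t)" using c by simp
    finally show "A t <= b / 2 ^ Suc n * exp (2 * c * t)" using elim t by linarith
   qed
  qed
 qed
 have "AEl t. \<forall>n. 0 < t --> A t <= b / 2 ^ n * exp (2 * c * t)" unfolding AE_all_countable by (intro allI step)
 then show ?thesis
 proof eventually_elim
  case (elim t)
  show ?case
  proof
   assume "0 < t"
   have "(%n. (b * exp (2 * c * t)) * (1 / 2) ^ n) ---> (b * exp (2 * c * t)) * 0" by (intro tendsto_intros LIMSEQ_realpow_zero) auto
   moreover have "A t <= (b * exp (2 * c * t)) * (1 / 2) ^ n" for n using elim \<open>0 < t\<close> by (simp add: power_divide)
   ultimately have "A t <= 0" using LIMSEQ_le_const by fastforce
   then show "A t = 0" using A0[of t] by simp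
  qed
 qed
qed

lemma norm_diff_squared_le: "(norm (x - y))^2 <= 2 * (norm x)^2 + 2 * (norm y)^2" for x y :: "'a::real_normed_vector"
proof -
 have "(norm (x - y))^2 <= (norm x + norm y)^2" by (intro power_mono norm_triangle_ineq4) simp
 also have "... <= 2 * (norm x)^2 + 2 * (norm y)^2" using sum_squares_bound[of "norm x" "norm y"] by (simp add: power2_sum)
 finally show ?thesis .
qed

lemma sphere_slice_difference:
 assumes "sphere_slice K m1 D1 DD1" "sphere_slice K m2 D2 DD2" and [measurable]: "m1 : Bm" "m2 : Bm"
 shows "integ (%x. (norm (m1 x - m2 x))^2)" "(LBINT x. (norm (m1 x - m2 x))^2) <= 4 * K"
proof -
 have i: "integ (%x. (norm (m1 x - e3))^2)" "integ (%x. (norm (m2 x - e3))^2)"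
  by (rule vec_L2, rule H2fD(1)[OF sphere_sliceD(1)[OF assms(1)]]) (rule vec_L2, rule H2fD(1)[OF sphere_sliceD(1)[OF assms(2)]])
 have ii: "integ (%x. 2 * (norm (m1 x - e3))^2 + 2 * (norm (m2 x - e3))^2)" using i by simp
 have "integ (%x. (norm (m1 x - m2 x))^2) \<and> (LBINT x. \<bar>(norm (m1 x - m2 x))\<^sup>2\<bar>) <= 4 * K"
 proof (rule integrable_abs_le[OF ii])
  show "AEl x. \<bar>(norm (m1 x - m2 x))\<^sup>2\<bar> <= 2 * (norm (m1 x - e3))^2 + 2 * (norm (m2 x - e3))^2"
   using norm_diff_squared_le[of "m1 _ - e3" "m2 _ - e3"] by (intro AE_I2) simp
  show "(LBINT x. 2 * (norm (m1 x - e3))^2 + 2 * (norm (m2 x - e3))^2) <= 4 * K"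
   using i sphere_sliceD(4)[OF assms(1)] sphere_sliceD(4)[OF assms(2)] by simp
 qed measurable
 then show "integ (%x. (norm (m1 x - m2 x))^2)" "(LBINT x. (norm (m1 x - m2 x))^2) <= 4 * K" by simp_all
qed

text \<open>
 The squared difference is absolutely continuous in time along almost every line; integrating its
 increment over space and inserting the estimate at a fixed time gives the integral inequality.
\<close>

lemma difference_growth:
 assumes alpha: "0 < alpha" and K: "0 <= K"
  and S1: "st_data K j m1 D1 DD1 p1" and E1: "st_equation alpha h j m1 D1 DD1 p1"
  and S2: "st_data K j m2 D2 DD2 p2" and E2: "st_equation alpha h j m2 D2 DD2 p2"
 defines "A \<equiv> %t. \<integral>x. (norm (m1 (t, x) - m2 (t, x)))^2 \<partial>lborel"
 shows "A : Bm"
  and "AEl t. 0 < t --> integ (%x. (norm (m1 (t, x) - m2 (t, x)))^2) \<and> A t <= 4 * K"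
  and "\<exists>c>0. AEl s. 0 < s --> (AEl t. s < t --> A t <= A s + c * (LBINT r. indicator {0..t} r * A r))"
proof -
 note mm = st_dataD(1,2,5)[OF S1] st_dataD(2,5)[OF S2]
 note [measurable] = mm
 show Am[measurable]: "A : Bm" unfolding A_def by measurable
 have A0: "0 <= A t" for t unfolding A_def by (rule integral_nonneg_AE) simp
 show bnd: "AEl t. 0 < t --> integ (%x. (norm (m1 (t, x) - m2 (t, x)))^2) \<and> A t <= 4 * K"
  using st_dataD(12)[OF S1] st_dataD(12)[OF S2]
 proof eventually_elim
  case (elim t)
  show ?case
  proof
   assume "0 < t"
   then obtain D1' DD1' D2' DD2' where s: "sphere_slice K (%x. m1 (t, x)) D1' DD1'" "sphere_slice K (%x. m2 (t, x)) D2' DD2'" using elim by blast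
   have m: "(%x. m1 (t, x)) : Bm" "(%x. m2 (t, x)) : Bm" by measurable
   show "integ (%x. (norm (m1 (t, x) - m2 (t, x)))^2) \<and> A t <= 4 * K"
    unfolding A_def using sphere_slice_difference[OF s m] by blast
  qed
 qed
 define u where "u z = m1 z - m2 z" for z
 define q where "q z = p1 z - p2 z" for z
 define f where "f z = 2 * (q z \<bullet> u z)" for z
 have [measurable]: "u : Bm" "q : Bm" "f : Bm"
  unfolding u_def[abs_def] q_def[abs_def] f_def[abs_def] by measurable
 have Fm: "(%z. (norm (u z))^2) : Bm" by measurable
 obtain C where C: "0 <= C"
  "!!j m1 D1 DD1 p1 m2 D2 DD2 p2. [|slice_sol alpha h j m1 D1 DD1 p1; slice_sol alpha h j m2 D2 DD2 p2; j : Bm;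
   integ (%x. norm (j x) powr (6/5)); (LBINT x. norm (j x) powr (6/5)) <= K;
   (LBINT x. (norm (SUM3 k. DD1 k k x))^2) <= K; (LBINT x. (norm (SUM3 k. DD2 k k x))^2) <= K;
   !!k. (LBINT x. (norm (D1 k x)) ^ 4) <= K; !!k. (LBINT x. (norm (D2 k x)) ^ 4) <= K|]
   ==> (LBINT x. (p1 x - p2 x) \<bullet> (m1 x - m2 x)) <= C * (LBINT x. (norm (m1 x - m2 x))^2)"
  by (rule slice_energy_estimate[OF alpha K, of h]) blast
 define c where "c = 2 * C + 1"
 have c: "0 < c" using C by (simp add: c_def)
 have energy: "AEl t. 0 < t --> (LBINT x. f (t, x)) <= c * A t"
  using solution_slices[OF S1 E1] solution_slices[OF S2 E2] st_dataD(11)[OF S1]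
 proof eventually_elim
  case (elim t)
  show ?case
  proof
   assume t: "0 < t"
   obtain D1' DD1' where s1: "sphere_slice K (%x. m1 (t, x)) D1' DD1'" "slice_sol alpha h (%x. j (t, x)) (%x. m1 (t, x)) D1' DD1' (%x. p1 (t, x))" using elim(1) t by blast
   obtain D2' DD2' where s2: "sphere_slice K (%x. m2 (t, x)) D2' DD2'" "slice_sol alpha h (%x. j (t, x)) (%x. m2 (t, x)) D2' DD2' (%x. p2 (t, x))" using elim(2) t by blast
   have jm: "(%x. j (t, x)) : Bm" by measurable
   have J: "integ (%x. norm (j (t, x)) powr (6/5))" "(LBINT x. norm (j (t, x)) powr (6/5)) <= K" using elim(3) t by blast+
   have "(LBINT x. (p1 (t, x) - p2 (t, x)) \<bullet> (m1 (t, x) - m2 (t, x))) <= C * A t"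
    unfolding A_def
    by (rule C(2)[OF s1(2) s2(2) jm J sphere_sliceD(8)[OF s1(1)] sphere_sliceD(8)[OF s2(1)] sphere_sliceD(6)[OF s1(1)] sphere_sliceD(6)[OF s2(1)]])
   moreover have "(LBINT x. f (t, x)) = 2 * (LBINT x. (p1 (t, x) - p2 (t, x)) \<bullet> (m1 (t, x) - m2 (t, x)))"
    unfolding f_def q_def u_def by (rule integral_mult_right_zero)
   moreover have "2 * (C * A t) <= c * A t" using A0[of t] by (simp add: c_def distrib_right)
   ultimately show "(LBINT x. f (t, x)) <= c * A t" by linarith
  qed
 qed
 have lines: "AEl z. z \<in> spacetime --> line_ac (%s. (norm (u (z + s *R time_dir)))^2) (%s. f (z + s *R time_dir))"
 proof -
  have 1: "AEl z. \<forall>a. z \<in> spacetime --> line_ac (%s. m1 (z + s *R time_dir) $ a) (%s. p1 (z + s *R time_dir) $ a)"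
   unfolding AE_all_countable by (intro allI wder_line_ac[OF open_spacetime spacetime_forward(2) st_dataD(7)[OF S1]])
  have 2: "AEl z. \<forall>a. z \<in> spacetime --> line_ac (%s. m2 (z + s *R time_dir) $ a) (%s. p2 (z + s *R time_dir) $ a)"
   unfolding AE_all_countable by (intro allI wder_line_ac[OF open_spacetime spacetime_forward(2) st_dataD(7)[OF S2]])
  show ?thesis using 1 2
  proof eventually_elim
   case (elim z)
   show ?case
   proof
    assume "z \<in> spacetime"
    then have l: "line_ac (%s. u (z + s *R time_dir) $ a) (%s. q (z + s *R time_dir) $ a)" for a
     unfolding u_def q_def vector_minus_component using elim by (intro line_ac_diff) blast+
    have "line_ac (%s. SUM3 a. u (z + s *R time_dir) $ a * u (z + s *R time_dir) $ a)
     (%s. SUM3 a. u (z + s *R time_dir) $ a * q (z + s *R time_dir) $ a + q (z + s *R time_dir) $ a * u (z + s *R time_dir) $ a)"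
     by (intro line_ac_sum line_ac_mult l; measurable)
    moreover have "(SUM3 a. v $ a * v $ a) = (norm v)^2" for v :: "real^3" unfolding norm_power2_vec3 by (simp only: power2_eq_square)
    moreover have "(SUM3 a. v $ a * w $ a + w $ a * v $ a) = 2 * (w \<bullet> v)" for v w :: "real^3" by (simp add: inner_vec_def sum_3 algebra_simps)
    ultimately show "line_ac (%s. (norm (u (z + s *R time_dir)))^2) (%s. f (z + s *R time_dir))" by (simp only: f_def)
   qed
  qed
 qed
 have incr: "AEl r. AEl s. AEl x. 0 < r --> 0 < s -->
   (norm (u (s + r, x)))\<^sup>2 = (norm (u (s, x)))^2 + (LBINT ta. indicator {0..r} ta * f (s + ta, x))"
 proof -
  have "AEl r. AEl z. 0 < r --> z \<in> spacetime -->
    (norm (u (z + r *R time_dir)))\<^sup>2 = (norm (u z))^2 + (LBINT s. indicator {0..r} s * f (z + s *R time_dir))"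
   by (rule line_ac_AE_commute[OF lines Fm]) measurable
  then show ?thesis
  proof (rule eventually_mono)
   fix r
   assume "AEl z. 0 < r --> z \<in> spacetime --> (norm (u (z + r *R time_dir)))^2 = (norm (u z))^2 + (LBINT s. indicator {0..r} s * f (z + s *R time_dir))"
   from AE_slices[OF this]
   show "AEl s. AEl x. 0 < r --> 0 < s -->
    (norm (u (s + r, x)))\<^sup>2 = (norm (u (s, x)))^2 + (LBINT ta. indicator {0..r} ta * f (s + ta, x))" by simp
  qed
 qed
 have q2: "integ (%z. indicator spacetime z * (norm (q z))^2)"
 proof (rule Bi_integrable_bound)
  show "integ (%z. 2 * (indicator spacetime z * (norm (p1 z))^2) + 2 * (indicator spacetime z * (norm (p2 z))^2))"
   using st_dataD(10)[OF S1] st_dataD(10)[OF S2] by simp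
  show "AEl z. norm (indicator spacetime z * (norm (q z))^2) <= norm (2 * (indicator spacetime z * (norm (p1 z))^2) + 2 * (indicator spacetime z * (norm (p2 z))^2))"
   using norm_diff_squared_le[of "p1 _" "p2 _"] by (intro AE_I2) (simp add: q_def indicator_def)
 qed measurable
 have fi: "integrable (lborel \<Otimes>\<^sub>M lborel) (%(ta, x). indicator {0..r} ta * f (s + ta, x))" if s: "0 < s" for r s
 proof (rule Bi_integrable_bound)
  have bs: "AEl ta. 0 < s + ta --> integ (%x. (norm (u (s + ta, x)))^2) \<and> A (s + ta) <= 4 * K"
   using AE_shift[OF bnd, of s] by (simp add: add.commute u_def)
  have i1: "integrable (lborel \<Otimes>\<^sub>M lborel) (%(ta, x). indicator {0..r} ta * (norm (u (s + ta, x)))^2)"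
  proof (rule lborel_pair.integrable_prodI)
   have "(NN ta. NN x. ennreal \<bar>indicator {0..r} ta * (norm (u (s + ta, x)))^2\<bar>) <= (NN ta. ennreal (4 * K) * indicator {0..r} ta)"
   proof (rule nn_integral_mono_AE)
    show "AEl ta. (NN x. ennreal \<bar>indicator {0..r} ta * (norm (u (s + ta, x)))^2\<bar>) <= ennreal (4 * K) * indicator {0..r} ta"
     using bs
    proof eventually_elim
     case (elim ta)
     show ?case
     proof (cases "ta \<in> {0..r}")
      case True
      then have e: "integ (%x. (norm (u (s + ta, x)))^2)" "A (s + ta) <= 4 * K" using elim s by auto
      have "(NN x. ennreal ((norm (u (s + ta, x)))^2)) = ennreal (A (s + ta))"
       unfolding A_def using nn_integral_eq_integral[OF e(1)] by (simp add: u_def)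
      also have "... <= ennreal (4 * K)" by (rule ennreal_leI[OF e(2)])
      finally show ?thesis using True by simp
     qed simp
    qed
   qed
   also have "... < \<infinity>" by (simp add: nn_integral_cmult_indicator ennreal_mult_less_top emeasure_lborel_Icc_eq)
   finally show "(NN ta. NN x. ennreal \<bar>indicator {0..r} ta * (norm (u (s + ta, x)))^2\<bar>) < \<infinity>" .
  qed measurable
  have i2: "integrable (lborel \<Otimes>\<^sub>M lborel) (%(ta, x). indicator spacetime (s + ta, x) * (norm (q (s + ta, x)))^2)"
  proof -
   have e: "(%(ta, x). indicator spacetime (s + ta, x) * (norm (q (s + ta, x)))^2) = (%z. indicator spacetime (z + (s, 0)) * (norm (q (z + (s, 0))))^2)"
    by (auto simp: fun_eq_iff add.commute)
   show ?thesis unfolding e lborel_prod by (rule integrable_shift[OF q2])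
  qed
  show "integrable (lborel \<Otimes>\<^sub>M lborel) (%z. (case z of (ta, x) => indicator {0..r} ta * (norm (u (s + ta, x)))^2) + (case z of (ta, x) => indicator spacetime (s + ta, x) * (norm (q (s + ta, x)))^2))"
   by (rule Bi_integrable_add[OF i1 i2])
  have fb: "\<bar>f z\<bar> <= (norm (u z))^2 + (norm (q z))^2" for z
  proof -
   have "\<bar>f z\<bar> <= 2 * (norm (q z) * norm (u z))" unfolding f_def abs_mult using Cauchy_Schwarz_ineq2[of "q z" "u z"] by simp
   then show ?thesis using sum_squares_bound[of "norm (u z)" "norm (q z)"] by (simp add: mult_ac)
  qed
  show "AE z in lborel \<Otimes>\<^sub>M lborel. norm (case z of (ta, x) => indicator {0..r} ta * f (s + ta, x)) \<le>
   norm ((case z of (ta, x) => indicator {0..r} ta * (norm (u (s + ta, x)))^2) + (case z of (ta, x) => indicator spacetime (s + ta, x) * (norm (q (s + ta, x)))^2))"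
  proof (rule AE_I2)
   fix z :: "real \<times> (real^3)"
   obtain ta x where z: "z = (ta, x)" by (cases z)
   show "norm (case z of (ta, x) => indicator {0..r} ta * f (s + ta, x)) \<le>
    norm ((case z of (ta, x) => indicator {0..r} ta * (norm (u (s + ta, x)))^2) + (case z of (ta, x) => indicator spacetime (s + ta, x) * (norm (q (s + ta, x)))^2))"
    unfolding z using fb[of "(s + ta, x)"] s by (auto simp: indicator_def)
  qed
 qed measurable
 have main: "AEl r. AEl s. 0 < r --> 0 < s --> A (s + r) <= A s + c * (LBINT ta. indicator {0..r} ta * A (s + ta))"
  using incr
 proof (rule eventually_mono)
  fix r
  assume inc: "AEl s. AEl x. 0 < r --> 0 < s -->
   (norm (u (s + r, x)))\<^sup>2 = (norm (u (s, x)))^2 + (LBINT ta. indicator {0..r} ta * f (s + ta, x))"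
  show "AEl s. 0 < r --> 0 < s --> A (s + r) <= A s + c * (LBINT ta. indicator {0..r} ta * A (s + ta))"
   using inc bnd
  proof eventually_elim
   case (elim s)
   show ?case
   proof (intro impI)
    assume r: "0 < r" and s: "0 < s"
    note fi = fi[OF s, of r]
    have iA: "integ (%x. (norm (u (s, x)))^2)" using elim(2) s by (simp add: u_def)
    have iI: "integ (%x. LBINT ta. indicator {0..r} ta * f (s + ta, x))" by (rule lborel_pair.integrable_snd[OF fi])
    have "A (s + r) = (LBINT x. (norm (u (s, x)))^2 + (LBINT ta. indicator {0..r} ta * f (s + ta, x)))"
     unfolding A_def u_def[symmetric]
    proof (rule integral_cong_AE)
     show "AEl x. (norm (u (s + r, x)))^2 = (norm (u (s, x)))^2 + (LBINT ta. indicator {0..r} ta * f (s + ta, x))"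
      using elim(1) by eventually_elim (use r s in blast)
    qed measurable
    also have "... = A s + (LBINT x. LBINT ta. indicator {0..r} ta * f (s + ta, x))"
     unfolding A_def u_def[symmetric] by (rule Bi_integral_add[OF iA iI])
    also have "(LBINT x. LBINT ta. indicator {0..r} ta * f (s + ta, x)) = (LBINT ta. LBINT x. indicator {0..r} ta * f (s + ta, x))"
     by (rule lborel_pair.Fubini_integral[OF fi])
    also have "... <= (LBINT ta. c * (indicator {0..r} ta * A (s + ta)))"
    proof (rule integral_mono_AE)
     show "integ (%ta. LBINT x. indicator {0..r} ta * f (s + ta, x))" by (rule lborel_pair.integrable_fst[OF fi])
     have ib: "integ (%ta. indicator {0..r} ta * (4 * K))" by (intro integrable_mult_left integrable_real_indicator) (auto simp: emeasure_lborel_Icc_eq)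
     have ae: "AEl ta. \<bar>indicator {0..r} ta * A (s + ta)\<bar> <= indicator {0..r} ta * (4 * K)"
      using AE_shift[OF bnd, of s] by eventually_elim (use s A0 in \<open>auto simp: indicator_def add.commute\<close>)
     have "integ (%ta. indicator {0..r} ta * A (s + ta))"
      using integrable_abs_le[OF ib _ ae order_refl] by simp
     then show "integ (%ta. c * (indicator {0..r} ta * A (s + ta)))" by (rule integrable_mult_right)
     show "AEl ta. (LBINT x. indicator {0..r} ta * f (s + ta, x)) <= c * (indicator {0..r} ta * A (s + ta))"
      using AE_shift[OF energy, of s] by eventually_elim (use s in \<open>auto simp: indicator_def add.commute\<close>)
    qed
    finally show "A (s + r) <= A s + c * (LBINT ta. indicator {0..r} ta * A (s + ta))" by simp
   qed
  qed
 qed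
 have "AEl s. AEl r. 0 < r --> 0 < s --> A (s + r) <= A s + c * (LBINT ta. indicator {0..r} ta * A (s + ta))"
  using main by (rule lborel_pair.AE_commute[THEN iffD1, rotated]) measurable
 then have "AEl s. 0 < s --> (AEl t. s < t --> A t <= A s + c * (LBINT r. indicator {0..t} r * A r))"
 proof (rule eventually_mono, intro impI)
  fix s :: real
  assume s: "0 < s" and a: "AEl r. 0 < r --> 0 < s --> A (s + r) <= A s + c * (LBINT ta. indicator {0..r} ta * A (s + ta))"
  show "AEl t. s < t --> A t <= A s + c * (LBINT r. indicator {0..t} r * A r)"
   using AE_shift[OF a, of "- s"]
  proof eventually_elim
   case (elim t)
   show ?case
   proof
    assume t: "s < t"
    have "(LBINT ta. indicator {0..t - s} ta * A (s + ta)) = (LBINT ta. indicator {s..t} (ta + s) * A (ta + s))"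
     by (intro Bi_integral_cong) (auto simp: indicator_def add.commute)
    also have "... = (LBINT ta. indicator {s..t} ta * A ta)" by (rule integral_shift) measurable
    also have "... <= (LBINT ta. indicator {0..t} ta * A ta)"
    proof (rule integral_mono_AE)
     have ib: "integ (%ta. indicator {0..t} ta * (4 * K))" by (intro integrable_mult_left integrable_real_indicator) (auto simp: emeasure_lborel_Icc_eq)
     have ae: "AEl ta. \<bar>indicator {0..t} ta * A ta\<bar> <= indicator {0..t} ta * (4 * K)"
      using bnd AE_lborel_singleton[of 0] by eventually_elim (use A0 in \<open>auto simp: indicator_def\<close>)
     have ae': "AEl ta. \<bar>indicator {s..t} ta * A ta\<bar> <= indicator {0..t} ta * (4 * K)"
      using ae by eventually_elim (use s A0 K in \<open>auto simp: indicator_def split: if_splits\<close>)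
     show "integ (%ta. indicator {0..t} ta * A ta)" "integ (%ta. indicator {s..t} ta * A ta)"
      using integrable_abs_le[OF ib _ ae order_refl] integrable_abs_le[OF ib _ ae' order_refl] by simp_all
     show "AEl ta. indicator {s..t} ta * A ta <= indicator {0..t} ta * A ta"
      using s A0 by (intro AE_I2) (auto simp: indicator_def)
    qed
    finally have "c * (LBINT ta. indicator {0..t - s} ta * A (s + ta)) <= c * (LBINT ta. indicator {0..t} ta * A ta)"
     using c by (intro mult_left_mono) auto
    moreover have "A t <= A s + c * (LBINT ta. indicator {0..t - s} ta * A (s + ta))" using elim t s by simp
    ultimately show "A t <= A s + c * (LBINT r. indicator {0..t} r * A r)" by linarith
   qed
  qed
 qed
 then show "\<exists>c>0. AEl s. 0 < s --> (AEl t. s < t --> A t <= A s + c * (LBINT r. indicator {0..t} r * A r))" using c by blast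
qed

section \<open>Uniqueness\<close>

lemma Lp2_diff:
 fixes f g :: "'a => 'b::euclidean_space"
 assumes f: "f \<in> Lp 2 M" and g: "g \<in> Lp 2 M"
 shows "integrable M (%x. (norm (f x - g x))^2)" "(Lp_norm 2 M (%x. f x - g x))^2 = (\<integral>x. (norm (f x - g x))^2 \<partial>M)"
proof -
 have [measurable]: "f : borel_measurable M" "g : borel_measurable M" using f g by (auto simp: Lp_def)
 show "integrable M (%x. (norm (f x - g x))^2)"
 proof (rule Bi_integrable_bound)
  show "integrable M (%x. 2 * (norm (f x))^2 + 2 * (norm (g x))^2)" using f g by (simp add: Lp_def)
  show "AE x in M. norm ((norm (f x - g x))^2) <= norm (2 * (norm (f x))^2 + 2 * (norm (g x))^2)"
   using norm_diff_squared_le[of "f _" "g _"] by (intro AE_I2) simp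
 qed measurable
 have "0 <= (\<integral>x. (norm (f x - g x))^2 \<partial>M)" by (rule integral_nonneg_AE) simp
 then show "(Lp_norm 2 M (%x. f x - g x))^2 = (\<integral>x. (norm (f x - g x))^2 \<partial>M)"
  by (simp add: Lp_norm_def powr_half_sqrt)
qed

text \<open>
 Only the initial value distinguishes the two continuous representatives at time zero, so the
 difference is small at small times.
\<close>

lemma initial_difference:
 assumes h1: "has_initial_value m1 m0" and h2: "has_initial_value m2 m0"
  and r1: "borel_rep spacetime m1 m1'" and r2: "borel_rep spacetime m2 m2'"
 obtains ep where "(ep \<longlongrightarrow> 0) (at (0::real) within {0..})"
  "AEl t. 0 < t --> (LBINT x. (norm (m1' (t, x) - m2' (t, x)))^2) <= ep t"
proof -
 note [measurable] = borel_repD(1)[OF r1] borel_repD(1)[OF r2]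
 obtain M1 where M1: "!!t. 0 <= t ==> (%x. M1 t x - e3) \<in> Lp 2 lebesgue"
  "((%t. Lp_norm 2 lebesgue (%x. M1 t x - M1 0 x)) \<longlongrightarrow> 0) (at 0 within {0..})"
  "AE t in lebesgue_on {0<..}. AE x in lebesgue. M1 t x = m1 (t, x)" "AE x in lebesgue. M1 0 x = m0 x"
  using h1 unfolding has_initial_value_def by blast
 obtain M2 where M2: "!!t. 0 <= t ==> (%x. M2 t x - e3) \<in> Lp 2 lebesgue"
  "((%t. Lp_norm 2 lebesgue (%x. M2 t x - M2 0 x)) \<longlongrightarrow> 0) (at 0 within {0..})"
  "AE t in lebesgue_on {0<..}. AE x in lebesgue. M2 t x = m2 (t, x)" "AE x in lebesgue. M2 0 x = m0 x"
  using h2 unfolding has_initial_value_def by blast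
 define ep where "ep t = 2 * (Lp_norm 2 lebesgue (%x. M1 t x - M1 0 x))^2 + 2 * (Lp_norm 2 lebesgue (%x. M2 t x - M2 0 x))^2" for t
 have "(ep \<longlongrightarrow> 2 * 0^2 + 2 * 0^2) (at 0 within {0..})"
  unfolding ep_def by (intro tendsto_intros M1(2) M2(2))
 then have lim: "(ep \<longlongrightarrow> 0) (at 0 within {0..})" by simp
 show thesis
 proof (rule that[OF lim])
  show "AEl t. 0 < t --> (LBINT x. (norm (m1' (t, x) - m2' (t, x)))^2) <= ep t"
   using AE_positive_times[OF M1(3)] AE_positive_times[OF M2(3)] AE_slices[OF borel_repD(2)[OF r1]] AE_slices[OF borel_repD(2)[OF r2]]
  proof eventually_elim
   case (elim t)
   show ?case
   proof
    assume t: "0 < t"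
    have a: "AEl x. M1 t x = m1 (t, x)" "AEl x. M2 t x = m2 (t, x)" using elim(1,2) t AE_completion_iff by blast+
    have e: "AEl x. (norm (M1 t x - M2 t x))^2 = (norm (m1' (t, x) - m2' (t, x)))^2"
     using a elim(3,4) by eventually_elim (use t in simp)
    have m: "(%x. (norm (m1' (t, x) - m2' (t, x)))^2) : Bm" by measurable
    have l: "(%x. M1 t x - e3) \<in> Lp 2 lebesgue" "(%x. M2 t x - e3) \<in> Lp 2 lebesgue" "(%x. M1 0 x - e3) \<in> Lp 2 lebesgue" "(%x. M2 0 x - e3) \<in> Lp 2 lebesgue"
     using M1(1) M2(1) t by auto
    note d12 = Lp2_diff[OF l(1,2), simplified] and d1 = Lp2_diff[OF l(1,3), simplified] and d2 = Lp2_diff[OF l(2,4), simplified]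
    have "(LBINT x. (norm (m1' (t, x) - m2' (t, x)))^2) = (\<integral>x. (norm (M1 t x - M2 t x))^2 \<partial>lebesgue)"
     by (rule lebesgue_rep(3)[OF m e, symmetric])
    also have "... <= (\<integral>x. 2 * (norm (M1 t x - M1 0 x))^2 + 2 * (norm (M2 t x - M2 0 x))^2 \<partial>lebesgue)"
    proof (rule integral_mono_AE[OF d12(1)])
     show "integrable lebesgue (%x. 2 * (norm (M1 t x - M1 0 x))^2 + 2 * (norm (M2 t x - M2 0 x))^2)"
      by (intro Bi_integrable_add integrable_mult_right d1(1) d2(1))
     show "AE x in lebesgue. (norm (M1 t x - M2 t x))^2 <= 2 * (norm (M1 t x - M1 0 x))^2 + 2 * (norm (M2 t x - M2 0 x))^2"
      using M1(4) M2(4)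
     proof eventually_elim
      case (elim x)
      then have e: "M1 t x - M2 t x = (M1 t x - M1 0 x) - (M2 t x - M2 0 x)" by simp
      show ?case by (subst e) (rule norm_diff_squared_le)
     qed
    qed
    also have "... = ep t"
     unfolding ep_def d1(2) d2(2) using d1(1) d2(1) by simp
    finally show "(LBINT x. (norm (m1' (t, x) - m2' (t, x)))^2) <= ep t" .
   qed
  qed
 qed
qed

lemma AE_small_real_ex:
 assumes P: "AEl r. 0 < r --> P r" and de: "0 < de"
 shows "\<exists>r. 0 < r \<and> r < de \<and> P (r::real)"
proof (rule ccontr)
 assume *: "\<not> ?thesis"
 have "AEl r. r \<notin> {0<..<de}" using P by eventually_elim (use * in auto)
 then have "{0<..<de} \<in> null_sets lborel" by (subst AE_iff_null_sets) auto
 then have "emeasure lborel {0<..<de} = 0" by (rule null_setsD1)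
 then show False using de by simp
qed

theorem theorem2:
  fixes \<alpha> h :: real
    and j :: "real \<times> (real^3) \<Rightarrow> real^3"
    and m0 :: "real^3 \<Rightarrow> real^3"
    and m1 m2 :: "real \<times> (real^3) \<Rightarrow> real^3"
  assumes "\<alpha> > 0"
    and "j \<in> Linf_Lp (6/5)"
    and "m1 \<in> Linf_H2_sphere \<inter> Hdot1_L2"
    and "distributional_solution \<alpha> h j m1"
    and "has_initial_value m1 m0"
    and "m2 \<in> Linf_H2_sphere \<inter> Hdot1_L2"
    and "distributional_solution \<alpha> h j m2"
    and "has_initial_value m2 m0"
  shows "AE z in lebesgue_on spacetime. m1 z = m2 z"
proof -
 have s: "m1 \<in> Linf_H2_sphere" "m1 \<in> Hdot1_L2" "m2 \<in> Linf_H2_sphere" "m2 \<in> Hdot1_L2" using assms by auto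
 obtain K0 j' where j': "0 <= K0" "borel_rep spacetime j j'"
  "AEl t. 0 < t --> integ (%x. norm (j' (t, x)) powr (6/5)) \<and> (LBINT x. norm (j' (t, x)) powr (6/5)) <= K0"
  by (rule current_representative[OF assms(2)])
 obtain K1 m1' where m1': "0 <= K1" "borel_rep spacetime m1 m1'" "!!z. norm (m1' z) = 1"
  "AEl t. 0 < t --> (\<exists>D DD. sphere_slice K1 (%x. m1' (t, x)) D DD)" by (rule sphere_representative[OF s(1)]) blast
 obtain K2 m2' where m2': "0 <= K2" "borel_rep spacetime m2 m2'" "!!z. norm (m2' z) = 1"
  "AEl t. 0 < t --> (\<exists>D DD. sphere_slice K2 (%x. m2' (t, x)) D DD)" by (rule sphere_representative[OF s(3)]) blast
 define K where "K = K0 + K1 + K2"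
 have K: "0 <= K" "K0 <= K" "K1 <= K" "K2 <= K" using j'(1) m1'(1) m2'(1) by (auto simp: K_def)
 have jK: "AEl t. 0 < t --> integ (%x. norm (j' (t, x)) powr (6/5)) \<and> (LBINT x. norm (j' (t, x)) powr (6/5)) <= K"
  using j'(3) by eventually_elim (use K(2) in auto)
 have mK1: "AEl t. 0 < t --> (\<exists>D DD. sphere_slice K (%x. m1' (t, x)) D DD)"
  using m1'(4) by eventually_elim (use sphere_slice_mono[OF _ K(3)] in blast)
 have mK2: "AEl t. 0 < t --> (\<exists>D DD. sphere_slice K (%x. m2' (t, x)) D DD)"
  using m2'(4) by eventually_elim (use sphere_slice_mono[OF _ K(4)] in blast)
 obtain D1 DD1 p1 where S1: "st_data K j' m1' D1 DD1 p1" "st_equation \<alpha> h j' m1' D1 DD1 p1"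
  by (rule solution_representatives[OF j'(2) jK m1'(2,3) mK1 s(2) assms(4)])
 obtain D2 DD2 p2 where S2: "st_data K j' m2' D2 DD2 p2" "st_equation \<alpha> h j' m2' D2 DD2 p2"
  by (rule solution_representatives[OF j'(2) jK m2'(2,3) mK2 s(4) assms(7)])
 note [measurable] = borel_repD(1)[OF m1'(2)] borel_repD(1)[OF m2'(2)]
 define A where "A t = (LBINT x. (norm (m1' (t, x) - m2' (t, x)))^2)" for t
 note growth = difference_growth[OF assms(1) K(1) S1 S2, folded A_def]
 have A0: "0 <= A t" for t unfolding A_def by (rule integral_nonneg_AE) simp
 have bnd: "AEl t. 0 < t --> A t <= 4 * K" using growth(2) by eventually_elim blast
 obtain c where c: "0 < c" "AEl s. 0 < s --> (AEl t. s < t --> A t <= A s + c * (LBINT r. indicator {0..t} r * A r))"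
  using growth(3) by blast
 obtain \<epsilon> where \<epsilon>: "(\<epsilon> \<longlongrightarrow> 0) (at (0::real) within {0..})" "AEl t. 0 < t --> A t <= \<epsilon> t"
  unfolding A_def by (rule initial_difference[OF assms(5,8) m1'(2) m2'(2)])
 \<comment> \<open>starting times tending to zero at which both the inequality and the smallness hold\<close>
 have "AEl s. 0 < s --> A s <= \<epsilon> s \<and> (AEl t. s < t --> A t <= A s + c * (LBINT r. indicator {0..t} r * A r))"
  using c(2) \<epsilon>(2) by eventually_elim blast
 from AE_small_real_ex[OF this]
 have ex: "\<forall>n. \<exists>s. 0 < s \<and> s < inverse (real (Suc n)) \<and> A s <= \<epsilon> s \<and> (AEl t. s < t --> A t <= A s + c * (LBINT r. indicator {0..t} r * A r))"
  by simp
 from choice[OF ex] obtain \<sigma> where \<sigma>': "\<forall>n. 0 < \<sigma> n \<and> \<sigma> n < inverse (real (Suc n)) \<and> A (\<sigma> n) <= \<epsilon> (\<sigma> n) \<and>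
  (AEl t. \<sigma> n < t --> A t <= A (\<sigma> n) + c * (LBINT r. indicator {0..t} r * A r))" ..
 then have \<sigma>: "0 < \<sigma> n" "\<sigma> n < inverse (real (Suc n))" "A (\<sigma> n) <= \<epsilon> (\<sigma> n)"
  "AEl t. \<sigma> n < t --> A t <= A (\<sigma> n) + c * (LBINT r. indicator {0..t} r * A r)" for n
  by blast+
 have \<sigma>0: "\<sigma> ---> 0"
  by (rule tendsto_sandwich[OF _ _ tendsto_const LIMSEQ_inverse_real_of_nat])
   (use \<sigma>(1,2) in \<open>auto intro!: always_eventually less_imp_le simp del: of_nat_Suc\<close>)
 have "filterlim \<sigma> (at 0 within {0..}) sequentially"
  unfolding filterlim_at using \<sigma>(1) \<sigma>0 by (auto intro!: always_eventually simp: less_imp_le less_imp_neq[symmetric])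
 from filterlim_compose[OF \<epsilon>(1) this] have \<epsilon>\<sigma>: "(%n. \<epsilon> (\<sigma> n)) ---> 0" .
 have "AEl t. \<forall>n. \<sigma> n < t --> A t <= A (\<sigma> n) + c * (LBINT r. indicator {0..t} r * A r)"
  unfolding AE_all_countable by (intro allI \<sigma>(4))
 then have g: "AEl t. 0 < t --> A t <= c * (LBINT r. indicator {0..t} r * A r)"
 proof eventually_elim
  case (elim t)
  show ?case
  proof
   assume "0 < t"
   have l: "(%n. \<epsilon> (\<sigma> n) + c * (LBINT r. indicator {0..t} r * A r)) ---> 0 + c * (LBINT r. indicator {0..t} r * A r)"
    by (intro tendsto_intros \<epsilon>\<sigma>)
   obtain N where N: "!!n. n >= N ==> \<sigma> n < t"
    using order_tendstoD(2)[OF \<sigma>0 \<open>0 < t\<close>] by (auto simp: eventually_sequentially)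
   have "A t <= \<epsilon> (\<sigma> n) + c * (LBINT r. indicator {0..t} r * A r)" if "n >= N" for n
    using elim N[OF that] \<sigma>(3)[of n] by (meson add_right_mono order_trans)
   then have "A t <= 0 + c * (LBINT r. indicator {0..t} r * A r)" using LIMSEQ_le_const[OF l] by blast
   then show "A t <= c * (LBINT r. indicator {0..t} r * A r)" by simp
  qed
 qed
 have "AEl t. 0 < t --> A t = 0"
  by (rule gronwall_AE[OF growth(1) A0 _ bnd c(1) g]) (use K in simp)
 then have "AEl t. AEl x. (t, x) \<in> spacetime --> norm (m1' (t, x) - m2' (t, x)) = 0"
  using growth(2)
 proof eventually_elim
  case (elim t)
  show ?case
  proof (cases "0 < t")
   case True
   then have "AEl x. (norm (m1' (t, x) - m2' (t, x)))^2 = 0"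
    using elim integral_nonneg_eq_0_iff_AE[of lborel "%x. (norm (m1' (t, x) - m2' (t, x)))^2"] by (simp add: A_def)
   then show ?thesis by eventually_elim simp
  qed simp
 qed
 then have "AE z in lborel \<Otimes>\<^sub>M lborel. z \<in> spacetime --> norm (m1' z - m2' z) = 0"
  by (intro lborel_pair.AE_pair_measure) (unfold lborel_prod, measurable)
 then have "AEl z. z \<in> spacetime --> norm (m1' z - m2' z) = 0" unfolding lborel_prod .
 then have "AEl z. z \<in> spacetime --> m1 z = m2 z"
  using borel_repD(2)[OF m1'(2)] borel_repD(2)[OF m2'(2)] by eventually_elim simp
 then have "AE z in lebesgue. z \<in> spacetime --> m1 z = m2 z" by (rule AE_completion)
 then show ?thesis by (subst AE_restrict_space_iff) auto
qed

end
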